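(* Let $n$ be a positive integer, $Y$ a Banach space, $k$ an integer, $0<\alpha\le1$, $k+\alpha\ge0$, $\nu$ a continuous seminorm on $\mathscr D_{\mathbf B(0,1)}(\mathbf R^n,Y)$, and $T\in\mathscr D'(\mathbf R^n,Y)$. Let $Y_k$ be the vector space of polynomial functions $\mathbf R^n\to Y'$ of degree at most $k$. Then: (1) The set $D'$ of all $(a,P)\in\mathbf R^n\times Y_k$ such that $T$ is $\nu$ pointwise differentiable of order $(k,\alpha)$ at $a$ with $k$ jet $P$ is a countable union of compact subsets of $\mathbf R^n\times Y_k$. (2) If $k\ge0$, then the set $D_0'$ of all $(a,P)\in\mathbf R^n\times Y_k$ such that $T$ is $\nu$ pointwise differentiable of order $k$ at $a$ with $k$ jet $P$ is a Borel subset of $\mathbf R^n\times Y_k$. (3) The set of $a\in\mathbf R^n$ such that $T$ is $\nu$ pointwise differentiable of order $(k,\alpha)$ at $a$ is a countable union of compact subsets of $\mathbf R^n$. (4) If $k\ge0$ and $Y$ is separable, then $D_0'$ (the set of pairs in (2)) is a Borel function (mapping $a$ to $P$). Furthermore, its domain is a Borel set. (5) If $k\ge0$ and $Y$ is finite dimensional, then for every $j\in\{0,1,\dots,k\}$ the set of all $(a,S,P)\in\mathbf R^n\times\mathscr D'(\mathbf R^n,Y)\times Y_k$ such that $S$ is $\nu$ pointwise differentiable of order $k$ at $a$ with $k$ jet $P$ is a Borel subset of $\mathbf R^n\times\mathscr D'(\mathbf R^n,Y)_s\times Y_k$, and the function mapping $(a,S)$, for those $(a,S)\in\mathbf R^n\times\mathscr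 D'(\mathbf R^n,Y)$ such that $S$ is $\nu$ pointwise differentiable of order $k$ at $a$, onto $\mathrm{pt}\,D^jS(a)$ is a Borel function on $\mathbf R^n\times\mathscr D'(\mathbf R^n,Y)_s$ whose domain is a Borel set.
   Context: All vector spaces are real. $Y'$ is the topological dual of $Y$. $\mathscr D(\mathbf R^n,Y)$ is the space of smooth compactly supported functions $\mathbf R^n\to Y$; for compact $K$, $\mathscr D_K(\mathbf R^n,Y)$ is the subspace of those with support in $K$, topologized by the seminorms $\sup_{x\in K}\|D^j\theta(x)\|$, $j=0,1,2,\dots$. $\mathscr D'(\mathbf R^n,Y)$ is the space of distributions: linear $T:\mathscr D(\mathbf R^n,Y)\to\mathbf R$ continuous on each $\mathscr D_K(\mathbf R^n,Y)$. $\mathscr D'(\mathbf R^n,Y)_s$ is this space with the topology of pointwise convergence on $\mathscr D(\mathbf R^n,Y)$. $\mathbf B(a,r)$ is the closed ball, $\mathscr L^n$ Lebesgue measure. A polynomial function $P:\mathbf R^n\to Y'$ is a finite sum of maps $x\mapsto\psi_m(x,\dots,x)$ with $\psi_m$ symmetric $m$-linear with values in $Y'$; a polynomial function of degree at most $-1$ is by convention zero (so $Y_{-1}=\{0\}$). $P$ is identified with the distribution $P(\theta)=\int\langle\theta(x),P(x)\rangle\,d\mathscr L^n_x$. $Y_k$ has its natural normed topology, e.g. with norm $\sum_{m=0}^k\|D^mP(0)\|$. For a distribution $T$, $a\in\mathbf R^n$, $0<r<\infty$: $T^{a,r}(\theta)=r^{-n}T_x(\theta(r^{-1}(x-a)))$,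 where $T_x(\cdot)$ means $T$ applied to the indicated function of $x$. For $k+\alpha\ge0$, $0<\alpha\le 1$, $T$ is $\nu$ pointwise differentiable of order $(k,\alpha)$ at $a$ iff there is a polynomial function $P:\mathbf R^n\to Y'$ of degree at most $k$ with $$\limsup_{r\to0^+}\sup\{r^{-k-\alpha}(T-P)^{a,r}(\theta):\theta\in\mathscr D_{\mathbf B(0,1)}(\mathbf R^n,Y),\ \nu(\theta)\le1\}<\infty.$$ For $k\ge0$, $T$ is $\nu$ pointwise differentiable of order $k$ at $a$ iff there is a polynomial function $P:\mathbf R^n\to Y'$ of degree at most $k$ with $$\lim_{r\to0^+}\sup\{r^{-k}(T-P)^{a,r}(\theta):\theta\in\mathscr D_{\mathbf B(0,1)}(\mathbf R^n,Y),\ \nu(\theta)\le1\}=0.$$ In either case such $P$ is unique and is called the $k$ jet of $T$ at $a$ (it is $0$ if $k=-1$). For $k\ge 0$ and $0\le m\le k$, $\mathrm{pt}\,D^mT(a)=D^mP(a)$, a symmetric $m$-linear map on $\mathbf R^n$ with values in $Y'$. A Borel function is a (partially defined) function for which preimages of Borel sets are Borel sets. *)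

theory Defs
  imports "HOL-Analysis.Analysis"
begin

text \<open>An \<open>m\<close>-linear map on \<open>'a\<close> is encoded as a function on the lists of length \<open>m\<close>
  (and \<open>undefined\<close> on all other lists), since its arity may not be part of its type.
  Accordingly, \<open>dderiv [v\<^sub>1, \<dots>, v\<^sub>m] f x\<close> is \<open>D\<^sup>m f(x)(v\<^sub>1, \<dots>, v\<^sub>m)\<close>.\<close>

primrec dderiv ::
  "'a list \<Rightarrow> ('a::real_normed_vector \<Rightarrow> 'b::real_normed_vector) \<Rightarrow> 'a \<Rightarrow> 'b" where
  "dderiv [] f = f"
| "dderiv (v # vs) f = (\<lambda>x. frechet_derivative (dderiv vs f) (at x) v)"

definition nth_deriv ::
  "nat \<Rightarrow> ('a::real_normed_vector \<Rightarrow> 'b::real_normed_vector) \<Rightarrow> 'a \<Rightarrow> 'a list \<Rightarrow> 'b" where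
  "nth_deriv m f x = (\<lambda>vs\<in>{vs. length vs = m}. dderiv vs f x)"

text \<open>On a finite dimensional domain, \<open>f\<close> is of class \<open>C\<^sup>\<infinity>\<close> iff all iterated derivatives,
  evaluated at arbitrary fixed vectors, are again differentiable.\<close>

definition smooth :: "('a::euclidean_space \<Rightarrow> 'b::real_normed_vector) \<Rightarrow> bool" where
  "smooth f \<longleftrightarrow> (\<forall>vs x. dderiv vs f differentiable (at x))"

definition mlin_norm :: "nat \<Rightarrow> ('a::real_normed_vector list \<Rightarrow> 'b::real_normed_vector) \<Rightarrow> real" where
  "mlin_norm m \<psi> = (SUP vs\<in>{vs. length vs = m \<and> (\<forall>v\<in>set vs. norm v \<le> 1)}. norm (\<psi> vs))"

definition sym_mlin :: "nat \<Rightarrow> ('a::real_vector list \<Rightarrow> 'b::real_vector) set" where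
  "sym_mlin m = {\<psi> \<in> extensional {vs. length vs = m}.
     (\<forall>vs i. length vs = m \<longrightarrow> i < m \<longrightarrow> linear (\<lambda>v. \<psi> (vs[i := v]))) \<and>
     (\<forall>vs ws. length vs = m \<longrightarrow> mset ws = mset vs \<longrightarrow> \<psi> ws = \<psi> vs)}"

text \<open>The open balls of all the seminorms \<open>p i\<close> about all centres form a subbasis;
  a single norm is a one-element family.\<close>

definition seminorms_topology ::
  "('a \<Rightarrow> 'b::minus) set \<Rightarrow> 'i set \<Rightarrow> ('i \<Rightarrow> ('a \<Rightarrow> 'b) \<Rightarrow> real) \<Rightarrow> ('a \<Rightarrow> 'b) topology" where
  "seminorms_topology V I p =
     topology_generated_by {{w \<in> V. p i (\<lambda>x. w x - v x) < e} | v i e. v \<in> V \<and> i \<in> I \<and> 0 < e}"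

definition sym_mlin_top ::
  "nat \<Rightarrow> ('a::real_normed_vector list \<Rightarrow> 'b::real_normed_vector) topology" where
  "sym_mlin_top m = seminorms_topology (sym_mlin m) {()} (\<lambda>_. mlin_norm m)"

definition borel_in :: "'a topology \<Rightarrow> 'a set set" where
  "borel_in X = sigma_sets (topspace X) {U. openin X U}"

text \<open>A partially defined function from \<open>X\<close> to \<open>Z\<close> is given by its graph \<open>F\<close>.\<close>

definition borel_pfun :: "'a topology \<Rightarrow> 'b topology \<Rightarrow> ('a \<times> 'b) set \<Rightarrow> bool" where
  "borel_pfun X Z F \<longleftrightarrow> F \<subseteq> topspace X \<times> topspace Z \<and> single_valued F \<and>
     (\<forall>B\<in>borel_in Z. F\<inverse> `` B \<in> borel_in X)"

definition countable_union_of_compacts :: "'a topology \<Rightarrow> 'a set \<Rightarrow> bool" where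
  "countable_union_of_compacts X A \<longleftrightarrow>
     (\<exists>C :: nat \<Rightarrow> 'a set. (\<forall>i. compactin X (C i)) \<and> A = (\<Union>i. C i))"

definition test_fun :: "(real^'n \<Rightarrow> 'y::banach) set" where
  "test_fun = {\<theta>. smooth \<theta> \<and> compact (closure {x. \<theta> x \<noteq> 0})}"

definition test_fun_in :: "(real^'n) set \<Rightarrow> (real^'n \<Rightarrow> 'y::banach) set" where
  "test_fun_in K = {\<theta> \<in> test_fun. closure {x. \<theta> x \<noteq> 0} \<subseteq> K}"

definition test_fun_top :: "(real^'n) set \<Rightarrow> (real^'n \<Rightarrow> 'y::banach) topology" where
  "test_fun_top K =
     seminorms_topology (test_fun_in K) (UNIV :: nat set)
       (\<lambda>j \<theta>. SUP x\<in>K. mlin_norm j (nth_deriv j \<theta> x))"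

definition cont_seminorm_on :: "(real^'n) set \<Rightarrow> ((real^'n \<Rightarrow> 'y::banach) \<Rightarrow> real) \<Rightarrow> bool" where
  "cont_seminorm_on K \<nu> \<longleftrightarrow>
     (\<forall>\<theta>\<in>test_fun_in K. \<forall>\<eta>\<in>test_fun_in K. \<nu> (\<lambda>x. \<theta> x + \<eta> x) \<le> \<nu> \<theta> + \<nu> \<eta>) \<and>
     (\<forall>c. \<forall>\<theta>\<in>test_fun_in K. \<nu> (\<lambda>x. c *\<^sub>R \<theta> x) = \<bar>c\<bar> * \<nu> \<theta>) \<and>
     continuous_map (test_fun_top K) euclideanreal \<nu>"

text \<open>Outside the test functions a distribution is \<open>undefined\<close>, so that equality of
  distributions is equality on the test functions.\<close>

definition distributions :: "((real^'n \<Rightarrow> 'y::banach) \<Rightarrow> real) set" where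
  "distributions = {T \<in> extensional test_fun.
     (\<forall>\<theta>\<in>test_fun. \<forall>\<eta>\<in>test_fun. T (\<lambda>x. \<theta> x + \<eta> x) = T \<theta> + T \<eta>) \<and>
     (\<forall>c. \<forall>\<theta>\<in>test_fun. T (\<lambda>x. c *\<^sub>R \<theta> x) = c * T \<theta>) \<and>
     (\<forall>K. compact K \<longrightarrow> continuous_map (test_fun_top K) euclideanreal T)}"

definition distributions_top :: "((real^'n \<Rightarrow> 'y::banach) \<Rightarrow> real) topology" where
  "distributions_top =
     subtopology (product_topology (\<lambda>_. euclideanreal) test_fun) distributions"

definition rescale ::
  "((real^'n \<Rightarrow> 'y::banach) \<Rightarrow> real) \<Rightarrow> real^'n \<Rightarrow> real \<Rightarrow> (real^'n \<Rightarrow> 'y) \<Rightarrow> real" where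
  "rescale T a r \<theta> = T (\<lambda>x. \<theta> ((1 / r) *\<^sub>R (x - a))) / r ^ CARD('n)"

text \<open>Polynomial functions of degree at most \<open>k\<close>; the sum is empty if \<open>k \<le> -1\<close>.\<close>

definition poly_upto :: "int \<Rightarrow> (real^'n \<Rightarrow> ('y::banach \<Rightarrow>\<^sub>L real)) set" where
  "poly_upto k = {P. \<exists>\<psi>. (\<forall>m. \<psi> m \<in> sym_mlin m) \<and>
     P = (\<lambda>x. \<Sum>m | int m \<le> k. \<psi> m (replicate m x))}"

definition poly_top :: "int \<Rightarrow> (real^'n \<Rightarrow> ('y::banach \<Rightarrow>\<^sub>L real)) topology" where
  "poly_top k = seminorms_topology (poly_upto k) {()}
     (\<lambda>_ P. \<Sum>m | int m \<le> k. mlin_norm m (nth_deriv m P 0))"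

definition distr_of :: "(real^'n \<Rightarrow> ('y::banach \<Rightarrow>\<^sub>L real)) \<Rightarrow> (real^'n \<Rightarrow> 'y) \<Rightarrow> real" where
  "distr_of P = (\<lambda>\<theta>\<in>test_fun. \<integral>x. blinfun_apply (P x) (\<theta> x) \<partial>lebesgue)"

text \<open>The suprema below may be infinite, hence are formed in the extended reals.\<close>

definition has_jet_holder ::
  "((real^'n \<Rightarrow> 'y::banach) \<Rightarrow> real) \<Rightarrow> int \<Rightarrow> real \<Rightarrow> ((real^'n \<Rightarrow> 'y) \<Rightarrow> real) \<Rightarrow> real^'n
     \<Rightarrow> (real^'n \<Rightarrow> ('y \<Rightarrow>\<^sub>L real)) \<Rightarrow> bool" where
  "has_jet_holder \<nu> k \<alpha> T a P \<longleftrightarrow> P \<in> poly_upto k \<and>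
     Limsup (at_right 0)
       (\<lambda>r. SUP \<theta>\<in>{\<theta> \<in> test_fun_in (cball 0 1). \<nu> \<theta> \<le> 1}.
          ereal (r powr (- real_of_int k - \<alpha>) * rescale (\<lambda>\<eta>. T \<eta> - distr_of P \<eta>) a r \<theta>)) < \<infinity>"

definition has_jet ::
  "((real^'n \<Rightarrow> 'y::banach) \<Rightarrow> real) \<Rightarrow> int \<Rightarrow> ((real^'n \<Rightarrow> 'y) \<Rightarrow> real) \<Rightarrow> real^'n
     \<Rightarrow> (real^'n \<Rightarrow> ('y \<Rightarrow>\<^sub>L real)) \<Rightarrow> bool" where
  "has_jet \<nu> k T a P \<longleftrightarrow> P \<in> poly_upto k \<and>
     ((\<lambda>r. SUP \<theta>\<in>{\<theta> \<in> test_fun_in (cball 0 1). \<nu> \<theta> \<le> 1}.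
          ereal (r powi (- k) * rescale (\<lambda>\<eta>. T \<eta> - distr_of P \<eta>) a r \<theta>))
       \<longlongrightarrow> 0) (at_right 0)"

definition pt_differentiable_holder ::
  "((real^'n \<Rightarrow> 'y::banach) \<Rightarrow> real) \<Rightarrow> int \<Rightarrow> real \<Rightarrow> ((real^'n \<Rightarrow> 'y) \<Rightarrow> real) \<Rightarrow> real^'n \<Rightarrow> bool"
  where "pt_differentiable_holder \<nu> k \<alpha> T a \<longleftrightarrow> (\<exists>P. has_jet_holder \<nu> k \<alpha> T a P)"

definition pt_differentiable ::
  "((real^'n \<Rightarrow> 'y::banach) \<Rightarrow> real) \<Rightarrow> int \<Rightarrow> ((real^'n \<Rightarrow> 'y) \<Rightarrow> real) \<Rightarrow> real^'n \<Rightarrow> bool"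
  where "pt_differentiable \<nu> k T a \<longleftrightarrow> (\<exists>P. has_jet \<nu> k T a P)"

text \<open>\<open>pt D\<^sup>m T(a)\<close>, computed from the jet of order \<open>k \<ge> m\<close>.\<close>

definition pt_deriv ::
  "((real^'n \<Rightarrow> 'y::banach) \<Rightarrow> real) \<Rightarrow> int \<Rightarrow> nat \<Rightarrow> ((real^'n \<Rightarrow> 'y) \<Rightarrow> real) \<Rightarrow> real^'n
     \<Rightarrow> (real^'n) list \<Rightarrow> ('y \<Rightarrow>\<^sub>L real)" where
  "pt_deriv \<nu> k m T a = nth_deriv m (THE P. has_jet \<nu> k T a P) a"

end

theory Submission
  imports Defs "HOL-Complex_Analysis.Great_Picard"
begin

text \<open>
  Write \<open>(T - P)\<^sup>a\<^sup>,\<^sup>r(\<theta>)\<close> for the rescaled difference of a distribution and a polynomial function.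
  Order \<open>(k, \<alpha>)\<close> at \<open>a\<close> with jet \<open>P\<close> means that, for some \<open>c\<close> and \<open>\<delta>\<close>, this difference is at most
  \<open>c r\<^sup>s\<close> with \<open>s = k + \<alpha>\<close> for all \<open>r < \<delta>\<close> and all \<open>\<theta>\<close> with \<open>\<nu>(\<theta>) \<le> 1\<close>. Order \<open>k\<close> means that for every
  \<open>c > 0\<close> there is \<open>\<delta>\<close> with this property for \<open>s = k\<close>. So everything is governed by the sets
  \<open>approx_set \<nu> T k s c \<delta>\<close> of pairs \<open>(a, P)\<close> that satisfy the inequality with fixed constants. They
  are closed, because the rescaled difference is continuous in \<open>(a, P)\<close>, even for weak-star convergence
  of \<open>P\<close> (\<open>defect_tendsto\<close>, \<open>approx_set_closed\<close>).

  The central estimate compares two pairs \<open>(a\<^sub>1, P\<^sub>1)\<close>, \<open>(a\<^sub>2, P\<^sub>2)\<close> of such sets with \<open>a\<^sub>1\<close>, \<open>a\<^sub>2\<close> within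
  \<open>\<rho>\<close> of \<open>a\<close>. There is a mollifier that reproduces polynomial functions of degree at most \<open>k\<close>
  (\<open>reproducing_mollifier\<close>). Testing \<open>P\<^sub>1 - P\<^sub>2 = (T - P\<^sub>2) - (T - P\<^sub>1)\<close> against its rescaled
  translates, on which \<open>\<nu>\<close> stays bounded, evaluates \<open>P\<^sub>1 - P\<^sub>2\<close> at points and bounds it by a multiple
  of \<open>(c\<^sub>1 + c\<^sub>2) \<rho>\<^sup>s\<close> on the ball of radius \<open>\<rho>\<close> about \<open>a\<close>. Going from this ball to the unit ball
  costs a factor \<open>\<rho>\<^sup>-\<^sup>k\<close>, whence \<open>\<parallel>P\<^sub>1 - P\<^sub>2\<parallel> \<le> C (c\<^sub>1 + c\<^sub>2) \<rho>\<^sup>s\<^sup>-\<^sup>k\<close>, locally uniformly in \<open>a\<close>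
  (\<open>approx_set_poly_norm_close\<close>).

  If \<open>s = k + \<alpha>\<close>, the bound tends to \<open>0\<close> with \<open>\<rho>\<close>. Hence the part of \<open>approx_set\<close> over a ball is the
  graph of a uniformly continuous function on a closed bounded set and therefore compact, and so is its
  projection (\<open>compact_uniform_graph\<close>). Letting the constants run through the natural numbers gives
  the two statements on order \<open>(k, \<alpha>)\<close>.

  If \<open>s = k\<close>, the bound is only proportional to \<open>c\<^sub>1 + c\<^sub>2\<close>. The set of jets is a countable intersection
  of countable unions of the closed sets \<open>approx_set\<close>, hence Borel. The bound gives uniqueness of the jet
  and, together with completeness of the space of polynomial functions, the converse \<open>jet_exists\<close>: if
  \<open>a\<close> admits approximations \<open>P\<^sub>p\<close> with constants \<open>1/p\<close>, then the \<open>P\<^sub>p\<close> converge to a jet. So projecting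
  to \<open>a\<close> commutes with the intersection over \<open>p\<close>. When \<open>Y\<close> is separable, bounded sets of polynomial
  functions are weak-star sequentially compact, the projection of each \<open>approx_set\<close> is closed, and the
  domain of the jet function is Borel; preimages of closed sets are handled similarly (\<open>jets_preimage\<close>).

  When \<open>Y\<close> is finite dimensional, countably many test functions and rational scales suffice to define \<open>approx_set\<close>, and each
  single inequality is a Borel condition on \<open>(a, S, P)\<close>, since the rescaled difference is continuous in
  \<open>a\<close> and in \<open>(S, P)\<close> separately (\<open>separately_continuous_sublevel_borel\<close>). To eliminate \<open>P\<close>, norm
  compactness of bounded sets of polynomial functions turns the existence of \<open>P\<close> into a condition on a
  countable dense set of candidates (\<open>approx_projection_borel\<close>), and \<open>jet_exists\<close> again deals with the
  intersection over the constants.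
\<close>

section \<open>Smooth functions\<close>

text \<open>A class of differentiable functions that contains its own directional derivatives consists of smooth
  functions; this avoids explicit formulas for the higher derivatives.\<close>

lemma smooth_coinduct:
  assumes "f \<in> C"
    and "\<And>g x. g \<in> C \<Longrightarrow> g differentiable (at x)"
    and "\<And>g v. g \<in> C \<Longrightarrow> (\<lambda>x. frechet_derivative g (at x) v) \<in> C"
  shows "smooth f"
proof -
  have "dderiv vs f \<in> C" for vs
    by (induction vs) (use assms in auto)
  then show ?thesis
    unfolding smooth_def using assms(2) by blast
qed

lemma dderiv_append: "dderiv (vs @ ws) f = dderiv vs (dderiv ws f)"
  by (induction vs) auto

lemma smooth_dderiv: "smooth f \<Longrightarrow> smooth (dderiv vs f)"
  unfolding smooth_def by (metis dderiv_append)

lemma has_derivative_dderiv: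
  assumes "smooth f"
  shows "(dderiv vs f has_derivative (\<lambda>v. dderiv (v # vs) f x)) (at x)"
  using assms unfolding smooth_def by (auto simp: frechet_derivative_works[symmetric])

text \<open>The step in all inductions on the list of directions: a formula \<open>g\<close> for the derivative along \<open>vs\<close>
  is differentiated once more.\<close>

lemma dderiv_Cons_eqI:
  "dderiv vs f = g \<Longrightarrow> (g has_derivative D) (at x) \<Longrightarrow> dderiv (v # vs) f x = D v"
  using frechet_derivative_at[of g D x] by simp

lemma continuous_on_dderiv: "smooth f \<Longrightarrow> continuous_on A (dderiv vs f)"
  by (meson has_derivative_continuous_on has_derivative_at_withinI has_derivative_dderiv)

lemma smooth_imp_continuous_on: "smooth f \<Longrightarrow> continuous_on A f"
  using continuous_on_dderiv[of f A "[]"] by simp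

lemma linear_dderiv_Cons: "smooth f \<Longrightarrow> linear (\<lambda>v. dderiv (v # vs) f x)"
  using has_derivative_dderiv has_derivative_linear by blast

lemma dderiv_bounded_linear:
  assumes "smooth f" "bounded_linear h"
  shows "dderiv vs (\<lambda>x. h (f x)) = (\<lambda>x. h (dderiv vs f x))"
proof (induction vs)
  case (Cons v vs)
  show ?case
  proof
    fix x
    have "((\<lambda>x. h (dderiv vs f x)) has_derivative (\<lambda>v. h (dderiv (v # vs) f x))) (at x)"
      by (rule bounded_linear.has_derivative[OF assms(2) has_derivative_dderiv[OF assms(1)]])
    then show "dderiv (v # vs) (\<lambda>x. h (f x)) x = h (dderiv (v # vs) f x)"
      by (rule dderiv_Cons_eqI[OF Cons.IH])
  qed
qed auto

lemma smooth_bounded_linear: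
  assumes "smooth f" "bounded_linear h"
  shows "smooth (\<lambda>x. h (f x))"
  unfolding smooth_def dderiv_bounded_linear[OF assms]
  using bounded_linear.has_derivative[OF assms(2) has_derivative_dderiv[OF assms(1)]]
  by (auto simp: differentiable_def)

lemma dderiv_add:
  assumes "smooth f" "smooth g"
  shows "dderiv vs (\<lambda>x. f x + g x) = (\<lambda>x. dderiv vs f x + dderiv vs g x)"
proof (induction vs)
  case (Cons v vs)
  show ?case
  proof
    fix x
    have "((\<lambda>x. dderiv vs f x + dderiv vs g x) has_derivative
       (\<lambda>v. dderiv (v # vs) f x + dderiv (v # vs) g x)) (at x)"
      by (intro has_derivative_add has_derivative_dderiv assms)
    then show "dderiv (v # vs) (\<lambda>x. f x + g x) x = dderiv (v # vs) f x + dderiv (v # vs) g x"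
      by (rule dderiv_Cons_eqI[OF Cons.IH])
  qed
qed auto

lemma smooth_add:
  assumes "smooth f" "smooth g"
  shows "smooth (\<lambda>x. f x + g x)"
  unfolding smooth_def dderiv_add[OF assms]
  using assms by (auto simp: smooth_def)

lemma smooth_scaleR: "smooth f \<Longrightarrow> smooth (\<lambda>x. c *\<^sub>R f x)"
  and dderiv_scaleR: "smooth f \<Longrightarrow> dderiv vs (\<lambda>x. c *\<^sub>R f x) = (\<lambda>x. c *\<^sub>R dderiv vs f x)"
  using smooth_bounded_linear dderiv_bounded_linear bounded_linear_scaleR_right by blast+

lemma smooth_diff: "smooth f \<Longrightarrow> smooth g \<Longrightarrow> smooth (\<lambda>x. f x - g x)"
  using smooth_add[of f "\<lambda>x. (-1) *\<^sub>R g x"] smooth_scaleR[of g "-1"] by simp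

lemma dderiv_diff:
  "smooth f \<Longrightarrow> smooth g \<Longrightarrow> dderiv vs (\<lambda>x. f x - g x) = (\<lambda>x. dderiv vs f x - dderiv vs g x)"
  using dderiv_add[of f "\<lambda>x. (-1) *\<^sub>R g x" vs] smooth_scaleR[of g "-1"] dderiv_scaleR[of g vs "-1"]
  by simp

lemma dderiv_zero: "dderiv vs (\<lambda>x. 0) = (\<lambda>x. 0)"
  by (induction vs) auto

lemma smooth_zero: "smooth (\<lambda>x. 0)"
  unfolding smooth_def dderiv_zero by simp

lemma smooth_sum: "(\<And>i. i \<in> I \<Longrightarrow> smooth (f i)) \<Longrightarrow> smooth (\<lambda>x. \<Sum>i\<in>I. f i x)"
  by (induction I rule: infinite_finite_induct) (auto intro: smooth_zero smooth_add)

lemma dderiv_sum: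
  "(\<And>i. i \<in> I \<Longrightarrow> smooth (f i)) \<Longrightarrow>
     dderiv vs (\<lambda>x. \<Sum>i\<in>I. f i x) = (\<lambda>x. \<Sum>i\<in>I. dderiv vs (f i) x)"
  by (induction I rule: infinite_finite_induct)
     (auto simp: dderiv_zero dderiv_add smooth_sum)

lemma dderiv_affine:
  assumes "smooth f"
  shows "dderiv vs (\<lambda>x. f (s *\<^sub>R x + c)) = (\<lambda>x. s ^ length vs *\<^sub>R dderiv vs f (s *\<^sub>R x + c))"
proof (induction vs)
  case (Cons v vs)
  show ?case
  proof
    fix x
    have 1: "((\<lambda>x. s *\<^sub>R x + c) has_derivative (\<lambda>v. s *\<^sub>R v)) (at x)"
      by (auto intro!: derivative_eq_intros)
    have 2: "((\<lambda>x. dderiv vs f (s *\<^sub>R x + c)) has_derivative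
         (\<lambda>v. dderiv (s *\<^sub>R v # vs) f (s *\<^sub>R x + c))) (at x)"
      using has_derivative_compose[OF 1 has_derivative_dderiv[OF assms]] .
    have "((\<lambda>x. s ^ length vs *\<^sub>R dderiv vs f (s *\<^sub>R x + c)) has_derivative
        (\<lambda>v. s ^ length vs *\<^sub>R dderiv (s *\<^sub>R v # vs) f (s *\<^sub>R x + c))) (at x)"
      by (rule has_derivative_scaleR_right[OF 2])
    then have "dderiv (v # vs) (\<lambda>x. f (s *\<^sub>R x + c)) x
        = s ^ length vs *\<^sub>R dderiv (s *\<^sub>R v # vs) f (s *\<^sub>R x + c)"
      by (rule dderiv_Cons_eqI[OF Cons.IH])
    also have "\<dots> = s ^ length (v # vs) *\<^sub>R dderiv (v # vs) f (s *\<^sub>R x + c)"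
      using linear_cmul[OF linear_dderiv_Cons[OF assms], of s v] by (simp del: dderiv.simps add: mult.commute)
    finally show "dderiv (v # vs) (\<lambda>x. f (s *\<^sub>R x + c)) x
        = s ^ length (v # vs) *\<^sub>R dderiv (v # vs) f (s *\<^sub>R x + c)" .
  qed
qed auto

lemma smooth_affine:
  assumes "smooth f"
  shows "smooth (\<lambda>x. f (s *\<^sub>R x + c))"
proof -
  have "dderiv vs (\<lambda>x. f (s *\<^sub>R x + c)) differentiable (at x)" for vs x
  proof -
    have 1: "((\<lambda>x. s *\<^sub>R x + c) has_derivative (\<lambda>v. s *\<^sub>R v)) (at x)"
      by (auto intro!: derivative_eq_intros)
    show ?thesis
      unfolding dderiv_affine[OF assms]
      using has_derivative_scaleR_right[OF has_derivative_compose[OF 1 has_derivative_dderiv[OF assms]]]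
      by (auto simp: differentiable_def)
  qed
  then show ?thesis by (auto simp: smooth_def)
qed

lemma dderiv_support:
  assumes "x \<notin> closure {x. f x \<noteq> 0}"
  shows "dderiv vs f x = 0"
  using assms
proof (induction vs arbitrary: x)
  case Nil
  then have "x \<notin> {x. f x \<noteq> 0}"
    using closure_subset[of "{x. f x \<noteq> 0}"] by blast
  then show ?case by simp
next
  case (Cons v vs)
  let ?U = "- closure {x. f x \<noteq> 0}"
  have "(dderiv vs f has_derivative (\<lambda>_. 0)) (at x)"
  proof (rule has_derivative_transform_within_open)
    show "((\<lambda>_. 0) has_derivative (\<lambda>_. 0)) (at x)" by simp
    show "open ?U" by (simp add: open_Compl)
    show "x \<in> ?U" using Cons.prems by simp
    show "\<And>y. y \<in> ?U \<Longrightarrow> 0 = dderiv vs f y" using Cons.IH by simp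
  qed
  then show ?case by (rule dderiv_Cons_eqI[OF refl])
qed

text \<open>By multilinearity in the directions it suffices to control the finitely many derivatives along lists
  of basis vectors. Each of the \<open>m\<close> directions is expanded in the basis with coefficients at most \<open>1\<close>,
  which produces \<open>DIM('a)^m\<close> terms.\<close>

lemma dderiv_basis_bound:
  fixes f :: "'a::euclidean_space \<Rightarrow> 'b::real_normed_vector"
  assumes "smooth f"
    and "\<And>bs. length bs = m \<Longrightarrow> set bs \<subseteq> Basis \<Longrightarrow> norm (dderiv bs f x) \<le> e"
    and "length vs = m" and "\<forall>v\<in>set vs. norm v \<le> 1"
  shows "norm (dderiv vs f x) \<le> real DIM('a) ^ m * e"
  using assms
proof (induction m arbitrary: f vs)
  case (Suc m)
  \<comment> \<open>The last entry is the direction of the innermost derivative, so splitting it off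
    leaves a derivative of the same kind of the smooth function \<open>dderiv [w] f\<close>.\<close>
  obtain ws w where vs: "vs = ws @ [w]"
    using Suc.prems(3) by (metis length_Suc_conv_rev)
  let ?D = "\<lambda>u. dderiv [u] f"
  have sm: "smooth (?D b)" for b using Suc.prems(1) by (rule smooth_dderiv)
  have eq: "?D w = (\<lambda>x. \<Sum>b\<in>Basis. (w \<bullet> b) *\<^sub>R ?D b x)"
  proof
    fix x
    interpret linear "\<lambda>v. dderiv [v] f x" using linear_dderiv_Cons[OF Suc.prems(1), of "[]" x] .
    have "?D w x = ?D (\<Sum>b\<in>Basis. (w \<bullet> b) *\<^sub>R b) x" by (simp only: euclidean_representation)
    also have "\<dots> = (\<Sum>b\<in>Basis. (w \<bullet> b) *\<^sub>R ?D b x)" by (simp only: sum scaleR)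
    finally show "?D w x = (\<Sum>b\<in>Basis. (w \<bullet> b) *\<^sub>R ?D b x)" .
  qed
  have "dderiv vs f x = dderiv ws (?D w) x" unfolding vs dderiv_append ..
  also have "\<dots> = (\<Sum>b\<in>Basis. (w \<bullet> b) *\<^sub>R dderiv ws (?D b) x)"
    unfolding eq by (subst dderiv_sum) (auto intro!: smooth_scaleR sm[simplified] simp: dderiv_scaleR sm[simplified])
  finally have "norm (dderiv vs f x) \<le> (\<Sum>b\<in>Basis. norm ((w \<bullet> b) *\<^sub>R dderiv ws (?D b) x))"
    by (simp only: norm_sum)
  also have "\<dots> \<le> (\<Sum>b\<in>(Basis::'a set). real DIM('a) ^ m * e)"
  proof (rule sum_mono)
    fix b :: 'a assume b: "b \<in> Basis"
    have "norm w \<le> 1" using Suc.prems(4) vs by simp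
    then have "\<bar>w \<bullet> b\<bar> \<le> 1" using Basis_le_norm[OF b, of w] by linarith
    moreover have "norm (dderiv ws (?D b) x) \<le> real DIM('a) ^ m * e"
    proof (rule Suc.IH[OF sm])
      fix bs :: "'a list" assume "length bs = m" "set bs \<subseteq> Basis"
      then show "norm (dderiv bs (?D b) x) \<le> e"
        using Suc.prems(2)[of "bs @ [b]"] b by (simp add: dderiv_append)
    qed (use Suc.prems vs in auto)
    ultimately have "\<bar>w \<bullet> b\<bar> * norm (dderiv ws (?D b) x) \<le> 1 * (real DIM('a) ^ m * e)"
      by (intro mult_mono) auto
    then show "norm ((w \<bullet> b) *\<^sub>R dderiv ws (?D b) x) \<le> real DIM('a) ^ m * e"
      by (simp only: norm_scaleR mult_1)
  qed
  finally show ?case by simp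
qed auto

lemma finite_basis_lists: "finite {bs. length bs = m \<and> set bs \<subseteq> (Basis::'a::euclidean_space set)}"
  using finite_lists_length_eq[OF finite_Basis, of m] by (simp add: conj_commute)

section \<open>Test functions\<close>

lemma test_fun_inD: "\<theta> \<in> test_fun_in K \<Longrightarrow> \<theta> \<in> test_fun" "\<theta> \<in> test_fun_in K \<Longrightarrow> smooth \<theta>"
  by (simp_all add: test_fun_def test_fun_in_def)

text \<open>For compact \<open>K\<close> the support condition is pointwise, as \<open>K\<close> is closed and a closed subset of it is compact.\<close>

lemma test_fun_in_iff:
  assumes "compact K"
  shows "\<theta> \<in> test_fun_in K \<longleftrightarrow> smooth \<theta> \<and> (\<forall>x. x \<notin> K \<longrightarrow> \<theta> x = 0)"
proof
  assume L: "\<theta> \<in> test_fun_in K"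
  then have "{x. \<theta> x \<noteq> 0} \<subseteq> K"
    using closure_subset[of "{x. \<theta> x \<noteq> 0}"] by (auto simp: test_fun_in_def)
  then show "smooth \<theta> \<and> (\<forall>x. x \<notin> K \<longrightarrow> \<theta> x = 0)" using test_fun_inD[OF L] by auto
next
  assume R: "smooth \<theta> \<and> (\<forall>x. x \<notin> K \<longrightarrow> \<theta> x = 0)"
  then have "closure {x. \<theta> x \<noteq> 0} \<subseteq> K"
    by (intro closure_minimal) (auto simp: assms compact_imp_closed)
  moreover from this have "compact (closure {x. \<theta> x \<noteq> 0})"
    using bounded_subset[OF compact_imp_bounded[OF assms]] by (simp add: compact_eq_bounded_closed)
  ultimately show "\<theta> \<in> test_fun_in K" using R by (simp add: test_fun_in_def test_fun_def)
qed

lemma dderiv_outside: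
  assumes "\<theta> \<in> test_fun_in K" "x \<notin> K"
  shows "dderiv vs \<theta> x = 0"
  by (rule dderiv_support) (use assms in \<open>auto simp: test_fun_in_def\<close>)

lemma dderiv_bounded:
  fixes \<theta> :: "real^'n \<Rightarrow> 'y::banach"
  assumes "\<theta> \<in> test_fun_in K" "compact K"
  obtains B where "B > 0"
    "\<And>vs x. length vs = m \<Longrightarrow> \<forall>v\<in>set vs. norm v \<le> 1 \<Longrightarrow> norm (dderiv vs \<theta> x) \<le> B"
proof -
  have sm: "smooth \<theta>" using assms test_fun_inD by auto
  let ?L = "{bs. length bs = m \<and> set bs \<subseteq> (Basis::(real^'n) set)}"
  have "\<exists>b. \<forall>x. norm (dderiv bs \<theta> x) \<le> b" for bs
  proof -
    have "bounded (dderiv bs \<theta> ` K)"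
      by (intro compact_imp_bounded compact_continuous_image assms continuous_on_dderiv sm)
    then obtain b where b: "\<And>x. x \<in> K \<Longrightarrow> norm (dderiv bs \<theta> x) \<le> b"
      by (auto simp: bounded_iff)
    have "norm (dderiv bs \<theta> x) \<le> max b 0" for x
      by (cases "x \<in> K") (use b dderiv_outside[OF assms(1)] in \<open>force+\<close>)
    then show ?thesis by blast
  qed
  then obtain b where b: "\<And>bs x. norm (dderiv bs \<theta> x) \<le> b bs" by metis
  let ?e = "\<Sum>bs\<in>?L. \<bar>b bs\<bar>"
  have e: "norm (dderiv bs \<theta> x) \<le> ?e" if "length bs = m" "set bs \<subseteq> Basis" for bs x
  proof -
    have "\<bar>b bs\<bar> \<le> ?e" by (rule member_le_sum) (use that finite_basis_lists in auto)
    then show ?thesis using b[of bs x] by linarith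
  qed
  show ?thesis
  proof (rule that[of "1 + real DIM(real^'n) ^ m * ?e"])
    show "0 < 1 + real DIM(real^'n) ^ m * ?e"
      by (intro add_pos_nonneg mult_nonneg_nonneg sum_nonneg) auto
    fix vs :: "(real^'n) list" and x
    assume "length vs = m" "\<forall>v\<in>set vs. norm v \<le> 1"
    then have "norm (dderiv vs \<theta> x) \<le> real DIM(real^'n) ^ m * ?e"
      using dderiv_basis_bound[OF sm e] by blast
    then show "norm (dderiv vs \<theta> x) \<le> 1 + real DIM(real^'n) ^ m * ?e" by linarith
  qed
qed

lemma dderiv_lipschitz:
  fixes \<theta> :: "real^'n \<Rightarrow> 'y::banach"
  assumes "smooth \<theta>"
    and B: "\<And>vs x. length vs = Suc m \<Longrightarrow> \<forall>v\<in>set vs. norm v \<le> 1 \<Longrightarrow> norm (dderiv vs \<theta> x) \<le> B"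
    and vs: "length vs = m" "\<forall>v\<in>set vs. norm v \<le> 1"
  shows "norm (dderiv vs \<theta> x - dderiv vs \<theta> z) \<le> B * norm (x - z)"
proof (rule differentiable_bound[of UNIV "dderiv vs \<theta>" "\<lambda>x v. dderiv (v # vs) \<theta> x"])
  fix x
  show "onorm (\<lambda>v. dderiv (v # vs) \<theta> x) \<le> B"
  proof (rule onorm_le)
    fix v
    have lin: "linear (\<lambda>v. dderiv (v # vs) \<theta> x)" by (rule linear_dderiv_Cons[OF assms(1)])
    show "norm (dderiv (v # vs) \<theta> x) \<le> B * norm v"
    proof (cases "v = 0")
      case True
      then show ?thesis using linear_0[OF lin] by simp
    next
      case False
      have "dderiv (v # vs) \<theta> x = norm v *\<^sub>R dderiv ((v /\<^sub>R norm v) # vs) \<theta> x"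
        using linear_cmul[OF lin, of "norm v" "v /\<^sub>R norm v"] False by (simp del: dderiv.simps)
      moreover have "norm (dderiv ((v /\<^sub>R norm v) # vs) \<theta> x) \<le> B"
        by (rule B) (use vs in \<open>auto simp: False\<close>)
      ultimately have "norm (dderiv (v # vs) \<theta> x) \<le> norm v * B"
        by (simp only: norm_scaleR abs_norm_cancel mult_left_mono norm_ge_zero)
      then show ?thesis by (simp only: mult.commute)
    qed
  qed
qed (use has_derivative_dderiv[OF assms(1)] has_derivative_at_withinI in auto)

section \<open>Topologies generated by seminorms\<close>

text \<open>The generating sets are balls about arbitrary centres; by the triangle inequality, balls about the
  point itself form a neighbourhood base.\<close>

lemma openin_seminorms_topology:
  fixes p :: "'i \<Rightarrow> ('a \<Rightarrow> 'b::ab_group_add) \<Rightarrow> real"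
  assumes I: "I \<noteq> {}"
    and zero: "\<And>i v. i \<in> I \<Longrightarrow> v \<in> V \<Longrightarrow> p i (\<lambda>x. v x - v x) = 0"
    and tri: "\<And>i u v w. i \<in> I \<Longrightarrow> u \<in> V \<Longrightarrow> v \<in> V \<Longrightarrow> w \<in> V \<Longrightarrow>
        p i (\<lambda>x. u x - w x) \<le> p i (\<lambda>x. u x - v x) + p i (\<lambda>x. v x - w x)"
  shows "openin (seminorms_topology V I p) U \<longleftrightarrow>
    U \<subseteq> V \<and> (\<forall>w\<in>U. \<exists>J e. finite J \<and> J \<subseteq> I \<and> e > 0 \<and>
        {u \<in> V. \<forall>i\<in>J. p i (\<lambda>x. u x - w x) < e} \<subseteq> U)"
proof
  let ?S = "{{w \<in> V. p i (\<lambda>x. w x - v x) < e} | v i e. v \<in> V \<and> i \<in> I \<and> 0 < e}"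
  assume "openin (seminorms_topology V I p) U"
  then have "generate_topology_on ?S U"
    unfolding seminorms_topology_def openin_topology_generated_by_iff .
  then show "U \<subseteq> V \<and> (\<forall>w\<in>U. \<exists>J e. finite J \<and> J \<subseteq> I \<and> e > 0 \<and>
        {u \<in> V. \<forall>i\<in>J. p i (\<lambda>x. u x - w x) < e} \<subseteq> U)"
  proof induction
    case (Int A B)
    show ?case
    proof (intro conjI ballI)
      fix w assume w: "w \<in> A \<inter> B"
      obtain J e where J: "finite J" "J \<subseteq> I" "e > 0" "{u \<in> V. \<forall>i\<in>J. p i (\<lambda>x. u x - w x) < e} \<subseteq> A"
        using Int.IH(1) w by blast
      obtain J' e' where J': "finite J'" "J' \<subseteq> I" "e' > 0"
        "{u \<in> V. \<forall>i\<in>J'. p i (\<lambda>x. u x - w x) < e'} \<subseteq> B"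
        using Int.IH(2) w by blast
      have "{u \<in> V. \<forall>i\<in>J \<union> J'. p i (\<lambda>x. u x - w x) < min e e'} \<subseteq> A \<inter> B"
        using J(4) J'(4) by auto
      then show "\<exists>J e. finite J \<and> J \<subseteq> I \<and> e > 0 \<and>
          {u \<in> V. \<forall>i\<in>J. p i (\<lambda>x. u x - w x) < e} \<subseteq> A \<inter> B"
        using J J' by (intro exI[of _ "J \<union> J'"] exI[of _ "min e e'"]) simp
    qed (use Int.IH in blast)
  next
    case (UN A)
    show ?case
    proof (intro conjI ballI)
      show "\<Union>A \<subseteq> V" using UN.IH by blast
      fix w assume "w \<in> \<Union>A"
      then obtain B where B: "B \<in> A" "w \<in> B" by blast
      then obtain J e where J: "finite J" "J \<subseteq> I" "e > 0"
        "{u \<in> V. \<forall>i\<in>J. p i (\<lambda>x. u x - w x) < e} \<subseteq> B"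
        using UN.IH[OF B(1)] by blast
      then show "\<exists>J e. finite J \<and> J \<subseteq> I \<and> e > 0 \<and>
          {u \<in> V. \<forall>i\<in>J. p i (\<lambda>x. u x - w x) < e} \<subseteq> \<Union>A"
        using B by (intro exI[of _ J] exI[of _ e]) auto
    qed
  next
    case (Basis B)
    then obtain v i e where v: "v \<in> V" "i \<in> I" "0 < e" and B: "B = {w \<in> V. p i (\<lambda>x. w x - v x) < e}"
      by blast
    show ?case
    proof (intro conjI ballI)
      fix w assume w: "w \<in> B"
      have "{u \<in> V. \<forall>i\<in>{i}. p i (\<lambda>x. u x - w x) < e - p i (\<lambda>x. w x - v x)} \<subseteq> B"
      proof
        fix u assume u: "u \<in> {u \<in> V. \<forall>i\<in>{i}. p i (\<lambda>x. u x - w x) < e - p i (\<lambda>x. w x - v x)}"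
        then have "p i (\<lambda>x. u x - v x) \<le> p i (\<lambda>x. u x - w x) + p i (\<lambda>x. w x - v x)"
          using v w by (intro tri) (auto simp: B)
        then show "u \<in> B" using u by (simp add: B)
      qed
      then show "\<exists>J e. finite J \<and> J \<subseteq> I \<and> e > 0 \<and>
          {u \<in> V. \<forall>i\<in>J. p i (\<lambda>x. u x - w x) < e} \<subseteq> B"
        using v w B by (intro exI[of _ "{i}"] exI[of _ "e - p i (\<lambda>x. w x - v x)"]) auto
    qed (use B in blast)
  qed auto
next
  assume R: "U \<subseteq> V \<and> (\<forall>w\<in>U. \<exists>J e. finite J \<and> J \<subseteq> I \<and> e > 0 \<and>
        {u \<in> V. \<forall>i\<in>J. p i (\<lambda>x. u x - w x) < e} \<subseteq> U)"
  obtain i0 where i0: "i0 \<in> I" using I by blast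
  show "openin (seminorms_topology V I p) U"
  proof (subst openin_subopen, intro ballI)
    fix w assume w: "w \<in> U"
    then obtain J e where J: "finite J" "J \<subseteq> I" "e > 0"
      "{u \<in> V. \<forall>i\<in>J. p i (\<lambda>x. u x - w x) < e} \<subseteq> U"
      using R by blast
    have wV: "w \<in> V" using R w by blast
    have ball: "openin (seminorms_topology V I p) {u \<in> V. p i (\<lambda>x. u x - w x) < e}" if "i \<in> I" for i
      unfolding seminorms_topology_def
      by (rule topology_generated_by_Basis) (use that wV J in blast)
    \<comment> \<open>The index \<open>i0\<close> keeps the intersection inside \<open>V\<close> when \<open>J\<close> is empty.\<close>
    let ?W = "\<Inter>((\<lambda>i. {u \<in> V. p i (\<lambda>x. u x - w x) < e}) ` insert i0 J)"
    have "openin (seminorms_topology V I p) ?W"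
      by (rule openin_Inter) (use J ball i0 in auto)
    moreover have "w \<in> ?W" using zero J wV i0 by auto
    moreover have "?W \<subseteq> U" using J(4) by auto
    ultimately show "\<exists>T. openin (seminorms_topology V I p) T \<and> w \<in> T \<and> T \<subseteq> U" by blast
  qed
qed

lemma topspace_seminorms_topology:
  assumes "I \<noteq> {}" and "\<And>i v. i \<in> I \<Longrightarrow> v \<in> V \<Longrightarrow> p i (\<lambda>x. v x - v x) = 0"
  shows "topspace (seminorms_topology V I p) = V"
proof
  show "V \<subseteq> topspace (seminorms_topology V I p)"
  proof
    fix v assume v: "v \<in> V"
    obtain i where i: "i \<in> I" using assms(1) by blast
    have "v \<in> {w \<in> V. p i (\<lambda>x. w x - v x) < 1}" using assms(2)[OF i v] v by simp
    moreover have "{w \<in> V. p i (\<lambda>x. w x - v x) < 1} \<in>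
        {{w \<in> V. p i (\<lambda>x. w x - v x) < e} | v i e. v \<in> V \<and> i \<in> I \<and> 0 < e}"
      using v i zero_less_one by blast
    ultimately show "v \<in> topspace (seminorms_topology V I p)"
      unfolding seminorms_topology_def topology_generated_by_topspace by blast
  qed
qed (auto simp: seminorms_topology_def topology_generated_by_topspace)

subsection \<open>Test functions supported in a compact set\<close>

lemma mlin_norm_le:
  assumes "\<And>vs. length vs = m \<Longrightarrow> \<forall>v\<in>set vs. norm v \<le> 1 \<Longrightarrow> norm (\<psi> vs) \<le> B"
  shows "mlin_norm m \<psi> \<le> B"
proof -
  have "replicate m 0 \<in> {vs. length vs = m \<and> (\<forall>v\<in>set vs. norm (v::'a) \<le> 1)}" by simp
  then have "{vs. length vs = m \<and> (\<forall>v\<in>set vs. norm (v::'a) \<le> 1)} \<noteq> {}" by blast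
  then show ?thesis unfolding mlin_norm_def
    by (rule cSUP_least) (use assms in auto)
qed

text \<open>Some bound \<open>B\<close> must be known, since the supremum of an unbounded set of reals carries no information.\<close>

lemma norm_le_mlin_norm:
  assumes "\<And>vs. length vs = m \<Longrightarrow> \<forall>v\<in>set vs. norm v \<le> 1 \<Longrightarrow> norm (\<psi> vs) \<le> B"
    and "length ws = m" "\<forall>v\<in>set ws. norm v \<le> 1"
  shows "norm (\<psi> ws) \<le> mlin_norm m \<psi>"
  unfolding mlin_norm_def
  by (rule cSUP_upper) (use assms in \<open>auto intro!: bdd_aboveI[of _ B]\<close>)

lemma test_fun_in_scaleR: "compact K \<Longrightarrow> \<theta> \<in> test_fun_in K \<Longrightarrow> (\<lambda>x. c *\<^sub>R \<theta> x) \<in> test_fun_in K"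
  and test_fun_in_diff: "compact K \<Longrightarrow> \<theta> \<in> test_fun_in K \<Longrightarrow> \<eta> \<in> test_fun_in K \<Longrightarrow>
    (\<lambda>x. \<theta> x - \<eta> x) \<in> test_fun_in K"
  and test_fun_in_zero: "compact K \<Longrightarrow> (\<lambda>x. 0) \<in> test_fun_in K"
  by (auto simp: test_fun_in_iff smooth_scaleR smooth_add smooth_diff smooth_zero)

text \<open>The seminorms that generate \<open>test_fun_top\<close>.\<close>

definition deriv_sup :: "(real^'n) set \<Rightarrow> nat \<Rightarrow> (real^'n \<Rightarrow> 'y::banach) \<Rightarrow> real" where
  "deriv_sup K j \<theta> = (SUP x\<in>K. mlin_norm j (nth_deriv j \<theta> x))"

lemma deriv_sup_le:
  assumes "K \<noteq> {}"
    and "\<And>vs x. x \<in> K \<Longrightarrow> length vs = j \<Longrightarrow> \<forall>v\<in>set vs. norm v \<le> 1 \<Longrightarrow> norm (dderiv vs \<theta> x) \<le> B"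
  shows "deriv_sup K j \<theta> \<le> B"
  unfolding deriv_sup_def
  by (intro cSUP_least mlin_norm_le) (use assms in \<open>auto simp: nth_deriv_def\<close>)

lemma norm_dderiv_le_deriv_sup:
  assumes "compact K" "\<theta> \<in> test_fun_in K" "x \<in> K" "length vs = j" "\<forall>v\<in>set vs. norm v \<le> 1"
  shows "norm (dderiv vs \<theta> x) \<le> deriv_sup K j \<theta>"
proof -
  obtain B where B: "\<And>vs x. length vs = j \<Longrightarrow> \<forall>v\<in>set vs. norm v \<le> 1 \<Longrightarrow> norm (dderiv vs \<theta> x) \<le> B"
    using dderiv_bounded[OF assms(2,1)] by metis
  have "norm (nth_deriv j \<theta> x vs) \<le> mlin_norm j (nth_deriv j \<theta> x)"
    by (rule norm_le_mlin_norm[where B = B]) (use B assms in \<open>auto simp: nth_deriv_def\<close>)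
  moreover have "mlin_norm j (nth_deriv j \<theta> x) \<le> deriv_sup K j \<theta>"
    unfolding deriv_sup_def
    by (rule cSUP_upper[OF assms(3)])
      (use B in \<open>auto intro!: bdd_aboveI[of _ B] mlin_norm_le simp: nth_deriv_def\<close>)
  ultimately show ?thesis using assms(4) by (simp add: nth_deriv_def)
qed

lemma openin_test_fun_top:
  fixes K :: "(real^'n) set" and U :: "(real^'n \<Rightarrow> 'y::banach) set"
  assumes K: "compact K" "K \<noteq> {}"
  shows "openin (test_fun_top K) U \<longleftrightarrow> U \<subseteq> test_fun_in K \<and> (\<forall>\<eta>\<in>U. \<exists>J e. finite J \<and> e > 0 \<and>
      {\<theta> \<in> test_fun_in K. \<forall>j\<in>J. deriv_sup K j (\<lambda>x. \<theta> x - \<eta> x) < e} \<subseteq> U)"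
    and topspace_test_fun_top: "topspace (test_fun_top K) = (test_fun_in K :: (real^'n \<Rightarrow> 'y) set)"
proof -
  have z: "deriv_sup K j (\<lambda>x. \<theta> x - \<theta> x) = 0" for j and \<theta> :: "real^'n \<Rightarrow> 'y"
  proof (rule antisym)
    show "deriv_sup K j (\<lambda>x. \<theta> x - \<theta> x) \<le> 0" by (rule deriv_sup_le) (auto simp: K dderiv_zero)
    obtain x where "x \<in> K" using K by blast
    then show "0 \<le> deriv_sup K j (\<lambda>x. \<theta> x - \<theta> x)"
      using norm_dderiv_le_deriv_sup[OF K(1) test_fun_in_zero[OF K(1)], of x "replicate j 0" j]
      by (simp add: dderiv_zero)
  qed
  have tri: "deriv_sup K j (\<lambda>x. u x - w x) \<le> deriv_sup K j (\<lambda>x. u x - v x) + deriv_sup K j (\<lambda>x. v x - w x)"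
    if uvw: "u \<in> test_fun_in K" "v \<in> test_fun_in K" "w \<in> test_fun_in K" for j and u v w :: "real^'n \<Rightarrow> 'y"
  proof (rule deriv_sup_le)
    fix vs :: "(real^'n) list" and x
    assume x: "x \<in> K" "length vs = j" "\<forall>v\<in>set vs. norm v \<le> 1"
    have "dderiv vs (\<lambda>x. u x - w x) x = dderiv vs (\<lambda>x. u x - v x) x + dderiv vs (\<lambda>x. v x - w x) x"
      using uvw by (simp add: dderiv_diff test_fun_inD)
    also have "norm \<dots> \<le> deriv_sup K j (\<lambda>x. u x - v x) + deriv_sup K j (\<lambda>x. v x - w x)"
      by (intro norm_triangle_mono norm_dderiv_le_deriv_sup K test_fun_in_diff uvw x)
    finally show "norm (dderiv vs (\<lambda>x. u x - w x) x)
      \<le> deriv_sup K j (\<lambda>x. u x - v x) + deriv_sup K j (\<lambda>x. v x - w x)" .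
  qed (rule K)
  have top: "test_fun_top K = seminorms_topology (test_fun_in K :: (real^'n \<Rightarrow> 'y) set) UNIV (deriv_sup K)"
    by (simp add: test_fun_top_def deriv_sup_def[abs_def])
  show "openin (test_fun_top K) U \<longleftrightarrow> U \<subseteq> test_fun_in K \<and> (\<forall>\<eta>\<in>U. \<exists>J e. finite J \<and> e > 0 \<and>
      {\<theta> \<in> test_fun_in K. \<forall>j\<in>J. deriv_sup K j (\<lambda>x. \<theta> x - \<eta> x) < e} \<subseteq> U)"
    unfolding top by (subst openin_seminorms_topology) (use z tri in auto)
  show "topspace (test_fun_top K) = (test_fun_in K :: (real^'n \<Rightarrow> 'y) set)"
    unfolding top by (rule topspace_seminorms_topology) (use z in auto)
qed

text \<open>Continuity at \<open>0\<close> controls \<open>f\<close> on a ball of finitely many seminorms, and homogeneity extends this to all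
  test functions. Only the absolute value of \<open>f\<close> has to be homogeneous, so the lemma covers distributions and
  continuous seminorms.\<close>

lemma continuous_functional_bounded:
  fixes f :: "(real^'n \<Rightarrow> 'y::banach) \<Rightarrow> real"
  assumes K: "compact K" "K \<noteq> {}"
    and cont: "continuous_map (test_fun_top K) euclideanreal f"
    and hom: "\<And>c \<theta>. \<theta> \<in> test_fun_in K \<Longrightarrow> c \<ge> 0 \<Longrightarrow> \<bar>f (\<lambda>x. c *\<^sub>R \<theta> x)\<bar> = c * \<bar>f \<theta>\<bar>"
  obtains N C where "C > 0"
    "\<And>\<theta> B. \<theta> \<in> test_fun_in K \<Longrightarrow> B \<ge> 0 \<Longrightarrow>
       (\<And>vs x. x \<in> K \<Longrightarrow> length vs \<le> N \<Longrightarrow> \<forall>v\<in>set vs. norm v \<le> 1 \<Longrightarrow> norm (dderiv vs \<theta> x) \<le> B) \<Longrightarrow>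
       \<bar>f \<theta>\<bar> \<le> C * B"
proof -
  have f0: "f (\<lambda>x. 0) = 0"
    using hom[OF test_fun_in_zero[OF K(1)], of 0] by simp
  let ?U = "{\<theta> \<in> topspace (test_fun_top K). f \<theta> \<in> {-1<..<1}}"
  have "openin (test_fun_top K) ?U"
    by (rule openin_continuous_map_preimage[OF cont]) auto
  then have op: "\<forall>\<eta>\<in>?U. \<exists>J e. finite J \<and> e > 0 \<and>
      {\<theta> \<in> test_fun_in K. \<forall>j\<in>J. deriv_sup K j (\<lambda>x. \<theta> x - \<eta> x) < e} \<subseteq> ?U"
    using openin_test_fun_top[OF K] by blast
  have "(\<lambda>x. 0) \<in> ?U"
    using test_fun_in_zero[OF K(1)] topspace_test_fun_top[OF K] f0 by auto
  from bspec[OF op this] obtain J e where J: "finite J" "e > 0"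
    and sub: "{\<theta> \<in> test_fun_in K. \<forall>j\<in>J. deriv_sup K j (\<lambda>x. \<theta> x - 0) < e} \<subseteq> ?U"
    by (elim exE conjE) (rule that)
  obtain N where N: "\<forall>j\<in>J. j \<le> N" using J(1) finite_nat_set_iff_bounded_le by blast
  show ?thesis
  proof (rule that[of "2/e" N])
    show "0 < 2/e" using J by simp
    fix \<theta> :: "real^'n \<Rightarrow> 'y" and B :: real
    assume \<theta>: "\<theta> \<in> test_fun_in K" and B: "B \<ge> 0"
      "\<And>vs x. x \<in> K \<Longrightarrow> length vs \<le> N \<Longrightarrow> \<forall>v\<in>set vs. norm v \<le> 1 \<Longrightarrow> norm (dderiv vs \<theta> x) \<le> B"
    have main: "c * \<bar>f \<theta>\<bar> \<le> 1" if c: "c > 0" "c * B < e" for c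
    proof -
      let ?\<eta> = "\<lambda>x. c *\<^sub>R \<theta> x"
      have "deriv_sup K j (\<lambda>x. ?\<eta> x - 0) \<le> c * B" if "j \<in> J" for j
      proof (rule deriv_sup_le[OF K(2)])
        fix vs :: "(real^'n) list" and x
        assume "x \<in> K" "length vs = j" "\<forall>v\<in>set vs. norm v \<le> 1"
        then have "norm (dderiv vs \<theta> x) \<le> B" using B(2) N that by blast
        then show "norm (dderiv vs (\<lambda>x. ?\<eta> x - 0) x) \<le> c * B"
          using c \<theta> by (simp add: dderiv_scaleR test_fun_inD)
      qed
      then have "?\<eta> \<in> {\<theta> \<in> test_fun_in K. \<forall>j\<in>J. deriv_sup K j (\<lambda>x. \<theta> x - 0) < e}"
        using c test_fun_in_scaleR[OF K(1) \<theta>] by fastforce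
      then have "\<bar>f ?\<eta>\<bar> \<le> 1" using sub by auto
      then show ?thesis using hom[OF \<theta>, of c] c by simp
    qed
    \<comment> \<open>The scaling factor is \<open>e/(2B)\<close>; if \<open>B = 0\<close>, arbitrarily large factors are admissible.\<close>
    show "\<bar>f \<theta>\<bar> \<le> 2/e * B"
    proof (cases "B = 0")
      case True
      have "\<not> \<bar>f \<theta>\<bar> > 0"
      proof
        assume "\<bar>f \<theta>\<bar> > 0"
        then show False using main[of "2 / \<bar>f \<theta>\<bar>"] True J by simp
      qed
      then show ?thesis using True by simp
    next
      case False
      then have "e / (2*B) * \<bar>f \<theta>\<bar> \<le> 1" using main[of "e/(2*B)"] B J by simp
      then show ?thesis using False B J by (simp add: field_simps)
    qed
  qed
qed

section \<open>Distributions\<close>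

lemma distributionsD:
  assumes "T \<in> distributions"
  shows "\<theta> \<in> test_fun \<Longrightarrow> \<eta> \<in> test_fun \<Longrightarrow> T (\<lambda>x. \<theta> x + \<eta> x) = T \<theta> + T \<eta>"
    and "\<theta> \<in> test_fun \<Longrightarrow> T (\<lambda>x. c *\<^sub>R \<theta> x) = c * T \<theta>"
    and "compact K \<Longrightarrow> continuous_map (test_fun_top K) euclideanreal T"
  using assms by (auto simp: distributions_def)

lemma distribution_bounded:
  assumes "(T :: (real^'n \<Rightarrow> 'y::banach) \<Rightarrow> real) \<in> distributions" "compact K" "K \<noteq> {}"
  obtains N C where "C > 0"
    "\<And>\<theta> B. \<theta> \<in> test_fun_in K \<Longrightarrow> B \<ge> 0 \<Longrightarrow>
       (\<And>vs x. x \<in> K \<Longrightarrow> length vs \<le> N \<Longrightarrow> \<forall>v\<in>set vs. norm v \<le> 1 \<Longrightarrow> norm (dderiv vs \<theta> x) \<le> B) \<Longrightarrow>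
       \<bar>T \<theta>\<bar> \<le> C * B"
proof (rule continuous_functional_bounded[OF assms(2,3) distributionsD(3)[OF assms(1,2)]])
  show "\<bar>T (\<lambda>x. c *\<^sub>R \<theta> x)\<bar> = c * \<bar>T \<theta>\<bar>" if "\<theta> \<in> test_fun_in K" "c \<ge> 0" for c \<theta>
    using that test_fun_inD(1)[OF that(1)] by (simp add: distributionsD(2)[OF assms(1)] abs_mult)
qed (use that in metis)

text \<open>Convergence in the space of test functions supported in \<open>K\<close>: every derivative converges uniformly.\<close>

definition tconv :: "(real^'n) set \<Rightarrow> (nat \<Rightarrow> real^'n \<Rightarrow> 'y::banach) \<Rightarrow> (real^'n \<Rightarrow> 'y) \<Rightarrow> bool" where
  "tconv K \<theta>s \<theta> \<longleftrightarrow> \<theta> \<in> test_fun_in K \<and> (\<forall>i. \<theta>s i \<in> test_fun_in K) \<and>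
     (\<forall>m. \<forall>e>0. \<forall>\<^sub>F i in sequentially. \<forall>vs x. length vs = m \<longrightarrow> (\<forall>v\<in>set vs. norm v \<le> 1) \<longrightarrow>
        norm (dderiv vs (\<theta>s i) x - dderiv vs \<theta> x) \<le> e)"

lemma tconv_const: "\<theta> \<in> test_fun_in K \<Longrightarrow> tconv K (\<lambda>_. \<theta>) \<theta>"
  by (auto simp: tconv_def)

lemma tconv_pointwise:
  assumes "tconv K \<theta>s \<theta>"
  shows "(\<lambda>i. \<theta>s i x) \<longlonglongrightarrow> \<theta> x"
proof (rule tendstoI)
  fix e :: real assume e: "e > 0"
  have "\<forall>\<^sub>F i in sequentially. \<forall>vs x. length vs = 0 \<longrightarrow> (\<forall>v\<in>set vs. norm v \<le> 1) \<longrightarrow>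
        norm (dderiv vs (\<theta>s i) x - dderiv vs \<theta> x) \<le> e/2"
    using assms half_gt_zero[OF e] unfolding tconv_def by blast
  then show "\<forall>\<^sub>F i in sequentially. dist (\<theta>s i x) (\<theta> x) < e"
  proof eventually_elim
    case (elim i)
    have "norm (\<theta>s i x - \<theta> x) \<le> e/2" using elim[rule_format, of "[]" x] by simp
    then show ?case unfolding dist_norm using e by linarith
  qed
qed

lemma distribution_tconv:
  fixes T :: "(real^'n \<Rightarrow> 'y::banach) \<Rightarrow> real"
  assumes T: "T \<in> distributions" and K: "compact K" and c: "tconv K \<theta>s \<theta>"
  shows "(\<lambda>i. T (\<theta>s i)) \<longlonglongrightarrow> T \<theta>"
proof (cases "K = {}")
  case True
  then have "\<theta>s i = \<theta>" for i
    using c K by (auto simp: tconv_def test_fun_in_iff)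
  then show ?thesis by simp
next
  case False
  obtain N C where C: "C > 0"
    "\<And>\<theta> B. \<theta> \<in> test_fun_in K \<Longrightarrow> B \<ge> 0 \<Longrightarrow>
       (\<And>vs x. x \<in> K \<Longrightarrow> length vs \<le> N \<Longrightarrow> \<forall>v\<in>set vs. norm v \<le> 1 \<Longrightarrow> norm (dderiv vs \<theta> x) \<le> B) \<Longrightarrow>
       \<bar>T \<theta>\<bar> \<le> C * B"
    using distribution_bounded[OF T K False] by metis
  show ?thesis
  proof (rule tendstoI)
    fix e :: real assume e: "e > 0"
    have "\<forall>\<^sub>F i in sequentially. \<forall>m\<in>{..N}. \<forall>vs x. length vs = m \<longrightarrow> (\<forall>v\<in>set vs. norm v \<le> 1) \<longrightarrow>
        norm (dderiv vs (\<theta>s i) x - dderiv vs \<theta> x) \<le> e/(2*C)"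
      using c e C unfolding tconv_def by (intro eventually_ball_finite) auto
    then show "\<forall>\<^sub>F i in sequentially. dist (T (\<theta>s i)) (T \<theta>) < e"
    proof eventually_elim
      case (elim i)
      have tf: "\<theta> \<in> test_fun_in K" "\<theta>s i \<in> test_fun_in K" using c by (auto simp: tconv_def)
      have "\<bar>T (\<lambda>x. \<theta>s i x - \<theta> x)\<bar> \<le> C * (e/(2*C))"
        by (rule C(2)) (use elim tf e C in \<open>auto simp: K test_fun_in_diff dderiv_diff test_fun_inD\<close>)
      moreover have "T (\<theta>s i) = T (\<lambda>x. \<theta>s i x - \<theta> x) + T \<theta>"
        using distributionsD(1)[OF T, of "\<lambda>x. \<theta>s i x - \<theta> x" \<theta>] tf test_fun_in_diff[OF K tf(2,1)]
        by (simp add: test_fun_inD)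
      ultimately show ?case using e C by (simp add: dist_real_def)
    qed
  qed
qed

lemma rescaled_test_fun:
  assumes "\<theta> \<in> test_fun_in (cball 0 1)" "0 < r" "norm a + r \<le> R"
  shows "(\<lambda>x. \<theta> ((1/r) *\<^sub>R (x - a))) \<in> test_fun_in (cball 0 R)"
proof -
  have "smooth (\<lambda>x. \<theta> ((1/r) *\<^sub>R x + (- (1/r) *\<^sub>R a)))"
    by (rule smooth_affine) (use assms test_fun_inD in blast)
  moreover have "\<theta> ((1/r) *\<^sub>R (x - a)) = 0" if "x \<notin> cball 0 R" for x
  proof -
    have "norm x > R" using that by simp
    then have "norm (x - a) > r" using norm_triangle_ineq2[of x a] assms by linarith
    then have "(1/r) *\<^sub>R (x - a) \<notin> cball 0 1"
      using assms(2) by (simp del: scaleR_right_diff_distrib add: less_divide_eq)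
    then show ?thesis using assms(1) by (simp add: test_fun_in_iff)
  qed
  ultimately show ?thesis by (simp add: test_fun_in_iff algebra_simps)
qed

lemma rescaled_test_fun': "\<theta> \<in> test_fun_in (cball 0 1) \<Longrightarrow> 0 < r \<Longrightarrow> (\<lambda>x. \<theta> ((1/r) *\<^sub>R (x - a))) \<in> test_fun"
  using rescaled_test_fun test_fun_inD(1) by blast

lemma dderiv_rescaled:
  assumes "smooth \<theta>"
  shows "dderiv vs (\<lambda>x. \<theta> ((1/r) *\<^sub>R (x - a))) x = (1/r) ^ length vs *\<^sub>R dderiv vs \<theta> ((1/r) *\<^sub>R (x - a))"
  using fun_cong[OF dderiv_affine[OF assms, of vs "1/r" "- (1/r) *\<^sub>R a"]]
  by (simp add: algebra_simps)

text \<open>The supports of the rescaled functions stay in a common ball because centres and radii are bounded. This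
  makes the value of a distribution on a rescaled test function jointly continuous in the test function, the
  centre and the radius.\<close>

lemma tconv_rescaled:
  fixes \<theta> :: "real^'n \<Rightarrow> 'y::banach"
  assumes c: "tconv (cball 0 1) \<theta>s \<theta>" and a: "as \<longlonglongrightarrow> a" and r: "rs \<longlonglongrightarrow> r" "\<And>i. rs i > 0" "r > 0"
  obtains R where
    "tconv (cball 0 R) (\<lambda>i x. \<theta>s i ((1/rs i) *\<^sub>R (x - as i))) (\<lambda>x. \<theta> ((1/r) *\<^sub>R (x - a)))"
proof -
  obtain A where A: "\<And>i. norm (as i) \<le> A" using convergent_imp_bounded[OF a] by (auto simp: bounded_iff)
  obtain B where B: "\<And>i. norm (rs i) \<le> B" using convergent_imp_bounded[OF r(1)] by (auto simp: bounded_iff)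
  define R where "R = max (A + B) (norm a + r)"
  have tf: "\<theta> \<in> test_fun_in (cball 0 1)" "\<And>i. \<theta>s i \<in> test_fun_in (cball 0 1)"
    using c by (auto simp: tconv_def)
  have sm: "smooth \<theta>" "\<And>i. smooth (\<theta>s i)" using tf test_fun_inD by blast+
  have "norm (as i) + rs i \<le> R" for i using A[of i] B[of i] r(2)[of i] by (simp add: R_def)
  then have tfs: "(\<lambda>x. \<theta>s i ((1/rs i) *\<^sub>R (x - as i))) \<in> test_fun_in (cball 0 R)" for i
    using rescaled_test_fun[OF tf(2) r(2)] by blast
  have tf0: "(\<lambda>x. \<theta> ((1/r) *\<^sub>R (x - a))) \<in> test_fun_in (cball 0 R)"
    by (rule rescaled_test_fun[OF tf(1) r(3)]) (simp add: R_def)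
  have "\<forall>\<^sub>F i in sequentially. \<forall>vs x. length vs = m \<longrightarrow> (\<forall>v\<in>set vs. norm v \<le> 1) \<longrightarrow>
        norm (dderiv vs (\<lambda>x. \<theta>s i ((1/rs i) *\<^sub>R (x - as i))) x - dderiv vs (\<lambda>x. \<theta> ((1/r) *\<^sub>R (x - a))) x) \<le> e"
    if e: "e > 0" for m e
  proof -
    obtain C0 where C0: "C0 > 0" "\<And>vs x. length vs = m \<Longrightarrow> \<forall>v\<in>set vs. norm v \<le> 1 \<Longrightarrow> norm (dderiv vs \<theta> x) \<le> C0"
      using dderiv_bounded[OF tf(1) compact_cball] by metis
    obtain C1 where C1: "C1 > 0" "\<And>vs x. length vs = Suc m \<Longrightarrow> \<forall>v\<in>set vs. norm v \<le> 1 \<Longrightarrow> norm (dderiv vs \<theta> x) \<le> C1"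
      using dderiv_bounded[OF tf(1) compact_cball] by metis
    define s where "s = (\<lambda>i. (1/rs i)^m)"
    have s: "s \<longlonglongrightarrow> (1/r)^m" unfolding s_def using r by (intro tendsto_intros) auto
    have s0: "s i > 0" for i using r(2) by (simp add: s_def)
    obtain S where S: "\<And>i. norm (s i) \<le> S" using convergent_imp_bounded[OF s] by (auto simp: bounded_iff)
    have S0: "S > 0" using S[of 0] s0[of 0] by simp
    \<comment> \<open>A bound for the distance of the two rescaled arguments of a point of the ball of radius \<open>R\<close>.\<close>
    define h where "h = (\<lambda>i. \<bar>1/rs i - 1/r\<bar> * R + norm ((1/rs i) *\<^sub>R as i - (1/r) *\<^sub>R a))"
    have h: "h \<longlonglongrightarrow> \<bar>1/r - 1/r\<bar> * R + norm ((1/r) *\<^sub>R a - (1/r) *\<^sub>R a)"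
      unfolding h_def using r a by (intro tendsto_intros) auto
    have "\<forall>\<^sub>F i in sequentially. \<forall>vs x. length vs = m \<longrightarrow> (\<forall>v\<in>set vs. norm v \<le> 1) \<longrightarrow>
        norm (dderiv vs (\<theta>s i) x - dderiv vs \<theta> x) \<le> e/(3*S)"
      using c e S0 unfolding tconv_def by auto
    moreover have "\<forall>\<^sub>F i in sequentially. h i < e/(3*S*C1)"
      using order_tendstoD(2)[OF h] e S0 C1 by simp
    moreover have "\<forall>\<^sub>F i in sequentially. \<bar>s i - (1/r)^m\<bar> < e/(3*C0)"
      using tendstoD[OF s, of "e/(3*C0)"] e C0 by (simp add: dist_real_def)
    ultimately show ?thesis
    proof eventually_elim
      case (elim i)
      show ?case
      proof (intro allI impI)
        fix vs :: "(real^'n) list" and x :: "real^'n"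
        assume vs: "length vs = m" "\<forall>v\<in>set vs. norm v \<le> 1"
        show "norm (dderiv vs (\<lambda>x. \<theta>s i ((1/rs i) *\<^sub>R (x - as i))) x - dderiv vs (\<lambda>x. \<theta> ((1/r) *\<^sub>R (x - a))) x) \<le> e"
        proof (cases "x \<in> cball 0 R")
          case False
          then show ?thesis using dderiv_outside[OF tfs] dderiv_outside[OF tf0] e by simp
        next
          case True
          define z where "z = (1/rs i) *\<^sub>R (x - as i)"
          define z' where "z' = (1/r) *\<^sub>R (x - a)"
          have "z - z' = (1/rs i - 1/r) *\<^sub>R x - ((1/rs i) *\<^sub>R as i - (1/r) *\<^sub>R a)"
            by (simp add: z_def z'_def algebra_simps)
          then have "norm (z - z') \<le> norm ((1/rs i - 1/r) *\<^sub>R x) + norm ((1/rs i) *\<^sub>R as i - (1/r) *\<^sub>R a)"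
            by (simp only: norm_triangle_ineq4)
          also have "\<dots> \<le> h i"
            using True unfolding h_def by (auto intro!: mult_left_mono simp del: scaleR_diff_left)
          finally have zz: "norm (z - z') \<le> h i" .
          have "dderiv vs (\<lambda>x. \<theta>s i ((1/rs i) *\<^sub>R (x - as i))) x - dderiv vs (\<lambda>x. \<theta> ((1/r) *\<^sub>R (x - a))) x
             = s i *\<^sub>R dderiv vs (\<theta>s i) z - (1/r)^m *\<^sub>R dderiv vs \<theta> z'"
            by (simp only: dderiv_rescaled[OF sm(1)] dderiv_rescaled[OF sm(2)] vs(1) s_def z_def z'_def)
          also have "\<dots> = s i *\<^sub>R (dderiv vs (\<theta>s i) z - dderiv vs \<theta> z) + s i *\<^sub>R (dderiv vs \<theta> z - dderiv vs \<theta> z')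
              + (s i - (1/r)^m) *\<^sub>R dderiv vs \<theta> z'"
            by (simp add: algebra_simps)
          finally have eq: "dderiv vs (\<lambda>x. \<theta>s i ((1/rs i) *\<^sub>R (x - as i))) x - dderiv vs (\<lambda>x. \<theta> ((1/r) *\<^sub>R (x - a))) x
            = s i *\<^sub>R (dderiv vs (\<theta>s i) z - dderiv vs \<theta> z) + s i *\<^sub>R (dderiv vs \<theta> z - dderiv vs \<theta> z')
              + (s i - (1/r)^m) *\<^sub>R dderiv vs \<theta> z'" .
          have 1: "norm (s i *\<^sub>R (dderiv vs (\<theta>s i) z - dderiv vs \<theta> z)) \<le> S * (e/(3*S))"
            unfolding norm_scaleR using S[of i] elim(1) vs S0 by (intro mult_mono) auto
          have "norm (dderiv vs \<theta> z - dderiv vs \<theta> z') \<le> C1 * norm (z - z')"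
            by (rule dderiv_lipschitz[OF sm(1) C1(2)]) (use vs in auto)
          also have "\<dots> \<le> C1 * (e/(3*S*C1))" using zz elim(2) C1 by (intro mult_left_mono) auto
          finally have 2: "norm (s i *\<^sub>R (dderiv vs \<theta> z - dderiv vs \<theta> z')) \<le> S * (C1 * (e/(3*S*C1)))"
            unfolding norm_scaleR using S[of i] S0 by (intro mult_mono) auto
          have 3: "norm ((s i - (1/r)^m) *\<^sub>R dderiv vs \<theta> z') \<le> e/(3*C0) * C0"
            unfolding norm_scaleR using C0(2)[OF vs, of z'] elim(3) e C0 by (intro mult_mono) auto
          have "S * (e/(3*S)) + S * (C1 * (e/(3*S*C1))) + e/(3*C0) * C0 = e"
            using S0 C1 C0 by (simp add: field_simps)
          then show ?thesis unfolding eq using norm_triangle_mono[OF norm_triangle_mono[OF 1 2] 3] by simp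
        qed
      qed
    qed
  qed
  then have "tconv (cball 0 R) (\<lambda>i x. \<theta>s i ((1/rs i) *\<^sub>R (x - as i))) (\<lambda>x. \<theta> ((1/r) *\<^sub>R (x - a)))"
    using tfs tf0 unfolding tconv_def by blast
  then show ?thesis by (rule that)
qed

section \<open>Interpolation weights\<close>

text \<open>Solvability of the Vandermonde system, by induction on the number of nodes.\<close>

lemma vandermonde_weights:
  fixes t \<mu> :: "nat \<Rightarrow> real"
  assumes "inj_on t {..<K}"
  shows "\<exists>w. \<forall>m<K. (\<Sum>j<K. w j * t j ^ m) = \<mu> m"
  using assms
proof (induction K arbitrary: \<mu>)
  case (Suc K)
  have "inj_on t {..<K}" using Suc.prems by (rule inj_on_subset) auto
  then obtain u where u: "\<And>m. m < K \<Longrightarrow> (\<Sum>j<K. u j * t j ^ m) = \<mu> (Suc m) - t K * \<mu> m"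
    using Suc.IH[of "\<lambda>m. \<mu> (Suc m) - t K * \<mu> m"] by blast
  \<comment> \<open>Both sides satisfy the same recursion \<open>z (m + 1) - t K * z m = (\<Sum>j<K. u j * t j ^ m)\<close>, and
    the weight at the node \<open>t K\<close> adjusts the initial value.\<close>
  define v where "v = (\<lambda>j. u j / (t j - t K))"
  define w where "w = (\<lambda>j. if j < K then v j else \<mu> 0 - sum v {..<K})"
  have ne: "t j - t K \<noteq> 0" if "j < K" for j
    using inj_onD[OF Suc.prems, of j K] that by auto
  have S: "(\<Sum>j<Suc K. w j * t j ^ m) = (\<Sum>j<K. v j * t j ^ m) + (\<mu> 0 - sum v {..<K}) * t K ^ m" for m
    by (simp add: w_def)
  have "(\<Sum>j<Suc K. w j * t j ^ m) = \<mu> m" if "m < Suc K" for m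
    using that
  proof (induction m)
    case 0
    then show ?case unfolding S by simp
  next
    case (Suc m)
    have "(\<Sum>j<K. v j * t j ^ Suc m) - t K * (\<Sum>j<K. v j * t j ^ m) = (\<Sum>j<K. u j * t j ^ m)"
      unfolding sum_distrib_left sum_subtractf[symmetric]
    proof (rule sum.cong[OF refl])
      fix j assume "j \<in> {..<K}"
      then have uj: "u j = v j * (t j - t K)" using ne by (simp add: v_def)
      show "v j * t j ^ Suc m - t K * (v j * t j ^ m) = u j * t j ^ m"
        unfolding uj by (simp add: algebra_simps)
    qed
    then have "(\<Sum>j<Suc K. w j * t j ^ Suc m) - t K * (\<Sum>j<Suc K. w j * t j ^ m) = \<mu> (Suc m) - t K * \<mu> m"
      unfolding S using u[of m] Suc.prems by (simp add: algebra_simps)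
    then show ?case using Suc by simp
  qed
  then show ?case by blast
qed auto

text \<open>Any fixed sequence of distinct points of the interval from \<open>0\<close> to \<open>1\<close> would serve; evaluating a
  polynomial function at points \<open>a + node j x\<close> remains inside a ball about \<open>a\<close> that contains \<open>a + x\<close>.\<close>

definition node :: "nat \<Rightarrow> real" where "node j = 1 / real (Suc j)"

lemma node_bounds: "0 < node j" "node j \<le> 1" "\<bar>node j\<bar> \<le> 1"
  by (auto simp: node_def)

lemma node_weights: "\<exists>w. \<forall>m<K. (\<Sum>j<K. w j * node j ^ m) = \<mu> m"
  by (rule vandermonde_weights) (auto simp: inj_on_def node_def)

text \<open>Weights that extrapolate polynomials of degree below \<open>K\<close> from the nodes to \<open>t\<close>. They are linear
  combinations of fixed dual weights with coefficients \<open>t\<^sup>i\<close>, \<open>i < K\<close>, and so grow at most like \<open>t\<^sup>K\<^sup>-\<^sup>1\<close>.\<close>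

lemma extrapolation_weights:
  "\<exists>W>0. \<forall>t\<ge>1. \<exists>w. (\<forall>j. \<bar>w j\<bar> \<le> W * t ^ (K - 1)) \<and> (\<forall>m<K. (\<Sum>j<K. w j * node j ^ m) = t ^ m)"
proof -
  have "\<forall>i. \<exists>w. \<forall>m<K. (\<Sum>j<K. w j * node j ^ m) = (if m = i then 1 else 0)"
    by (rule allI, rule node_weights)
  from choice[OF this] obtain u
    where u: "\<And>i m. m < K \<Longrightarrow> (\<Sum>j<K. u i j * node j ^ m) = (if m = i then 1 else 0)"
    by blast
  define u' where "u' = (\<lambda>i j. if j < K then u i j else 0)"
  have u': "(\<Sum>j<K. u' i j * node j ^ m) = (if m = i then 1 else 0)" if "m < K" for i m
    using u[OF that, of i] by (simp add: u'_def)
  define W where "W = 1 + (\<Sum>j<K. \<Sum>i<K. \<bar>u i j\<bar>)"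
  have W: "(\<Sum>i<K. \<bar>u' i j\<bar>) \<le> W" for j
  proof (cases "j < K")
    case True
    then have "(\<Sum>i<K. \<bar>u i j\<bar>) \<le> (\<Sum>j<K. \<Sum>i<K. \<bar>u i j\<bar>)"
      by (intro member_le_sum[of j "{..<K}" "\<lambda>j. \<Sum>i<K. \<bar>u i j\<bar>"]) (auto intro: sum_nonneg)
    then show ?thesis using True by (simp add: u'_def W_def)
  next
    case False
    then show ?thesis by (simp add: u'_def W_def sum_nonneg add_nonneg_nonneg)
  qed
  have W0: "W > 0" unfolding W_def by (intro add_pos_nonneg sum_nonneg) auto
  have "\<exists>w. (\<forall>j. \<bar>w j\<bar> \<le> W * t ^ (K - 1)) \<and> (\<forall>m<K. (\<Sum>j<K. w j * node j ^ m) = t ^ m)"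
    if t: "t \<ge> 1" for t
  proof (intro exI conjI allI impI)
    let ?w = "\<lambda>j. \<Sum>i<K. t ^ i * u' i j"
    fix j
    have "\<bar>?w j\<bar> \<le> (\<Sum>i<K. t ^ (K - 1) * \<bar>u' i j\<bar>)"
    proof (rule order_trans[OF sum_abs sum_mono])
      fix i assume "i \<in> {..<K}"
      then have "t ^ i \<le> t ^ (K - 1)" using t by (intro power_increasing) auto
      then show "\<bar>t ^ i * u' i j\<bar> \<le> t ^ (K - 1) * \<bar>u' i j\<bar>"
        using t by (simp add: abs_mult mult_right_mono)
    qed
    also have "\<dots> \<le> W * t ^ (K - 1)"
      unfolding sum_distrib_left[symmetric] using W[of j] t by (simp add: mult.commute mult_left_mono)
    finally show "\<bar>?w j\<bar> \<le> W * t ^ (K - 1)" .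
  next
    fix m assume m: "m < K"
    have "(\<Sum>j<K. (\<Sum>i<K. t ^ i * u' i j) * node j ^ m) = (\<Sum>i<K. t ^ i * (\<Sum>j<K. u' i j * node j ^ m))"
      unfolding sum_distrib_left sum_distrib_right by (subst sum.swap) (simp add: mult.assoc)
    also have "\<dots> = (\<Sum>i<K. if m = i then t ^ i else 0)"
      by (intro sum.cong) (auto simp: u'[OF m])
    also have "\<dots> = t ^ m" using m by simp
    finally show "(\<Sum>j<K. (\<Sum>i<K. t ^ i * u' i j) * node j ^ m) = t ^ m" .
  qed
  then show ?thesis using W0 by blast
qed

section \<open>Symmetric multilinear maps and polynomial functions\<close>

lemma sym_mlin_linear:
  assumes "\<psi> \<in> sym_mlin m" "m = Suc (length vs + length ws)"
  shows "linear (\<lambda>v. \<psi> (vs @ v # ws))"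
proof -
  have "\<forall>us i. length us = m \<longrightarrow> i < m \<longrightarrow> linear (\<lambda>v. \<psi> (us[i := v]))"
    using assms(1) by (simp add: sym_mlin_def)
  from this[rule_format, of "vs @ undefined # ws" "length vs"] show ?thesis
    using assms(2) by simp
qed

lemma sym_mlin_perm: "\<psi> \<in> sym_mlin m \<Longrightarrow> length vs = m \<Longrightarrow> mset ws = mset vs \<Longrightarrow> \<psi> ws = \<psi> vs"
  unfolding sym_mlin_def by blast

lemma sym_mlin_restrictI:
  assumes "\<And>vs ws. length vs + length ws + 1 = m \<Longrightarrow> linear (\<lambda>v. f (vs @ v # ws))"
    and "\<And>vs ws. length vs = m \<Longrightarrow> mset ws = mset vs \<Longrightarrow> f ws = f vs"
  shows "(\<lambda>vs\<in>{vs. length vs = m}. f vs) \<in> sym_mlin m"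
  unfolding sym_mlin_def
proof (intro CollectI conjI allI impI)
  fix vs :: "'a list" and i assume "length vs = m" "i < m"
  then have "linear (\<lambda>v. f (take i vs @ v # drop (Suc i) vs))" by (intro assms) auto
  then show "linear (\<lambda>v. (\<lambda>vs\<in>{vs. length vs = m}. f vs) (vs[i := v]))"
    using \<open>length vs = m\<close> \<open>i < m\<close> by (simp add: upd_conv_take_nth_drop)
next
  fix vs ws :: "'a list" assume vs: "length vs = m" "mset ws = mset vs"
  then have "length ws = m" using mset_eq_length[OF vs(2)] by simp
  then show "(\<lambda>vs\<in>{vs. length vs = m}. f vs) ws = (\<lambda>vs\<in>{vs. length vs = m}. f vs) vs"
    using assms(2)[OF vs] vs(1) by simp
qed auto

text \<open>Expanding \<open>\<psi>\<close> by multilinearity along a line gives a polynomial in the parameter \<open>t\<close>.\<close>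

lemma sym_mlin_line:
  assumes "\<psi> \<in> sym_mlin m" "length vs + p = m"
  shows "\<exists>c. \<forall>t. \<psi> (vs @ replicate p (a + t *\<^sub>R x)) = (\<Sum>j\<le>p. t ^ j *\<^sub>R c j)"
  using assms(2)
proof (induction p arbitrary: vs)
  case (Suc p)
  obtain c where c: "\<And>t. \<psi> ((vs @ [a]) @ replicate p (a + t *\<^sub>R x)) = (\<Sum>j\<le>p. t ^ j *\<^sub>R c j)"
    using Suc.IH[of "vs @ [a]"] Suc.prems by auto
  obtain d where d: "\<And>t. \<psi> ((vs @ [x]) @ replicate p (a + t *\<^sub>R x)) = (\<Sum>j\<le>p. t ^ j *\<^sub>R d j)"
    using Suc.IH[of "vs @ [x]"] Suc.prems by auto
  let ?c = "\<lambda>j. (if j \<le> p then c j else 0) + (if j = 0 then 0 else d (j - 1))"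
  have "\<psi> (vs @ replicate (Suc p) (a + t *\<^sub>R x)) = (\<Sum>j\<le>Suc p. t ^ j *\<^sub>R ?c j)" for t
  proof -
    have lin: "linear (\<lambda>v. \<psi> (vs @ v # replicate p (a + t *\<^sub>R x)))"
      by (rule sym_mlin_linear[OF assms(1)]) (use Suc.prems in auto)
    have "\<psi> (vs @ replicate (Suc p) (a + t *\<^sub>R x))
        = (\<Sum>j\<le>p. t ^ j *\<^sub>R c j) + t *\<^sub>R (\<Sum>j\<le>p. t ^ j *\<^sub>R d j)"
      using c[of t] d[of t] linear_add[OF lin] linear_scale[OF lin] by simp
    also have "(\<Sum>j\<le>p. t ^ j *\<^sub>R c j) = (\<Sum>j\<le>Suc p. t ^ j *\<^sub>R (if j \<le> p then c j else 0))" by simp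
    also have "t *\<^sub>R (\<Sum>j\<le>p. t ^ j *\<^sub>R d j) = (\<Sum>j\<le>Suc p. t ^ j *\<^sub>R (if j = 0 then 0 else d (j - 1)))"
      by (simp add: sum.atMost_Suc_shift scaleR_sum_right del: sum.atMost_Suc)
    also have "(\<Sum>j\<le>Suc p. t ^ j *\<^sub>R (if j \<le> p then c j else 0)) +
        (\<Sum>j\<le>Suc p. t ^ j *\<^sub>R (if j = 0 then 0 else d (j - 1))) = (\<Sum>j\<le>Suc p. t ^ j *\<^sub>R ?c j)"
      by (simp only: sum.distrib scaleR_add_right)
    finally show ?thesis .
  qed
  then show ?case by (intro exI[of _ ?c]) blast
qed auto

text \<open>Expanding one argument in the basis makes the map a sum of products of a linear function and a map of the
  same form with one argument less, to which the induction hypothesis applies; symmetry collects the terms.\<close>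

lemma sym_mlin_power_has_derivative:
  fixes \<psi> :: "'a::euclidean_space list \<Rightarrow> 'b::real_normed_vector"
  assumes "\<psi> \<in> sym_mlin m" "length vs + p = m"
  shows "((\<lambda>x. \<psi> (vs @ replicate p x)) has_derivative
     (\<lambda>v. real p *\<^sub>R \<psi> (vs @ v # replicate (p - 1) x))) (at x)"
  using assms(2)
proof (induction p arbitrary: vs)
  case (Suc p)
  have expand: "\<psi> (vs @ y # replicate p z) = (\<Sum>b\<in>Basis. (y \<bullet> b) *\<^sub>R \<psi> ((vs @ [b]) @ replicate p z))" for y z
  proof -
    have lin: "linear (\<lambda>v. \<psi> (vs @ v # replicate p z))"
      by (rule sym_mlin_linear[OF assms(1)]) (use Suc.prems in auto)
    have "\<psi> (vs @ y # replicate p z) = \<psi> (vs @ (\<Sum>b\<in>Basis. (y \<bullet> b) *\<^sub>R b) # replicate p z)"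
      by (simp only: euclidean_representation)
    also have "\<dots> = (\<Sum>b\<in>Basis. (y \<bullet> b) *\<^sub>R \<psi> (vs @ b # replicate p z))"
      by (simp only: linear_sum[OF lin] linear_scale[OF lin])
    finally show ?thesis by simp
  qed
  have "((\<lambda>x. \<Sum>b\<in>Basis. (x \<bullet> b) *\<^sub>R \<psi> ((vs @ [b]) @ replicate p x)) has_derivative
     (\<lambda>v. \<Sum>b\<in>Basis. (x \<bullet> b) *\<^sub>R (real p *\<^sub>R \<psi> ((vs @ [b]) @ v # replicate (p - 1) x)) +
        (v \<bullet> b) *\<^sub>R \<psi> ((vs @ [b]) @ replicate p x))) (at x)"
    by (intro has_derivative_sum has_derivative_scaleR Suc.IH has_derivative_inner_left has_derivative_ident)
      (use Suc.prems in auto)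
  moreover have "(\<lambda>x. \<psi> (vs @ replicate (Suc p) x)) = (\<lambda>x. \<Sum>b\<in>Basis. (x \<bullet> b) *\<^sub>R \<psi> ((vs @ [b]) @ replicate p x))"
    by (rule ext) (simp only: replicate_Suc expand)
  moreover have "(\<lambda>v. \<Sum>b\<in>Basis. (x \<bullet> b) *\<^sub>R (real p *\<^sub>R \<psi> ((vs @ [b]) @ v # replicate (p - 1) x)) +
        (v \<bullet> b) *\<^sub>R \<psi> ((vs @ [b]) @ replicate p x))
      = (\<lambda>v. real (Suc p) *\<^sub>R \<psi> (vs @ v # replicate (Suc p - 1) x))"
  proof
    fix v
    have A: "(\<Sum>b\<in>Basis. (v \<bullet> b) *\<^sub>R \<psi> ((vs @ [b]) @ replicate p x)) = \<psi> (vs @ v # replicate p x)"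
      by (simp only: expand)
    have B: "(\<Sum>b\<in>Basis. (x \<bullet> b) *\<^sub>R (real p *\<^sub>R \<psi> ((vs @ [b]) @ v # replicate (p - 1) x)))
        = real p *\<^sub>R \<psi> (vs @ v # replicate p x)"
    proof (cases p)
      case (Suc q)
      have lin: "linear (\<lambda>u. \<psi> (vs @ u # v # replicate q x))"
        by (rule sym_mlin_linear[OF assms(1)]) (use Suc.prems \<open>p = Suc q\<close> in auto)
      have "(\<Sum>b\<in>Basis. (x \<bullet> b) *\<^sub>R \<psi> (vs @ b # v # replicate q x))
          = \<psi> (vs @ (\<Sum>b\<in>Basis. (x \<bullet> b) *\<^sub>R b) # v # replicate q x)"
        by (simp only: linear_sum[OF lin] linear_scale[OF lin])
      also have "\<dots> = \<psi> (vs @ v # replicate p x)"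
        unfolding euclidean_representation
        by (rule sym_mlin_perm[OF assms(1)]) (use Suc.prems \<open>p = Suc q\<close> in auto)
      finally have "real p *\<^sub>R (\<Sum>b\<in>Basis. (x \<bullet> b) *\<^sub>R \<psi> (vs @ b # v # replicate q x))
          = real p *\<^sub>R \<psi> (vs @ v # replicate p x)" by simp
      then show ?thesis using Suc by (simp add: scaleR_sum_right mult.commute)
    qed simp
    show "(\<Sum>b\<in>Basis. (x \<bullet> b) *\<^sub>R (real p *\<^sub>R \<psi> ((vs @ [b]) @ v # replicate (p - 1) x)) +
        (v \<bullet> b) *\<^sub>R \<psi> ((vs @ [b]) @ replicate p x))
      = real (Suc p) *\<^sub>R \<psi> (vs @ v # replicate (Suc p - 1) x)"
      unfolding sum.distrib A B by (simp add: algebra_simps)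
  qed
  ultimately show ?case by simp
qed auto

lemma degree_set: "{m. int m \<le> k} = {..<nat (k + 1)}"
  by auto

lemma poly_uptoE:
  assumes "P \<in> poly_upto k"
  obtains \<psi> where "\<And>m. \<psi> m \<in> sym_mlin m" "P = (\<lambda>x. \<Sum>m<nat (k + 1). \<psi> m (replicate m x))"
  using assms unfolding poly_upto_def degree_set by blast

lemma poly_uptoI:
  assumes "\<And>m. \<psi> m \<in> sym_mlin m" "\<And>x. P x = (\<Sum>m<nat (k + 1). \<psi> m (replicate m x))"
  shows "P \<in> poly_upto k"
  unfolding poly_upto_def degree_set using assms by auto

text \<open>The falling factorial \<open>m (m - 1) \<dots> (m - l + 1)\<close>. By truncated subtraction it vanishes for \<open>l > m\<close>, as it should
  for the coefficient of a derivative of order \<open>l\<close> of a form of degree \<open>m\<close>.\<close>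

definition falling :: "nat \<Rightarrow> nat \<Rightarrow> real" where
  "falling m l = (\<Prod>i<l. real (m - i))"

lemma falling_zero: "m < l \<Longrightarrow> falling m l = 0"
  unfolding falling_def by (rule prod_zero) auto

lemma falling_self: "falling m m = fact m"
  unfolding falling_def by (simp add: fact_prod_rev lessThan_atLeast0)

lemma poly_sum_has_derivative:
  fixes \<psi> :: "nat \<Rightarrow> 'a::euclidean_space list \<Rightarrow> 'b::real_normed_vector"
  assumes \<psi>: "\<And>m. \<psi> m \<in> sym_mlin m"
  shows "((\<lambda>x. \<Sum>m<K. falling m (length us) *\<^sub>R \<psi> m (us @ replicate (m - length us) x)) has_derivative
     (\<lambda>v. \<Sum>m<K. falling m (Suc (length us)) *\<^sub>R \<psi> m ((v # us) @ replicate (m - Suc (length us)) x))) (at x)"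
proof (rule has_derivative_sum)
  fix m
  let ?l = "length us"
  show "((\<lambda>x. falling m ?l *\<^sub>R \<psi> m (us @ replicate (m - ?l) x)) has_derivative
     (\<lambda>v. falling m (Suc ?l) *\<^sub>R \<psi> m ((v # us) @ replicate (m - Suc ?l) x))) (at x)"
  proof (cases "?l < m")
    case True
    have "((\<lambda>x. \<psi> m (us @ replicate (m - ?l) x)) has_derivative
        (\<lambda>v. real (m - ?l) *\<^sub>R \<psi> m (us @ v # replicate (m - ?l - 1) x))) (at x)"
      by (rule sym_mlin_power_has_derivative[OF \<psi>]) (use True in simp)
    from has_derivative_scaleR_right[OF this, of "falling m ?l"]
    have "((\<lambda>x. falling m ?l *\<^sub>R \<psi> m (us @ replicate (m - ?l) x)) has_derivative
        (\<lambda>v. falling m ?l *\<^sub>R (real (m - ?l) *\<^sub>R \<psi> m (us @ v # replicate (m - ?l - 1) x)))) (at x)" .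
    moreover have "\<psi> m (us @ v # replicate (m - ?l - 1) x) = \<psi> m ((v # us) @ replicate (m - Suc ?l) x)" for v
      by (rule sym_mlin_perm[OF \<psi>]) (use True in auto)
    moreover have "falling m (Suc ?l) = falling m ?l * real (m - ?l)" by (simp add: falling_def)
    ultimately show ?thesis by simp
  next
    case False
    then have 0: "falling m (Suc ?l) = 0" by (simp add: falling_zero)
    have "(\<lambda>x. falling m ?l *\<^sub>R \<psi> m (us @ replicate (m - ?l) x)) = (\<lambda>x. falling m ?l *\<^sub>R \<psi> m us)"
      using False by simp
    then show ?thesis by (simp add: 0)
  qed
qed

lemma dderiv_poly_sum:
  fixes \<psi> :: "nat \<Rightarrow> 'a::euclidean_space list \<Rightarrow> 'b::real_normed_vector"
  assumes \<psi>: "\<And>m. \<psi> m \<in> sym_mlin m"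
  shows "dderiv us (\<lambda>x. \<Sum>m<K. \<psi> m (replicate m x))
    = (\<lambda>x. \<Sum>m<K. falling m (length us) *\<^sub>R \<psi> m (us @ replicate (m - length us) x))"
proof (induction us)
  case (Cons v us)
  show ?case
    using dderiv_Cons_eqI[OF Cons.IH poly_sum_has_derivative[OF \<psi>]] by (intro ext) simp
qed (simp add: falling_def)

lemma smooth_poly_sum:
  fixes \<psi> :: "nat \<Rightarrow> 'a::euclidean_space list \<Rightarrow> 'b::real_normed_vector"
  assumes \<psi>: "\<And>m. \<psi> m \<in> sym_mlin m"
  shows "smooth (\<lambda>x. \<Sum>m<K. \<psi> m (replicate m x))"
  unfolding smooth_def dderiv_poly_sum[OF \<psi>] differentiable_def
  using poly_sum_has_derivative[OF \<psi>] by blast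

lemma smooth_poly: "P \<in> poly_upto k \<Longrightarrow> smooth P"
  by (erule poly_uptoE) (simp add: smooth_poly_sum)

text \<open>At \<open>0\<close> only the homogeneous component of degree \<open>length us\<close> contributes.\<close>

lemma dderiv_poly_at_0:
  assumes \<psi>: "\<And>m. \<psi> m \<in> sym_mlin m"
  shows "dderiv us (\<lambda>x. \<Sum>m<K. \<psi> m (replicate m x)) (0::'a::euclidean_space)
    = (if length us < K then fact (length us) *\<^sub>R \<psi> (length us) us else (0::'b::real_normed_vector))"
proof -
  let ?l = "length us"
  have "falling m ?l *\<^sub>R \<psi> m (us @ replicate (m - ?l) 0) = (if m = ?l then fact ?l *\<^sub>R \<psi> ?l us else 0)" for m
  proof (cases m ?l rule: linorder_cases)
    case greater
    then obtain q where q: "m - ?l = Suc q" by (metis Suc_diff_Suc)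
    have lin: "linear (\<lambda>v. \<psi> m (us @ v # replicate q 0))"
      by (rule sym_mlin_linear[OF \<psi>]) (use q greater in auto)
    show ?thesis using linear_0[OF lin] greater q by simp
  qed (auto simp: falling_zero falling_self)
  then show ?thesis unfolding dderiv_poly_sum[OF \<psi>] by simp
qed

lemma poly_taylor:
  assumes "P \<in> poly_upto k"
  shows "P x = (\<Sum>m<nat (k + 1). (1 / fact m) *\<^sub>R dderiv (replicate m x) P 0)"
proof -
  obtain \<psi> where \<psi>: "\<And>m. \<psi> m \<in> sym_mlin m" and P: "P = (\<lambda>x. \<Sum>m<nat (k + 1). \<psi> m (replicate m x))"
    using poly_uptoE[OF assms] by blast
  show ?thesis
    unfolding P by (subst dderiv_poly_at_0[OF \<psi>]) simp
qed

text \<open>The degree bound \<open>k\<close> enters all later estimates in this form: restricted to a line, every derivative of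
  \<open>P\<close> is an ordinary polynomial with vector coefficients, to which interpolation weights apply.\<close>

lemma poly_line:
  assumes "P \<in> poly_upto k"
  shows "\<exists>c. \<forall>t. dderiv us P (a + t *\<^sub>R x) = (\<Sum>j<nat (k + 1). t ^ j *\<^sub>R c j)"
proof -
  let ?K = "nat (k + 1)" and ?l = "length us"
  obtain \<psi> where \<psi>: "\<And>m. \<psi> m \<in> sym_mlin m" and P: "P = (\<lambda>x. \<Sum>m<?K. \<psi> m (replicate m x))"
    using poly_uptoE[OF assms] by blast
  have "\<forall>m. \<exists>c. m < ?K \<longrightarrow> (\<forall>t.
      falling m ?l *\<^sub>R \<psi> m (us @ replicate (m - ?l) (a + t *\<^sub>R x)) = (\<Sum>j<?K. t ^ j *\<^sub>R c j))"
  proof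
    fix m
    show "\<exists>c. m < ?K \<longrightarrow> (\<forall>t.
      falling m ?l *\<^sub>R \<psi> m (us @ replicate (m - ?l) (a + t *\<^sub>R x)) = (\<Sum>j<?K. t ^ j *\<^sub>R c j))"
  proof (cases "?l \<le> m")
    case True
    then obtain c where c: "\<And>t. \<psi> m (us @ replicate (m - ?l) (a + t *\<^sub>R x)) = (\<Sum>j\<le>m - ?l. t ^ j *\<^sub>R c j)"
      using sym_mlin_line[OF \<psi>, of us "m - ?l" m a x] by auto
    let ?c = "\<lambda>j. if j \<le> m - ?l then falling m ?l *\<^sub>R c j else 0"
    have "falling m ?l *\<^sub>R \<psi> m (us @ replicate (m - ?l) (a + t *\<^sub>R x)) = (\<Sum>j<?K. t ^ j *\<^sub>R ?c j)" if m: "m < ?K" for t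
    proof -
      have "(\<Sum>j<?K. t ^ j *\<^sub>R ?c j) = (\<Sum>j\<le>m - ?l. t ^ j *\<^sub>R ?c j)"
        by (rule sum.mono_neutral_right) (use m in auto)
      then show ?thesis unfolding c by (simp add: scaleR_sum_right mult.commute)
    qed
    then show ?thesis by (intro exI[of _ ?c]) blast
  next
    case False
    then show ?thesis by (intro exI[of _ "\<lambda>_. 0"]) (simp add: falling_zero)
  qed
  qed
  from choice[OF this] obtain c where c: "\<And>m t. m < ?K \<Longrightarrow>
      falling m ?l *\<^sub>R \<psi> m (us @ replicate (m - ?l) (a + t *\<^sub>R x)) = (\<Sum>j<?K. t ^ j *\<^sub>R c m j)"
    by blast
  have "dderiv us P (a + t *\<^sub>R x) = (\<Sum>j<?K. t ^ j *\<^sub>R (\<Sum>m<?K. c m j))" for t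
  proof -
    have "dderiv us P (a + t *\<^sub>R x) = (\<Sum>m<?K. \<Sum>j<?K. t ^ j *\<^sub>R c m j)"
      unfolding P dderiv_poly_sum[OF \<psi>] by (rule sum.cong) (auto simp: c)
    also have "\<dots> = (\<Sum>j<?K. t ^ j *\<^sub>R (\<Sum>m<?K. c m j))"
      unfolding scaleR_sum_right by (rule sum.swap)
    finally show ?thesis .
  qed
  then show ?thesis by (intro exI[of _ "\<lambda>j. \<Sum>m<?K. c m j"]) blast
qed

lemma weights_apply:
  fixes c :: "nat \<Rightarrow> 'b::real_vector"
  assumes w: "\<forall>m<K. (\<Sum>j<K. w j * s j ^ m) = \<mu> m"
  shows "(\<Sum>j<K. w j *\<^sub>R (\<Sum>m<K. s j ^ m *\<^sub>R c m)) = (\<Sum>m<K. \<mu> m *\<^sub>R c m)"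
proof -
  have "(\<Sum>j<K. w j *\<^sub>R (\<Sum>m<K. s j ^ m *\<^sub>R c m)) = (\<Sum>m<K. \<Sum>j<K. (w j * s j ^ m) *\<^sub>R c m)"
    unfolding scaleR_sum_right scaleR_scaleR by (rule sum.swap)
  also have "\<dots> = (\<Sum>m<K. \<mu> m *\<^sub>R c m)"
    unfolding scaleR_sum_left[symmetric] by (rule sum.cong) (use w in auto)
  finally show ?thesis .
qed

lemma poly_extrapolate:
  assumes "P \<in> poly_upto k"
    and w: "\<forall>m<nat (k + 1). (\<Sum>j<nat (k + 1). w j * s j ^ m) = t ^ m"
  shows "P (a + t *\<^sub>R x) = (\<Sum>j<nat (k + 1). w j *\<^sub>R P (a + s j *\<^sub>R x))"
proof -
  obtain c where c: "\<And>t. P (a + t *\<^sub>R x) = (\<Sum>j<nat (k + 1). t ^ j *\<^sub>R c j)"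
    using poly_line[OF assms(1), of "[]" a x] by auto
  show ?thesis unfolding c weights_apply[OF w] ..
qed

text \<open>A derivative of a polynomial function is a fixed finite combination of nearby values, with weights
  independent of the function. So bounds and pointwise limits pass from values to derivatives.\<close>

lemma poly_derivative_difference:
  obtains w where "\<And>(P :: real^'n \<Rightarrow> ('y::banach \<Rightarrow>\<^sub>L real)) us v x. P \<in> poly_upto k \<Longrightarrow>
    dderiv (v # us) P x = (\<Sum>j<nat (k + 1). w j *\<^sub>R dderiv us P (x + node j *\<^sub>R v))"
proof -
  let ?K = "nat (k + 1)"
  obtain w where w: "\<forall>m<?K. (\<Sum>j<?K. w j * node j ^ m) = (if m = 1 then 1 else 0)"
    using node_weights[of ?K "\<lambda>m. if m = 1 then 1 else 0"] by blast
  show ?thesis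
  proof (rule that)
    fix P :: "real^'n \<Rightarrow> ('y \<Rightarrow>\<^sub>L real)" and us v x
    assume P: "P \<in> poly_upto k"
    obtain c where c: "\<And>t. dderiv us P (x + t *\<^sub>R v) = (\<Sum>j<?K. t ^ j *\<^sub>R c j)"
      using poly_line[OF P, of us x v] by auto
    have 1: "((\<lambda>t. x + t *\<^sub>R v) has_vector_derivative v) (at 0)"
      by (auto intro!: derivative_eq_intros)
    have D: "(dderiv us P has_derivative (\<lambda>v. dderiv (v # us) P x)) (at (x + 0 *\<^sub>R v))"
      using has_derivative_dderiv[OF smooth_poly[OF P]] by simp
    have A: "((\<lambda>t. dderiv us P (x + t *\<^sub>R v)) has_vector_derivative dderiv (v # us) P x) (at 0)"
      using vector_derivative_diff_chain_within[OF 1, of "dderiv us P" "\<lambda>v. dderiv (v # us) P x"]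
        has_derivative_at_withinI[OF D] by (simp add: o_def)
    have "((\<lambda>t. \<Sum>j<?K. t ^ j *\<^sub>R c j) has_vector_derivative (\<Sum>j<?K. (real j * 0 ^ (j - 1)) *\<^sub>R c j)) (at 0)"
      by (intro has_vector_derivative_sum) (auto intro!: derivative_eq_intros)
    then have "dderiv (v # us) P x = (\<Sum>j<?K. (real j * 0 ^ (j - 1)) *\<^sub>R c j)"
      using A vector_derivative_unique_at unfolding c by blast
    also have "\<dots> = (\<Sum>j<?K. (if j = 1 then 1 else 0) *\<^sub>R c j)"
    proof (rule sum.cong[OF refl])
      fix j
      show "(real j * 0 ^ (j - 1)) *\<^sub>R c j = (if j = 1 then 1 else 0) *\<^sub>R c j"
        by (cases "j = 0 \<or> j = 1") (auto simp: power_0_left)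
    qed
    also have "\<dots> = (\<Sum>j<?K. w j *\<^sub>R dderiv us P (x + node j *\<^sub>R v))"
      unfolding c weights_apply[OF w] ..
    finally show "dderiv (v # us) P x = (\<Sum>j<?K. w j *\<^sub>R dderiv us P (x + node j *\<^sub>R v))" .
  qed
qed

section \<open>The normed space of polynomial functions\<close>

lemma sym_mlin_diff:
  assumes "\<psi> \<in> sym_mlin m" "\<phi> \<in> sym_mlin m"
  shows "(\<lambda>vs\<in>{vs. length vs = m}. \<psi> vs - \<phi> vs) \<in> sym_mlin m"
proof (rule sym_mlin_restrictI)
  fix vs ws :: "'a list" assume "length vs + length ws + 1 = m"
  then show "linear (\<lambda>v. \<psi> (vs @ v # ws) - \<phi> (vs @ v # ws))"
    by (intro linear_compose_sub sym_mlin_linear[OF assms(1)] sym_mlin_linear[OF assms(2)]) auto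
next
  fix vs ws :: "'a list" assume vs: "length vs = m" "mset ws = mset vs"
  show "\<psi> ws - \<phi> ws = \<psi> vs - \<phi> vs"
    using sym_mlin_perm[OF assms(1) vs] sym_mlin_perm[OF assms(2) vs] by simp
qed

lemma poly_diff:
  assumes "P \<in> poly_upto k" "Q \<in> poly_upto k"
  shows "(\<lambda>x. P x - Q x) \<in> poly_upto k"
proof -
  obtain \<psi> where \<psi>: "\<And>m. \<psi> m \<in> sym_mlin m" and P: "P = (\<lambda>x. \<Sum>m<nat (k + 1). \<psi> m (replicate m x))"
    using poly_uptoE[OF assms(1)] by blast
  obtain \<phi> where \<phi>: "\<And>m. \<phi> m \<in> sym_mlin m" and Q: "Q = (\<lambda>x. \<Sum>m<nat (k + 1). \<phi> m (replicate m x))"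
    using poly_uptoE[OF assms(2)] by blast
  show ?thesis
    by (rule poly_uptoI[of "\<lambda>m. \<lambda>vs\<in>{vs. length vs = m}. \<psi> m vs - \<phi> m vs"])
      (auto intro: sym_mlin_diff \<psi> \<phi> simp: P Q sum_subtractf)
qed

lemma nth_deriv_poly_sym_mlin:
  assumes "P \<in> poly_upto k"
  shows "nth_deriv m P a \<in> sym_mlin m"
proof -
  obtain \<psi> where \<psi>: "\<And>m. \<psi> m \<in> sym_mlin m" and P: "P = (\<lambda>x. \<Sum>m<nat (k + 1). \<psi> m (replicate m x))"
    using poly_uptoE[OF assms(1)] by blast
  let ?f = "\<lambda>us. \<Sum>M<nat (k + 1). falling M m *\<^sub>R \<psi> M (us @ replicate (M - m) a)"
  have "nth_deriv m P a = (\<lambda>us\<in>{us. length us = m}. ?f us)"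
    unfolding nth_deriv_def P dderiv_poly_sum[OF \<psi>] by (rule restrict_ext) simp
  also have "\<dots> \<in> sym_mlin m"
  proof (rule sym_mlin_restrictI)
    fix vs ws :: "(real^'a) list" assume L: "length vs + length ws + 1 = m"
    show "linear (\<lambda>v. ?f (vs @ v # ws))"
    proof (rule linear_compose_sum, rule ballI)
      fix M
      show "linear (\<lambda>v. falling M m *\<^sub>R \<psi> M ((vs @ v # ws) @ replicate (M - m) a))"
      proof (cases "m \<le> M")
        case True
        have "linear (\<lambda>v. \<psi> M (vs @ v # (ws @ replicate (M - m) a)))"
          by (rule sym_mlin_linear[OF \<psi>]) (use True L in auto)
        then show ?thesis by (simp add: linear_compose_scale_right)
      qed (simp add: falling_zero linear_zero)
    qed
  next
    fix vs ws :: "(real^'a) list" assume L: "length vs = m" "mset ws = mset vs"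
    show "?f ws = ?f vs"
    proof (rule sum.cong[OF refl])
      fix M
      show "falling M m *\<^sub>R \<psi> M (ws @ replicate (M - m) a) = falling M m *\<^sub>R \<psi> M (vs @ replicate (M - m) a)"
      proof (cases "m \<le> M")
        case True
        have "\<psi> M (ws @ replicate (M - m) a) = \<psi> M (vs @ replicate (M - m) a)"
          by (rule sym_mlin_perm[OF \<psi>]) (use True L in auto)
        then show ?thesis by simp
      qed (simp add: falling_zero)
    qed
  qed
  finally show ?thesis .
qed

text \<open>A bound on a ball of radius \<open>\<rho>\<close> extends to radius \<open>R\<close> at the cost of \<open>(R/\<rho>)\<^sup>k\<close>; the constant is
  uniform in the polynomial function and the centre.\<close>

lemma poly_bound_extrapolate:
  shows "\<exists>W>0. \<forall>(P :: real^'n \<Rightarrow> ('y::banach \<Rightarrow>\<^sub>L real)) a \<rho> R M x. P \<in> poly_upto k \<longrightarrow> 0 < \<rho> \<longrightarrow> \<rho> \<le> R \<longrightarrow>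
       (\<forall>x. norm x \<le> 1 \<longrightarrow> norm (P (a + \<rho> *\<^sub>R x)) \<le> M) \<longrightarrow> norm x \<le> 1 \<longrightarrow>
       norm (P (a + R *\<^sub>R x)) \<le> W * (R / \<rho>) ^ nat k * M"
proof -
  let ?K = "nat (k + 1)"
  obtain W where W: "W > 0" "\<And>t. t \<ge> 1 \<Longrightarrow>
      \<exists>w. (\<forall>j. \<bar>w j\<bar> \<le> W * t ^ (?K - 1)) \<and> (\<forall>m<?K. (\<Sum>j<?K. w j * node j ^ m) = t ^ m)"
    using extrapolation_weights[of ?K] by blast
  have K1: "?K - 1 = nat k" by simp
  show ?thesis
  proof (intro exI[of _ "W * (1 + ?K)"] conjI allI impI)
    show "0 < W * (1 + ?K)" using W by simp
    fix P :: "real^'n \<Rightarrow> ('y \<Rightarrow>\<^sub>L real)" and \<rho> R M :: real and a x :: "real^'n"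
    assume P: "P \<in> poly_upto k" and r: "0 < \<rho>" "\<rho> \<le> R"
      and "\<forall>x. norm x \<le> 1 \<longrightarrow> norm (P (a + \<rho> *\<^sub>R x)) \<le> M" and x: "norm x \<le> 1"
    then have M: "\<And>x. norm x \<le> 1 \<Longrightarrow> norm (P (a + \<rho> *\<^sub>R x)) \<le> M" by blast
    have t: "R / \<rho> \<ge> 1" using r by simp
    have M0: "M \<ge> 0" by (rule order_trans[OF norm_ge_zero M[of 0]]) simp
    obtain w where w: "\<And>j. \<bar>w j\<bar> \<le> W * (R/\<rho>) ^ nat k" "\<forall>m<?K. (\<Sum>j<?K. w j * node j ^ m) = (R/\<rho>) ^ m"
      using W(2)[OF t] unfolding K1 by blast
    have "P (a + R *\<^sub>R x) = P (a + (R/\<rho>) *\<^sub>R (\<rho> *\<^sub>R x))" using r by simp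
    also have "\<dots> = (\<Sum>j<?K. w j *\<^sub>R P (a + node j *\<^sub>R (\<rho> *\<^sub>R x)))"
      by (rule poly_extrapolate[OF P w(2)])
    also have "norm \<dots> \<le> (\<Sum>j<?K. W * (R/\<rho>) ^ nat k * M)"
    proof (rule sum_norm_le)
      fix j
      have "norm (node j *\<^sub>R x) \<le> 1" using node_bounds[of j] x by (simp add: mult_le_one)
      then have "norm (P (a + \<rho> *\<^sub>R (node j *\<^sub>R x))) \<le> M" by (rule M)
      then have "norm (P (a + node j *\<^sub>R (\<rho> *\<^sub>R x))) \<le> M" by (simp add: mult.commute)
      then show "norm (w j *\<^sub>R P (a + node j *\<^sub>R (\<rho> *\<^sub>R x))) \<le> W * (R/\<rho>) ^ nat k * M"
        unfolding norm_scaleR using w(1)[of j] W(1) t M0 by (intro mult_mono) auto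
    qed
    also have "\<dots> = W * ?K * (R/\<rho>) ^ nat k * M" by simp
    also have "\<dots> \<le> W * (1 + ?K) * (R/\<rho>) ^ nat k * M"
      using W(1) r M0 by (intro mult_right_mono) auto
    finally show "norm (P (a + R *\<^sub>R x)) \<le> W * (1 + ?K) * (R/\<rho>) ^ nat k * M" .
  qed
qed

text \<open>Each derivative is a combination of differences with steps of length at most \<open>1\<close>, so a derivative of order
  \<open>m\<close> in the ball of radius \<open>R\<close> is controlled by the values in the ball of radius \<open>R + m\<close>, and these by the
  values in the unit ball.\<close>

lemma poly_deriv_bound:
  "\<exists>C>0. \<forall>(P :: real^'n \<Rightarrow> ('y::banach \<Rightarrow>\<^sub>L real)) us x M. P \<in> poly_upto k \<longrightarrow>
       (\<forall>x. norm x \<le> 1 \<longrightarrow> norm (P x) \<le> M) \<longrightarrow> length us = m \<longrightarrow> (\<forall>u\<in>set us. norm u \<le> 1) \<longrightarrow> norm x \<le> R \<longrightarrow>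
       norm (dderiv us P x) \<le> C * M"
proof -
  let ?K = "nat (k + 1)"
  obtain w where w: "\<And>(P :: real^'n \<Rightarrow> ('y::banach \<Rightarrow>\<^sub>L real)) us v x. P \<in> poly_upto k \<Longrightarrow>
    dderiv (v # us) P x = (\<Sum>j<?K. w j *\<^sub>R dderiv us P (x + node j *\<^sub>R v))"
    by (rule poly_derivative_difference[of k]) (rule that)
  define V where "V = 1 + (\<Sum>j<?K. \<bar>w j\<bar>)"
  have V: "V > 0" unfolding V_def by (intro add_pos_nonneg sum_nonneg) auto
  have *: "norm (dderiv us P x) \<le> V ^ length us * M"
    if "P \<in> poly_upto k" "\<forall>u\<in>set us. norm u \<le> 1" "norm x \<le> S"
      "\<And>x. norm x \<le> S + length us \<Longrightarrow> norm (P x) \<le> M"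
    for P :: "real^'n \<Rightarrow> ('y \<Rightarrow>\<^sub>L real)" and us x M S
    using that(2,3,4)
  proof (induction us arbitrary: x S)
    case (Cons u us)
    have S: "S \<ge> 0" by (rule order_trans[OF norm_ge_zero Cons.prems(2)])
    have M0: "0 \<le> M" by (rule order_trans[OF norm_ge_zero Cons.prems(3)[of 0]]) (use S in simp)
    have "norm (dderiv (u # us) P x) \<le> (\<Sum>j<?K. \<bar>w j\<bar> * (V ^ length us * M))"
      unfolding w[OF that(1)]
    proof (rule sum_norm_le)
      fix j
      have "norm (node j *\<^sub>R u) \<le> 1" using node_bounds[of j] Cons.prems(1) by (simp add: mult_le_one)
      then have "norm (x + node j *\<^sub>R u) \<le> S + 1" by (rule norm_triangle_mono[OF Cons.prems(2)])
      then have "norm (dderiv us P (x + node j *\<^sub>R u)) \<le> V ^ length us * M"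
        by (rule Cons.IH[rotated]) (use Cons.prems in auto)
      then show "norm (w j *\<^sub>R dderiv us P (x + node j *\<^sub>R u)) \<le> \<bar>w j\<bar> * (V ^ length us * M)"
        by (simp add: mult_left_mono)
    qed
    also have "\<dots> \<le> V * (V ^ length us * M)"
      unfolding sum_distrib_right[symmetric] using V M0 by (intro mult_right_mono) (auto simp: V_def)
    finally show ?case by simp
  qed auto
  obtain W where W: "W > 0"
    "\<forall>(P :: real^'n \<Rightarrow> ('y::banach \<Rightarrow>\<^sub>L real)) a \<rho> R M x. P \<in> poly_upto k \<longrightarrow> 0 < \<rho> \<longrightarrow> \<rho> \<le> R \<longrightarrow>
       (\<forall>x. norm x \<le> 1 \<longrightarrow> norm (P (a + \<rho> *\<^sub>R x)) \<le> M) \<longrightarrow> norm x \<le> 1 \<longrightarrow>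
       norm (P (a + R *\<^sub>R x)) \<le> W * (R / \<rho>) ^ nat k * M"
    using poly_bound_extrapolate[of k] by (elim exE conjE) (rule that)
  define S where "S = 1 + \<bar>R\<bar> + real m"
  have S: "S \<ge> 1" by (simp add: S_def)
  show ?thesis
  proof (intro exI[of _ "V ^ m * (W * S ^ nat k)"] conjI allI impI)
    show "0 < V ^ m * (W * S ^ nat k)" using V W S by simp
    fix P :: "real^'n \<Rightarrow> ('y \<Rightarrow>\<^sub>L real)" and us :: "(real^'n) list" and x :: "real^'n" and M :: real
    assume P: "P \<in> poly_upto k" and "\<forall>x. norm x \<le> 1 \<longrightarrow> norm (P x) \<le> M"
      and us: "length us = m" "\<forall>u\<in>set us. norm u \<le> 1" and x: "norm x \<le> R"
    then have M: "\<And>x. norm x \<le> 1 \<Longrightarrow> norm (P x) \<le> M" by blast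
    have "norm (P z) \<le> W * S ^ nat k * M" if "norm z \<le> S" for z
    proof -
      have "norm (P (0 + S *\<^sub>R (z /\<^sub>R S))) \<le> W * (S / 1) ^ nat k * M"
        by (rule W(2)[rule_format, OF P _ S]) (use M S that in \<open>auto simp: divide_simps\<close>)
      then show ?thesis using S by simp
    qed
    then have "norm (dderiv us P x) \<le> V ^ length us * (W * S ^ nat k * M)"
      by (intro *[OF P us(2) x]) (use us in \<open>auto simp: S_def\<close>)
    then show "norm (dderiv us P x) \<le> V ^ m * (W * S ^ nat k) * M"
      using us by (simp add: mult.assoc)
  qed
qed

lemma poly_bounded_on_ball:
  assumes "P \<in> poly_upto k"
  obtains M where "\<And>x. norm x \<le> R \<Longrightarrow> norm (P x) \<le> M"
proof -
  have "bounded (P ` cball 0 R)"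
    by (intro compact_imp_bounded compact_continuous_image smooth_imp_continuous_on smooth_poly[OF assms]) auto
  then obtain M where "\<forall>x\<in>cball 0 R. norm (P x) \<le> M" by (auto simp: bounded_iff)
  then show ?thesis by (intro that[of M]) simp
qed

text \<open>The norm that defines \<open>poly_top\<close>.\<close>

definition poly_norm :: "int \<Rightarrow> (real^'n \<Rightarrow> ('y::banach \<Rightarrow>\<^sub>L real)) \<Rightarrow> real" where
  "poly_norm k P = (\<Sum>m | int m \<le> k. mlin_norm m (nth_deriv m P 0))"

text \<open>The supremum in \<open>mlin_norm\<close> is finite by \<open>poly_deriv_bound\<close>.\<close>

lemma norm_dderiv_le_mlin_norm:
  fixes P :: "real^'n \<Rightarrow> ('y::banach \<Rightarrow>\<^sub>L real)"
  assumes P: "P \<in> poly_upto k" and us: "length us = m" "\<forall>u\<in>set us. norm u \<le> 1"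
  shows "norm (dderiv us P x) \<le> mlin_norm m (nth_deriv m P x)"
proof -
  obtain M where M: "\<And>x. norm x \<le> 1 \<Longrightarrow> norm (P x) \<le> M" using poly_bounded_on_ball[OF P] by blast
  obtain C where C: "\<forall>(P :: real^'n \<Rightarrow> ('y \<Rightarrow>\<^sub>L real)) us z M. P \<in> poly_upto k \<longrightarrow>
       (\<forall>x. norm x \<le> 1 \<longrightarrow> norm (P x) \<le> M) \<longrightarrow> length us = m \<longrightarrow> (\<forall>u\<in>set us. norm u \<le> 1) \<longrightarrow>
       norm z \<le> norm x \<longrightarrow> norm (dderiv us P z) \<le> C * M"
    using poly_deriv_bound[of k m "norm x"] by (elim exE conjE) (rule that)
  have "norm (nth_deriv m P x us) \<le> mlin_norm m (nth_deriv m P x)"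
  proof (rule norm_le_mlin_norm[OF _ us])
    fix vs :: "(real^'n) list" assume "length vs = m" "\<forall>v\<in>set vs. norm v \<le> 1"
    then show "norm (nth_deriv m P x vs) \<le> C * M"
      using C[rule_format, of P M vs x] P M by (simp add: nth_deriv_def)
  qed
  then show ?thesis using us(1) by (simp add: nth_deriv_def)
qed

lemma mlin_norm_nonneg: "P \<in> poly_upto k \<Longrightarrow> 0 \<le> mlin_norm m (nth_deriv m P x)"
  by (rule order_trans[OF norm_ge_zero norm_dderiv_le_mlin_norm[of P k "replicate m 0" m x]]) auto

lemma poly_norm_nonneg: "P \<in> poly_upto k \<Longrightarrow> 0 \<le> poly_norm k P"
  unfolding poly_norm_def by (intro sum_nonneg mlin_norm_nonneg)

lemma poly_le_poly_norm:
  assumes P: "P \<in> poly_upto k" and x: "norm x \<le> 1"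
  shows "norm (P x) \<le> poly_norm k P"
proof -
  have "norm (P x) \<le> (\<Sum>m<nat (k + 1). mlin_norm m (nth_deriv m P 0))"
    unfolding poly_taylor[OF P, of x]
  proof (rule sum_norm_le)
    fix m
    have "norm (dderiv (replicate m x) P 0) \<le> mlin_norm m (nth_deriv m P 0)"
      by (rule norm_dderiv_le_mlin_norm[OF P]) (use x in auto)
    moreover have "(1 / fact m :: real) \<le> 1" by (simp add: fact_ge_1)
    ultimately have "(1 / fact m) * norm (dderiv (replicate m x) P 0) \<le> 1 * mlin_norm m (nth_deriv m P 0)"
      by (intro mult_mono) auto
    then show "norm ((1 / fact m) *\<^sub>R dderiv (replicate m x) P 0) \<le> mlin_norm m (nth_deriv m P 0)"
      by simp
  qed
  then show ?thesis by (simp add: poly_norm_def degree_set)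
qed

text \<open>Together with \<open>poly_le_poly_norm\<close> this shows that \<open>poly_norm\<close> is equivalent to the supremum norm on the
  unit ball, which is the norm that the estimates below produce.\<close>

lemma poly_norm_le:
  "\<exists>C>0. \<forall>(P :: real^'n \<Rightarrow> ('y::banach \<Rightarrow>\<^sub>L real)) M. P \<in> poly_upto k \<longrightarrow>
       (\<forall>x. norm x \<le> 1 \<longrightarrow> norm (P x) \<le> M) \<longrightarrow> poly_norm k P \<le> C * M"
proof -
  let ?K = "nat (k + 1)"
  have "\<forall>m. \<exists>C>0. \<forall>(P :: real^'n \<Rightarrow> ('y::banach \<Rightarrow>\<^sub>L real)) us x M. P \<in> poly_upto k \<longrightarrow>
       (\<forall>x. norm x \<le> 1 \<longrightarrow> norm (P x) \<le> M) \<longrightarrow> length us = m \<longrightarrow> (\<forall>u\<in>set us. norm u \<le> 1) \<longrightarrow> norm x \<le> 0 \<longrightarrow>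
       norm (dderiv us P x) \<le> C * M"
    by (rule allI, rule poly_deriv_bound)
  from choice[OF this] obtain C where C0: "\<And>m. C m > 0"
    and C: "\<And>m. \<forall>(P :: real^'n \<Rightarrow> ('y::banach \<Rightarrow>\<^sub>L real)) us x M. P \<in> poly_upto k \<longrightarrow>
       (\<forall>x. norm x \<le> 1 \<longrightarrow> norm (P x) \<le> M) \<longrightarrow> length us = m \<longrightarrow> (\<forall>u\<in>set us. norm u \<le> 1) \<longrightarrow> norm x \<le> 0 \<longrightarrow>
       norm (dderiv us P x) \<le> C m * M"
    by blast
  show ?thesis
  proof (intro exI[of _ "1 + (\<Sum>m<?K. C m)"] conjI allI impI)
    show "0 < 1 + (\<Sum>m<?K. C m)"
      using C0 by (intro add_pos_nonneg sum_nonneg) (auto intro: less_imp_le)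
    fix P :: "real^'n \<Rightarrow> ('y \<Rightarrow>\<^sub>L real)" and M :: real
    assume P: "P \<in> poly_upto k" and M: "\<forall>x. norm x \<le> 1 \<longrightarrow> norm (P x) \<le> M"
    have M0: "M \<ge> 0" using order_trans[OF norm_ge_zero M[rule_format, of 0]] by simp
    have "mlin_norm m (nth_deriv m P 0) \<le> C m * M" for m
    proof (rule mlin_norm_le)
      fix vs :: "(real^'n) list" assume "length vs = m" "\<forall>v\<in>set vs. norm v \<le> 1"
      then show "norm (nth_deriv m P 0 vs) \<le> C m * M"
        using C[rule_format, of P M vs m 0] P M by (simp add: nth_deriv_def)
    qed
    then have "poly_norm k P \<le> (\<Sum>m<?K. C m * M)"
      unfolding poly_norm_def degree_set by (intro sum_mono)
    also have "\<dots> \<le> (1 + (\<Sum>m<?K. C m)) * M"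
      using M0 by (simp add: sum_distrib_right[symmetric] distrib_right)
    finally show "poly_norm k P \<le> (1 + (\<Sum>m<?K. C m)) * M" .
  qed
qed

lemma poly_norm_zero: "poly_norm k (\<lambda>x::real^'n. 0::'y::banach \<Rightarrow>\<^sub>L real) = 0"
proof -
  have "mlin_norm m (nth_deriv m (\<lambda>x::real^'n. 0::'y::banach \<Rightarrow>\<^sub>L real) 0) = 0" for m
  proof (rule antisym)
    show "mlin_norm m (nth_deriv m (\<lambda>x::real^'n. 0::'y::banach \<Rightarrow>\<^sub>L real) 0) \<le> 0"
      by (rule mlin_norm_le) (simp add: nth_deriv_def dderiv_zero)
    have "norm (nth_deriv m (\<lambda>x::real^'n. 0::'y::banach \<Rightarrow>\<^sub>L real) 0 (replicate m 0))
      \<le> mlin_norm m (nth_deriv m (\<lambda>x::real^'n. 0::'y::banach \<Rightarrow>\<^sub>L real) 0)"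
      by (rule norm_le_mlin_norm[where B = 0]) (auto simp: nth_deriv_def dderiv_zero)
    then show "0 \<le> mlin_norm m (nth_deriv m (\<lambda>x::real^'n. 0::'y::banach \<Rightarrow>\<^sub>L real) 0)"
      by (simp add: nth_deriv_def dderiv_zero)
  qed
  then show ?thesis by (simp add: poly_norm_def)
qed

lemma poly_norm_triangle:
  fixes P :: "real^'n \<Rightarrow> ('y::banach \<Rightarrow>\<^sub>L real)"
  assumes "P \<in> poly_upto k" "Q \<in> poly_upto k" "S \<in> poly_upto k"
  shows "poly_norm k (\<lambda>x. P x - S x) \<le> poly_norm k (\<lambda>x. P x - Q x) + poly_norm k (\<lambda>x. Q x - S x)"
proof -
  have "mlin_norm m (nth_deriv m (\<lambda>x. P x - S x) 0)
     \<le> mlin_norm m (nth_deriv m (\<lambda>x. P x - Q x) 0) + mlin_norm m (nth_deriv m (\<lambda>x. Q x - S x) 0)" for m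
  proof (rule mlin_norm_le)
    fix vs :: "(real^'n) list" assume vs: "length vs = m" "\<forall>v\<in>set vs. norm v \<le> 1"
    have "nth_deriv m (\<lambda>x. P x - S x) 0 vs = dderiv vs (\<lambda>x. P x - Q x) 0 + dderiv vs (\<lambda>x. Q x - S x) 0"
      using assms vs by (simp add: nth_deriv_def dderiv_diff smooth_poly)
    also have "norm \<dots> \<le> mlin_norm m (nth_deriv m (\<lambda>x. P x - Q x) 0) + mlin_norm m (nth_deriv m (\<lambda>x. Q x - S x) 0)"
      by (intro norm_triangle_mono norm_dderiv_le_mlin_norm[OF poly_diff[OF assms(1,2)]]
          norm_dderiv_le_mlin_norm[OF poly_diff[OF assms(2,3)]] vs)
    finally show "norm (nth_deriv m (\<lambda>x. P x - S x) 0 vs)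
      \<le> mlin_norm m (nth_deriv m (\<lambda>x. P x - Q x) 0) + mlin_norm m (nth_deriv m (\<lambda>x. Q x - S x) 0)" .
  qed
  then show ?thesis unfolding poly_norm_def sum.distrib[symmetric] by (rule sum_mono)
qed

lemma poly_norm_commute:
  fixes P :: "real^'n \<Rightarrow> ('y::banach \<Rightarrow>\<^sub>L real)"
  assumes "P \<in> poly_upto k" "Q \<in> poly_upto k"
  shows "poly_norm k (\<lambda>x. P x - Q x) = poly_norm k (\<lambda>x. Q x - P x)"
proof -
  have le: "poly_norm k (\<lambda>x. P x - Q x) \<le> poly_norm k (\<lambda>x. Q x - P x)"
    if "P \<in> poly_upto k" "Q \<in> poly_upto k" for P Q :: "real^'n \<Rightarrow> ('y \<Rightarrow>\<^sub>L real)"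
  proof -
    have "mlin_norm m (nth_deriv m (\<lambda>x. P x - Q x) 0) \<le> mlin_norm m (nth_deriv m (\<lambda>x. Q x - P x) 0)" for m
    proof (rule mlin_norm_le)
      fix vs :: "(real^'n) list" assume vs: "length vs = m" "\<forall>v\<in>set vs. norm v \<le> 1"
      have "norm (nth_deriv m (\<lambda>x. P x - Q x) 0 vs) = norm (dderiv vs (\<lambda>x. Q x - P x) 0)"
        using that vs by (simp add: nth_deriv_def dderiv_diff smooth_poly norm_minus_commute)
      also have "\<dots> \<le> mlin_norm m (nth_deriv m (\<lambda>x. Q x - P x) 0)"
        by (intro norm_dderiv_le_mlin_norm[OF poly_diff[OF that(2,1)]] vs)
      finally show "norm (nth_deriv m (\<lambda>x. P x - Q x) 0 vs) \<le> mlin_norm m (nth_deriv m (\<lambda>x. Q x - P x) 0)" .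
    qed
    then show ?thesis unfolding poly_norm_def by (rule sum_mono)
  qed
  show ?thesis by (rule antisym[OF le[OF assms] le[OF assms(2,1)]])
qed

lemma openin_poly_top:
  fixes U :: "(real^'n \<Rightarrow> ('y::banach \<Rightarrow>\<^sub>L real)) set"
  shows "openin (poly_top k) U \<longleftrightarrow> U \<subseteq> poly_upto k \<and>
     (\<forall>P\<in>U. \<exists>e>0. \<forall>Q\<in>poly_upto k. poly_norm k (\<lambda>x. Q x - P x) < e \<longrightarrow> Q \<in> U)"
  and topspace_poly_top: "topspace (poly_top k) = (poly_upto k :: (real^'n \<Rightarrow> ('y::banach \<Rightarrow>\<^sub>L real)) set)"
proof -
  have top: "poly_top k = seminorms_topology (poly_upto k :: (real^'n \<Rightarrow> ('y::banach \<Rightarrow>\<^sub>L real)) set) {()} (\<lambda>_. poly_norm k)"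
    by (simp add: poly_top_def poly_norm_def[abs_def])
  have J: "J \<subseteq> {()} \<longleftrightarrow> J = {} \<or> J = {()}" for J by auto
  have "openin (poly_top k) U \<longleftrightarrow> U \<subseteq> poly_upto k \<and> (\<forall>w\<in>U. \<exists>J e. finite J \<and> J \<subseteq> {()} \<and> e > 0 \<and>
        {u \<in> poly_upto k. \<forall>i\<in>J. poly_norm k (\<lambda>x. u x - w x) < e} \<subseteq> U)"
    unfolding top by (rule openin_seminorms_topology) (auto simp: poly_norm_zero poly_norm_triangle)
  also have "\<dots> \<longleftrightarrow> U \<subseteq> poly_upto k \<and>
     (\<forall>P\<in>U. \<exists>e>0. \<forall>Q\<in>poly_upto k. poly_norm k (\<lambda>x. Q x - P x) < e \<longrightarrow> Q \<in> U)"
  proof (intro conj_cong refl ball_cong iffI)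
    fix P assume "\<exists>J e. finite J \<and> J \<subseteq> {()} \<and> e > 0 \<and>
        {u \<in> poly_upto k. \<forall>i\<in>J. poly_norm k (\<lambda>x. u x - P x) < e} \<subseteq> U"
    then show "\<exists>e>0. \<forall>Q\<in>poly_upto k. poly_norm k (\<lambda>x. Q x - P x) < e \<longrightarrow> Q \<in> U"
      unfolding J by blast
  next
    fix P assume "\<exists>e>0. \<forall>Q\<in>poly_upto k. poly_norm k (\<lambda>x. Q x - P x) < e \<longrightarrow> Q \<in> U"
    then obtain e where "e > 0" "\<forall>Q\<in>poly_upto k. poly_norm k (\<lambda>x. Q x - P x) < e \<longrightarrow> Q \<in> U" by blast
    then show "\<exists>J e. finite J \<and> J \<subseteq> {()} \<and> e > 0 \<and>
        {u \<in> poly_upto k. \<forall>i\<in>J. poly_norm k (\<lambda>x. u x - P x) < e} \<subseteq> U"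
      by (intro exI[of _ "{()}"] exI[of _ e]) auto
  qed
  finally show "openin (poly_top k) U \<longleftrightarrow> U \<subseteq> poly_upto k \<and>
     (\<forall>P\<in>U. \<exists>e>0. \<forall>Q\<in>poly_upto k. poly_norm k (\<lambda>x. Q x - P x) < e \<longrightarrow> Q \<in> U)" .
  show "topspace (poly_top k) = (poly_upto k :: (real^'n \<Rightarrow> ('y::banach \<Rightarrow>\<^sub>L real)) set)"
    unfolding top by (rule topspace_seminorms_topology) (auto simp: poly_norm_zero)
qed

section \<open>A smooth bump function\<close>

text \<open>The factor \<open>t\<^sup>-\<^sup>m\<close> is included since derivatives of \<open>exp (- 1/t)\<close> are combinations of these functions.\<close>

definition exp_cutoff :: "nat \<Rightarrow> real \<Rightarrow> real" where
  "exp_cutoff m t = (if t \<le> 0 then 0 else exp (- (1 / t)) / t ^ m)"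

text \<open>The inequality \<open>(1 + x/n)\<^sup>n \<le> exp x\<close> with \<open>x = 1/t\<close> and \<open>n = m + 2\<close> beats the factor \<open>t\<^sup>-\<^sup>m\<close> and
  leaves \<open>t\<^sup>2\<close>, so that the derivative at \<open>0\<close> vanishes.\<close>

lemma exp_cutoff_bound: "\<bar>exp_cutoff m t\<bar> \<le> real (m + 2) ^ (m + 2) * t\<^sup>2"
proof (cases "t \<le> 0")
  case False
  then have t: "t > 0" by simp
  let ?n = "m + 2"
  have "(1 / t / real ?n) ^ ?n \<le> (1 + 1 / t / real ?n) ^ ?n"
    using t by (intro power_mono) auto
  also have "\<dots> \<le> exp (1 / t)"
    by (rule exp_ge_one_plus_x_over_n_power_n) (use t in \<open>auto intro: order_trans[of _ 0]\<close>)
  finally have "1 / exp (1 / t) \<le> 1 / (1 / t / real ?n) ^ ?n"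
    using t by (intro divide_left_mono) auto
  also have "\<dots> = (t * real ?n) ^ ?n"
  proof -
    have "1 / t / real ?n = 1 / (t * real ?n)" by simp
    then show ?thesis by (simp only: power_one_over divide_divide_eq_right mult_1)
  qed
  also have "\<dots> = real ?n ^ ?n * t ^ ?n" by (simp only: power_mult_distrib mult.commute)
  finally have "exp (- (1 / t)) / t ^ m \<le> real ?n ^ ?n * t ^ ?n / t ^ m"
    using t by (intro divide_right_mono) (auto simp: exp_minus inverse_eq_divide)
  also have "\<dots> = real ?n ^ ?n * t\<^sup>2" using t by (simp add: power_add power2_eq_square)
  finally show ?thesis using t by (simp add: exp_cutoff_def)
qed (simp add: exp_cutoff_def)

lemma exp_cutoff_deriv:
  "(exp_cutoff m has_real_derivative (exp_cutoff (m + 2) t - real m * exp_cutoff (m + 1) t)) (at t)"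
proof (cases t "0::real" rule: linorder_cases)
  case less
  have "((\<lambda>_. 0) has_real_derivative 0) (at t)" by simp
  then have "(exp_cutoff m has_real_derivative 0) (at t)"
    by (rule has_field_derivative_transform_within_open[of _ _ _ "{..<0}"])
      (use less in \<open>auto simp: exp_cutoff_def\<close>)
  then show ?thesis using less by (simp add: exp_cutoff_def)
next
  case equal
  let ?C = "real (m + 2) ^ (m + 2)"
  have "(exp_cutoff m has_derivative (\<lambda>_. 0)) (at 0)"
  proof (rule has_derivativeI_sandwich[of 1 _ _ _ _ "\<lambda>y. ?C * \<bar>y\<bar>"])
    fix y :: real assume y: "y \<noteq> 0"
    have "norm (exp_cutoff m y - exp_cutoff m 0 - 0) \<le> ?C * \<bar>y\<bar> * norm (y - 0)"
      using exp_cutoff_bound[of m y] by (simp add: exp_cutoff_def[of m 0] power2_eq_square abs_mult_self_eq mult.assoc)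
    then show "norm (exp_cutoff m y - exp_cutoff m 0 - 0) / norm (y - 0) \<le> ?C * \<bar>y\<bar>"
      using y by (simp add: divide_le_eq)
  next
    have "((\<lambda>y. ?C * \<bar>y\<bar>) \<longlongrightarrow> ?C * \<bar>0\<bar>) (at 0)" by (intro tendsto_intros)
    then show "((\<lambda>y::real. ?C * \<bar>y\<bar>) \<longlongrightarrow> 0) (at 0)" by simp
  qed auto
  then have "(exp_cutoff m has_real_derivative 0) (at 0)"
    by (simp add: has_field_derivative_def lambda_zero)
  then show ?thesis using equal by (simp add: exp_cutoff_def[of _ 0])
next
  case greater
  have "((\<lambda>t. exp (- (1 / t)) * inverse (t ^ m)) has_real_derivative
      (exp (- (1 / t)) / t\<^sup>2 * inverse (t ^ m) - exp (- (1 / t)) * real m / t ^ (m + 1))) (at t)"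
  proof -
    have 1: "((\<lambda>t. exp (- (1 / t))) has_real_derivative exp (- (1 / t)) / t\<^sup>2) (at t)"
      using greater by (auto intro!: derivative_eq_intros simp: power2_eq_square field_simps)
    have 2: "((\<lambda>t. inverse (t ^ m)) has_real_derivative - (real m * t ^ (m - 1)) / (t ^ m)\<^sup>2) (at t)"
      using greater by (auto intro!: derivative_eq_intros simp: power2_eq_square field_simps)
    have 3: "- (real m * t ^ (m - 1)) / (t ^ m)\<^sup>2 = - real m / t ^ (m + 1)"
      using greater by (cases m) (auto simp: power2_eq_square field_simps)
    show ?thesis using DERIV_mult[OF 1 2] unfolding 3 by (simp add: algebra_simps)
  qed
  then have "(exp_cutoff m has_real_derivative
      (exp (- (1 / t)) / t\<^sup>2 * inverse (t ^ m) - exp (- (1 / t)) * real m / t ^ (m + 1))) (at t)"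
    by (rule has_field_derivative_transform_within_open[of _ _ _ "{0<..}"])
      (use greater in \<open>auto simp: exp_cutoff_def divide_inverse\<close>)
  then show ?thesis
    using greater by (simp add: exp_cutoff_def power_add power2_eq_square field_simps)
qed

text \<open>A class of functions containing the bump function and closed under directional derivatives, as
  \<open>smooth_coinduct\<close> requires.\<close>

inductive_set bump_class :: "(real^'n \<Rightarrow> real) set" where
  base: "(\<lambda>x. exp_cutoff m (1 - x \<bullet> x)) \<in> bump_class"
| coord: "g \<in> bump_class \<Longrightarrow> (\<lambda>x. (x \<bullet> v) * g x) \<in> bump_class"
| scale: "g \<in> bump_class \<Longrightarrow> (\<lambda>x. c * g x) \<in> bump_class"
| add: "f \<in> bump_class \<Longrightarrow> g \<in> bump_class \<Longrightarrow> (\<lambda>x. f x + g x) \<in> bump_class"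

lemma bump_class_deriv:
  assumes "g \<in> bump_class"
  shows "\<exists>D. (\<forall>x. (g has_derivative D x) (at x)) \<and> (\<forall>v. (\<lambda>x. D x v) \<in> bump_class)"
  using assms
proof induction
  case (base m)
  let ?d = "\<lambda>t. exp_cutoff (m + 2) t - real m * exp_cutoff (m + 1) t"
  let ?D = "\<lambda>x v. ?d (1 - x \<bullet> x) * (- 2 * (x \<bullet> v))"
  have "((\<lambda>x. exp_cutoff m (1 - x \<bullet> x)) has_derivative ?D x) (at x)" for x :: "real^'n"
  proof -
    have "((\<lambda>x. 1 - x \<bullet> x) has_derivative (\<lambda>v. - 2 * (x \<bullet> v))) (at x)"
      by (auto intro!: derivative_eq_intros simp: inner_commute)
    from has_derivative_compose[OF this exp_cutoff_deriv[unfolded has_field_derivative_def]]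
    show ?thesis by simp
  qed
  moreover have "(\<lambda>x. ?D x v) \<in> bump_class" for v :: "real^'n"
  proof -
    have "(\<lambda>x. (-2) * ((x \<bullet> v) * exp_cutoff (m + 2) (1 - x \<bullet> x))
        + (2 * real m) * ((x \<bullet> v) * exp_cutoff (m + 1) (1 - x \<bullet> x))) \<in> bump_class"
      by (intro bump_class.intros)
    then show ?thesis by (simp add: algebra_simps)
  qed
  ultimately show ?case by (intro exI[of _ ?D]) blast
next
  case (coord g u)
  then obtain D where D: "\<And>x. (g has_derivative D x) (at x)" "\<And>v. (\<lambda>x. D x v) \<in> bump_class" by blast
  have "((\<lambda>x. (x \<bullet> u) * g x) has_derivative (\<lambda>v. (x \<bullet> u) * D x v + (v \<bullet> u) * g x)) (at x)" for x
    by (intro has_derivative_mult D has_derivative_inner_left has_derivative_ident)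
  moreover have "(\<lambda>x. (x \<bullet> u) * D x v + (v \<bullet> u) * g x) \<in> bump_class" for v
    by (intro bump_class.intros D coord)
  ultimately show ?case by (intro exI[of _ "\<lambda>x v. (x \<bullet> u) * D x v + (v \<bullet> u) * g x"]) blast
next
  case (scale g c)
  then obtain D where D: "\<And>x. (g has_derivative D x) (at x)" "\<And>v. (\<lambda>x. D x v) \<in> bump_class" by blast
  have "((\<lambda>x. c * g x) has_derivative (\<lambda>v. c * D x v)) (at x)" for x
    by (rule has_derivative_mult_right[OF D(1)])
  moreover have "(\<lambda>x. c * D x v) \<in> bump_class" for v
    by (intro bump_class.intros D)
  ultimately show ?case by (intro exI[of _ "\<lambda>x v. c * D x v"]) blast
next
  case (add f g)
  then obtain D E where D: "\<And>x. (f has_derivative D x) (at x)" "\<And>v. (\<lambda>x. D x v) \<in> bump_class"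
    and E: "\<And>x. (g has_derivative E x) (at x)" "\<And>v. (\<lambda>x. E x v) \<in> bump_class" by blast
  have "((\<lambda>x. f x + g x) has_derivative (\<lambda>v. D x v + E x v)) (at x)" for x
    by (intro has_derivative_add D E)
  moreover have "(\<lambda>x. D x v + E x v) \<in> bump_class" for v
    by (intro bump_class.intros D E)
  ultimately show ?case by (intro exI[of _ "\<lambda>x v. D x v + E x v"]) blast
qed

definition bump :: "real^'n \<Rightarrow> real" where "bump x = exp_cutoff 0 (1 - x \<bullet> x)"

lemma smooth_bump: "smooth (bump :: real^'n \<Rightarrow> real)"
proof (rule smooth_coinduct[of _ bump_class])
  show "bump \<in> bump_class" using bump_class.base[of 0] by (simp add: bump_def[abs_def])
next
  fix g :: "real^'n \<Rightarrow> real" and x assume "g \<in> bump_class"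
  then show "g differentiable (at x)" using bump_class_deriv[of g] by (auto simp: differentiable_def)
next
  fix g :: "real^'n \<Rightarrow> real" and v assume "g \<in> bump_class"
  then obtain D where D: "\<And>x. (g has_derivative D x) (at x)" "\<And>v. (\<lambda>x. D x v) \<in> bump_class"
    using bump_class_deriv[of g] by blast
  have "(\<lambda>x. frechet_derivative g (at x) v) = (\<lambda>x. D x v)"
    by (rule ext) (simp add: frechet_derivative_at[OF D(1), symmetric])
  then show "(\<lambda>x. frechet_derivative g (at x) v) \<in> bump_class" using D(2) by simp
qed

lemma bump_nonneg: "0 \<le> bump x" by (simp add: bump_def exp_cutoff_def)

lemma bump_outside: "norm x \<ge> 1 \<Longrightarrow> bump x = 0"
  by (simp add: bump_def exp_cutoff_def dot_square_norm one_le_power)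

section \<open>Pairing polynomial functions with test functions\<close>

lemma integrable_compact_support:
  fixes g :: "real^'n \<Rightarrow> real"
  assumes "continuous_on UNIV g" "compact K" "\<And>x. x \<notin> K \<Longrightarrow> g x = 0"
  shows "integrable lebesgue g"
proof -
  have "integrable lborel (\<lambda>x. indicator K x *\<^sub>R g x)"
    by (rule borel_integrable_compact[OF assms(2)]) (use assms(1) continuous_on_subset in blast)
  moreover have "(\<lambda>x. indicator K x *\<^sub>R g x) = g"
    using assms(3) by (auto simp: indicator_def fun_eq_iff)
  moreover have "g \<in> borel_measurable lborel"
    using borel_measurable_continuous_onI[OF assms(1)] by simp
  ultimately show ?thesis by (simp add: integrable_completion)
qed

lemma lebesgue_integral_affine:
  fixes g :: "real^'n \<Rightarrow> real"
  assumes "continuous_on UNIV g" "r > 0"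
  shows "(\<integral>x. g x \<partial>lebesgue) = r ^ CARD('n) * (\<integral>x. g (a + r *\<^sub>R x) \<partial>lebesgue)"
proof -
  have [measurable]: "g \<in> borel_measurable borel"
    using borel_measurable_continuous_onI[OF assms(1)] .
  have "(\<integral>x. g x \<partial>lebesgue) = (\<integral>x. g x \<partial>lborel)" by (rule integral_completion) simp
  also have "\<dots> = (\<integral>x. g x \<partial>density (distr lborel borel (\<lambda>x. a + r *\<^sub>R x)) (\<lambda>_. ennreal (\<bar>r\<bar>^DIM(real^'n))))"
    using lborel_affine[of r a] assms(2) by simp
  also have "\<dots> = r ^ CARD('n) * (\<integral>x. g (a + r *\<^sub>R x) \<partial>lborel)"
    using assms(2) by (subst integral_density) (auto simp: integral_distr)
  also have "(\<integral>x. g (a + r *\<^sub>R x) \<partial>lborel) = (\<integral>x. g (a + r *\<^sub>R x) \<partial>lebesgue)"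
    by (rule integral_completion[symmetric]) simp
  finally show ?thesis .
qed

text \<open>The integral that defines \<open>distr_of\<close>, for arbitrary functions in place of test functions.\<close>

definition pairing :: "(real^'n \<Rightarrow> ('y::banach \<Rightarrow>\<^sub>L real)) \<Rightarrow> (real^'n \<Rightarrow> 'y) \<Rightarrow> real" where
  "pairing P \<theta> = (\<integral>x. blinfun_apply (P x) (\<theta> x) \<partial>lebesgue)"

lemma continuous_on_pairing:
  assumes "continuous_on UNIV P" "continuous_on UNIV \<theta>"
  shows "continuous_on UNIV (\<lambda>x. blinfun_apply (P x) (\<theta> x))"
  by (intro blinfun.continuous_on assms)

lemma integrable_pairing:
  fixes P :: "real^'n \<Rightarrow> ('y::banach \<Rightarrow>\<^sub>L real)"
  assumes "continuous_on UNIV P" "continuous_on UNIV \<theta>" "compact K" "\<And>x. x \<notin> K \<Longrightarrow> \<theta> x = 0"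
  shows "integrable lebesgue (\<lambda>x. blinfun_apply (P x) (\<theta> x))"
proof (rule integrable_compact_support[OF continuous_on_pairing[OF assms(1,2)] assms(3)])
  show "blinfun_apply (P x) (\<theta> x) = 0" if "x \<notin> K" for x
    using assms(4)[OF that] by (simp add: blinfun.zero_right)
qed

text \<open>The substitution \<open>x \<mapsto> a + r x\<close> moves the rescaling from the test function to \<open>P\<close>; its Jacobian \<open>r\<^sup>n\<close> cancels
  the normalisation of \<open>rescale\<close>.\<close>

lemma rescale_distr_of:
  fixes \<theta> :: "real^'n \<Rightarrow> 'y::banach"
  assumes P: "continuous_on UNIV P" and \<theta>: "\<theta> \<in> test_fun_in (cball 0 1)" and r: "r > 0"
  shows "rescale (\<lambda>\<eta>. T \<eta> - distr_of P \<eta>) a r \<theta> =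
    T (\<lambda>x. \<theta> ((1/r) *\<^sub>R (x - a))) / r ^ CARD('n) - pairing (\<lambda>x. P (a + r *\<^sub>R x)) \<theta>"
proof -
  have c: "continuous_on UNIV \<theta>" by (rule smooth_imp_continuous_on) (use \<theta> test_fun_inD in blast)
  have "continuous_on UNIV (\<lambda>x. \<theta> ((1/r) *\<^sub>R (x - a)))"
    by (intro continuous_on_compose2[OF c] continuous_intros) auto
  from lebesgue_integral_affine[OF continuous_on_pairing[OF P this] r, of a]
  have "distr_of P (\<lambda>x. \<theta> ((1/r) *\<^sub>R (x - a))) = r ^ CARD('n) * pairing (\<lambda>x. P (a + r *\<^sub>R x)) \<theta>"
    using rescaled_test_fun'[OF \<theta> r] r by (simp add: distr_of_def pairing_def)
  then show ?thesis using r by (simp add: rescale_def diff_divide_distrib)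
qed

section \<open>A mollifier reproducing polynomial functions\<close>

lemma bump_integral_pos: "(\<integral>x. bump (x::real^'n) \<partial>lebesgue) > 0"
proof -
  let ?B = "cball (0::real^'n) (1/2)"
  have int: "integrable lebesgue (bump :: real^'n \<Rightarrow> real)"
    by (rule integrable_compact_support[OF smooth_imp_continuous_on[OF smooth_bump] compact_cball[of 0 1]])
      (auto intro: bump_outside)
  \<comment> \<open>On the ball of radius \<open>1/2\<close> the argument \<open>1 - x \<bullet> x\<close> is at least \<open>1/2\<close>, so the bump is
    at least \<open>exp (-2)\<close>.\<close>
  have "0 < exp (-2) * measure lebesgue ?B"
    using content_cball_pos[of "1/2" "0::real^'n"] by simp
  also have "\<dots> = (\<integral>x. exp (-2) * indicator ?B x \<partial>lebesgue)" by simp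
  also have "\<dots> \<le> (\<integral>x. bump (x::real^'n) \<partial>lebesgue)"
  proof (rule integral_mono[OF _ int])
    show "integrable lebesgue (\<lambda>x. exp (-2) * indicat_real ?B x)"
      by (intro integrable_mult_right integrable_real_indicator) (use emeasure_bounded_finite[OF bounded_cball[of "0::real^'n" "1/2"]] in auto)
    fix x :: "real^'n"
    show "exp (-2) * indicat_real ?B x \<le> bump x"
    proof (cases "x \<in> ?B")
      case True
      then have "(norm x)\<^sup>2 \<le> (1/2)\<^sup>2" by (intro power_mono) auto
      then have t: "1 - x \<bullet> x \<ge> 1/2" by (simp add: dot_square_norm power2_eq_square)
      then have "1 / (1 - x \<bullet> x) \<le> 2" by (simp add: divide_le_eq)
      then show ?thesis using True t by (simp add: bump_def exp_cutoff_def)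
    qed (simp add: bump_nonneg)
  qed
  finally show ?thesis .
qed

text \<open>Averages of \<open>P\<close> about \<open>z\<close> against a bump of width \<open>s\<close> are polynomial in \<open>s\<close> of degree at most \<open>k\<close>, and
  the value at \<open>s = 0\<close> is \<open>P(z)\<close>. Extrapolating from finitely many widths to \<open>0\<close> gives a combination of
  rescaled bumps that reproduces \<open>P\<close> exactly.\<close>

lemma reproducing_mollifier:
  "\<exists>\<phi> :: real^'n \<Rightarrow> real. \<phi> \<in> test_fun_in (cball 0 (1/2)) \<and>
    (\<forall>(P :: real^'n \<Rightarrow> ('y::banach \<Rightarrow>\<^sub>L real)) a r z y. P \<in> poly_upto k \<longrightarrow>
       pairing (\<lambda>x. P (a + r *\<^sub>R x)) (\<lambda>x. \<phi> (x - z) *\<^sub>R y) = blinfun_apply (P (a + r *\<^sub>R z)) y)"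
proof -
  let ?K = "nat (k + 1)" and ?I = "\<integral>x. bump (x::real^'n) \<partial>lebesgue"
  define s where "s = (\<lambda>j. node j / 2)"
  have s: "0 < s j" "s j \<le> 1/2" for j using node_bounds[of j] by (auto simp: s_def)
  have "inj_on s {..<?K}" by (auto simp: inj_on_def s_def node_def)
  \<comment> \<open>The right-hand side \<open>0 ^ m\<close> expresses extrapolation to width \<open>0\<close>.\<close>
  from vandermonde_weights[OF this, of "\<lambda>m. 0 ^ m"] obtain w
    where w: "\<forall>m<?K. (\<Sum>j<?K. w j * s j ^ m) = 0 ^ m" by blast
  define \<phi> where "\<phi> = (\<lambda>x::real^'n. \<Sum>j<?K. (w j / (?I * s j ^ CARD('n))) *\<^sub>R bump ((1 / s j) *\<^sub>R x + 0))"
  have "\<phi> \<in> test_fun_in (cball 0 (1/2))"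
    unfolding test_fun_in_iff[OF compact_cball]
  proof (intro conjI allI impI)
    show "smooth \<phi>" unfolding \<phi>_def by (intro smooth_sum smooth_scaleR smooth_affine smooth_bump)
    fix x :: "real^'n" assume "x \<notin> cball 0 (1/2)"
    then have "s j \<le> norm x" for j using s(2)[of j] by simp
    then have "bump ((1 / s j) *\<^sub>R x + 0) = 0" for j
      using s(1)[of j] by (intro bump_outside) (simp add: le_divide_eq)
    then show "\<phi> x = 0" by (simp add: \<phi>_def)
  qed
  moreover have "pairing (\<lambda>x. P (a + r *\<^sub>R x)) (\<lambda>x. \<phi> (x - z) *\<^sub>R y) = blinfun_apply (P (a + r *\<^sub>R z)) y"
    if P: "P \<in> poly_upto k" for P :: "real^'n \<Rightarrow> ('y \<Rightarrow>\<^sub>L real)" and a r z y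
  proof -
    have cP: "continuous_on UNIV P" by (rule smooth_imp_continuous_on[OF smooth_poly[OF P]])
    have cb: "continuous_on UNIV (bump :: real^'n \<Rightarrow> real)" by (rule smooth_imp_continuous_on[OF smooth_bump])
    define p where "p = (\<lambda>x. blinfun_apply (P (a + r *\<^sub>R x)) y)"
    have cp: "continuous_on UNIV p" unfolding p_def
      by (intro blinfun.continuous_on continuous_on_compose2[OF cP] continuous_intros) auto
    have cj: "continuous_on UNIV (\<lambda>x. bump ((1 / s j) *\<^sub>R (x - z)) * p x)" for j
      by (intro continuous_intros continuous_on_compose2[OF cb] continuous_on_compose2[OF cp]) auto
    have out: "bump ((1 / s j) *\<^sub>R (x - z)) * p x = 0" if "x \<notin> cball z 1" for x j
    proof -
      have "s j \<le> norm (x - z)" using that s(2)[of j] by (simp add: dist_norm norm_minus_commute)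
      then have "1 \<le> norm ((1 / s j) *\<^sub>R (x - z))" using s(1)[of j] by (simp add: le_divide_eq del: scaleR_right_diff_distrib)
      then show ?thesis by (simp add: bump_outside del: scaleR_right_diff_distrib)
    qed
    have ij: "integrable lebesgue (\<lambda>x. bump ((1 / s j) *\<^sub>R (x - z)) * p x)" for j
      by (rule integrable_compact_support[OF cj compact_cball out])
    have cj': "continuous_on UNIV (\<lambda>x. bump x * p (z + s j *\<^sub>R x))" for j
      by (intro continuous_intros continuous_on_compose2[OF cb] continuous_on_compose2[OF cp]) auto
    have ij': "integrable lebesgue (\<lambda>x. bump x * p (z + s j *\<^sub>R x))" for j
      by (rule integrable_compact_support[OF cj' compact_cball[of 0 1]]) (auto simp: bump_outside)
    have change: "(\<integral>x. bump ((1 / s j) *\<^sub>R (x - z)) * p x \<partial>lebesgue)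
        = s j ^ CARD('n) * (\<integral>x. bump x * p (z + s j *\<^sub>R x) \<partial>lebesgue)" for j
      using lebesgue_integral_affine[OF cj s(1), of j j z] s(1)[of j] by simp
    have I: "?I > 0" by (rule bump_integral_pos)
    have "pairing (\<lambda>x. P (a + r *\<^sub>R x)) (\<lambda>x. \<phi> (x - z) *\<^sub>R y)
        = (\<integral>x. (\<Sum>j<?K. (w j / (?I * s j ^ CARD('n))) * (bump ((1 / s j) *\<^sub>R (x - z)) * p x)) \<partial>lebesgue)"
      unfolding pairing_def \<phi>_def p_def
      by (simp add: blinfun.scaleR_right sum_distrib_right mult.assoc)
    also have "\<dots> = (\<Sum>j<?K. (w j / (?I * s j ^ CARD('n))) * (\<integral>x. bump ((1 / s j) *\<^sub>R (x - z)) * p x \<partial>lebesgue))"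
      by (subst Bochner_Integration.integral_sum) (auto intro!: ij simp del: scaleR_right_diff_distrib)
    also have "\<dots> = (\<Sum>j<?K. (w j / ?I) * (\<integral>x. bump x * p (z + s j *\<^sub>R x) \<partial>lebesgue))"
      unfolding change using s(1) by (intro sum.cong refl) (simp add: less_imp_neq[symmetric])
    also have "\<dots> = (\<integral>x. (\<Sum>j<?K. (w j / ?I) * (bump x * p (z + s j *\<^sub>R x))) \<partial>lebesgue)"
      by (subst Bochner_Integration.integral_sum) (auto intro!: ij')
    also have "\<dots> = (\<integral>x. (p z / ?I) * bump (x::real^'n) \<partial>lebesgue)"
    proof (rule Bochner_Integration.integral_cong[OF refl])
      fix x :: "real^'n"
      have "P (a + r *\<^sub>R z) = (\<Sum>j<?K. w j *\<^sub>R P ((a + r *\<^sub>R z) + s j *\<^sub>R (r *\<^sub>R x)))"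
        using poly_extrapolate[OF P w, of "a + r *\<^sub>R z" "r *\<^sub>R x"] by simp
      then have "p z = (\<Sum>j<?K. w j * p (z + s j *\<^sub>R x))"
        unfolding p_def
        by (simp add: blinfun.sum_left blinfun.scaleR_left algebra_simps)
      then show "(\<Sum>j<?K. (w j / ?I) * (bump x * p (z + s j *\<^sub>R x))) = (p z / ?I) * bump x"
        by (simp add: sum_divide_distrib sum_distrib_left mult_ac)
    qed
    also have "\<dots> = p z" using I by simp
    finally show ?thesis by (simp add: p_def)
  qed
  ultimately show ?thesis by blast
qed

section \<open>Comparison of nearby approximating polynomials\<close>

text \<open>The rescaled error of approximating the distribution \<open>S\<close> by \<open>P\<close>.\<close>

abbreviation defect ::
  "((real^'n \<Rightarrow> 'y::banach) \<Rightarrow> real) \<Rightarrow> (real^'n \<Rightarrow> ('y \<Rightarrow>\<^sub>L real)) \<Rightarrow> real^'n \<Rightarrow> real \<Rightarrow> (real^'n \<Rightarrow> 'y) \<Rightarrow> real" where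
  "defect S P \<equiv> rescale (\<lambda>\<eta>. S \<eta> - distr_of P \<eta>)"

definition close_at ::
  "((real^'n \<Rightarrow> 'y::banach) \<Rightarrow> real) \<Rightarrow> ((real^'n \<Rightarrow> 'y) \<Rightarrow> real) \<Rightarrow> real^'n \<Rightarrow> real \<Rightarrow> (real^'n \<Rightarrow> ('y \<Rightarrow>\<^sub>L real)) \<Rightarrow> real \<Rightarrow> bool" where
  "close_at \<nu> S a r P c \<longleftrightarrow> (\<forall>\<theta>\<in>test_fun_in (cball 0 1). \<nu> \<theta> \<le> 1 \<longrightarrow> defect S P a r \<theta> \<le> c)"

lemma continuous_poly: "P \<in> poly_upto k \<Longrightarrow> continuous_on A P"
  by (rule smooth_imp_continuous_on[OF smooth_poly])

lemma continuous_poly_affine: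
  assumes "P \<in> poly_upto k"
  shows "continuous_on A (\<lambda>x. P (a + r *\<^sub>R x))"
  by (rule continuous_on_compose2[OF continuous_poly[OF assms, of UNIV]]) (auto intro!: continuous_intros)

lemma continuous_test_fun: "\<theta> \<in> test_fun_in K \<Longrightarrow> continuous_on A \<theta>"
  by (rule smooth_imp_continuous_on[OF test_fun_inD(2)])

lemma pairing_scaleR: "pairing P (\<lambda>x. c *\<^sub>R \<theta> x) = c * pairing P \<theta>"
  by (simp add: pairing_def blinfun.scaleR_right)

lemma integrable_poly_pairing:
  assumes "P \<in> poly_upto k" "\<theta> \<in> test_fun_in (cball 0 1)"
  shows "integrable lebesgue (\<lambda>x. blinfun_apply (P (a + r *\<^sub>R x)) (\<theta> x))"
  by (rule integrable_pairing[OF continuous_poly_affine[OF assms(1)] continuous_test_fun[OF assms(2)] compact_cball[of 0 1]])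
    (use assms(2) in \<open>simp add: test_fun_in_iff\<close>)

lemma pairing_diff:
  assumes "P \<in> poly_upto k" "Q \<in> poly_upto k" "\<theta> \<in> test_fun_in (cball 0 1)"
  shows "pairing (\<lambda>x. P (a + r *\<^sub>R x) - Q (a + r *\<^sub>R x)) \<theta>
    = pairing (\<lambda>x. P (a + r *\<^sub>R x)) \<theta> - pairing (\<lambda>x. Q (a + r *\<^sub>R x)) \<theta>"
  unfolding pairing_def
  using Bochner_Integration.integral_diff[OF integrable_poly_pairing[OF assms(1,3), of a r] integrable_poly_pairing[OF assms(2,3), of a r]]
  by (simp add: blinfun.diff_left)

lemma defect_eq:
  assumes "P \<in> poly_upto k" "\<theta> \<in> test_fun_in (cball 0 1)" "r > 0"
  shows "defect S P a r \<theta> =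
    S (\<lambda>x. \<theta> ((1/r) *\<^sub>R (x - a))) / r ^ CARD('n) - pairing (\<lambda>x::real^'n. P (a + r *\<^sub>R x)) \<theta>"
  by (rule rescale_distr_of[OF continuous_poly[OF assms(1)] assms(2,3)])

lemma defect_scaleR:
  fixes P :: "real^'n \<Rightarrow> ('y::banach \<Rightarrow>\<^sub>L real)"
  assumes S: "S \<in> distributions" and P: "P \<in> poly_upto k" and \<theta>: "\<theta> \<in> test_fun_in (cball 0 1)" and r: "r > 0"
  shows "defect S P a r (\<lambda>x. c *\<^sub>R \<theta> x) = c * defect S P a r \<theta>"
  unfolding defect_eq[OF P test_fun_in_scaleR[OF compact_cball \<theta>] r] defect_eq[OF P \<theta> r]
    distributionsD(2)[OF S rescaled_test_fun'[OF \<theta> r]] pairing_scaleR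
  by (simp add: right_diff_distrib)

lemma defect_diff:
  fixes P :: "real^'n \<Rightarrow> ('y::banach \<Rightarrow>\<^sub>L real)"
  assumes "P \<in> poly_upto k" "Q \<in> poly_upto k" "\<theta> \<in> test_fun_in (cball 0 1)" "r > 0"
  shows "pairing (\<lambda>x. P (a + r *\<^sub>R x) - Q (a + r *\<^sub>R x)) \<theta> = defect S Q a r \<theta> - defect S P a r \<theta>"
  unfolding pairing_diff[OF assms(1-3)] defect_eq[OF assms(1,3,4)] defect_eq[OF assms(2-4)] by simp

lemma seminorm_hom:
  "cont_seminorm_on (cball 0 1) \<nu> \<Longrightarrow> \<theta> \<in> test_fun_in (cball 0 1) \<Longrightarrow> \<nu> (\<lambda>x. c *\<^sub>R \<theta> x) = \<bar>c\<bar> * \<nu> \<theta>"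
  by (simp add: cont_seminorm_on_def)

text \<open>A one-sided bound is two-sided, since \<open>-\<theta>\<close> is admissible whenever \<open>\<theta>\<close> is.\<close>

lemma close_at_abs:
  fixes P :: "real^'n \<Rightarrow> ('y::banach \<Rightarrow>\<^sub>L real)"
  assumes nu: "cont_seminorm_on (cball 0 1) \<nu>" and S: "S \<in> distributions" and P: "P \<in> poly_upto k"
    and r: "r > 0" and close: "close_at \<nu> S a r P c"
    and \<theta>: "\<theta> \<in> test_fun_in (cball 0 1)" and C: "\<nu> \<theta> \<le> C" "C > 0"
  shows "\<bar>defect S P a r \<theta>\<bar> \<le> c * C"
proof -
  have "d * defect S P a r \<theta> \<le> c" if "\<bar>d\<bar> = 1 / C" for d
  proof -
    have t: "(\<lambda>x. d *\<^sub>R \<theta> x) \<in> test_fun_in (cball 0 1)" by (rule test_fun_in_scaleR[OF compact_cball \<theta>])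
    have "\<nu> (\<lambda>x. d *\<^sub>R \<theta> x) \<le> 1" using C by (simp add: seminorm_hom[OF nu \<theta>] that)
    then have "defect S P a r (\<lambda>x. d *\<^sub>R \<theta> x) \<le> c" using close t unfolding close_at_def by blast
    then show ?thesis by (simp only: defect_scaleR[OF S P \<theta> r])
  qed
  from this[of "1/C"] this[of "-1/C"] show ?thesis using C(2) by (simp add: abs_le_iff field_simps)
qed

lemma close_at_nonneg:
  fixes P :: "real^'n \<Rightarrow> ('y::banach \<Rightarrow>\<^sub>L real)"
  assumes nu: "cont_seminorm_on (cball 0 1) \<nu>" and S: "S \<in> distributions" and P: "P \<in> poly_upto k"
    and r: "r > 0" and close: "close_at \<nu> S a r P c"
  shows "c \<ge> 0"
proof -
  have z: "(\<lambda>x::real^'n. 0::'y) \<in> test_fun_in (cball 0 1)" by (rule test_fun_in_zero[OF compact_cball])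
  have "\<nu> (\<lambda>x. 0) = 0" using seminorm_hom[OF nu z, of 0] by simp
  then have "\<bar>defect S P a r (\<lambda>x. 0)\<bar> \<le> c * 1"
    by (intro close_at_abs[OF nu S P r close z]) auto
  then show ?thesis by linarith
qed

lemma blinfun_norm_le_unit:
  fixes L :: "'y::real_normed_vector \<Rightarrow>\<^sub>L real"
  assumes "\<And>y. norm y \<le> 1 \<Longrightarrow> \<bar>blinfun_apply L y\<bar> \<le> M"
  shows "norm L \<le> M"
proof (rule norm_blinfun_bound)
  show "M \<ge> 0" using assms[of 0] by simp
  fix y
  show "norm (blinfun_apply L y) \<le> M * norm y"
  proof (cases "y = 0")
    case False
    have "\<bar>blinfun_apply L (y /\<^sub>R norm y)\<bar> \<le> M" by (rule assms) (simp add: False)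
    then show ?thesis using False by (simp add: blinfun.scaleR_right abs_mult divide_simps mult.commute)
  qed (simp add: blinfun.zero_right)
qed

lemma dderiv_scaled_vector:
  fixes \<phi> :: "real^'n \<Rightarrow> real" and y :: "'y::banach"
  assumes "smooth \<phi>"
  shows "dderiv vs (\<lambda>x. \<phi> (s *\<^sub>R x + c) *\<^sub>R y) x = (s ^ length vs * dderiv vs \<phi> (s *\<^sub>R x + c)) *\<^sub>R y"
proof -
  have "dderiv vs (\<lambda>x. \<phi> (s *\<^sub>R x + c) *\<^sub>R y) = (\<lambda>x. dderiv vs (\<lambda>x. \<phi> (s *\<^sub>R x + c)) x *\<^sub>R y)"
    by (rule dderiv_bounded_linear[OF smooth_affine[OF assms] bounded_linear_scaleR_left])
  then show ?thesis by (simp add: dderiv_affine[OF assms])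
qed

lemma smooth_scaled_vector: "smooth \<phi> \<Longrightarrow> smooth (\<lambda>x. \<phi> (s *\<^sub>R x + c) *\<^sub>R y)"
  by (rule smooth_bounded_linear[OF smooth_affine bounded_linear_scaleR_left])

text \<open>A continuous seminorm is dominated by finitely many derivatives, and contraction by at most the factor \<open>2\<close>
  multiplies a derivative of order \<open>m\<close> by at most \<open>2\<^sup>m\<close>, uniformly in the translation.\<close>

lemma seminorm_bounded_on_rescalings:
  fixes \<nu> :: "(real^'n \<Rightarrow> 'y::banach) \<Rightarrow> real" and \<phi> :: "real^'n \<Rightarrow> real"
  assumes nu: "cont_seminorm_on (cball 0 1) \<nu>" and \<phi>: "\<phi> \<in> test_fun_in (cball 0 \<rho>)"
  shows "\<exists>C>0. \<forall>s c y. \<bar>s\<bar> \<le> 2 \<longrightarrow> norm y \<le> 1 \<longrightarrow> (\<lambda>x. \<phi> (s *\<^sub>R x + c) *\<^sub>R y) \<in> test_fun_in (cball 0 1) \<longrightarrow>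
     \<nu> (\<lambda>x. \<phi> (s *\<^sub>R x + c) *\<^sub>R y) \<le> C"
proof -
  have ne: "cball (0::real^'n) 1 \<noteq> {}" by simp
  have sm: "smooth \<phi>" using \<phi> test_fun_inD by blast
  obtain N C where C: "C > 0"
    "\<And>\<theta> B. \<theta> \<in> test_fun_in (cball 0 1) \<Longrightarrow> B \<ge> 0 \<Longrightarrow>
       (\<And>vs x. x \<in> cball 0 1 \<Longrightarrow> length vs \<le> N \<Longrightarrow> \<forall>v\<in>set vs. norm v \<le> 1 \<Longrightarrow> norm (dderiv vs \<theta> x) \<le> B) \<Longrightarrow>
       \<bar>\<nu> \<theta>\<bar> \<le> C * B"
  proof (rule continuous_functional_bounded[OF compact_cball ne])
    show "continuous_map (test_fun_top (cball 0 1)) euclideanreal \<nu>" using nu by (simp add: cont_seminorm_on_def)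
    show "\<bar>\<nu> (\<lambda>x. c *\<^sub>R \<theta> x)\<bar> = c * \<bar>\<nu> \<theta>\<bar>" if "\<theta> \<in> test_fun_in (cball 0 1)" "c \<ge> 0" for c \<theta>
      using that by (simp add: seminorm_hom[OF nu] abs_mult)
  qed (use that in metis)
  have "\<forall>m. \<exists>B>0. \<forall>vs x. length vs = m \<longrightarrow> (\<forall>v\<in>set vs. norm v \<le> 1) \<longrightarrow> norm (dderiv vs \<phi> x) \<le> B"
  proof
    fix m
    show "\<exists>B>0. \<forall>vs x. length vs = m \<longrightarrow> (\<forall>v\<in>set vs. norm v \<le> 1) \<longrightarrow> norm (dderiv vs \<phi> x) \<le> B"
      using dderiv_bounded[OF \<phi> compact_cball, of m] by metis
  qed
  from choice[OF this] obtain B where B: "\<And>m. B m > 0"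
    "\<And>m vs x. length vs = m \<Longrightarrow> \<forall>v\<in>set vs. norm v \<le> 1 \<Longrightarrow> norm (dderiv vs \<phi> x) \<le> B m"
    by blast
  define M where "M = 2 ^ N * (\<Sum>m\<le>N. B m)"
  have M0: "M \<ge> 0" unfolding M_def using B(1) by (intro mult_nonneg_nonneg sum_nonneg) (auto intro: less_imp_le)
  have "\<nu> (\<lambda>x. \<phi> (s *\<^sub>R x + c) *\<^sub>R y) \<le> C * M + 1"
    if s: "\<bar>s\<bar> \<le> 2" and y: "norm y \<le> 1" and t: "(\<lambda>x. \<phi> (s *\<^sub>R x + c) *\<^sub>R y) \<in> test_fun_in (cball 0 1)" for s c y
  proof -
    have "\<bar>\<nu> (\<lambda>x. \<phi> (s *\<^sub>R x + c) *\<^sub>R y)\<bar> \<le> C * M"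
    proof (rule C(2)[OF t M0])
      fix vs :: "(real^'n) list" and x :: "real^'n"
      assume vs: "length vs \<le> N" "\<forall>v\<in>set vs. norm v \<le> 1"
      have "\<bar>s\<bar> ^ length vs \<le> 2 ^ length vs" using s by (intro power_mono) auto
      also have "(2::real) ^ length vs \<le> 2 ^ N" using vs by (intro power_increasing) auto
      finally have 1: "\<bar>s\<bar> ^ length vs \<le> 2 ^ N" .
      have "norm (dderiv vs \<phi> (s *\<^sub>R x + c)) \<le> B (length vs)" using B(2) vs by blast
      also have "\<dots> \<le> (\<Sum>m\<le>N. B m)"
        by (rule member_le_sum) (use vs B(1) in \<open>auto intro: less_imp_le\<close>)
      finally have 2: "\<bar>dderiv vs \<phi> (s *\<^sub>R x + c)\<bar> \<le> (\<Sum>m\<le>N. B m)" by simp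
      have 3: "\<bar>s\<bar> ^ length vs * \<bar>dderiv vs \<phi> (s *\<^sub>R x + c)\<bar> \<le> M"
        unfolding M_def by (rule mult_mono[OF 1 2]) auto
      have "norm (dderiv vs (\<lambda>x. \<phi> (s *\<^sub>R x + c) *\<^sub>R y) x)
          = (\<bar>s\<bar> ^ length vs * \<bar>dderiv vs \<phi> (s *\<^sub>R x + c)\<bar>) * norm y"
        by (simp add: dderiv_scaled_vector[OF sm] abs_mult power_abs)
      also have "\<dots> \<le> M * 1" by (rule mult_mono[OF 3 y M0]) auto
      finally show "norm (dderiv vs (\<lambda>x. \<phi> (s *\<^sub>R x + c) *\<^sub>R y) x) \<le> M" by simp
    qed
    then show ?thesis by linarith
  qed
  moreover have "C * M + 1 > 0" using C(1) M0 by (intro add_nonneg_pos) auto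
  ultimately show ?thesis by blast
qed

text \<open>The value of \<open>P - Q\<close> at \<open>a + r x\<close> is obtained by testing \<open>(S - Q) - (S - P)\<close> against the reproducing
  mollifier centred there. Seen from \<open>a\<close> at scale \<open>r\<close> and from \<open>b\<close> at scale \<open>2 r\<close>, the mollifier is an
  admissible test function up to a constant factor: its support lies in the ball of radius \<open>r\<close> about \<open>a\<close>,
  which is contained in the ball of radius \<open>2 r\<close> about \<open>b\<close>.\<close>

lemma approximations_close:
  fixes \<nu> :: "(real^'n \<Rightarrow> 'y::banach) \<Rightarrow> real"
  assumes nu: "cont_seminorm_on (cball 0 1) \<nu>"
  shows "\<exists>C>0. \<forall>S a b r P Q c1 c2 x. S \<in> distributions \<longrightarrow> P \<in> poly_upto k \<longrightarrow> Q \<in> poly_upto k \<longrightarrow> 0 < r \<longrightarrow>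
    norm (a - b) \<le> r \<longrightarrow> close_at \<nu> S a r P c1 \<longrightarrow> close_at \<nu> S b (2 * r) Q c2 \<longrightarrow> norm x \<le> 1/2 \<longrightarrow>
    norm (P (a + r *\<^sub>R x) - Q (a + r *\<^sub>R x)) \<le> C * (c1 + c2)"
proof -
  obtain \<phi> :: "real^'n \<Rightarrow> real" where \<phi>: "\<phi> \<in> test_fun_in (cball 0 (1/2))"
    and rep: "\<forall>(P :: real^'n \<Rightarrow> ('y \<Rightarrow>\<^sub>L real)) a r z y. P \<in> poly_upto k \<longrightarrow>
       pairing (\<lambda>x. P (a + r *\<^sub>R x)) (\<lambda>x. \<phi> (x - z) *\<^sub>R y) = blinfun_apply (P (a + r *\<^sub>R z)) y"
    using reproducing_mollifier[of k] by (elim exE conjE) (rule that)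
  have sm: "smooth \<phi>" using \<phi> test_fun_inD by blast
  obtain C where C0: "C > 0" and C: "\<forall>s c (y::'y). \<bar>s\<bar> \<le> 2 \<longrightarrow> norm y \<le> 1 \<longrightarrow>
     (\<lambda>x. \<phi> (s *\<^sub>R x + c) *\<^sub>R y) \<in> test_fun_in (cball 0 1) \<longrightarrow> \<nu> (\<lambda>x. \<phi> (s *\<^sub>R x + c) *\<^sub>R y) \<le> C"
    using seminorm_bounded_on_rescalings[OF nu \<phi>] by (elim exE conjE) (rule that)
  let ?n = "CARD('n)"
  have supp: "(\<lambda>x. \<phi> (s *\<^sub>R x + c) *\<^sub>R y) \<in> test_fun_in (cball 0 1)"
    if "\<And>x. norm x > 1 \<Longrightarrow> norm (s *\<^sub>R x + c) > 1/2" for s c and y :: 'y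
    unfolding test_fun_in_iff[OF compact_cball]
  proof (intro conjI allI impI smooth_scaled_vector sm)
    fix x :: "real^'n" assume "x \<notin> cball 0 1"
    then have "s *\<^sub>R x + c \<notin> cball 0 (1/2)" using that[of x] by simp
    then have "\<phi> (s *\<^sub>R x + c) = 0" using \<phi> by (simp add: test_fun_in_iff)
    then show "\<phi> (s *\<^sub>R x + c) *\<^sub>R y = 0" by simp
  qed
  have "norm (P (a + r *\<^sub>R x) - Q (a + r *\<^sub>R x)) \<le> (2 ^ ?n * C) * (c1 + c2)"
    if S: "S \<in> distributions" and P: "P \<in> poly_upto k" and Q: "Q \<in> poly_upto k" and r: "0 < r"
    and ab: "norm (a - b) \<le> r" and c1: "close_at \<nu> S a r P c1" and c2: "close_at \<nu> S b (2 * r) Q c2"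
    and x: "norm x \<le> 1/2" for S a b r P Q c1 c2 x
  proof (rule blinfun_norm_le_unit)
    fix y :: 'y assume y: "norm y \<le> 1"
    define \<theta> where "\<theta> = (\<lambda>z. \<phi> (z - x) *\<^sub>R y)"
    \<comment> \<open>\<open>\<theta>\<close> is the mollifier in the coordinates of \<open>(a, r)\<close>, and \<open>\<eta>\<close> the same function in those of \<open>(b, 2 r)\<close>.\<close>
    define u where "u = (1/r) *\<^sub>R (b - a)"
    define \<eta> where "\<eta> = (\<lambda>z. \<phi> (2 *\<^sub>R z + (u - x)) *\<^sub>R y)"
    have u: "norm u \<le> 1" using ab r by (simp add: u_def norm_minus_commute)
    have \<theta>': "\<theta> = (\<lambda>z. \<phi> (1 *\<^sub>R z + (- x)) *\<^sub>R y)" by (simp add: \<theta>_def)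
    have \<theta>: "\<theta> \<in> test_fun_in (cball 0 1)" unfolding \<theta>'
    proof (rule supp)
      fix z :: "real^'n" assume "norm z > 1"
      then show "norm (1 *\<^sub>R z + - x) > 1/2" using norm_triangle_ineq2[of z x] x by simp
    qed
    have \<eta>: "\<eta> \<in> test_fun_in (cball 0 1)" unfolding \<eta>_def
    proof (rule supp)
      fix z :: "real^'n" assume "norm z > 1"
      then have "norm (2 *\<^sub>R z) > 2" by simp
      moreover have "norm (2 *\<^sub>R z + (u - x)) \<ge> norm (2 *\<^sub>R z) - norm (u - x)" by (rule norm_diff_ineq)
      moreover have "norm (u - x) \<le> 1 + 1/2" using norm_triangle_ineq4[of u x] u x by linarith
      ultimately show "norm (2 *\<^sub>R z + (u - x)) > 1/2" by linarith
    qed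
    have n\<theta>: "\<nu> \<theta> \<le> C" using C[rule_format, of 1 y "- x"] \<theta> y unfolding \<theta>' by simp
    have n\<eta>: "\<nu> \<eta> \<le> C" using C[rule_format, of 2 y "u - x"] \<eta> y unfolding \<eta>_def by simp
    have r2: "2 * r > 0" using r by simp
    have 1: "\<bar>defect S P a r \<theta>\<bar> \<le> c1 * C" by (rule close_at_abs[OF nu S P r c1 \<theta> n\<theta> C0])
    have 2: "\<bar>defect S Q b (2 * r) \<eta>\<bar> \<le> c2 * C" by (rule close_at_abs[OF nu S Q r2 c2 \<eta> n\<eta> C0])
    have "(\<lambda>z. \<eta> ((1/(2*r)) *\<^sub>R (z - b))) = (\<lambda>z. \<theta> ((1/r) *\<^sub>R (z - a)))"
    proof
      fix z
      have "2 *\<^sub>R ((1/(2*r)) *\<^sub>R (z - b)) + (u - x) = (1/r) *\<^sub>R (z - a) - x"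
        using r by (simp add: u_def algebra_simps)
      then show "\<eta> ((1/(2*r)) *\<^sub>R (z - b)) = \<theta> ((1/r) *\<^sub>R (z - a))" by (simp only: \<eta>_def \<theta>_def)
    qed
    then have shift: "defect S Q a r \<theta> = 2 ^ ?n * defect S Q b (2 * r) \<eta>"
      using r by (simp add: rescale_def power_mult_distrib)
    have c: "c1 \<ge> 0" "c2 \<ge> 0" using close_at_nonneg[OF nu S P r c1] close_at_nonneg[OF nu S Q r2 c2] by auto
    have "blinfun_apply (P (a + r *\<^sub>R x) - Q (a + r *\<^sub>R x)) y
        = pairing (\<lambda>x. P (a + r *\<^sub>R x)) \<theta> - pairing (\<lambda>x. Q (a + r *\<^sub>R x)) \<theta>"
      using rep[rule_format, OF P, of a r x y] rep[rule_format, OF Q, of a r x y]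
      by (simp add: \<theta>_def blinfun.diff_left)
    also have "\<dots> = defect S Q a r \<theta> - defect S P a r \<theta>"
      using defect_diff[OF P Q \<theta> r] pairing_diff[OF P Q \<theta>] by simp
    finally have eq: "blinfun_apply (P (a + r *\<^sub>R x) - Q (a + r *\<^sub>R x)) y
        = 2 ^ ?n * defect S Q b (2 * r) \<eta> - defect S P a r \<theta>" unfolding shift .
    have 3: "\<bar>2 ^ ?n * defect S Q b (2 * r) \<eta>\<bar> \<le> 2 ^ ?n * (c2 * C)"
      unfolding abs_mult using mult_left_mono[OF 2, of "2 ^ ?n"] by simp
    have "\<bar>blinfun_apply (P (a + r *\<^sub>R x) - Q (a + r *\<^sub>R x)) y\<bar> \<le> 2 ^ ?n * (c2 * C) + c1 * C"
      unfolding eq using 1 3 by linarith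
    also have "\<dots> \<le> 2 ^ ?n * (c2 * C) + 2 ^ ?n * (c1 * C)"
    proof -
      have "1 * (c1 * C) \<le> 2 ^ ?n * (c1 * C)" using c C0 by (intro mult_right_mono) auto
      then show ?thesis by simp
    qed
    finally show "\<bar>blinfun_apply (P (a + r *\<^sub>R x) - Q (a + r *\<^sub>R x)) y\<bar> \<le> (2 ^ ?n * C) * (c1 + c2)"
      by (simp add: algebra_simps)
  qed
  moreover have "2 ^ ?n * C > 0" using C0 by simp
  ultimately show ?thesis by blast
qed

text \<open>For points \<open>a\<^sub>1\<close>, \<open>a\<^sub>2\<close> within \<open>\<rho>\<close> of \<open>a\<close>, the ball of radius \<open>\<rho>\<close> about \<open>a\<close> lies in the ball of half the
  radius \<open>4 \<rho>\<close> about \<open>a\<^sub>1\<close>, where \<open>approximations_close\<close> applies. Extrapolation from radius \<open>\<rho>\<close> to \<open>R\<close>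
  gives the factor \<open>(R/\<rho>)\<^sup>k\<close>.\<close>

lemma approximations_close_at_larger_scales:
  fixes \<nu> :: "(real^'n \<Rightarrow> 'y::banach) \<Rightarrow> real"
  assumes nu: "cont_seminorm_on (cball 0 1) \<nu>"
  shows "\<exists>C>0. \<forall>S a a1 a2 \<rho> P1 P2 e1 e2 R x. S \<in> distributions \<longrightarrow> P1 \<in> poly_upto k \<longrightarrow> P2 \<in> poly_upto k \<longrightarrow>
    0 < \<rho> \<longrightarrow> norm (a1 - a) \<le> \<rho> \<longrightarrow> norm (a2 - a) \<le> \<rho> \<longrightarrow>
    close_at \<nu> S a1 (4 * \<rho>) P1 (e1 * (4 * \<rho>) powr s) \<longrightarrow> close_at \<nu> S a2 (8 * \<rho>) P2 (e2 * (8 * \<rho>) powr s) \<longrightarrow>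
    \<rho> \<le> R \<longrightarrow> norm x \<le> 1 \<longrightarrow>
    norm (P1 (a + R *\<^sub>R x) - P2 (a + R *\<^sub>R x)) \<le> C * (e1 + e2) * \<rho> powr s * (R / \<rho>) ^ nat k"
proof -
  obtain C where C0: "C > 0" and C: "\<forall>S a b r P Q c1 c2 x. S \<in> distributions \<longrightarrow> P \<in> poly_upto k \<longrightarrow> Q \<in> poly_upto k \<longrightarrow> 0 < r \<longrightarrow>
    norm (a - b) \<le> r \<longrightarrow> close_at \<nu> S a r P c1 \<longrightarrow> close_at \<nu> S b (2 * r) Q c2 \<longrightarrow> norm x \<le> 1/2 \<longrightarrow>
    norm (P (a + r *\<^sub>R x) - Q (a + r *\<^sub>R x)) \<le> C * (c1 + c2)"
    using approximations_close[OF nu, of k] by (elim exE conjE) (rule that)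
  obtain W where W: "W > 0"
    "\<forall>(P :: real^'n \<Rightarrow> ('y \<Rightarrow>\<^sub>L real)) a \<rho> R M x. P \<in> poly_upto k \<longrightarrow> 0 < \<rho> \<longrightarrow> \<rho> \<le> R \<longrightarrow>
       (\<forall>x. norm x \<le> 1 \<longrightarrow> norm (P (a + \<rho> *\<^sub>R x)) \<le> M) \<longrightarrow> norm x \<le> 1 \<longrightarrow>
       norm (P (a + R *\<^sub>R x)) \<le> W * (R / \<rho>) ^ nat k * M"
    using poly_bound_extrapolate[of k] by (elim exE conjE) (rule that)
  define E where "E = 4 powr s + 8 powr s"
  have E: "E > 0" by (simp add: E_def add_pos_pos)
  have "norm (P1 (a + R *\<^sub>R x) - P2 (a + R *\<^sub>R x)) \<le> (W * C * E) * (e1 + e2) * \<rho> powr s * (R / \<rho>) ^ nat k"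
    if S: "S \<in> distributions" and P: "P1 \<in> poly_upto k" "P2 \<in> poly_upto k" and \<rho>: "0 < \<rho>"
      and a: "norm (a1 - a) \<le> \<rho>" "norm (a2 - a) \<le> \<rho>"
      and c1: "close_at \<nu> S a1 (4 * \<rho>) P1 (e1 * (4 * \<rho>) powr s)"
      and c2: "close_at \<nu> S a2 (8 * \<rho>) P2 (e2 * (8 * \<rho>) powr s)"
      and R: "\<rho> \<le> R" and x: "norm x \<le> 1" for S a a1 a2 \<rho> P1 P2 e1 e2 R x
  proof -
    have 4: "4 * \<rho> > 0" "8 * \<rho> > 0" using \<rho> by auto
    have e1: "e1 \<ge> 0" using close_at_nonneg[OF nu S P(1) 4(1) c1] \<rho> by (simp add: zero_le_mult_iff)
    have e2: "e2 \<ge> 0" using close_at_nonneg[OF nu S P(2) 4(2) c2] \<rho> by (simp add: zero_le_mult_iff)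
    have c2': "close_at \<nu> S a2 (2 * (4 * \<rho>)) P2 (e2 * (8 * \<rho>) powr s)" using c2 by simp
    have "norm (a1 - a2) \<le> norm (a1 - a) + norm (a2 - a)"
      using norm_triangle_ineq4[of "a1 - a" "a2 - a"] by simp
    then have a12: "norm (a1 - a2) \<le> 4 * \<rho>" using a \<rho> by linarith
    have M: "\<forall>z. norm z \<le> 1 \<longrightarrow> norm (P1 (a + \<rho> *\<^sub>R z) - P2 (a + \<rho> *\<^sub>R z)) \<le> C * E * (e1 + e2) * \<rho> powr s"
    proof (intro allI impI)
      fix z :: "real^'n" assume z: "norm z \<le> 1"
      define w where "w = (1 / (4 * \<rho>)) *\<^sub>R (a - a1 + \<rho> *\<^sub>R z)"
      have "norm (a - a1 + \<rho> *\<^sub>R z) \<le> norm (a - a1) + norm (\<rho> *\<^sub>R z)" by (rule norm_triangle_ineq)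
      also have "\<dots> \<le> \<rho> + \<rho>" using a z \<rho> by (intro add_mono) (auto simp: norm_minus_commute)
      finally have "norm w \<le> 1/2" using \<rho> by (simp add: w_def divide_le_eq)
      from C[rule_format, OF S P 4(1) a12 c1 c2' this]
      have "norm (P1 (a1 + (4 * \<rho>) *\<^sub>R w) - P2 (a1 + (4 * \<rho>) *\<^sub>R w)) \<le> C * (e1 * (4 * \<rho>) powr s + e2 * (8 * \<rho>) powr s)" .
      also have "a1 + (4 * \<rho>) *\<^sub>R w = a + \<rho> *\<^sub>R z" using \<rho> by (simp add: w_def)
      also have "e1 * (4 * \<rho>) powr s + e2 * (8 * \<rho>) powr s = (e1 * 4 powr s + e2 * 8 powr s) * \<rho> powr s"
        using \<rho> by (simp add: powr_mult algebra_simps)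
      also have "\<dots> \<le> (E * (e1 + e2)) * \<rho> powr s"
      proof (rule mult_right_mono)
        have "e1 * 4 powr s + e2 * 8 powr s \<le> e1 * E + e2 * E"
          using e1 e2 by (intro add_mono mult_left_mono) (auto simp: E_def)
        then show "e1 * 4 powr s + e2 * 8 powr s \<le> E * (e1 + e2)" by (simp add: algebra_simps)
      qed simp
      finally show "norm (P1 (a + \<rho> *\<^sub>R z) - P2 (a + \<rho> *\<^sub>R z)) \<le> C * E * (e1 + e2) * \<rho> powr s"
        using C0 by (simp add: mult.assoc mult_left_mono)
    qed
    have "norm (P1 (a + R *\<^sub>R x) - P2 (a + R *\<^sub>R x)) \<le> W * (R / \<rho>) ^ nat k * (C * E * (e1 + e2) * \<rho> powr s)"
      using W(2)[rule_format, OF poly_diff[OF P] \<rho> R M[rule_format] x] by simp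
    then show ?thesis by (simp add: mult_ac)
  qed
  moreover have "W * C * E > 0" using W C0 E by simp
  ultimately show ?thesis by blast
qed

text \<open>The norm refers to the unit ball about \<open>0\<close>, which the ball of radius \<open>\<rho> + 1 + \<parallel>a\<parallel>\<close> about \<open>a\<close> contains.\<close>

lemma approximations_poly_norm_close:
  fixes \<nu> :: "(real^'n \<Rightarrow> 'y::banach) \<Rightarrow> real"
  assumes nu: "cont_seminorm_on (cball 0 1) \<nu>"
  shows "\<exists>C>0. \<forall>S a a1 a2 \<rho> P1 P2 e1 e2. S \<in> distributions \<longrightarrow> P1 \<in> poly_upto k \<longrightarrow> P2 \<in> poly_upto k \<longrightarrow>
    0 < \<rho> \<longrightarrow> norm (a1 - a) \<le> \<rho> \<longrightarrow> norm (a2 - a) \<le> \<rho> \<longrightarrow>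
    close_at \<nu> S a1 (4 * \<rho>) P1 (e1 * (4 * \<rho>) powr s) \<longrightarrow> close_at \<nu> S a2 (8 * \<rho>) P2 (e2 * (8 * \<rho>) powr s) \<longrightarrow>
    poly_norm k (\<lambda>x. P1 x - P2 x) \<le> C * (e1 + e2) * \<rho> powr s * ((\<rho> + 1 + norm a) / \<rho>) ^ nat k"
proof -
  obtain C where C0: "C > 0" and C: "\<forall>S a a1 a2 \<rho> P1 P2 e1 e2 R x. S \<in> distributions \<longrightarrow> P1 \<in> poly_upto k \<longrightarrow> P2 \<in> poly_upto k \<longrightarrow>
    0 < \<rho> \<longrightarrow> norm (a1 - a) \<le> \<rho> \<longrightarrow> norm (a2 - a) \<le> \<rho> \<longrightarrow>
    close_at \<nu> S a1 (4 * \<rho>) P1 (e1 * (4 * \<rho>) powr s) \<longrightarrow> close_at \<nu> S a2 (8 * \<rho>) P2 (e2 * (8 * \<rho>) powr s) \<longrightarrow>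
    \<rho> \<le> R \<longrightarrow> norm x \<le> 1 \<longrightarrow>
    norm (P1 (a + R *\<^sub>R x) - P2 (a + R *\<^sub>R x)) \<le> C * (e1 + e2) * \<rho> powr s * (R / \<rho>) ^ nat k"
    using approximations_close_at_larger_scales[OF nu, of k s] by (elim exE conjE) (rule that)
  obtain D where D: "D > 0" "\<forall>(P :: real^'n \<Rightarrow> ('y \<Rightarrow>\<^sub>L real)) M. P \<in> poly_upto k \<longrightarrow>
       (\<forall>x. norm x \<le> 1 \<longrightarrow> norm (P x) \<le> M) \<longrightarrow> poly_norm k P \<le> D * M"
    using poly_norm_le[of k] by (elim exE conjE) (rule that)
  have "poly_norm k (\<lambda>x. P1 x - P2 x) \<le> (D * C) * (e1 + e2) * \<rho> powr s * ((\<rho> + 1 + norm a) / \<rho>) ^ nat k"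
    if S: "S \<in> distributions" and P: "P1 \<in> poly_upto k" "P2 \<in> poly_upto k" and \<rho>: "0 < \<rho>"
      and a: "norm (a1 - a) \<le> \<rho>" "norm (a2 - a) \<le> \<rho>"
      and c1: "close_at \<nu> S a1 (4 * \<rho>) P1 (e1 * (4 * \<rho>) powr s)"
      and c2: "close_at \<nu> S a2 (8 * \<rho>) P2 (e2 * (8 * \<rho>) powr s)" for S a a1 a2 \<rho> P1 P2 e1 e2
  proof -
    let ?R = "\<rho> + 1 + norm a"
    have R: "?R > 0" "\<rho> \<le> ?R" using \<rho> by (auto simp: add_pos_nonneg)
    have "norm (P1 z - P2 z) \<le> C * (e1 + e2) * \<rho> powr s * (?R / \<rho>) ^ nat k" if z: "norm z \<le> 1" for z
    proof -
      define w where "w = (1 / ?R) *\<^sub>R (z - a)"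
      have "norm (z - a) \<le> ?R" using norm_triangle_ineq4[of z a] z \<rho> by linarith
      then have "norm w \<le> 1" using R by (simp add: w_def divide_le_eq)
      from C[rule_format, OF S P \<rho> a c1 c2 R(2) this] show ?thesis using R by (simp add: w_def)
    qed
    then have "poly_norm k (\<lambda>x. P1 x - P2 x) \<le> D * (C * (e1 + e2) * \<rho> powr s * (?R / \<rho>) ^ nat k)"
      by (intro D(2)[rule_format, OF poly_diff[OF P]])
    then show ?thesis by (simp only: mult.assoc)
  qed
  moreover have "D * C > 0" using C0 D by simp
  ultimately show ?thesis by blast
qed

section \<open>Convergence of polynomial functions and of defects\<close>

lemma poly_zero: "(\<lambda>x. 0) \<in> poly_upto k"
  by (rule poly_uptoI[of "\<lambda>m. \<lambda>vs\<in>{vs. length vs = m}. 0"])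
    (auto intro!: sym_mlin_restrictI linear_zero)

lemma poly_lipschitz:
  "\<exists>L>0. \<forall>(P :: real^'n \<Rightarrow> ('y::banach \<Rightarrow>\<^sub>L real)) x z. P \<in> poly_upto k \<longrightarrow> norm x \<le> R \<longrightarrow> norm z \<le> R \<longrightarrow>
     norm (P x - P z) \<le> L * poly_norm k P * norm (x - z) \<and> norm (P x) \<le> L * poly_norm k P"
proof -
  obtain C where C: "C > 0" "\<forall>(P :: real^'n \<Rightarrow> ('y \<Rightarrow>\<^sub>L real)) us x M. P \<in> poly_upto k \<longrightarrow>
       (\<forall>x. norm x \<le> 1 \<longrightarrow> norm (P x) \<le> M) \<longrightarrow> length us = 1 \<longrightarrow> (\<forall>u\<in>set us. norm u \<le> 1) \<longrightarrow>
       norm x \<le> R \<longrightarrow> norm (dderiv us P x) \<le> C * M"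
    using poly_deriv_bound[of k 1 R] by (elim exE conjE) (rule that)
  obtain D where D: "D > 0" "\<forall>(P :: real^'n \<Rightarrow> ('y \<Rightarrow>\<^sub>L real)) us x M. P \<in> poly_upto k \<longrightarrow>
       (\<forall>x. norm x \<le> 1 \<longrightarrow> norm (P x) \<le> M) \<longrightarrow> length us = 0 \<longrightarrow> (\<forall>u\<in>set us. norm u \<le> 1) \<longrightarrow>
       norm x \<le> R \<longrightarrow> norm (dderiv us P x) \<le> D * M"
    using poly_deriv_bound[of k 0 R] by (elim exE conjE) (rule that)
  have "norm (P x - P z) \<le> (C + D) * poly_norm k P * norm (x - z) \<and> norm (P x) \<le> (C + D) * poly_norm k P"
    if P: "P \<in> poly_upto k" and x: "norm x \<le> R" "norm z \<le> R" for P :: "real^'n \<Rightarrow> ('y \<Rightarrow>\<^sub>L real)" and x z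
  proof
    have M: "norm (P x) \<le> poly_norm k P" if "norm x \<le> 1" for x by (rule poly_le_poly_norm[OF P that])
    have p0: "poly_norm k P \<ge> 0" by (rule poly_norm_nonneg[OF P])
    have "norm (P x - P z) \<le> (C * poly_norm k P) * norm (x - z)"
    proof (rule differentiable_bound[of "cball 0 R" P "\<lambda>x v. dderiv [v] P x"])
      fix u assume "u \<in> cball (0::real^'n) R"
      then have u: "norm u \<le> R" by simp
      show "(P has_derivative (\<lambda>v. dderiv [v] P u)) (at u within cball 0 R)"
        by (rule has_derivative_at_withinI)
          (rule has_derivative_dderiv[OF smooth_poly[OF P], of "[]" u, unfolded dderiv.simps(1)])
      have lin: "linear (\<lambda>v. dderiv [v] P u)" using linear_dderiv_Cons[OF smooth_poly[OF P], of "[]" u] .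
      show "onorm (\<lambda>v. dderiv [v] P u) \<le> C * poly_norm k P"
      proof (rule onorm_le)
        fix v :: "real^'n"
        show "norm (dderiv [v] P u) \<le> C * poly_norm k P * norm v"
        proof (cases "v = 0")
          case True
          then show ?thesis using linear_0[OF lin] by simp
        next
          case False
          have eq: "dderiv [v] P u = norm v *\<^sub>R dderiv [v /\<^sub>R norm v] P u"
            using linear_cmul[OF lin, of "norm v" "v /\<^sub>R norm v"] False by (simp del: dderiv.simps)
          have "norm (dderiv [v /\<^sub>R norm v] P u) \<le> C * poly_norm k P"
            by (rule C(2)[rule_format, OF P M _ _ u]) (auto simp: False)
          then have "norm v * norm (dderiv [v /\<^sub>R norm v] P u) \<le> norm v * (C * poly_norm k P)"
            by (rule mult_left_mono) simp
          then show ?thesis unfolding eq norm_scaleR by (simp add: mult.commute)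
        qed
      qed
    qed (use x in auto)
    also have "\<dots> \<le> ((C + D) * poly_norm k P) * norm (x - z)"
      using D(1) p0 by (intro mult_right_mono) auto
    finally show "norm (P x - P z) \<le> (C + D) * poly_norm k P * norm (x - z)" .
    have "norm (dderiv [] P x) \<le> D * poly_norm k P"
      by (rule D(2)[rule_format, OF P M _ _ x(1)]) auto
    also have "\<dots> \<le> (C + D) * poly_norm k P" using C(1) p0 by (intro mult_right_mono) auto
    finally show "norm (P x) \<le> (C + D) * poly_norm k P" by simp
  qed
  moreover have "C + D > 0" using C D by simp
  ultimately show ?thesis by blast
qed

text \<open>Bounded weak-star convergence. If \<open>Y\<close> is separable, every bounded sequence has a subsequence that converges in
  this sense, while norm convergent subsequences may be lacking.\<close>

definition wconv :: "int \<Rightarrow> (nat \<Rightarrow> real^'n \<Rightarrow> ('y::banach \<Rightarrow>\<^sub>L real)) \<Rightarrow> (real^'n \<Rightarrow> ('y \<Rightarrow>\<^sub>L real)) \<Rightarrow> bool" where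
  "wconv k Ps P \<longleftrightarrow> P \<in> poly_upto k \<and> (\<forall>i. Ps i \<in> poly_upto k) \<and> (\<exists>M. \<forall>i. poly_norm k (Ps i) \<le> M) \<and>
     (\<forall>x y. (\<lambda>i. blinfun_apply (Ps i x) y) \<longlonglongrightarrow> blinfun_apply (P x) y)"

lemma wconv_const: "P \<in> poly_upto k \<Longrightarrow> wconv k (\<lambda>_. P) P"
  by (auto simp: wconv_def)

lemma wconvI_poly_norm:
  assumes P: "P \<in> poly_upto k" "\<And>i. Ps i \<in> poly_upto k"
    and lim: "(\<lambda>i. poly_norm k (\<lambda>x. Ps i x - P x)) \<longlonglongrightarrow> 0"
  shows "wconv k Ps (P :: real^'n \<Rightarrow> ('y::banach \<Rightarrow>\<^sub>L real))"
  unfolding wconv_def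
proof (intro conjI allI)
  obtain B where B: "\<And>i. norm (poly_norm k (\<lambda>x. Ps i x - P x)) \<le> B"
    using convergent_imp_bounded[OF lim] by (auto simp: bounded_iff)
  have "poly_norm k (Ps i) \<le> B + poly_norm k P" for i
    using poly_norm_triangle[OF P(2) P(1) poly_zero, of i] B[of i] by simp
  then show "\<exists>M. \<forall>i. poly_norm k (Ps i) \<le> M" by blast
  fix x :: "real^'n" and y :: 'y
  obtain L where L: "\<forall>(P :: real^'n \<Rightarrow> ('y \<Rightarrow>\<^sub>L real)) z w. P \<in> poly_upto k \<longrightarrow> norm z \<le> norm x \<longrightarrow> norm w \<le> norm x \<longrightarrow>
     norm (P z - P w) \<le> L * poly_norm k P * norm (z - w) \<and> norm (P z) \<le> L * poly_norm k P"
    using poly_lipschitz[of k "norm x"] by (elim exE conjE) (rule that)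
  have "(\<lambda>i. L * poly_norm k (\<lambda>x. Ps i x - P x)) \<longlonglongrightarrow> L * 0" by (intro tendsto_intros lim)
  then have l: "(\<lambda>i. L * poly_norm k (\<lambda>x. Ps i x - P x)) \<longlonglongrightarrow> 0" by simp
  have le: "norm (Ps i x - P x) \<le> L * poly_norm k (\<lambda>x. Ps i x - P x)" for i
    using L[rule_format, OF poly_diff[OF P(2)[of i] P(1)], of x x] by simp
  have "(\<lambda>i. Ps i x - P x) \<longlonglongrightarrow> 0"
    by (rule Lim_null_comparison[OF always_eventually[OF allI[OF le]] l])
  then have "(\<lambda>i. Ps i x) \<longlonglongrightarrow> P x" by (rule LIM_zero_cancel)
  then show "(\<lambda>i. blinfun_apply (Ps i x) y) \<longlonglongrightarrow> blinfun_apply (P x) y"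
    by (intro blinfun.tendsto tendsto_const)
qed (use P in auto)

lemma tconv_eventually_bounded:
  assumes "tconv K \<theta>s \<theta>" "compact K"
  obtains B where "B > 0" "\<forall>\<^sub>F i in sequentially. \<forall>x. norm (\<theta>s i x) \<le> B"
proof -
  have \<theta>: "\<theta> \<in> test_fun_in K" using assms by (simp add: tconv_def)
  obtain B where B: "B > 0" "\<And>vs x. length vs = 0 \<Longrightarrow> \<forall>v\<in>set vs. norm v \<le> 1 \<Longrightarrow> norm (dderiv vs \<theta> x) \<le> B"
    using dderiv_bounded[OF \<theta> assms(2), of 0] by metis
  have "\<forall>\<^sub>F i in sequentially. \<forall>vs x. length vs = 0 \<longrightarrow> (\<forall>v\<in>set vs. norm v \<le> 1) \<longrightarrow>
        norm (dderiv vs (\<theta>s i) x - dderiv vs \<theta> x) \<le> 1"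
    using assms(1) zero_less_one unfolding tconv_def by blast
  then have "\<forall>\<^sub>F i in sequentially. \<forall>x. norm (\<theta>s i x) \<le> B + 1"
  proof eventually_elim
    case (elim i)
    show ?case
    proof
      fix x
      have "norm (\<theta>s i x - \<theta> x) \<le> 1" using elim[rule_format, of "[]" x] by simp
      moreover have "norm (\<theta> x) \<le> B" using B(2)[of "[]" x] by simp
      ultimately show "norm (\<theta>s i x) \<le> B + 1" using norm_triangle_sub[of "\<theta>s i x" "\<theta> x"] by linarith
    qed
  qed
  then show ?thesis using B(1) by (intro that[of "B + 1"]) auto
qed

text \<open>Bounded sequences of polynomial functions are uniformly Lipschitz on bounded sets, so weak-star convergence
  tolerates moving evaluation points. Dominated convergence does the rest.\<close>

lemma pairing_tendsto:
  fixes Ps :: "nat \<Rightarrow> real^'n \<Rightarrow> ('y::banach \<Rightarrow>\<^sub>L real)"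
  assumes w: "wconv k Ps P" and t: "tconv (cball 0 1) \<theta>s \<theta>" and a: "as \<longlonglongrightarrow> a" and r: "rs \<longlonglongrightarrow> r"
  shows "(\<lambda>i. pairing (\<lambda>x. Ps i (as i + rs i *\<^sub>R x)) (\<theta>s i)) \<longlonglongrightarrow> pairing (\<lambda>x. P (a + r *\<^sub>R x)) \<theta>"
proof -
  have P: "P \<in> poly_upto k" "\<And>i. Ps i \<in> poly_upto k" using w by (auto simp: wconv_def)
  have \<theta>: "\<theta> \<in> test_fun_in (cball 0 1)" "\<And>i. \<theta>s i \<in> test_fun_in (cball 0 1)" using t by (auto simp: tconv_def)
  obtain M where M: "\<And>i. poly_norm k (Ps i) \<le> M" using w by (auto simp: wconv_def)
  have M0: "M \<ge> 0" by (rule order_trans[OF poly_norm_nonneg[OF P(2)] M[of 0]])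
  obtain A where A: "\<And>i. norm (as i) \<le> A" using convergent_imp_bounded[OF a] by (auto simp: bounded_iff)
  obtain B where B: "\<And>i. norm (rs i) \<le> B" using convergent_imp_bounded[OF r] by (auto simp: bounded_iff)
  define R where "R = max (A + B) (norm a + \<bar>r\<bar>)"
  have z: "norm (as i + rs i *\<^sub>R x) \<le> R" "norm (a + r *\<^sub>R x) \<le> R" if "norm x \<le> 1" for x i
  proof -
    have "norm (as i + rs i *\<^sub>R x) \<le> norm (as i) + norm (rs i *\<^sub>R x)" by (rule norm_triangle_ineq)
    also have "\<dots> \<le> A + B * 1" unfolding norm_scaleR
      using A[of i] B[of i] that norm_ge_zero[of "rs i"] by (intro add_mono mult_mono) auto
    finally show "norm (as i + rs i *\<^sub>R x) \<le> R" by (simp add: R_def)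
    have "norm (a + r *\<^sub>R x) \<le> norm a + norm (r *\<^sub>R x)" by (rule norm_triangle_ineq)
    also have "\<dots> \<le> norm a + \<bar>r\<bar> * 1" unfolding norm_scaleR using that by (intro add_mono mult_mono) auto
    finally show "norm (a + r *\<^sub>R x) \<le> R" by (simp add: R_def)
  qed
  obtain L where L0: "L > 0" and L: "\<forall>(P :: real^'n \<Rightarrow> ('y \<Rightarrow>\<^sub>L real)) x z. P \<in> poly_upto k \<longrightarrow> norm x \<le> R \<longrightarrow> norm z \<le> R \<longrightarrow>
     norm (P x - P z) \<le> L * poly_norm k P * norm (x - z) \<and> norm (P x) \<le> L * poly_norm k P"
    using poly_lipschitz[of k R] by (elim exE conjE) (rule that)
  have bd: "norm (Ps i z) \<le> L * M" if "norm z \<le> R" for i z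
    using L[rule_format, OF P(2) that that, of i] mult_left_mono[OF M[of i], of L] L0 by linarith
  have lip: "norm (Ps i z - Ps i z') \<le> L * M * norm (z - z')" if "norm z \<le> R" "norm z' \<le> R" for i z z'
  proof -
    have "norm (Ps i z - Ps i z') \<le> L * poly_norm k (Ps i) * norm (z - z')"
      using L[rule_format, OF P(2) that, of i] by simp
    also have "\<dots> \<le> L * M * norm (z - z')" using M[of i] L0 by (intro mult_right_mono mult_left_mono) auto
    finally show ?thesis .
  qed
  obtain T where T: "T > 0" "\<forall>\<^sub>F i in sequentially. \<forall>x. norm (\<theta>s i x) \<le> T"
    using tconv_eventually_bounded[OF t compact_cball] by blast
  then obtain N where N: "\<And>i x. i \<ge> N \<Longrightarrow> norm (\<theta>s i x) \<le> T" by (auto simp: eventually_sequentially)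
  have ptw: "(\<lambda>i. blinfun_apply (Ps i (as i + rs i *\<^sub>R x)) (\<theta>s i x)) \<longlonglongrightarrow> blinfun_apply (P (a + r *\<^sub>R x)) (\<theta> x)" for x
  proof (cases "norm x \<le> 1")
    case False
    then have "\<theta>s i x = 0" "\<theta> x = 0" for i using \<theta> by (simp_all add: test_fun_in_iff)
    then show ?thesis by (simp add: blinfun.zero_right)
  next
    case True
    let ?z = "\<lambda>i. as i + rs i *\<^sub>R x" and ?w = "a + r *\<^sub>R x"
    have zw: "(\<lambda>i. ?z i - ?w) \<longlonglongrightarrow> 0"
    proof -
      have "?z \<longlonglongrightarrow> ?w" using a r by (intro tendsto_intros)
      then show ?thesis by (rule LIM_zero)
    qed
    \<comment> \<open>The integrand is changed in one entry at a time: the test function, the point, and finally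
      the polynomial function.\<close>
    have 1: "(\<lambda>i. blinfun_apply (Ps i (?z i)) (\<theta>s i x - \<theta> x)) \<longlonglongrightarrow> 0"
    proof (rule Lim_null_comparison[of _ "\<lambda>i. L * M * norm (\<theta>s i x - \<theta> x)"])
      show "\<forall>\<^sub>F i in sequentially. norm (blinfun_apply (Ps i (?z i)) (\<theta>s i x - \<theta> x)) \<le> L * M * norm (\<theta>s i x - \<theta> x)"
        by (intro always_eventually allI order_trans[OF norm_blinfun] mult_right_mono bd z(1)[OF True] norm_ge_zero)
      have "(\<lambda>i. norm (\<theta>s i x - \<theta> x)) \<longlonglongrightarrow> 0"
        by (rule tendsto_norm_zero[OF LIM_zero[OF tconv_pointwise[OF t]]])
      then show "(\<lambda>i. L * M * norm (\<theta>s i x - \<theta> x)) \<longlonglongrightarrow> 0" by (rule tendsto_mult_right_zero)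
    qed
    have 2: "(\<lambda>i. blinfun_apply (Ps i (?z i) - Ps i ?w) (\<theta> x)) \<longlonglongrightarrow> 0"
    proof (rule Lim_null_comparison[of _ "\<lambda>i. (L * M * norm (?z i - ?w)) * norm (\<theta> x)"])
      show "\<forall>\<^sub>F i in sequentially. norm (blinfun_apply (Ps i (?z i) - Ps i ?w) (\<theta> x)) \<le> (L * M * norm (?z i - ?w)) * norm (\<theta> x)"
        by (intro always_eventually allI order_trans[OF norm_blinfun] mult_right_mono lip z[OF True] norm_ge_zero)
      show "(\<lambda>i. (L * M * norm (?z i - ?w)) * norm (\<theta> x)) \<longlonglongrightarrow> 0"
        by (intro tendsto_mult_left_zero tendsto_mult_right_zero tendsto_norm_zero zw)
    qed
    have 3: "(\<lambda>i. blinfun_apply (Ps i ?w) (\<theta> x)) \<longlonglongrightarrow> blinfun_apply (P ?w) (\<theta> x)"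
      using w by (simp add: wconv_def)
    have "(\<lambda>i. blinfun_apply (Ps i (?z i)) (\<theta>s i x - \<theta> x) + blinfun_apply (Ps i (?z i) - Ps i ?w) (\<theta> x)
       + blinfun_apply (Ps i ?w) (\<theta> x)) \<longlonglongrightarrow> 0 + 0 + blinfun_apply (P ?w) (\<theta> x)"
      by (intro tendsto_add 1 2 3)
    then show ?thesis by (simp add: blinfun.diff_left blinfun.diff_right)
  qed
  have "(\<lambda>i. \<integral>x. blinfun_apply (Ps (i + N) (as (i + N) + rs (i + N) *\<^sub>R x)) (\<theta>s (i + N) x) \<partial>lebesgue)
      \<longlonglongrightarrow> (\<integral>x. blinfun_apply (P (a + r *\<^sub>R x)) (\<theta> x) \<partial>lebesgue)"
  proof (rule integral_dominated_convergence[where w = "\<lambda>x. L * M * T * indicator (cball 0 1) x"])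
    show "(\<lambda>x. blinfun_apply (P (a + r *\<^sub>R x)) (\<theta> x)) \<in> borel_measurable lebesgue"
      by (rule borel_measurable_integrable[OF integrable_poly_pairing[OF P(1) \<theta>(1)]])
    show "(\<lambda>x. blinfun_apply (Ps (i + N) (as (i + N) + rs (i + N) *\<^sub>R x)) (\<theta>s (i + N) x)) \<in> borel_measurable lebesgue" for i
      by (rule borel_measurable_integrable[OF integrable_poly_pairing[OF P(2) \<theta>(2)]])
    show "integrable lebesgue (\<lambda>x. L * M * T * indicat_real (cball (0::real^'n) 1) x)"
      using emeasure_bounded_finite[OF bounded_cball[of "0::real^'n" 1]]
      by (intro integrable_mult_right integrable_real_indicator) auto
    show "AE x in lebesgue. (\<lambda>i. blinfun_apply (Ps (i + N) (as (i + N) + rs (i + N) *\<^sub>R x)) (\<theta>s (i + N) x))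
        \<longlonglongrightarrow> blinfun_apply (P (a + r *\<^sub>R x)) (\<theta> x)"
      by (intro always_eventually allI LIMSEQ_ignore_initial_segment ptw)
    show "AE x in lebesgue. norm (blinfun_apply (Ps (i + N) (as (i + N) + rs (i + N) *\<^sub>R x)) (\<theta>s (i + N) x))
        \<le> L * M * T * indicator (cball 0 1) x" for i
    proof (intro always_eventually allI)
      fix x :: "real^'n"
      show "norm (blinfun_apply (Ps (i + N) (as (i + N) + rs (i + N) *\<^sub>R x)) (\<theta>s (i + N) x))
        \<le> L * M * T * indicator (cball 0 1) x"
      proof (cases "norm x \<le> 1")
        case True
        have "norm (blinfun_apply (Ps (i + N) (as (i + N) + rs (i + N) *\<^sub>R x)) (\<theta>s (i + N) x))
          \<le> norm (Ps (i + N) (as (i + N) + rs (i + N) *\<^sub>R x)) * norm (\<theta>s (i + N) x)" by (rule norm_blinfun)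
        also have "\<dots> \<le> (L * M) * T"
          by (rule mult_mono[OF bd[OF z(1)[OF True]] N]) (use L0 M0 in auto)
        finally show ?thesis using True by simp
      next
        case False
        then have "\<theta>s (i + N) x = 0" using \<theta>(2) by (simp add: test_fun_in_iff)
        then show ?thesis using False by (simp add: blinfun.zero_right)
      qed
    qed
  qed
  then have "(\<lambda>i. pairing (\<lambda>x. Ps (i + N) (as (i + N) + rs (i + N) *\<^sub>R x)) (\<theta>s (i + N))) \<longlonglongrightarrow> pairing (\<lambda>x. P (a + r *\<^sub>R x)) \<theta>"
    by (simp only: pairing_def)
  then show ?thesis by (rule LIMSEQ_offset)
qed

lemma defect_tendsto:
  fixes Ps :: "nat \<Rightarrow> real^'n \<Rightarrow> ('y::banach \<Rightarrow>\<^sub>L real)"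
  assumes S: "S \<in> distributions" and w: "wconv k Ps P" and t: "tconv (cball 0 1) \<theta>s \<theta>"
    and a: "as \<longlonglongrightarrow> a" and r: "rs \<longlonglongrightarrow> r" "\<And>i. rs i > 0" "r > 0"
  shows "(\<lambda>i. defect S (Ps i) (as i) (rs i) (\<theta>s i)) \<longlonglongrightarrow> defect S P a r \<theta>"
proof -
  have P: "P \<in> poly_upto k" "\<And>i. Ps i \<in> poly_upto k" using w by (auto simp: wconv_def)
  have \<theta>: "\<theta> \<in> test_fun_in (cball 0 1)" "\<And>i. \<theta>s i \<in> test_fun_in (cball 0 1)" using t by (auto simp: tconv_def)
  obtain R where R: "tconv (cball 0 R) (\<lambda>i x. \<theta>s i ((1/rs i) *\<^sub>R (x - as i))) (\<lambda>x. \<theta> ((1/r) *\<^sub>R (x - a)))"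
    using tconv_rescaled[OF t a r] by blast
  show ?thesis
    unfolding defect_eq[OF P(1) \<theta>(1) r(3)] defect_eq[OF P(2) \<theta>(2) r(2)]
    by (intro tendsto_diff tendsto_divide distribution_tconv[OF S compact_cball R] tendsto_power r
        pairing_tendsto[OF w t a r(1)]) (use r(3) in simp)
qed

section \<open>Completeness and weak-star compactness\<close>

text \<open>Pointwise weak-star limits of the values give limits of the derivatives at \<open>0\<close>, as these are fixed finite
  combinations of values. The limits are symmetric multilinear, and Taylor's formula reassembles them to a
  polynomial function.\<close>

lemma wconv_exists:
  fixes Ps :: "nat \<Rightarrow> real^'n \<Rightarrow> ('y::banach \<Rightarrow>\<^sub>L real)"
  assumes P: "\<And>i. Ps i \<in> poly_upto k" and M: "\<And>i. poly_norm k (Ps i) \<le> M"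
    and conv: "\<And>x y. convergent (\<lambda>i. blinfun_apply (Ps i x) y)"
  shows "\<exists>P. wconv k Ps P"
proof -
  let ?K = "nat (k + 1)"
  obtain w where w: "\<And>(P :: real^'n \<Rightarrow> ('y::banach \<Rightarrow>\<^sub>L real)) us v x. P \<in> poly_upto k \<Longrightarrow>
    dderiv (v # us) P x = (\<Sum>j<?K. w j *\<^sub>R dderiv us P (x + node j *\<^sub>R v))"
    by (rule poly_derivative_difference[of k]) (rule that)
  have A: "convergent (\<lambda>i. blinfun_apply (dderiv us (Ps i) x) y)" for us x y
  proof (induction us arbitrary: x)
    case (Cons v us)
    have eq: "(\<lambda>i. blinfun_apply (dderiv (v # us) (Ps i) x) y)
       = (\<lambda>i. \<Sum>j<?K. w j * blinfun_apply (dderiv us (Ps i) (x + node j *\<^sub>R v)) y)"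
      by (rule ext) (simp only: w[OF P] blinfun.sum_left blinfun.scaleR_left real_scaleR_def)
    show ?case
      unfolding eq by (intro convergent_sum convergent_mult convergent_const Cons.IH)
  qed (simp add: conv)
  have B: "\<exists>B. \<forall>i. norm (dderiv us (Ps i) x) \<le> B" for us x
  proof (induction us arbitrary: x)
    case Nil
    obtain L where L0: "L > 0" and L: "\<forall>(P :: real^'n \<Rightarrow> ('y \<Rightarrow>\<^sub>L real)) z z'. P \<in> poly_upto k \<longrightarrow> norm z \<le> norm x \<longrightarrow> norm z' \<le> norm x \<longrightarrow>
       norm (P z - P z') \<le> L * poly_norm k P * norm (z - z') \<and> norm (P z) \<le> L * poly_norm k P"
      using poly_lipschitz[of k "norm x"] by (elim exE conjE) (rule that)
    have "norm (Ps i x) \<le> L * M" for i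
      using L[rule_format, OF P order_refl order_refl, of i] mult_left_mono[OF M[of i], of L] L0 by linarith
    then show ?case by auto
  next
    case (Cons v us)
    have "\<forall>j. \<exists>B. \<forall>i. norm (dderiv us (Ps i) (x + node j *\<^sub>R v)) \<le> B" using Cons.IH by blast
    from choice[OF this] obtain B where B: "\<And>j i. norm (dderiv us (Ps i) (x + node j *\<^sub>R v)) \<le> B j" by blast
    have "norm (dderiv (v # us) (Ps i) x) \<le> (\<Sum>j<?K. \<bar>w j\<bar> * B j)" for i
      unfolding w[OF P] by (rule sum_norm_le) (simp add: B mult_left_mono)
    then show ?case by blast
  qed
  define lam where "lam = (\<lambda>us y. lim (\<lambda>i. blinfun_apply (dderiv us (Ps i) 0) y))"
  have lam: "(\<lambda>i. blinfun_apply (dderiv us (Ps i) 0) y) \<longlonglongrightarrow> lam us y" for us y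
    unfolding lam_def using A[of us 0 y] by (simp add: convergent_LIMSEQ_iff)
  have bl: "bounded_linear (lam us)" for us
  proof -
    obtain B where B: "\<And>i. norm (dderiv us (Ps i) 0) \<le> B" using B[of us 0] by blast
    show ?thesis
    proof (rule bounded_linear_intro[of _ B])
      fix y z :: 'y and c :: real
      show "lam us (y + z) = lam us y + lam us z"
        by (rule LIMSEQ_unique[OF lam[of us "y + z"]])
          (simp only: blinfun.add_right tendsto_add[OF lam[of us y] lam[of us z]])
      show "lam us (c *\<^sub>R y) = c *\<^sub>R lam us y"
        by (rule LIMSEQ_unique[OF lam[of us "c *\<^sub>R y"]])
          (simp only: blinfun.scaleR_right real_scaleR_def tendsto_mult[OF tendsto_const[of c] lam[of us y]])
      have "norm (blinfun_apply (dderiv us (Ps i) 0) y) \<le> norm y * B" for i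
        using order_trans[OF norm_blinfun mult_right_mono[OF B norm_ge_zero]] by (simp only: mult.commute[of "norm y" B])
      then show "norm (lam us y) \<le> norm y * B"
        by (intro LIMSEQ_le_const2[OF tendsto_norm[OF lam[of us y]]] exI[of _ 0] allI impI)
    qed
  qed
  \<comment> \<open>The Taylor coefficients of the limit.\<close>
  define \<psi> where "\<psi> = (\<lambda>m. \<lambda>us\<in>{us. length us = m}. (1 / fact m) *\<^sub>R Blinfun (lam us))"
  have Bl: "blinfun_apply (Blinfun (lam us)) = lam us" for us
    by (rule bounded_linear_Blinfun_apply[OF bl])
  have nd: "dderiv us (Ps i) 0 = nth_deriv m (Ps i) 0 us" if "length us = m" for us m i
    using that by (simp add: nth_deriv_def)
  have \<psi>: "\<psi> m \<in> sym_mlin m" for m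
    unfolding \<psi>_def
  proof (rule sym_mlin_restrictI)
    fix vs ws :: "(real^'n) list" assume len: "length vs + length ws + 1 = m"
    have lin: "linear (\<lambda>v. dderiv (vs @ v # ws) (Ps i) 0)" for i
      using sym_mlin_linear[OF nth_deriv_poly_sym_mlin[OF P], of m vs ws] len nd[of _ m] by simp
    have "linear (\<lambda>v. Blinfun (lam (vs @ v # ws)))"
    proof (rule linearI)
      fix u v :: "real^'n" and c :: real
      have "lam (vs @ (u + v) # ws) y = lam (vs @ u # ws) y + lam (vs @ v # ws) y" for y
        by (rule LIMSEQ_unique[OF lam[of "vs @ (u + v) # ws" y]])
          (simp only: linear_add[OF lin] blinfun.add_left tendsto_add[OF lam[of "vs @ u # ws" y] lam[of "vs @ v # ws" y]])
      then show "Blinfun (lam (vs @ (u + v) # ws)) = Blinfun (lam (vs @ u # ws)) + Blinfun (lam (vs @ v # ws))"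
        by (intro blinfun_eqI) (simp add: Bl blinfun.add_left)
      have "lam (vs @ (c *\<^sub>R u) # ws) y = c * lam (vs @ u # ws) y" for y
        by (rule LIMSEQ_unique[OF lam[of "vs @ (c *\<^sub>R u) # ws" y]])
          (simp only: linear_scale[OF lin] blinfun.scaleR_left real_scaleR_def tendsto_mult[OF tendsto_const[of c] lam[of "vs @ u # ws" y]])
      then show "Blinfun (lam (vs @ (c *\<^sub>R u) # ws)) = c *\<^sub>R Blinfun (lam (vs @ u # ws))"
        by (intro blinfun_eqI) (simp add: Bl blinfun.scaleR_left)
    qed
    then show "linear (\<lambda>v. (1 / fact m) *\<^sub>R Blinfun (lam (vs @ v # ws)))"
      by (rule linear_compose_scale_right)
  next
    fix vs ws :: "(real^'n) list" assume vs: "length vs = m" "mset ws = mset vs"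
    then have "length ws = m" using mset_eq_length[OF vs(2)] by simp
    then have "dderiv ws (Ps i) 0 = dderiv vs (Ps i) 0" for i
      using sym_mlin_perm[OF nth_deriv_poly_sym_mlin[OF P] vs] vs(1) nd[of _ m] by simp
    then show "(1 / fact m) *\<^sub>R Blinfun (lam ws) = (1 / fact m) *\<^sub>R Blinfun (lam vs)"
      by (simp add: lam_def)
  qed
  define P where "P = (\<lambda>x. \<Sum>m<?K. \<psi> m (replicate m x))"
  have P': "P \<in> poly_upto k" by (rule poly_uptoI[OF \<psi>]) (simp add: P_def)
  have "(\<lambda>i. blinfun_apply (Ps i x) y) \<longlonglongrightarrow> blinfun_apply (P x) y" for x y
  proof -
    have "(\<lambda>i. \<Sum>m<?K. (1 / fact m) * blinfun_apply (dderiv (replicate m x) (Ps i) 0) y)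
        \<longlonglongrightarrow> (\<Sum>m<?K. (1 / fact m) * lam (replicate m x) y)"
      by (intro tendsto_intros lam)
    moreover have "(\<lambda>i. \<Sum>m<?K. (1 / fact m) * blinfun_apply (dderiv (replicate m x) (Ps i) 0) y)
        = (\<lambda>i. blinfun_apply (Ps i x) y)"
    proof
      fix i
      show "(\<Sum>m<?K. (1 / fact m) * blinfun_apply (dderiv (replicate m x) (Ps i) 0) y) = blinfun_apply (Ps i x) y"
        unfolding poly_taylor[OF P, of i x] by (simp only: blinfun.sum_left blinfun.scaleR_left real_scaleR_def)
    qed
    moreover have "(\<Sum>m<?K. (1 / fact m) * lam (replicate m x) y) = blinfun_apply (P x) y"
      by (simp add: P_def \<psi>_def blinfun.sum_left blinfun.scaleR_left Bl)
    ultimately show ?thesis by simp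
  qed
  then have "wconv k Ps P" unfolding wconv_def
    by (intro conjI allI P' P exI[of _ M] M)
  then show ?thesis by (intro exI[of _ P])
qed

lemma wconv_norm_le:
  fixes Ps :: "nat \<Rightarrow> real^'n \<Rightarrow> ('y::banach \<Rightarrow>\<^sub>L real)"
  assumes w: "wconv k Ps P" and Q: "Q \<in> poly_upto k"
    and le: "\<forall>\<^sub>F i in sequentially. poly_norm k (\<lambda>x. Ps i x - Q x) \<le> c" and x: "norm x \<le> 1"
  shows "norm (P x - Q x) \<le> c"
proof (rule blinfun_norm_le_unit)
  fix y :: 'y assume y: "norm y \<le> 1"
  have "(\<lambda>i. \<bar>blinfun_apply (Ps i x) y - blinfun_apply (Q x) y\<bar>) \<longlonglongrightarrow> \<bar>blinfun_apply (P x) y - blinfun_apply (Q x) y\<bar>"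
    using w by (intro tendsto_rabs tendsto_diff tendsto_const) (simp add: wconv_def)
  moreover have "\<forall>\<^sub>F i in sequentially. \<bar>blinfun_apply (Ps i x) y - blinfun_apply (Q x) y\<bar> \<le> c"
    using le
  proof eventually_elim
    case (elim i)
    have Pi: "Ps i \<in> poly_upto k" using w by (simp add: wconv_def)
    have "\<bar>blinfun_apply (Ps i x) y - blinfun_apply (Q x) y\<bar> = norm (blinfun_apply (Ps i x - Q x) y)"
      by (simp add: blinfun.diff_left)
    also have "\<dots> \<le> norm (Ps i x - Q x) * norm y" by (rule norm_blinfun)
    also have "\<dots> \<le> norm (Ps i x - Q x)" using y by (simp add: mult_left_le)
    also have "\<dots> \<le> c" using poly_le_poly_norm[OF poly_diff[OF Pi Q] x] elim by simp
    finally show ?case .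
  qed
  ultimately have "\<bar>blinfun_apply (P x) y - blinfun_apply (Q x) y\<bar> \<le> c"
    by (intro tendsto_upperbound[of _ _ sequentially]) auto
  then show "\<bar>blinfun_apply (P x - Q x) y\<bar> \<le> c" by (simp add: blinfun.diff_left)
qed

text \<open>The weak-star limit of a Cauchy sequence is its norm limit, because the norm is weak-star lower semicontinuous
  (\<open>wconv_norm_le\<close>).\<close>

lemma poly_complete:
  fixes Ps :: "nat \<Rightarrow> real^'n \<Rightarrow> ('y::banach \<Rightarrow>\<^sub>L real)"
  assumes P: "\<And>i. Ps i \<in> poly_upto k"
    and Cauchy: "\<And>e. e > 0 \<Longrightarrow> \<exists>N. \<forall>i\<ge>N. \<forall>j\<ge>N. poly_norm k (\<lambda>x. Ps i x - Ps j x) \<le> e"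
  shows "\<exists>P\<in>poly_upto k. (\<lambda>i. poly_norm k (\<lambda>x. Ps i x - P x)) \<longlonglongrightarrow> 0"
proof -
  have bounded: "\<exists>M. \<forall>i. poly_norm k (Ps (i + N)) \<le> M"
    if N: "\<forall>i\<ge>N. \<forall>j\<ge>N. poly_norm k (\<lambda>x. Ps i x - Ps j x) \<le> 1" for N
  proof -
    have "poly_norm k (Ps (i + N)) \<le> 1 + poly_norm k (Ps N)" for i
      using poly_norm_triangle[OF P[of "i + N"] P[of N] poly_zero] N[rule_format, of "i + N" N] by simp
    then show ?thesis by blast
  qed
  obtain N where N: "\<forall>i\<ge>N. \<forall>j\<ge>N. poly_norm k (\<lambda>x. Ps i x - Ps j x) \<le> 1"
    using Cauchy[of 1] by auto
  obtain M where M: "\<And>i. poly_norm k (Ps (i + N)) \<le> M" using bounded[OF N] by blast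
  have conv: "convergent (\<lambda>i. blinfun_apply (Ps (i + N) x) y)" for x y
  proof -
    obtain L where L0: "L > 0" and L: "\<forall>(P :: real^'n \<Rightarrow> ('y \<Rightarrow>\<^sub>L real)) z z'. P \<in> poly_upto k \<longrightarrow> norm z \<le> norm x \<longrightarrow> norm z' \<le> norm x \<longrightarrow>
       norm (P z - P z') \<le> L * poly_norm k P * norm (z - z') \<and> norm (P z) \<le> L * poly_norm k P"
      using poly_lipschitz[of k "norm x"] by (elim exE conjE) (rule that)
    have "Cauchy (\<lambda>i. Ps i x)"
    proof (rule CauchyI)
      fix e :: real assume e: "e > 0"
      obtain N where N: "\<forall>i\<ge>N. \<forall>j\<ge>N. poly_norm k (\<lambda>x. Ps i x - Ps j x) \<le> e / (2 * L)"
        using Cauchy[of "e / (2 * L)"] e L0 by auto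
      have "norm (Ps i x - Ps j x) < e" if ij: "i \<ge> N" "j \<ge> N" for i j
      proof -
        have "norm (Ps i x - Ps j x) \<le> L * poly_norm k (\<lambda>x. Ps i x - Ps j x)"
          using L[rule_format, OF poly_diff[OF P[of i] P[of j]] order_refl order_refl] by simp
        also have "\<dots> \<le> L * (e / (2 * L))" using N ij L0 by (intro mult_left_mono) auto
        also have "\<dots> < e" using e L0 by simp
        finally show ?thesis .
      qed
      then show "\<exists>N. \<forall>i\<ge>N. \<forall>j\<ge>N. norm (Ps i x - Ps j x) < e" by blast
    qed
    then obtain l where "(\<lambda>i. Ps i x) \<longlonglongrightarrow> l" by (auto simp: Cauchy_convergent_iff convergent_def)
    from LIMSEQ_ignore_initial_segment[OF this, of N]
    have "(\<lambda>i. blinfun_apply (Ps (i + N) x) y) \<longlonglongrightarrow> blinfun_apply l y" by (intro blinfun.tendsto tendsto_const)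
    then show ?thesis by (auto simp: convergent_def)
  qed
  have "\<exists>P. wconv k (\<lambda>i. Ps (i + N)) P" by (rule wconv_exists[OF P M conv])
  then obtain P where w: "wconv k (\<lambda>i. Ps (i + N)) P" by (elim exE) (rule that)
  have Pk: "P \<in> poly_upto k" using w by (simp add: wconv_def)
  obtain C where C: "C > 0" "\<forall>(P :: real^'n \<Rightarrow> ('y \<Rightarrow>\<^sub>L real)) M. P \<in> poly_upto k \<longrightarrow>
       (\<forall>x. norm x \<le> 1 \<longrightarrow> norm (P x) \<le> M) \<longrightarrow> poly_norm k P \<le> C * M"
    using poly_norm_le[of k] by (elim exE conjE) (rule that)
  have "(\<lambda>i. poly_norm k (\<lambda>x. Ps i x - P x)) \<longlonglongrightarrow> 0"
  proof (rule LIMSEQ_I)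
    fix e :: real assume e: "e > 0"
    obtain N' where N': "\<forall>i\<ge>N'. \<forall>j\<ge>N'. poly_norm k (\<lambda>x. Ps i x - Ps j x) \<le> e / (2 * C)"
      using Cauchy[of "e / (2 * C)"] e C(1) by auto
    have "norm (poly_norm k (\<lambda>x. Ps i x - P x) - 0) < e" if i: "i \<ge> N'" for i
    proof -
      have ev: "\<forall>\<^sub>F j in sequentially. poly_norm k (\<lambda>x. Ps (j + N) x - Ps i x) \<le> e / (2 * C)"
        using N' i by (auto simp: eventually_sequentially intro!: exI[of _ N'])
      have "norm (P x - Ps i x) \<le> e / (2 * C)" if "norm x \<le> 1" for x
        by (rule wconv_norm_le[OF w P ev that])
      then have "poly_norm k (\<lambda>x. P x - Ps i x) \<le> C * (e / (2 * C))"
        by (intro C(2)[rule_format, OF poly_diff[OF Pk P]])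
      then have "poly_norm k (\<lambda>x. Ps i x - P x) < e"
        using poly_norm_commute[OF Pk P[of i]] e C(1) by simp
      then show ?thesis using poly_norm_nonneg[OF poly_diff[OF P[of i] Pk]] by simp
    qed
    then show "\<exists>N. \<forall>i\<ge>N. norm (poly_norm k (\<lambda>x. Ps i x - P x) - 0) < e" by blast
  qed
  then show ?thesis using Pk by blast
qed

lemma poly_norm_eq_0D:
  assumes "P \<in> poly_upto k" "Q \<in> poly_upto k" "poly_norm k (\<lambda>x. P x - Q x) \<le> 0"
  shows "P = (Q :: real^'n \<Rightarrow> ('y::banach \<Rightarrow>\<^sub>L real))"
proof
  fix x :: "real^'n"
  obtain L where L0: "L > 0" and L: "\<forall>(P :: real^'n \<Rightarrow> ('y \<Rightarrow>\<^sub>L real)) z z'. P \<in> poly_upto k \<longrightarrow> norm z \<le> norm x \<longrightarrow> norm z' \<le> norm x \<longrightarrow>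
     norm (P z - P z') \<le> L * poly_norm k P * norm (z - z') \<and> norm (P z) \<le> L * poly_norm k P"
    using poly_lipschitz[of k "norm x"] by (elim exE conjE) (rule that)
  have "norm (P x - Q x) \<le> L * poly_norm k (\<lambda>x. P x - Q x)"
    using L[rule_format, OF poly_diff[OF assms(1,2)] order_refl order_refl] by simp
  also have "\<dots> \<le> 0" using assms(3) L0 by (simp add: mult_nonneg_nonpos)
  finally show "P x = Q x" by simp
qed

text \<open>By a diagonal argument a subsequence converges at the points of a countable dense set in \<open>\<real>\<^sup>n \<times> Y\<close>. The
  uniform Lipschitz bounds carry the convergence over to all points.\<close>

lemma weak_star_compact:
  fixes Ps :: "nat \<Rightarrow> real^'n \<Rightarrow> ('y::banach \<Rightarrow>\<^sub>L real)" and D :: "'y set"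
  assumes D: "countable D" "\<And>y e. e > 0 \<Longrightarrow> \<exists>d\<in>D. norm (y - d) < e"
    and P: "\<And>i. Ps i \<in> poly_upto k" and M: "\<And>i. poly_norm k (Ps i) \<le> M"
  shows "\<exists>r P. strict_mono (r :: nat \<Rightarrow> nat) \<and> wconv k (\<lambda>i. Ps (r i)) P"
proof -
  obtain E :: "(real^'n) set" where E: "countable E" "\<And>X. open X \<Longrightarrow> X \<noteq> {} \<Longrightarrow> \<exists>d\<in>E. d \<in> X"
    using countable_dense_exists by blast
  have M0: "M \<ge> 0" by (rule order_trans[OF poly_norm_nonneg[OF P] M[of 0]])
  have "\<forall>R. \<exists>L>0. \<forall>i x z. norm x \<le> R \<longrightarrow> norm z \<le> R \<longrightarrow>
       norm (Ps i x - Ps i z) \<le> L * norm (x - z) \<and> norm (Ps i x) \<le> L"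
  proof
    fix R
    obtain L where L0: "L > 0" and L: "\<forall>(P :: real^'n \<Rightarrow> ('y \<Rightarrow>\<^sub>L real)) x z. P \<in> poly_upto k \<longrightarrow> norm x \<le> R \<longrightarrow> norm z \<le> R \<longrightarrow>
       norm (P x - P z) \<le> L * poly_norm k P * norm (x - z) \<and> norm (P x) \<le> L * poly_norm k P"
      using poly_lipschitz[of k R] by (elim exE conjE) (rule that)
    have "norm (Ps i x - Ps i z) \<le> (L * (M + 1)) * norm (x - z) \<and> norm (Ps i x) \<le> L * (M + 1)"
      if xz: "norm x \<le> R" "norm z \<le> R" for i x z
    proof -
      have "L * poly_norm k (Ps i) \<le> L * (M + 1)" using M[of i] L0 by (intro mult_left_mono) auto
      moreover from mult_right_mono[OF this norm_ge_zero[of "x - z"]]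
      have "L * poly_norm k (Ps i) * norm (x - z) \<le> L * (M + 1) * norm (x - z)" .
      ultimately show ?thesis using L[rule_format, OF P xz, of i] by linarith
    qed
    then show "\<exists>L>0. \<forall>i x z. norm x \<le> R \<longrightarrow> norm z \<le> R \<longrightarrow>
       norm (Ps i x - Ps i z) \<le> L * norm (x - z) \<and> norm (Ps i x) \<le> L"
      using L0 M0 by (intro exI[of _ "L * (M + 1)"]) simp
  qed
  from choice[OF this] obtain L where L0: "\<And>R. L R > 0"
    and L: "\<And>R i x z. norm x \<le> R \<Longrightarrow> norm z \<le> R \<Longrightarrow> norm (Ps i x - Ps i z) \<le> L R * norm (x - z) \<and> norm (Ps i x) \<le> L R"
    by blast
  \<comment> \<open>Normalised so as to be bounded by \<open>1\<close>, as the diagonal argument requires.\<close>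
  define f where "f = (\<lambda>i (x, y). blinfun_apply (Ps i x) y / (L (norm x) * (norm y + 1)))"
  have bnd: "\<bar>blinfun_apply (Ps i x) y\<bar> \<le> L R * norm y" if "norm x \<le> R" for i x y R
    using order_trans[OF norm_blinfun mult_right_mono[of "norm (Ps i x)" "L R" "norm y"]] L[OF that that, of i] by simp
  have f1: "norm (f i s) \<le> 1" if "s \<in> E \<times> D" for i s
  proof -
    obtain x y where s: "s = (x, y)" by (cases s)
    have "\<bar>blinfun_apply (Ps i x) y\<bar> \<le> L (norm x) * norm y" by (rule bnd) simp
    also have "\<dots> \<le> L (norm x) * (norm y + 1)" using L0[of "norm x"] by simp
    finally show ?thesis using L0[of "norm x"] by (simp add: s f_def abs_mult add_nonneg_pos)
  qed
  obtain r where r: "strict_mono (r :: nat \<Rightarrow> nat)" "\<And>s. s \<in> E \<times> D \<Longrightarrow> \<exists>l. (\<lambda>n. f (r n) s) \<longlonglongrightarrow> l"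
  proof (rule function_convergent_subsequence[of "E \<times> D" f 1])
    show "countable (E \<times> D)" by (intro countable_SIGMA E(1) D(1))
    show "norm (f i s) \<le> 1" if "s \<in> E \<times> D" for i s by (rule f1[OF that])
  qed (rule that)
  have cED: "Cauchy (\<lambda>n. blinfun_apply (Ps (r n) x) y)" if xy: "x \<in> E" "y \<in> D" for x y
  proof -
    obtain l where l: "(\<lambda>n. f (r n) (x, y)) \<longlonglongrightarrow> l" using r(2)[of "(x, y)"] xy by auto
    have cc: "b / d * d = b" if "d > 0" for b d :: real using that by simp
    have c: "L (norm x) * (norm y + 1) > 0" using L0[of "norm x"] by (simp add: add_nonneg_pos)
    have "(\<lambda>n. f (r n) (x, y) * (L (norm x) * (norm y + 1))) \<longlonglongrightarrow> l * (L (norm x) * (norm y + 1))"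
      by (intro tendsto_mult l tendsto_const)
    moreover have "(\<lambda>n. f (r n) (x, y) * (L (norm x) * (norm y + 1))) = (\<lambda>n. blinfun_apply (Ps (r n) x) y)"
      by (rule ext) (simp only: f_def prod.case cc[OF c])
    ultimately have "(\<lambda>n. blinfun_apply (Ps (r n) x) y) \<longlonglongrightarrow> l * (L (norm x) * (norm y + 1))" by simp
    then show ?thesis by (rule LIMSEQ_imp_Cauchy)
  qed
  have conv: "convergent (\<lambda>n. blinfun_apply (Ps (r n) x) y)" for x y
  proof -
    have "Cauchy (\<lambda>n. blinfun_apply (Ps (r n) x) y)"
    proof (rule CauchyI)
      fix e :: real assume e: "e > 0"
      let ?L = "L (norm x + 1)"
      have Lp: "?L > 0" by (rule L0)
      obtain d where d: "d \<in> D" "norm (y - d) < e / (8 * ?L)" using D(2)[of "e / (8 * ?L)" y] e Lp by auto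
      let ?\<delta> = "min 1 (e / (8 * ?L * (norm d + 1)))"
      have \<delta>: "?\<delta> > 0" using e Lp by (simp add: add_nonneg_pos)
      obtain x' where x': "x' \<in> E" "x' \<in> ball x ?\<delta>" using E(2)[of "ball x ?\<delta>"] \<delta> by fastforce
      have xx: "norm (x - x') < 1" "norm (x - x') < e / (8 * ?L * (norm d + 1))"
        using x'(2) by (simp_all add: dist_norm)
      have nx: "norm x \<le> norm x + 1" "norm x' \<le> norm x + 1"
        using xx(1) norm_triangle_sub[of x' x] by (simp_all add: norm_minus_commute)
      have near: "\<bar>blinfun_apply (Ps i x) y - blinfun_apply (Ps i x') d\<bar> \<le> e / 4" for i
      proof -
        have eq: "blinfun_apply (Ps i x) y - blinfun_apply (Ps i x') d
            = blinfun_apply (Ps i x) (y - d) + blinfun_apply (Ps i x - Ps i x') d"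
          by (simp add: blinfun.diff_left blinfun.diff_right)
        have "\<bar>blinfun_apply (Ps i x) (y - d)\<bar> \<le> ?L * norm (y - d)" by (rule bnd[OF nx(1)])
        also have "\<dots> \<le> ?L * (e / (8 * ?L))" using d Lp by (intro mult_left_mono) auto
        finally have 1: "\<bar>blinfun_apply (Ps i x) (y - d)\<bar> \<le> e / 8" using Lp by simp
        have "\<bar>blinfun_apply (Ps i x - Ps i x') d\<bar> \<le> norm (Ps i x - Ps i x') * norm d"
          using norm_blinfun[of "Ps i x - Ps i x'" d] by simp
        also have "\<dots> \<le> (?L * norm (x - x')) * (norm d + 1)"
          using L[OF nx, of i] Lp by (intro mult_mono) auto
        also have "\<dots> \<le> (?L * (e / (8 * ?L * (norm d + 1)))) * (norm d + 1)"
          using xx(2) Lp by (intro mult_right_mono mult_left_mono) auto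
        also have "\<dots> = e / 8"
          using Lp norm_ge_zero[of d] by (simp add: field_simps add_nonneg_eq_0_iff)
        finally show ?thesis unfolding eq using 1 by linarith
      qed
      obtain N where N: "\<forall>m\<ge>N. \<forall>n\<ge>N. norm (blinfun_apply (Ps (r m) x') d - blinfun_apply (Ps (r n) x') d) < e / 4"
        using CauchyD[OF cED[OF x'(1) d(1)], of "e / 4"] e by auto
      have "norm (blinfun_apply (Ps (r m) x) y - blinfun_apply (Ps (r n) x) y) < e" if mn: "m \<ge> N" "n \<ge> N" for m n
        using near[of "r m"] near[of "r n"] N[rule_format, OF mn] e unfolding real_norm_def by linarith
      then show "\<exists>N. \<forall>m\<ge>N. \<forall>n\<ge>N. norm (blinfun_apply (Ps (r m) x) y - blinfun_apply (Ps (r n) x) y) < e" by blast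
    qed
    then show ?thesis by (simp add: Cauchy_convergent_iff)
  qed
  have "\<exists>P. wconv k (\<lambda>i. Ps (r i)) P" by (rule wconv_exists[OF P M conv])
  then obtain P where "wconv k (\<lambda>i. Ps (r i)) P" by (elim exE) (rule that)
  then show ?thesis using r(1) by (intro exI[of _ r] exI[of _ P] conjI)
qed

section \<open>Jets in terms of closeness at small scales\<close>

lemma close_at_mono: "close_at \<nu> S a r P c \<Longrightarrow> c \<le> d \<Longrightarrow> close_at \<nu> S a r P d"
  by (auto simp: close_at_def intro: order_trans)

text \<open>In contrast to the jets, these sets have uniform constants \<open>c\<close> and \<open>\<delta>\<close>, which makes them closed.\<close>

definition approx_set ::
  "((real^'n \<Rightarrow> 'y::banach) \<Rightarrow> real) \<Rightarrow> ((real^'n \<Rightarrow> 'y) \<Rightarrow> real) \<Rightarrow> int \<Rightarrow> real \<Rightarrow> real \<Rightarrow> real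
     \<Rightarrow> ((real^'n) \<times> (real^'n \<Rightarrow> ('y \<Rightarrow>\<^sub>L real))) set" where
  "approx_set \<nu> S k s c \<delta> = {(a, P). P \<in> poly_upto k \<and>
     (\<forall>r. 0 < r \<longrightarrow> r < \<delta> \<longrightarrow> close_at \<nu> S a r P (c * r powr s))}"

lemma approx_setD:
  assumes "(a, P) \<in> approx_set \<nu> S k s c \<delta>"
  shows "P \<in> poly_upto k" "\<And>r. 0 < r \<Longrightarrow> r < \<delta> \<Longrightarrow> close_at \<nu> S a r P (c * r powr s)"
  using assms by (auto simp: approx_set_def)

lemma approx_set_mono:
  assumes "c \<le> c'" "\<delta>' \<le> \<delta>"
  shows "approx_set \<nu> S k s c \<delta> \<subseteq> approx_set \<nu> S k s c' \<delta>'"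
proof
  fix z assume z: "z \<in> approx_set \<nu> S k s c \<delta>"
  obtain a P where aP: "z = (a, P)" by (cases z)
  have "close_at \<nu> S a r P (c' * r powr s)" if "0 < r" "r < \<delta>'" for r
    by (rule close_at_mono[OF approx_setD(2)[OF z[unfolded aP]]])
      (use that assms in \<open>auto intro: mult_right_mono\<close>)
  then show "z \<in> approx_set \<nu> S k s c' \<delta>'"
    using approx_setD(1)[OF z[unfolded aP]] by (simp add: aP approx_set_def)
qed

lemma SUP_le_iff_close_at:
  assumes "r > 0"
  shows "(SUP \<theta>\<in>{\<theta> \<in> test_fun_in (cball 0 1). \<nu> \<theta> \<le> 1}. ereal (r powr (- s) * defect S P a r \<theta>)) \<le> ereal c
    \<longleftrightarrow> close_at \<nu> S a r P (c * r powr s)"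
proof -
  have "r powr (- s) * defect S P a r \<theta> \<le> c \<longleftrightarrow> defect S P a r \<theta> \<le> c * r powr s" for \<theta>
    using assms by (simp add: powr_minus divide_simps mult.commute)
  then show ?thesis by (auto simp: SUP_le_iff close_at_def)
qed

lemma has_jet_holder_iff:
  "has_jet_holder \<nu> k \<alpha> S a P \<longleftrightarrow> (\<exists>c. \<exists>\<delta>>0. (a, P) \<in> approx_set \<nu> S k (real_of_int k + \<alpha>) c \<delta>)"
proof -
  let ?s = "real_of_int k + \<alpha>"
  define F where "F = (\<lambda>r. SUP \<theta>\<in>{\<theta> \<in> test_fun_in (cball 0 1). \<nu> \<theta> \<le> 1}. ereal (r powr (- ?s) * defect S P a r \<theta>))"
  have F: "F r \<le> ereal c \<longleftrightarrow> close_at \<nu> S a r P (c * r powr ?s)" if "r > 0" for r c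
    unfolding F_def by (rule SUP_le_iff_close_at[OF that])
  have main: "Limsup (at_right 0) F < \<infinity> \<longleftrightarrow> (\<exists>c. \<exists>\<delta>>0. \<forall>r. 0 < r \<longrightarrow> r < \<delta> \<longrightarrow> close_at \<nu> S a r P (c * r powr ?s))"
  proof
    assume "Limsup (at_right 0) F < \<infinity>"
    then have "Limsup (at_right 0) F \<noteq> \<infinity>" by simp
    then obtain c :: real where "Limsup (at_right 0) F < ereal c"
      using less_PInf_Ex_of_nat[of "Limsup (at_right 0) F"] by blast
    then have "\<forall>\<^sub>F r in at_right 0. F r < ereal c" by (rule Limsup_lessD)
    then obtain \<delta> where \<delta>: "\<delta> > 0" "\<And>r. 0 < r \<Longrightarrow> r < \<delta> \<Longrightarrow> F r < ereal c"
      by (auto simp: eventually_at_right_field)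
    have "close_at \<nu> S a r P (c * r powr ?s)" if "0 < r" "r < \<delta>" for r
      using less_imp_le[OF \<delta>(2)[OF that]] F[OF that(1), of c] by blast
    then show "\<exists>c. \<exists>\<delta>>0. \<forall>r. 0 < r \<longrightarrow> r < \<delta> \<longrightarrow> close_at \<nu> S a r P (c * r powr ?s)"
      using \<delta>(1) by blast
  next
    assume "\<exists>c. \<exists>\<delta>>0. \<forall>r. 0 < r \<longrightarrow> r < \<delta> \<longrightarrow> close_at \<nu> S a r P (c * r powr ?s)"
    then obtain c \<delta> where \<delta>: "\<delta> > 0" "\<And>r. 0 < r \<Longrightarrow> r < \<delta> \<Longrightarrow> close_at \<nu> S a r P (c * r powr ?s)" by blast
    have "\<forall>\<^sub>F r in at_right 0. F r \<le> ereal c"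
      unfolding eventually_at_right_field using \<delta> F by blast
    then have "Limsup (at_right 0) F \<le> ereal c" by (rule Limsup_bounded)
    then show "Limsup (at_right 0) F < \<infinity>" by (rule order_le_less_trans) simp
  qed
  have exponent: "- real_of_int k - \<alpha> = - ?s" by simp
  have "has_jet_holder \<nu> k \<alpha> S a P \<longleftrightarrow> P \<in> poly_upto k \<and> Limsup (at_right 0) F < \<infinity>"
    unfolding has_jet_holder_def F_def exponent ..
  also have "\<dots> \<longleftrightarrow> (\<exists>c. \<exists>\<delta>>0. (a, P) \<in> approx_set \<nu> S k ?s c \<delta>)"
    unfolding main approx_set_def mem_Collect_eq prod.case by blast
  finally show ?thesis .
qed

lemma has_jet_iff:
  fixes P :: "real^'n \<Rightarrow> ('y::banach \<Rightarrow>\<^sub>L real)"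
  assumes nu: "cont_seminorm_on (cball 0 1) \<nu>" and S: "S \<in> distributions"
  shows "has_jet \<nu> k S a P \<longleftrightarrow> (\<forall>e>0. \<exists>\<delta>>0. (a, P) \<in> approx_set \<nu> S k (real_of_int k) e \<delta>)"
proof (cases "P \<in> poly_upto k")
  case True
  let ?s = "real_of_int k"
  define F where "F = (\<lambda>r. SUP \<theta>\<in>{\<theta> \<in> test_fun_in (cball 0 1). \<nu> \<theta> \<le> 1}. ereal (r powr (- ?s) * defect S P a r \<theta>))"
  define G where "G = (\<lambda>r. SUP \<theta>\<in>{\<theta> \<in> test_fun_in (cball 0 1). \<nu> \<theta> \<le> 1}. ereal (r powi (- k) * defect S P a r \<theta>))"
  have F: "F r \<le> ereal c \<longleftrightarrow> close_at \<nu> S a r P (c * r powr ?s)" if "r > 0" for r c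
    unfolding F_def by (rule SUP_le_iff_close_at[OF that])
  \<comment> \<open>The test function \<open>0\<close> shows that the supremum is never negative, so that tending to \<open>0\<close> is
    only a condition from above.\<close>
  have F0: "F r \<ge> 0" if r: "r > 0" for r
  proof -
    have z: "(\<lambda>x::real^'n. 0::'y) \<in> test_fun_in (cball 0 1)" by (rule test_fun_in_zero[OF compact_cball])
    have "\<nu> (\<lambda>x. 0) = 0" using seminorm_hom[OF nu z, of 0] by simp
    moreover have "defect S P a r (\<lambda>x. 0) = 0" using defect_scaleR[OF S True z r, of a 0] by simp
    ultimately have "ereal 0 \<le> F r" unfolding F_def
      by (intro SUP_upper2[of "\<lambda>x. 0"]) (use z in auto)
    then show ?thesis by (simp add: zero_ereal_def)
  qed
  have GF: "G r = F r" if "r > 0" for r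
  proof -
    have "r powi (- k) = r powr (- ?s)" using that powr_real_of_int'[of r "- k"] by simp
    then show ?thesis by (simp add: F_def G_def)
  qed
  have "has_jet \<nu> k S a P \<longleftrightarrow> (G \<longlongrightarrow> 0) (at_right 0)"
    using True unfolding has_jet_def G_def by blast
  also have "\<dots> \<longleftrightarrow> (F \<longlongrightarrow> 0) (at_right 0)"
    by (rule filterlim_cong) (auto simp: eventually_at_right_field GF intro!: exI[of _ 1])
  also have "\<dots> \<longleftrightarrow> (\<forall>e>0. \<exists>\<delta>>0. \<forall>r. 0 < r \<longrightarrow> r < \<delta> \<longrightarrow> close_at \<nu> S a r P (e * r powr ?s))"
  proof (intro iffI allI impI)
    fix e :: real assume L: "(F \<longlongrightarrow> 0) (at_right 0)" and e: "e > 0"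
    have "\<forall>\<^sub>F r in at_right 0. F r < ereal e" using order_tendstoD(2)[OF L, of "ereal e"] e by simp
    then obtain \<delta> where \<delta>: "\<delta> > 0" "\<And>r. 0 < r \<Longrightarrow> r < \<delta> \<Longrightarrow> F r < ereal e"
      by (auto simp: eventually_at_right_field)
    have "close_at \<nu> S a r P (e * r powr ?s)" if "0 < r" "r < \<delta>" for r
      using less_imp_le[OF \<delta>(2)[OF that]] F[OF that(1), of e] by blast
    then show "\<exists>\<delta>>0. \<forall>r. 0 < r \<longrightarrow> r < \<delta> \<longrightarrow> close_at \<nu> S a r P (e * r powr ?s)"
      using \<delta>(1) by blast
  next
    assume R: "\<forall>e>0. \<exists>\<delta>>0. \<forall>r. 0 < r \<longrightarrow> r < \<delta> \<longrightarrow> close_at \<nu> S a r P (e * r powr ?s)"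
    show "(F \<longlongrightarrow> 0) (at_right 0)"
    proof (rule order_tendstoI)
      fix l :: ereal assume "l < 0"
      then have "l < F r" if "r > 0" for r using F0[OF that] by (rule order_less_le_trans)
      then show "\<forall>\<^sub>F r in at_right 0. l < F r"
        unfolding eventually_at_right_field by (intro exI[of _ 1]) simp
    next
      fix u :: ereal assume "0 < u"
      then obtain e where e: "0 < e" "ereal e < u" using ereal_dense2[of 0 u] by (auto simp: zero_ereal_def)
      then obtain \<delta> where \<delta>: "\<delta> > 0" "\<And>r. 0 < r \<Longrightarrow> r < \<delta> \<Longrightarrow> close_at \<nu> S a r P (e * r powr ?s)"
        using R by blast
      have "F r < u" if "0 < r" "r < \<delta>" for r
      proof -
        have "F r \<le> ereal e" using F[OF that(1), of e] \<delta>(2)[OF that] by blast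
        then show ?thesis using e(2) by (rule order_le_less_trans)
      qed
      then show "\<forall>\<^sub>F r in at_right 0. F r < u"
        unfolding eventually_at_right_field using \<delta>(1) by blast
    qed
  qed
  also have "\<dots> \<longleftrightarrow> (\<forall>e>0. \<exists>\<delta>>0. (a, P) \<in> approx_set \<nu> S k ?s e \<delta>)"
    using True unfolding approx_set_def mem_Collect_eq prod.case by blast
  finally show ?thesis .
next
  case False
  then show ?thesis unfolding has_jet_def approx_set_def mem_Collect_eq prod.case
    using zero_less_one by blast
qed

lemma approx_set_poly_norm_close:
  fixes \<nu> :: "(real^'n \<Rightarrow> 'y::banach) \<Rightarrow> real"
  assumes nu: "cont_seminorm_on (cball 0 1) \<nu>"
  shows "\<exists>C>0. \<forall>S c1 c2 \<delta>1 \<delta>2 a a1 a2 P1 P2 \<rho>. S \<in> distributions \<longrightarrow> (a1, P1) \<in> approx_set \<nu> S k s c1 \<delta>1 \<longrightarrow>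
    (a2, P2) \<in> approx_set \<nu> S k s c2 \<delta>2 \<longrightarrow> 0 < \<rho> \<longrightarrow> 8 * \<rho> < \<delta>1 \<longrightarrow> 8 * \<rho> < \<delta>2 \<longrightarrow>
    norm (a1 - a) \<le> \<rho> \<longrightarrow> norm (a2 - a) \<le> \<rho> \<longrightarrow>
    poly_norm k (\<lambda>x. P1 x - P2 x) \<le> C * (c1 + c2) * \<rho> powr s * ((\<rho> + 1 + norm a) / \<rho>) ^ nat k"
proof -
  obtain C where C0: "C > 0" and C: "\<forall>S a a1 a2 \<rho> P1 P2 e1 e2. S \<in> distributions \<longrightarrow> P1 \<in> poly_upto k \<longrightarrow> P2 \<in> poly_upto k \<longrightarrow>
    0 < \<rho> \<longrightarrow> norm (a1 - a) \<le> \<rho> \<longrightarrow> norm (a2 - a) \<le> \<rho> \<longrightarrow>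
    close_at \<nu> S a1 (4 * \<rho>) P1 (e1 * (4 * \<rho>) powr s) \<longrightarrow> close_at \<nu> S a2 (8 * \<rho>) P2 (e2 * (8 * \<rho>) powr s) \<longrightarrow>
    poly_norm k (\<lambda>x. P1 x - P2 x) \<le> C * (e1 + e2) * \<rho> powr s * ((\<rho> + 1 + norm a) / \<rho>) ^ nat k"
    using approximations_poly_norm_close[OF nu, of k s] by (elim exE conjE) (rule that)
  show ?thesis
  proof (intro exI[of _ C] conjI C0 allI impI)
    fix S c1 c2 \<delta>1 \<delta>2 a a1 a2 P1 P2 and \<rho> :: real
    assume S: "S \<in> distributions" and 1: "(a1, P1) \<in> approx_set \<nu> S k s c1 \<delta>1"
      and 2: "(a2, P2) \<in> approx_set \<nu> S k s c2 \<delta>2" and \<rho>: "0 < \<rho>" "8 * \<rho> < \<delta>1" "8 * \<rho> < \<delta>2"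
      and a: "norm (a1 - a) \<le> \<rho>" "norm (a2 - a) \<le> \<rho>"
    show "poly_norm k (\<lambda>x. P1 x - P2 x) \<le> C * (c1 + c2) * \<rho> powr s * ((\<rho> + 1 + norm a) / \<rho>) ^ nat k"
      by (rule C[rule_format, OF S approx_setD(1)[OF 1] approx_setD(1)[OF 2] \<rho>(1) a approx_setD(2)[OF 1] approx_setD(2)[OF 2]])
        (use \<rho> in auto)
  qed
qed

text \<open>Each defining inequality involves a single test function and a single scale and is preserved in the limit.\<close>

lemma approx_set_closed:
  fixes Ps :: "nat \<Rightarrow> real^'n \<Rightarrow> ('y::banach \<Rightarrow>\<^sub>L real)"
  assumes S: "S \<in> distributions" and mem: "\<And>i. (as i, Ps i) \<in> approx_set \<nu> S k s c \<delta>"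
    and a: "as \<longlonglongrightarrow> a" and w: "wconv k Ps P"
  shows "(a, P) \<in> approx_set \<nu> S k s c \<delta>"
proof -
  have "defect S P a r \<theta> \<le> c * r powr s"
    if r: "0 < r" "r < \<delta>" and \<theta>: "\<theta> \<in> test_fun_in (cball 0 1)" "\<nu> \<theta> \<le> 1" for r \<theta>
  proof -
    have "(\<lambda>i. defect S (Ps i) (as i) r \<theta>) \<longlonglongrightarrow> defect S P a r \<theta>"
      by (rule defect_tendsto[OF S w tconv_const[OF \<theta>(1)] a tendsto_const r(1) r(1)])
    moreover have "defect S (Ps i) (as i) r \<theta> \<le> c * r powr s" for i
      using approx_setD(2)[OF mem r] \<theta> by (simp add: close_at_def)
    ultimately show ?thesis by (intro LIMSEQ_le_const2[of _ "defect S P a r \<theta>"]) auto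
  qed
  then show ?thesis using w by (simp add: approx_set_def close_at_def wconv_def)
qed

lemma scale_cancel: "\<rho> > 0 \<Longrightarrow> k \<ge> 0 \<Longrightarrow> \<rho> powr real_of_int k * (X / \<rho>) ^ nat k = X ^ nat k"
proof -
  assume "\<rho> > 0" "k \<ge> 0"
  then have "\<rho> powr real_of_int k = \<rho> ^ nat k"
    using powr_realpow[of \<rho> "nat k"] by simp
  then show ?thesis using \<open>\<rho> > 0\<close> by (simp add: power_divide)
qed

text \<open>The approximations form a Cauchy sequence by the comparison estimate at a common small scale. That the limit
  \<open>Q\<close> is a jet needs more, since the error of \<open>P\<^sub>p\<close> must be compared with that of \<open>Q\<close> on all test functions
  with \<open>\<nu>(\<theta>) \<le> 1\<close>, and \<open>\<nu>\<close> need not control the integral of \<open>\<parallel>\<theta>\<parallel>\<close>: smallness of \<open>\<parallel>P\<^sub>p - Q\<parallel>\<close> does not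
  suffice. Instead, \<open>P\<^sub>p - P\<^sub>q\<close> paired with \<open>\<theta>\<close> is small at scales below both \<open>\<delta> p\<close> and \<open>\<delta> q\<close>. As a
  function of the scale it is a polynomial of degree at most \<open>k\<close>, hence extrapolation bounds it at every scale
  \<open>R\<close> by a multiple of \<open>R\<^sup>k / p + R\<^sup>k / q\<close>. Then \<open>q\<close> tends to infinity.\<close>

lemma jet_exists:
  fixes Ps :: "nat \<Rightarrow> real^'n \<Rightarrow> ('y::banach \<Rightarrow>\<^sub>L real)"
  assumes nu: "cont_seminorm_on (cball 0 1) \<nu>" and S: "S \<in> distributions" and k: "k \<ge> 0"
    and mem: "\<And>p. (a, Ps p) \<in> approx_set \<nu> S k (real_of_int k) (1 / real (Suc p)) (\<delta> p)" and \<delta>: "\<And>p. \<delta> p > 0"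
  shows "\<exists>P. has_jet \<nu> k S a P \<and> (\<lambda>p. poly_norm k (\<lambda>x. Ps p x - P x)) \<longlonglongrightarrow> 0"
proof -
  let ?s = "real_of_int k" and ?K = "nat (k + 1)" and ?e = "\<lambda>p. 1 / real (Suc p)"
  have P: "Ps p \<in> poly_upto k" for p by (rule approx_setD(1)[OF mem])
  obtain C where C0: "C > 0" and C: "\<forall>S c1 c2 \<delta>1 \<delta>2 a a1 a2 P1 P2 \<rho>. S \<in> distributions \<longrightarrow> (a1, P1) \<in> approx_set \<nu> S k ?s c1 \<delta>1 \<longrightarrow>
    (a2, P2) \<in> approx_set \<nu> S k ?s c2 \<delta>2 \<longrightarrow> 0 < \<rho> \<longrightarrow> 8 * \<rho> < \<delta>1 \<longrightarrow> 8 * \<rho> < \<delta>2 \<longrightarrow>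
    norm (a1 - a) \<le> \<rho> \<longrightarrow> norm (a2 - a) \<le> \<rho> \<longrightarrow>
    poly_norm k (\<lambda>x. P1 x - P2 x) \<le> C * (c1 + c2) * \<rho> powr ?s * ((\<rho> + 1 + norm a) / \<rho>) ^ nat k"
    using approx_set_poly_norm_close[OF nu, of k ?s] by (elim exE conjE) (rule that)
  define B where "B = C * (2 + norm a) ^ nat k"
  have B0: "B > 0" unfolding B_def using C0 by (intro mult_pos_pos zero_less_power add_pos_nonneg) auto
  have diff: "poly_norm k (\<lambda>x. Ps p x - Ps q x) \<le> B * (?e p + ?e q)" for p q
  proof -
    define \<rho> where "\<rho> = min 1 (min (\<delta> p) (\<delta> q) / 16)"
    have \<rho>: "0 < \<rho>" "8 * \<rho> < \<delta> p" "8 * \<rho> < \<delta> q" "\<rho> \<le> 1" using \<delta>[of p] \<delta>[of q] by (auto simp: \<rho>_def)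
    have "poly_norm k (\<lambda>x. Ps p x - Ps q x)
        \<le> C * (?e p + ?e q) * \<rho> powr ?s * ((\<rho> + 1 + norm a) / \<rho>) ^ nat k"
      by (rule C[rule_format, OF S mem mem \<rho>(1-3), of a]) (use \<rho> in auto)
    also have "\<dots> = C * (?e p + ?e q) * (\<rho> + 1 + norm a) ^ nat k"
      by (simp only: mult.assoc scale_cancel[OF \<rho>(1) k])
    also have "\<dots> \<le> C * (?e p + ?e q) * (2 + norm a) ^ nat k"
      using \<rho> C0 by (intro mult_left_mono power_mono) (auto simp: add_nonneg_nonneg)
    finally show ?thesis by (simp add: B_def mult_ac)
  qed
  have e_small: "\<exists>N. \<forall>p\<ge>N. ?e p \<le> d" if d: "d > 0" for d :: real
  proof -
    obtain N where N: "inverse (real (Suc N)) < d" using reals_Archimedean[OF d] by blast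
    have "?e p \<le> d" if "p \<ge> N" for p
    proof -
      have "?e p \<le> ?e N" using that by (intro divide_left_mono) auto
      then show ?thesis using N by (simp add: inverse_eq_divide)
    qed
    then show ?thesis by blast
  qed
  have "\<exists>P\<in>poly_upto k. (\<lambda>i. poly_norm k (\<lambda>x. Ps i x - P x)) \<longlonglongrightarrow> 0"
  proof (rule poly_complete[OF P])
    fix e :: real assume e: "e > 0"
    obtain N where N: "\<forall>p\<ge>N. ?e p \<le> e / (2 * B)" using e_small[of "e / (2 * B)"] e B0 by auto
    have "poly_norm k (\<lambda>x. Ps i x - Ps j x) \<le> e" if "i \<ge> N" "j \<ge> N" for i j
    proof -
      have "?e i + ?e j \<le> e / (2 * B) + e / (2 * B)" using N that by (intro add_mono) auto
      then have "B * (?e i + ?e j) \<le> B * (e / (2 * B) + e / (2 * B))" using B0 by (intro mult_left_mono) auto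
      also have "\<dots> = e" using B0 by simp
      finally show ?thesis using diff[of i j] by linarith
    qed
    then show "\<exists>N. \<forall>i\<ge>N. \<forall>j\<ge>N. poly_norm k (\<lambda>x. Ps i x - Ps j x) \<le> e" by blast
  qed
  then obtain Q where Q: "Q \<in> poly_upto k" and lim: "(\<lambda>i. poly_norm k (\<lambda>x. Ps i x - Q x)) \<longlonglongrightarrow> 0" by blast
  have w: "wconv k Ps Q" by (rule wconvI_poly_norm[OF Q P lim])
  obtain W where W0: "W > 0" and W: "\<And>t. t \<ge> 1 \<Longrightarrow>
      \<exists>w. (\<forall>j. \<bar>w j\<bar> \<le> W * t ^ (?K - 1)) \<and> (\<forall>m<?K. (\<Sum>j<?K. w j * node j ^ m) = t ^ m)"
    using extrapolation_weights[of ?K] by blast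
  have K1: "?K - 1 = nat k" by simp
  define V where "V = real ?K * W"
  have V0: "V \<ge> 0" using W0 by (simp add: V_def)
  have pair: "\<bar>pairing (\<lambda>x. Ps p (a + R *\<^sub>R x) - Ps q (a + R *\<^sub>R x)) \<theta>\<bar> \<le> V * (?e p + ?e q) * R ^ nat k"
    if R: "R > 0" and \<theta>: "\<theta> \<in> test_fun_in (cball 0 1)" "\<nu> \<theta> \<le> 1" for R p q \<theta>
  proof -
    \<comment> \<open>Below the scale \<open>\<tau>\<close> both approximations are effective, and the bound is extrapolated
      from \<open>\<tau>\<close> to \<open>R\<close>.\<close>
    define \<tau> where "\<tau> = min R (min (\<delta> p) (\<delta> q) / 2)"
    have \<tau>: "0 < \<tau>" "\<tau> \<le> R" "\<tau> < \<delta> p" "\<tau> < \<delta> q" using \<delta>[of p] \<delta>[of q] R by (auto simp: \<tau>_def)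
    define D where "D = (\<lambda>x. Ps p x - Ps q x)"
    have D: "D \<in> poly_upto k" unfolding D_def by (rule poly_diff[OF P P])
    have small: "\<bar>pairing (\<lambda>x. D (a + r *\<^sub>R x)) \<theta>\<bar> \<le> (?e p + ?e q) * r ^ nat k" if r: "0 < r" "r \<le> \<tau>" for r
    proof -
      have rr: "r < \<delta> p" "r < \<delta> q" using r \<tau> by auto
      have "\<bar>defect S (Ps p) a r \<theta>\<bar> \<le> (?e p * r powr ?s) * 1"
        by (rule close_at_abs[OF nu S P r(1) approx_setD(2)[OF mem r(1) rr(1)] \<theta>]) simp
      moreover have "\<bar>defect S (Ps q) a r \<theta>\<bar> \<le> (?e q * r powr ?s) * 1"
        by (rule close_at_abs[OF nu S P r(1) approx_setD(2)[OF mem r(1) rr(2)] \<theta>]) simp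
      moreover have "pairing (\<lambda>x. D (a + r *\<^sub>R x)) \<theta> = defect S (Ps q) a r \<theta> - defect S (Ps p) a r \<theta>"
        unfolding D_def by (rule defect_diff[OF P P \<theta>(1) r(1)])
      moreover have "r powr ?s = r ^ nat k" using powr_realpow[OF r(1), of "nat k"] k by simp
      ultimately show ?thesis by (simp only: mult_1_right distrib_right)
    qed
    have t: "R / \<tau> \<ge> 1" using \<tau> by simp
    obtain w where w: "\<And>j. \<bar>w j\<bar> \<le> W * (R / \<tau>) ^ nat k" "\<forall>m<?K. (\<Sum>j<?K. w j * node j ^ m) = (R / \<tau>) ^ m"
      using W[OF t] unfolding K1 by blast
    have "pairing (\<lambda>x. D (a + R *\<^sub>R x)) \<theta>
        = (\<integral>x. (\<Sum>j<?K. w j * blinfun_apply (D (a + (node j * \<tau>) *\<^sub>R x)) (\<theta> x)) \<partial>lebesgue)"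
      unfolding pairing_def
    proof (rule Bochner_Integration.integral_cong[OF refl])
      fix x :: "real^'n"
      have "D (a + R *\<^sub>R x) = (\<Sum>j<?K. w j *\<^sub>R D (a + node j *\<^sub>R (\<tau> *\<^sub>R x)))"
        using poly_extrapolate[OF D w(2), of a "\<tau> *\<^sub>R x"] \<tau> by simp
      then show "blinfun_apply (D (a + R *\<^sub>R x)) (\<theta> x) = (\<Sum>j<?K. w j * blinfun_apply (D (a + (node j * \<tau>) *\<^sub>R x)) (\<theta> x))"
        by (simp add: blinfun.sum_left blinfun.scaleR_left)
    qed
    also have "\<dots> = (\<Sum>j<?K. w j * pairing (\<lambda>x. D (a + (node j * \<tau>) *\<^sub>R x)) \<theta>)"
      unfolding pairing_def
      by (subst Bochner_Integration.integral_sum) (auto intro!: integrable_mult_right integrable_poly_pairing[OF D \<theta>(1)])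
    finally have eq: "pairing (\<lambda>x. D (a + R *\<^sub>R x)) \<theta> = (\<Sum>j<?K. w j * pairing (\<lambda>x. D (a + (node j * \<tau>) *\<^sub>R x)) \<theta>)" .
    have "\<bar>pairing (\<lambda>x. D (a + R *\<^sub>R x)) \<theta>\<bar> \<le> (\<Sum>j<?K. (W * (R / \<tau>) ^ nat k) * ((?e p + ?e q) * \<tau> ^ nat k))"
      unfolding eq
    proof (rule order_trans[OF sum_abs sum_mono])
      fix j
      have n: "0 < node j * \<tau>" "node j * \<tau> \<le> \<tau>" using node_bounds[of j] \<tau>(1) by (simp_all add: mult_left_le_one_le)
      have "\<bar>pairing (\<lambda>x. D (a + (node j * \<tau>) *\<^sub>R x)) \<theta>\<bar> \<le> (?e p + ?e q) * (node j * \<tau>) ^ nat k" by (rule small[OF n])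
      also have "\<dots> \<le> (?e p + ?e q) * \<tau> ^ nat k" using n by (intro mult_left_mono power_mono) auto
      finally have "\<bar>pairing (\<lambda>x. D (a + (node j * \<tau>) *\<^sub>R x)) \<theta>\<bar> \<le> (?e p + ?e q) * \<tau> ^ nat k" .
      then show "\<bar>w j * pairing (\<lambda>x. D (a + (node j * \<tau>) *\<^sub>R x)) \<theta>\<bar>
          \<le> (W * (R / \<tau>) ^ nat k) * ((?e p + ?e q) * \<tau> ^ nat k)"
        unfolding abs_mult using w(1)[of j] W0 R \<tau>(1) by (intro mult_mono) auto
    qed
    also have "\<dots> = V * (?e p + ?e q) * R ^ nat k"
      using \<tau>(1) by (simp add: V_def power_divide)
    finally show ?thesis by (simp only: D_def)
  qed
  have pairQ: "\<bar>pairing (\<lambda>x. Ps p (a + R *\<^sub>R x) - Q (a + R *\<^sub>R x)) \<theta>\<bar> \<le> V * ?e p * R ^ nat k"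
    if R: "R > 0" and \<theta>: "\<theta> \<in> test_fun_in (cball 0 1)" "\<nu> \<theta> \<le> 1" for R p \<theta>
  proof -
    have "(\<lambda>q. pairing (\<lambda>x. Ps q (a + R *\<^sub>R x)) \<theta>) \<longlonglongrightarrow> pairing (\<lambda>x. Q (a + R *\<^sub>R x)) \<theta>"
      by (rule pairing_tendsto[OF w tconv_const[OF \<theta>(1)] tendsto_const tendsto_const])
    then have "(\<lambda>q. \<bar>pairing (\<lambda>x. Ps p (a + R *\<^sub>R x)) \<theta> - pairing (\<lambda>x. Ps q (a + R *\<^sub>R x)) \<theta>\<bar>)
        \<longlonglongrightarrow> \<bar>pairing (\<lambda>x. Ps p (a + R *\<^sub>R x)) \<theta> - pairing (\<lambda>x. Q (a + R *\<^sub>R x)) \<theta>\<bar>"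
      by (intro tendsto_rabs tendsto_diff tendsto_const)
    moreover have "(\<lambda>q. V * (?e p + ?e q) * R ^ nat k) \<longlonglongrightarrow> V * (?e p + 0) * R ^ nat k"
      using LIMSEQ_inverse_real_of_nat
      by (intro tendsto_mult tendsto_add tendsto_const) (simp add: inverse_eq_divide)
    moreover have "\<exists>N. \<forall>q\<ge>N. \<bar>pairing (\<lambda>x. Ps p (a + R *\<^sub>R x)) \<theta> - pairing (\<lambda>x. Ps q (a + R *\<^sub>R x)) \<theta>\<bar> \<le> V * (?e p + ?e q) * R ^ nat k"
      using pair[OF R \<theta>, of p] pairing_diff[OF P P \<theta>(1), of p a R] by simp
    ultimately have "\<bar>pairing (\<lambda>x. Ps p (a + R *\<^sub>R x)) \<theta> - pairing (\<lambda>x. Q (a + R *\<^sub>R x)) \<theta>\<bar> \<le> V * (?e p + 0) * R ^ nat k"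
      by (rule LIMSEQ_le)
    then show ?thesis using pairing_diff[OF P Q \<theta>(1), of p a R] by simp
  qed
  have approx: "(a, Q) \<in> approx_set \<nu> S k ?s ((1 + V) * ?e p) (\<delta> p)" for p
  proof -
    have "defect S Q a r \<theta> \<le> (1 + V) * ?e p * r powr ?s"
      if r: "0 < r" "r < \<delta> p" and \<theta>: "\<theta> \<in> test_fun_in (cball 0 1)" "\<nu> \<theta> \<le> 1" for r \<theta>
    proof -
      have "defect S (Ps p) a r \<theta> \<le> ?e p * r powr ?s"
        using approx_setD(2)[OF mem r] \<theta> by (simp add: close_at_def)
      moreover have "pairing (\<lambda>x. Ps p (a + r *\<^sub>R x) - Q (a + r *\<^sub>R x)) \<theta> = defect S Q a r \<theta> - defect S (Ps p) a r \<theta>"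
        by (rule defect_diff[OF P Q \<theta>(1) r(1)])
      moreover have "r powr ?s = r ^ nat k" using powr_realpow[OF r(1), of "nat k"] k by simp
      ultimately have "defect S Q a r \<theta> \<le> ?e p * r powr ?s + V * ?e p * r powr ?s"
        using pairQ[OF r(1) \<theta>, of p] by (simp only:)
      then show ?thesis by (simp only: distrib_right mult_1)
    qed
    then show ?thesis using Q by (simp add: approx_set_def close_at_def)
  qed
  have "has_jet \<nu> k S a Q"
    unfolding has_jet_iff[OF nu S]
  proof (intro allI impI)
    fix e :: real assume e: "e > 0"
    obtain p where p: "?e p \<le> e / (1 + V)" using e_small[of "e / (1 + V)"] e V0 by (auto simp: add_pos_nonneg)
    then have "(1 + V) * ?e p \<le> e" using V0 by (simp add: le_divide_eq mult.commute)
    then have "(a, Q) \<in> approx_set \<nu> S k ?s e (\<delta> p)"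
      using approx[of p] approx_set_mono[of "(1 + V) * ?e p" e "\<delta> p" "\<delta> p"] by blast
    then show "\<exists>\<delta>>0. (a, Q) \<in> approx_set \<nu> S k ?s e \<delta>" using \<delta>[of p] by blast
  qed
  then show ?thesis using lim by blast
qed

lemma jet_unique:
  fixes P :: "real^'n \<Rightarrow> ('y::banach \<Rightarrow>\<^sub>L real)"
  assumes nu: "cont_seminorm_on (cball 0 1) \<nu>" and S: "S \<in> distributions" and k: "k \<ge> 0"
    and P: "has_jet \<nu> k S a P" and Q: "has_jet \<nu> k S a Q"
  shows "P = Q"
proof (rule poly_norm_eq_0D)
  let ?s = "real_of_int k"
  show PQ: "P \<in> poly_upto k" "Q \<in> poly_upto k" using P Q by (auto simp: has_jet_def)
  obtain C where C0: "C > 0" and C: "\<forall>S c1 c2 \<delta>1 \<delta>2 a a1 a2 P1 P2 \<rho>. S \<in> distributions \<longrightarrow> (a1, P1) \<in> approx_set \<nu> S k ?s c1 \<delta>1 \<longrightarrow>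
    (a2, P2) \<in> approx_set \<nu> S k ?s c2 \<delta>2 \<longrightarrow> 0 < \<rho> \<longrightarrow> 8 * \<rho> < \<delta>1 \<longrightarrow> 8 * \<rho> < \<delta>2 \<longrightarrow>
    norm (a1 - a) \<le> \<rho> \<longrightarrow> norm (a2 - a) \<le> \<rho> \<longrightarrow>
    poly_norm k (\<lambda>x. P1 x - P2 x) \<le> C * (c1 + c2) * \<rho> powr ?s * ((\<rho> + 1 + norm a) / \<rho>) ^ nat k"
    using approx_set_poly_norm_close[OF nu, of k ?s] by (elim exE conjE) (rule that)
  define B where "B = C * (2 + norm a) ^ nat k"
  have B0: "B > 0" unfolding B_def using C0 by (intro mult_pos_pos zero_less_power add_pos_nonneg) auto
  have le: "poly_norm k (\<lambda>x. P x - Q x) \<le> e" if e: "e > 0" for e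
  proof -
    define d where "d = e / (2 * B)"
    have d: "d > 0" using e B0 by (simp add: d_def)
    obtain \<delta>1 where 1: "\<delta>1 > 0" "(a, P) \<in> approx_set \<nu> S k ?s d \<delta>1" using P d has_jet_iff[OF nu S] by blast
    obtain \<delta>2 where 2: "\<delta>2 > 0" "(a, Q) \<in> approx_set \<nu> S k ?s d \<delta>2" using Q d has_jet_iff[OF nu S] by blast
    define \<rho> where "\<rho> = min 1 (min \<delta>1 \<delta>2 / 16)"
    have \<rho>: "0 < \<rho>" "8 * \<rho> < \<delta>1" "8 * \<rho> < \<delta>2" "\<rho> \<le> 1" using 1(1) 2(1) by (auto simp: \<rho>_def)
    have "poly_norm k (\<lambda>x. P x - Q x) \<le> C * (d + d) * \<rho> powr ?s * ((\<rho> + 1 + norm a) / \<rho>) ^ nat k"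
      by (rule C[rule_format, OF S 1(2) 2(2) \<rho>(1-3), of a]) (use \<rho> in auto)
    also have "\<dots> = C * (d + d) * (\<rho> + 1 + norm a) ^ nat k"
      by (simp only: mult.assoc scale_cancel[OF \<rho>(1) k])
    also have "\<dots> \<le> C * (d + d) * (2 + norm a) ^ nat k"
      using \<rho> C0 d by (intro mult_left_mono power_mono) (auto simp: add_nonneg_nonneg)
    also have "\<dots> = B * (2 * d)" by (simp add: B_def)
    also have "\<dots> = e" using B0 by (simp add: d_def)
    finally show ?thesis .
  qed
  show "poly_norm k (\<lambda>x. P x - Q x) \<le> 0"
  proof (rule ccontr)
    assume "\<not> poly_norm k (\<lambda>x. P x - Q x) \<le> 0"
    then show False using le[of "poly_norm k (\<lambda>x. P x - Q x) / 2"] by simp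
  qed
qed

section \<open>Borel sets and partially defined Borel functions\<close>

lemma sigma_algebra_borel_in: "sigma_algebra (topspace X) (borel_in X)"
  unfolding borel_in_def by (rule sigma_algebra_sigma_sets) (auto dest: openin_subset)

lemma borel_in_openin: "openin X U \<Longrightarrow> U \<in> borel_in X"
  unfolding borel_in_def by (rule sigma_sets.Basic) simp

lemma borel_in_diff: "A \<in> borel_in X \<Longrightarrow> B \<in> borel_in X \<Longrightarrow> A - B \<in> borel_in X"
proof -
  interpret sigma_algebra "topspace X" "borel_in X" by (rule sigma_algebra_borel_in)
  show "A \<in> borel_in X \<Longrightarrow> B \<in> borel_in X \<Longrightarrow> A - B \<in> borel_in X" by (rule Diff)
qed

lemma borel_in_Int: "A \<in> borel_in X \<Longrightarrow> B \<in> borel_in X \<Longrightarrow> A \<inter> B \<in> borel_in X"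
proof -
  interpret sigma_algebra "topspace X" "borel_in X" by (rule sigma_algebra_borel_in)
  show "A \<in> borel_in X \<Longrightarrow> B \<in> borel_in X \<Longrightarrow> A \<inter> B \<in> borel_in X" by (rule Int)
qed

lemma borel_in_closedin: "closedin X C \<Longrightarrow> C \<in> borel_in X"
  using borel_in_diff[OF borel_in_openin[OF openin_topspace[of X]] borel_in_openin[of X "topspace X - C"]]
  by (auto simp: closedin_def double_diff)

lemma borel_in_UN: "(\<And>i::nat. A i \<in> borel_in X) \<Longrightarrow> (\<Union>i. A i) \<in> borel_in X"
  unfolding borel_in_def by (rule sigma_sets.Union)

lemma borel_in_INT: "(\<And>i::nat. A i \<in> borel_in X) \<Longrightarrow> (\<Inter>i. A i) \<in> borel_in X"
proof -
  interpret sigma_algebra "topspace X" "borel_in X" by (rule sigma_algebra_borel_in)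
  show "(\<And>i::nat. A i \<in> borel_in X) \<Longrightarrow> (\<Inter>i. A i) \<in> borel_in X"
    by (rule countable_INT) auto
qed

text \<open>Closed sets suffice, since the sets with Borel preimage form a \<open>\<sigma>\<close>-algebra; complements are taken relative to
  the domain, whence the assumption on it.\<close>

lemma borel_pfunI:
  assumes sub: "F \<subseteq> topspace X \<times> topspace Z" and sv: "single_valued F"
    and dom: "Domain F \<in> borel_in X"
    and closed: "\<And>C. closedin Z C \<Longrightarrow> F\<inverse> `` C \<in> borel_in X"
  shows "borel_pfun X Z F"
  unfolding borel_pfun_def
proof (intro conjI ballI sub sv)
  fix B assume "B \<in> borel_in Z"
  then have "B \<in> sigma_sets (topspace Z) {U. openin Z U}" by (simp add: borel_in_def)
  then show "F\<inverse> `` B \<in> borel_in X"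
  proof induction
    case (Basic U)
    have "F\<inverse> `` U = Domain F - F\<inverse> `` (topspace Z - U)"
      using sub sv openin_subset[of Z U] Basic unfolding single_valued_def by fast
    moreover have "closedin Z (topspace Z - U)"
      using Basic by (intro closedin_diff closedin_topspace) simp
    ultimately show ?case using closed[of "topspace Z - U"] dom by (simp add: borel_in_diff)
  next
    case Empty
    show ?case using borel_in_openin[OF openin_empty[of X]] by simp
  next
    case (Compl A)
    have "F\<inverse> `` (topspace Z - A) = Domain F - F\<inverse> `` A"
      using sub sv unfolding single_valued_def by fast
    then show ?case using Compl.IH dom by (simp add: borel_in_diff)
  next
    case (Union A)
    have "F\<inverse> `` (\<Union>i. A i) = (\<Union>i. F\<inverse> `` A i)" by blast
    then show ?case using Union.IH by (simp add: borel_in_UN)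
  qed
qed

section \<open>Topology of the space of pairs of points and polynomials\<close>

lemma openin_poly_ball:
  fixes P :: "real^'n \<Rightarrow> ('y::banach \<Rightarrow>\<^sub>L real)"
  assumes "P \<in> poly_upto k"
  shows "openin (poly_top k) {Q \<in> poly_upto k. poly_norm k (\<lambda>x. Q x - P x) < e}"
  unfolding openin_poly_top
proof (intro conjI ballI)
  fix Q assume "Q \<in> {Q \<in> poly_upto k. poly_norm k (\<lambda>x. Q x - P x) < e}"
  then have Q: "Q \<in> poly_upto k" "poly_norm k (\<lambda>x. Q x - P x) < e" by auto
  show "\<exists>d>0. \<forall>R\<in>poly_upto k. poly_norm k (\<lambda>x. R x - Q x) < d \<longrightarrow> R \<in> {Q \<in> poly_upto k. poly_norm k (\<lambda>x. Q x - P x) < e}"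
  proof (intro exI[of _ "e - poly_norm k (\<lambda>x. Q x - P x)"] conjI ballI impI)
    fix R assume R: "R \<in> poly_upto k" "poly_norm k (\<lambda>x. R x - Q x) < e - poly_norm k (\<lambda>x. Q x - P x)"
    then show "R \<in> {Q \<in> poly_upto k. poly_norm k (\<lambda>x. Q x - P x) < e}"
      using poly_norm_triangle[OF R(1) Q(1) assms] by simp
  qed (use Q in simp)
qed auto

lemma one_over_Suc_null: "(\<lambda>i. 1 / real (Suc i)) \<longlonglongrightarrow> 0"
  using LIMSEQ_inverse_real_of_nat by (simp add: inverse_eq_divide)

text \<open>The product of a Euclidean space with a normed space is first countable, so sequences detect closedness.\<close>

lemma closedin_prod_poly_seqI:
  fixes C :: "((real^'n) \<times> (real^'n \<Rightarrow> ('y::banach \<Rightarrow>\<^sub>L real))) set"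
  assumes sub: "C \<subseteq> UNIV \<times> poly_upto k"
    and seq: "\<And>as Ps a P. (\<And>i. (as i, Ps i) \<in> C) \<Longrightarrow> as \<longlonglongrightarrow> a \<Longrightarrow> P \<in> poly_upto k \<Longrightarrow>
       (\<lambda>i. poly_norm k (\<lambda>x. Ps i x - P x)) \<longlonglongrightarrow> 0 \<Longrightarrow> (a, P) \<in> C"
  shows "closedin (prod_topology euclidean (poly_top k)) C"
  unfolding closedin_def topspace_prod_topology topspace_poly_top topspace_euclidean
proof (intro conjI sub)
  show "openin (prod_topology euclidean (poly_top k)) (UNIV \<times> poly_upto k - C)"
    unfolding openin_prod_topology_alt
  proof (intro allI impI)
    fix a P assume "(a, P) \<in> UNIV \<times> poly_upto k - C"
    then have P: "P \<in> poly_upto k" and nC: "(a, P) \<notin> C" by auto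
    let ?U = "\<lambda>i::nat. ball a (1 / real (Suc i))"
    let ?V = "\<lambda>i::nat. {Q \<in> poly_upto k. poly_norm k (\<lambda>x. Q x - P x) < 1 / real (Suc i)}"
    have "\<exists>i. ?U i \<times> ?V i \<inter> C = {}"
    proof (rule ccontr)
      assume "\<nexists>i. ?U i \<times> ?V i \<inter> C = {}"
      then have "\<forall>i. \<exists>z. z \<in> ?U i \<times> ?V i \<inter> C" by blast
      from choice[OF this] obtain z where z: "\<And>i. z i \<in> ?U i \<times> ?V i \<inter> C" by blast
      define as where "as = (\<lambda>i. fst (z i))"
      define Ps where "Ps = (\<lambda>i. snd (z i))"
      have zi: "(as i, Ps i) \<in> C" "dist a (as i) < 1 / real (Suc i)" "Ps i \<in> poly_upto k"
        "poly_norm k (\<lambda>x. Ps i x - P x) < 1 / real (Suc i)" for i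
        using z[of i] by (auto simp: as_def Ps_def mem_Times_iff)
      have "as \<longlonglongrightarrow> a"
      proof (rule metric_LIMSEQ_I)
        fix e :: real assume "e > 0"
        then obtain N where N: "1 / real (Suc N) < e" using reals_Archimedean[of e] by (auto simp: inverse_eq_divide)
        have "dist (as i) a < e" if "i \<ge> N" for i
        proof -
          have "1 / real (Suc i) \<le> 1 / real (Suc N)" using that by (intro divide_left_mono) auto
          then show ?thesis using zi(2)[of i] N by (simp add: dist_commute)
        qed
        then show "\<exists>N. \<forall>i\<ge>N. dist (as i) a < e" by blast
      qed
      moreover have "(\<lambda>i. poly_norm k (\<lambda>x. Ps i x - P x)) \<longlonglongrightarrow> 0"
      proof (rule tendsto_sandwich[OF _ _ tendsto_const one_over_Suc_null])
        show "\<forall>\<^sub>F i in sequentially. 0 \<le> poly_norm k (\<lambda>x. Ps i x - P x)"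
          by (intro always_eventually allI poly_norm_nonneg poly_diff zi(3) P)
        show "\<forall>\<^sub>F i in sequentially. poly_norm k (\<lambda>x. Ps i x - P x) \<le> 1 / real (Suc i)"
          by (intro always_eventually allI less_imp_le zi(4))
      qed
      ultimately have "(a, P) \<in> C" by (intro seq[OF zi(1) _ P])
      then show False using nC by simp
    qed
    then obtain i where i: "?U i \<times> ?V i \<inter> C = {}" by blast
    show "\<exists>U V. openin euclidean U \<and> openin (poly_top k) V \<and> a \<in> U \<and> P \<in> V \<and> U \<times> V \<subseteq> UNIV \<times> poly_upto k - C"
    proof (intro exI conjI)
      show "openin euclidean (?U i)" by simp
      show "openin (poly_top k) (?V i)" by (rule openin_poly_ball[OF P])
      show "a \<in> ?U i" by simp
      show "P \<in> ?V i" using P by (simp add: poly_norm_zero)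
      show "?U i \<times> ?V i \<subseteq> UNIV \<times> poly_upto k - C" using i by blast
    qed
  qed
qed

text \<open>The oscillation hypothesis makes \<open>E\<close> the graph of a uniformly continuous function. Completeness and
  sequential closedness make its domain closed, so \<open>E\<close> is a continuous image of a compact set.\<close>

lemma compact_uniform_graph:
  fixes E :: "((real^'n) \<times> (real^'n \<Rightarrow> ('y::banach \<Rightarrow>\<^sub>L real))) set"
  assumes sub: "E \<subseteq> cball 0 R \<times> poly_upto k"
    and osc: "\<And>e. e > 0 \<Longrightarrow> \<exists>\<rho>>0. \<forall>a1 P1 a2 P2. (a1, P1) \<in> E \<longrightarrow> (a2, P2) \<in> E \<longrightarrow> norm (a1 - a2) \<le> \<rho> \<longrightarrow>
       poly_norm k (\<lambda>x. P1 x - P2 x) \<le> e"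
    and seq: "\<And>as Ps a P. (\<And>i. (as i, Ps i) \<in> E) \<Longrightarrow> as \<longlonglongrightarrow> a \<Longrightarrow> P \<in> poly_upto k \<Longrightarrow>
       (\<lambda>i. poly_norm k (\<lambda>x. Ps i x - P x)) \<longlonglongrightarrow> 0 \<Longrightarrow> (a, P) \<in> E"
  shows "compactin (prod_topology euclidean (poly_top k)) E \<and> compact (fst ` E)"
proof -
  have poly: "P \<in> poly_upto k" if "(a, P) \<in> E" for a P using sub that by auto
  have "closed (fst ` E)"
    unfolding closed_sequential_limits
  proof (intro allI impI, elim conjE)
    fix as a assume mem: "\<forall>i. as i \<in> fst ` E" and lim: "as \<longlonglongrightarrow> a"
    have "\<forall>i. \<exists>P. (as i, P) \<in> E" using mem by force
    from choice[OF this] obtain Ps where Ps: "\<And>i. (as i, Ps i) \<in> E" by blast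
    have "\<exists>P\<in>poly_upto k. (\<lambda>i. poly_norm k (\<lambda>x. Ps i x - P x)) \<longlonglongrightarrow> 0"
    proof (rule poly_complete[OF poly[OF Ps]])
      fix e :: real assume "e > 0"
      then obtain \<rho> where \<rho>: "\<rho> > 0" "\<And>a1 P1 a2 P2. (a1, P1) \<in> E \<Longrightarrow> (a2, P2) \<in> E \<Longrightarrow> norm (a1 - a2) \<le> \<rho> \<Longrightarrow>
         poly_norm k (\<lambda>x. P1 x - P2 x) \<le> e" using osc by meson
      obtain N where N: "\<forall>i\<ge>N. \<forall>j\<ge>N. norm (as i - as j) < \<rho>"
        using CauchyD[OF LIMSEQ_imp_Cauchy[OF lim] \<rho>(1)] by blast
      have "poly_norm k (\<lambda>x. Ps i x - Ps j x) \<le> e" if "i \<ge> N" "j \<ge> N" for i j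
        by (rule \<rho>(2)[OF Ps Ps]) (use N that less_imp_le in blast)
      then show "\<exists>N. \<forall>i\<ge>N. \<forall>j\<ge>N. poly_norm k (\<lambda>x. Ps i x - Ps j x) \<le> e" by blast
    qed
    then obtain P where "P \<in> poly_upto k" "(\<lambda>i. poly_norm k (\<lambda>x. Ps i x - P x)) \<longlonglongrightarrow> 0" by blast
    then have "(a, P) \<in> E" by (rule seq[OF Ps lim])
    then show "a \<in> fst ` E" by force
  qed
  moreover have "bounded (fst ` E)"
    by (rule bounded_subset[OF bounded_cball[of 0 R]]) (use sub in auto)
  ultimately have comp: "compact (fst ` E)" by (simp add: compact_eq_bounded_closed)
  define f where "f = (\<lambda>a. SOME P. (a, P) \<in> E)"
  have f: "(a, f a) \<in> E" if "a \<in> fst ` E" for a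
  proof -
    have "\<exists>P. (a, P) \<in> E" using that by force
    from someI_ex[OF this] show ?thesis unfolding f_def .
  qed
  have uniq: "P = Q" if PQ: "(a, P) \<in> E" "(a, Q) \<in> E" for a P Q
  proof (rule poly_norm_eq_0D[OF poly[OF PQ(1)] poly[OF PQ(2)]])
    show "poly_norm k (\<lambda>x. P x - Q x) \<le> 0"
    proof (rule field_le_epsilon)
      fix e :: real assume "e > 0"
      then obtain \<rho> where \<rho>: "\<rho> > 0" "\<And>a1 P1 a2 P2. (a1, P1) \<in> E \<Longrightarrow> (a2, P2) \<in> E \<Longrightarrow> norm (a1 - a2) \<le> \<rho> \<Longrightarrow>
         poly_norm k (\<lambda>x. P1 x - P2 x) \<le> e" using osc by meson
      show "poly_norm k (\<lambda>x. P x - Q x) \<le> 0 + e" using \<rho>(2)[OF PQ] \<rho>(1) by simp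
    qed
  qed
  have "continuous_map (top_of_set (fst ` E)) (poly_top k) f"
    unfolding continuous_map_def
  proof (intro conjI allI impI)
    show "f \<in> topspace (top_of_set (fst ` E)) \<rightarrow> topspace (poly_top k)"
      using poly[OF f] by (auto simp: topspace_poly_top)
    fix U :: "(real^'n \<Rightarrow> ('y \<Rightarrow>\<^sub>L real)) set" assume "openin (poly_top k) U"
    then have U: "\<And>P. P \<in> U \<Longrightarrow> \<exists>e>0. \<forall>Q\<in>poly_upto k. poly_norm k (\<lambda>x. Q x - P x) < e \<longrightarrow> Q \<in> U"
      unfolding openin_poly_top by blast
    show "openin (top_of_set (fst ` E)) {x \<in> topspace (top_of_set (fst ` E)). f x \<in> U}"
      unfolding openin_euclidean_subtopology_iff
    proof (intro conjI ballI)
      fix a assume "a \<in> {x \<in> topspace (top_of_set (fst ` E)). f x \<in> U}"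
      then have a: "a \<in> fst ` E" "f a \<in> U" by auto
      obtain e where e: "e > 0" "\<forall>Q\<in>poly_upto k. poly_norm k (\<lambda>x. Q x - f a x) < e \<longrightarrow> Q \<in> U"
        using U[OF a(2)] by blast
      obtain \<rho> where \<rho>: "\<rho> > 0" "\<And>a1 P1 a2 P2. (a1, P1) \<in> E \<Longrightarrow> (a2, P2) \<in> E \<Longrightarrow> norm (a1 - a2) \<le> \<rho> \<Longrightarrow>
         poly_norm k (\<lambda>x. P1 x - P2 x) \<le> e / 2" using osc[of "e / 2"] e(1) by (meson half_gt_zero)
      have "f b \<in> U" if b: "b \<in> fst ` E" "dist b a < \<rho>" for b
      proof -
        have "poly_norm k (\<lambda>x. f b x - f a x) \<le> e / 2"
          by (rule \<rho>(2)[OF f[OF b(1)] f[OF a(1)]]) (use b(2) in \<open>simp add: dist_norm\<close>)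
        then have "poly_norm k (\<lambda>x. f b x - f a x) < e" using e(1) by linarith
        then show ?thesis using e(2) poly[OF f[OF b(1)]] by blast
      qed
      then show "\<exists>e>0. \<forall>x'\<in>fst ` E. dist x' a < e \<longrightarrow> x' \<in> {x \<in> topspace (top_of_set (fst ` E)). f x \<in> U}"
        using \<rho>(1) by (intro exI[of _ \<rho>]) simp
    qed auto
  qed
  then have cont: "continuous_map (top_of_set (fst ` E)) (prod_topology euclidean (poly_top k)) (\<lambda>a. (a, f a))"
    by (intro continuous_map_pairedI) (auto intro: continuous_map_from_subtopology)
  have "compactin (top_of_set (fst ` E)) (fst ` E)"
    using comp by (simp add: compactin_subtopology)
  then have "compactin (prod_topology euclidean (poly_top k)) ((\<lambda>a. (a, f a)) ` (fst ` E))"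
    by (rule image_compactin[OF _ cont])
  moreover have "(\<lambda>a. (a, f a)) ` (fst ` E) = E"
  proof
    show "(\<lambda>a. (a, f a)) ` (fst ` E) \<subseteq> E" using f by auto
    show "E \<subseteq> (\<lambda>a. (a, f a)) ` (fst ` E)"
    proof
      fix z assume z: "z \<in> E"
      then have "z = (fst z, f (fst z))" using uniq[of "fst z" "snd z" "f (fst z)"] f[of "fst z"] by (simp add: prod_eq_iff)
      then show "z \<in> (\<lambda>a. (a, f a)) ` (fst ` E)" using z by blast
    qed
  qed
  ultimately show ?thesis using comp by simp
qed

section \<open>Hoelder differentiability\<close>

text \<open>In the comparison estimate the factor \<open>\<rho>\<^sup>-\<^sup>k\<close> leaves \<open>\<rho>\<^sup>\<alpha>\<close>, which is small for small \<open>\<rho>\<close>. Over a bounded set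
  of points the remaining factors are bounded by a constant \<open>B\<close>.\<close>

lemma approx_set_oscillation:
  fixes \<nu> :: "(real^'n \<Rightarrow> 'y::banach) \<Rightarrow> real"
  assumes nu: "cont_seminorm_on (cball 0 1) \<nu>" and S: "S \<in> distributions" and \<alpha>: "\<alpha> > 0" and \<delta>: "\<delta> > 0" and e: "e > 0"
  shows "\<exists>\<rho>>0. \<forall>a1 P1 a2 P2. (a1, P1) \<in> approx_set \<nu> S k (real_of_int k + \<alpha>) c \<delta> \<longrightarrow>
     (a2, P2) \<in> approx_set \<nu> S k (real_of_int k + \<alpha>) c \<delta> \<longrightarrow> norm a1 \<le> R \<longrightarrow> norm (a1 - a2) \<le> \<rho> \<longrightarrow>
     poly_norm k (\<lambda>x. P1 x - P2 x) \<le> e"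
proof (cases "k \<ge> 0")
  \<comment> \<open>For negative \<open>k\<close> the only polynomial function is \<open>0\<close>.\<close>
  case False
  then have z: "P = (\<lambda>x. 0)" if "P \<in> poly_upto k" for P :: "real^'n \<Rightarrow> ('y \<Rightarrow>\<^sub>L real)"
    using poly_uptoE[OF that] by fastforce
  have "poly_norm k (\<lambda>x. P1 x - P2 x) \<le> e"
    if "(a1, P1) \<in> approx_set \<nu> S k (real_of_int k + \<alpha>) c \<delta>" "(a2, P2) \<in> approx_set \<nu> S k (real_of_int k + \<alpha>) c \<delta>" for a1 a2 P1 P2
    using z[OF approx_setD(1)[OF that(1)]] z[OF approx_setD(1)[OF that(2)]] e by (simp add: poly_norm_zero)
  then show ?thesis by (intro exI[of _ 1]) simp
next
  case True
  let ?s = "real_of_int k + \<alpha>"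
  obtain C where C0: "C > 0" and C: "\<forall>S c1 c2 \<delta>1 \<delta>2 a a1 a2 P1 P2 \<rho>. S \<in> distributions \<longrightarrow> (a1, P1) \<in> approx_set \<nu> S k ?s c1 \<delta>1 \<longrightarrow>
    (a2, P2) \<in> approx_set \<nu> S k ?s c2 \<delta>2 \<longrightarrow> 0 < \<rho> \<longrightarrow> 8 * \<rho> < \<delta>1 \<longrightarrow> 8 * \<rho> < \<delta>2 \<longrightarrow>
    norm (a1 - a) \<le> \<rho> \<longrightarrow> norm (a2 - a) \<le> \<rho> \<longrightarrow>
    poly_norm k (\<lambda>x. P1 x - P2 x) \<le> C * (c1 + c2) * \<rho> powr ?s * ((\<rho> + 1 + norm a) / \<rho>) ^ nat k"
    using approx_set_poly_norm_close[OF nu, of k ?s] by (elim exE conjE) (rule that)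
  define B where "B = C * (2 * \<bar>c\<bar> + 1) * (2 + \<bar>R\<bar>) ^ nat k"
  have B: "B > 0" unfolding B_def using C0 by (intro mult_pos_pos zero_less_power) auto
  define \<rho> where "\<rho> = min (min 1 (\<delta> / 16)) ((e / B) powr (1 / \<alpha>))"
  have \<rho>: "\<rho> > 0" "\<rho> \<le> 1" "8 * \<rho> < \<delta>" "\<rho> \<le> (e / B) powr (1 / \<alpha>)" using \<delta> e B by (auto simp: \<rho>_def)
  have "\<rho> powr \<alpha> \<le> ((e / B) powr (1 / \<alpha>)) powr \<alpha>" using \<rho> \<alpha> by (intro powr_mono2) auto
  also have "\<dots> = e / B" using \<alpha> e B by (simp add: powr_powr)
  finally have \<rho>\<alpha>: "\<rho> powr \<alpha> \<le> e / B" .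
  have "poly_norm k (\<lambda>x. P1 x - P2 x) \<le> e"
    if 1: "(a1, P1) \<in> approx_set \<nu> S k ?s c \<delta>" and 2: "(a2, P2) \<in> approx_set \<nu> S k ?s c \<delta>"
      and a1: "norm a1 \<le> R" and a: "norm (a1 - a2) \<le> \<rho>" for a1 P1 a2 P2
  proof -
    have "poly_norm k (\<lambda>x. P1 x - P2 x) \<le> C * (c + c) * \<rho> powr ?s * ((\<rho> + 1 + norm a1) / \<rho>) ^ nat k"
      by (rule C[rule_format, OF S 1 2 \<rho>(1) \<rho>(3) \<rho>(3), of a1]) (use \<rho> a in \<open>auto simp: norm_minus_commute\<close>)
    also have "\<dots> = C * (c + c) * \<rho> powr \<alpha> * (\<rho> powr real_of_int k * ((\<rho> + 1 + norm a1) / \<rho>) ^ nat k)"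
      by (simp add: powr_add mult_ac)
    also have "\<dots> = C * (c + c) * \<rho> powr \<alpha> * (\<rho> + 1 + norm a1) ^ nat k"
      by (simp only: scale_cancel[OF \<rho>(1) True])
    also have "\<dots> \<le> C * (2 * \<bar>c\<bar> + 1) * \<rho> powr \<alpha> * (\<rho> + 1 + norm a1) ^ nat k"
      using C0 \<rho> by (intro mult_right_mono mult_left_mono) auto
    also have "\<dots> \<le> C * (2 * \<bar>c\<bar> + 1) * (e / B) * (\<rho> + 1 + norm a1) ^ nat k"
      using C0 \<rho> \<rho>\<alpha> by (intro mult_right_mono mult_left_mono) auto
    also have "\<dots> \<le> C * (2 * \<bar>c\<bar> + 1) * (e / B) * (2 + \<bar>R\<bar>) ^ nat k"
      using C0 \<rho> a1 e B by (intro mult_left_mono power_mono) auto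
    also have "\<dots> = B * (e / B)" by (simp add: B_def)
    also have "\<dots> = e" using B by simp
    finally show ?thesis .
  qed
  then show ?thesis using \<rho>(1) by blast
qed

context
  fixes \<nu> :: "(real^'n \<Rightarrow> 'y::banach) \<Rightarrow> real" and T :: "(real^'n \<Rightarrow> 'y) \<Rightarrow> real" and k :: int
  assumes nu: "cont_seminorm_on (cball 0 1) \<nu>" and T: "T \<in> distributions"
begin

lemma approx_set_closed_norm:
  assumes "\<And>i. (as i, Ps i) \<in> approx_set \<nu> T k s c \<delta>" "as \<longlonglongrightarrow> a" "P \<in> poly_upto k"
    "(\<lambda>i. poly_norm k (\<lambda>x. Ps i x - P x)) \<longlonglongrightarrow> 0"
  shows "(a, P) \<in> approx_set \<nu> T k s c \<delta>"
  by (rule approx_set_closed[OF T assms(1,2) wconvI_poly_norm[OF assms(3) approx_setD(1)[OF assms(1)] assms(4)]])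

lemma holder_jets_compact_union:
  assumes \<alpha>: "\<alpha> > 0"
  shows "\<exists>E :: nat \<Rightarrow> _. {(a, P). has_jet_holder \<nu> k \<alpha> T a P} = (\<Union>i. E i) \<and>
    (\<forall>i. compactin (prod_topology euclidean (poly_top k)) (E i) \<and> compact (fst ` E i))"
proof -
  let ?s = "real_of_int k + \<alpha>"
  \<comment> \<open>One index controls the constant, the scale and the radius of the ball.\<close>
  define E where "E = (\<lambda>i::nat. approx_set \<nu> T k ?s (real i) (1 / real (Suc i)) \<inter> (cball 0 (real i) \<times> UNIV))"
  have "{(a, P). has_jet_holder \<nu> k \<alpha> T a P} = (\<Union>i. E i)"
  proof
    show "(\<Union>i. E i) \<subseteq> {(a, P). has_jet_holder \<nu> k \<alpha> T a P}"
    proof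
      fix z assume "z \<in> (\<Union>i. E i)"
      then obtain i where i: "z \<in> E i" by blast
      obtain a P where z: "z = (a, P)" by (cases z)
      have "(a, P) \<in> approx_set \<nu> T k ?s (real i) (1 / real (Suc i))" using i by (simp add: z E_def)
      then have "has_jet_holder \<nu> k \<alpha> T a P"
        unfolding has_jet_holder_iff by (intro exI[of _ "real i"] exI[of _ "1 / real (Suc i)"]) simp
      then show "z \<in> {(a, P). has_jet_holder \<nu> k \<alpha> T a P}" by (simp add: z)
    qed
    show "{(a, P). has_jet_holder \<nu> k \<alpha> T a P} \<subseteq> (\<Union>i. E i)"
    proof clarify
      fix a P assume "has_jet_holder \<nu> k \<alpha> T a P"
      then obtain c \<delta> where c: "\<delta> > 0" "(a, P) \<in> approx_set \<nu> T k ?s c \<delta>" unfolding has_jet_holder_iff by blast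
      obtain i :: nat where i: "max (max c (1 / \<delta>)) (norm a) \<le> real i" using real_arch_simple by blast
      have "1 / real (Suc i) \<le> \<delta>"
      proof -
        have "1 / \<delta> \<le> real (Suc i)" using i by simp
        then show ?thesis using c(1) by (simp add: divide_le_eq mult.commute)
      qed
      moreover have "c \<le> real i" using i by simp
      ultimately have "(a, P) \<in> approx_set \<nu> T k ?s (real i) (1 / real (Suc i))"
        by (intro subsetD[OF approx_set_mono c(2)])
      then have "(a, P) \<in> E i" using i by (simp add: E_def)
      then show "(a, P) \<in> (\<Union>i. E i)" by blast
    qed
  qed
  moreover have "compactin (prod_topology euclidean (poly_top k)) (E i) \<and> compact (fst ` E i)" for i
  proof -
    have sub: "E i \<subseteq> cball 0 (real i) \<times> poly_upto k" using approx_setD(1) by (fastforce simp: E_def)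
    have osc: "\<exists>\<rho>>0. \<forall>a1 P1 a2 P2. (a1, P1) \<in> E i \<longrightarrow> (a2, P2) \<in> E i \<longrightarrow> norm (a1 - a2) \<le> \<rho> \<longrightarrow>
       poly_norm k (\<lambda>x. P1 x - P2 x) \<le> e" if e: "e > 0" for e
    proof -
      have "1 / real (Suc i) > 0" by simp
      from approx_set_oscillation[OF nu T \<alpha> this e, of k "real i" "real i"]
      obtain \<rho> where \<rho>: "\<rho> > 0" "\<forall>a1 P1 a2 P2. (a1, P1) \<in> approx_set \<nu> T k ?s (real i) (1 / real (Suc i)) \<longrightarrow>
         (a2, P2) \<in> approx_set \<nu> T k ?s (real i) (1 / real (Suc i)) \<longrightarrow> norm a1 \<le> real i \<longrightarrow> norm (a1 - a2) \<le> \<rho> \<longrightarrow>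
         poly_norm k (\<lambda>x. P1 x - P2 x) \<le> e" by (elim exE conjE) (rule that)
      show ?thesis by (intro exI[of _ \<rho>] conjI \<rho>(1) allI impI \<rho>(2)[rule_format]) (auto simp: E_def)
    qed
    have seq: "(a, P) \<in> E i"
      if mem: "\<And>j. (as j, Ps j) \<in> E i" and lim: "as \<longlonglongrightarrow> a" "P \<in> poly_upto k" "(\<lambda>j. poly_norm k (\<lambda>x. Ps j x - P x)) \<longlonglongrightarrow> 0"
      for as a Ps P
    proof -
      have "(a, P) \<in> approx_set \<nu> T k ?s (real i) (1 / real (Suc i))"
        by (rule approx_set_closed_norm[OF _ lim]) (use mem in \<open>auto simp: E_def\<close>)
      moreover have "a \<in> cball 0 (real i)"
        by (rule closed_sequentially[OF closed_cball _ lim(1)]) (use mem in \<open>auto simp: E_def\<close>)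
      ultimately show ?thesis by (simp add: E_def)
    qed
    show ?thesis
    proof (rule compact_uniform_graph[OF sub])
      fix as a Ps P
      assume "\<And>j. (as j, Ps j) \<in> E i" "as \<longlonglongrightarrow> a" "P \<in> poly_upto k" "(\<lambda>j. poly_norm k (\<lambda>x. Ps j x - P x)) \<longlonglongrightarrow> 0"
      then show "(a, P) \<in> E i" by (rule seq)
    qed (rule osc)
  qed
  ultimately show ?thesis by blast
qed

end

section \<open>Differentiability of integer order\<close>

lemma has_jet_iff_nat:
  fixes P :: "real^'n \<Rightarrow> ('y::banach \<Rightarrow>\<^sub>L real)"
  assumes nu: "cont_seminorm_on (cball 0 1) \<nu>" and S: "S \<in> distributions"
  shows "has_jet \<nu> k S a P \<longleftrightarrow>
    (\<forall>p. \<exists>q. (a, P) \<in> approx_set \<nu> S k (real_of_int k) (1 / real (Suc p)) (1 / real (Suc q)))"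
  unfolding has_jet_iff[OF nu S]
proof (intro iffI allI impI)
  fix p assume "\<forall>e>0. \<exists>\<delta>>0. (a, P) \<in> approx_set \<nu> S k (real_of_int k) e \<delta>"
  then have "\<exists>\<delta>>0. (a, P) \<in> approx_set \<nu> S k (real_of_int k) (1 / real (Suc p)) \<delta>" by simp
  then obtain \<delta> where \<delta>: "\<delta> > 0" "(a, P) \<in> approx_set \<nu> S k (real_of_int k) (1 / real (Suc p)) \<delta>" by blast
  obtain q where "1 / real (Suc q) < \<delta>" using reals_Archimedean[OF \<delta>(1)] by (auto simp: inverse_eq_divide)
  then have "(a, P) \<in> approx_set \<nu> S k (real_of_int k) (1 / real (Suc p)) (1 / real (Suc q))"
    by (intro subsetD[OF approx_set_mono \<delta>(2)]) auto
  then show "\<exists>q. (a, P) \<in> approx_set \<nu> S k (real_of_int k) (1 / real (Suc p)) (1 / real (Suc q))" by blast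
next
  fix e :: real
  assume R: "\<forall>p. \<exists>q. (a, P) \<in> approx_set \<nu> S k (real_of_int k) (1 / real (Suc p)) (1 / real (Suc q))" and e: "e > 0"
  obtain p where p: "1 / real (Suc p) < e" using reals_Archimedean[OF e] by (auto simp: inverse_eq_divide)
  obtain q where q: "(a, P) \<in> approx_set \<nu> S k (real_of_int k) (1 / real (Suc p)) (1 / real (Suc q))"
    using R by blast
  have "(a, P) \<in> approx_set \<nu> S k (real_of_int k) e (1 / real (Suc q))"
    by (rule subsetD[OF approx_set_mono q]) (use p in auto)
  then show "\<exists>\<delta>>0. (a, P) \<in> approx_set \<nu> S k (real_of_int k) e \<delta>" by (intro exI[of _ "1 / real (Suc q)"]) simp
qed

lemma separable_dense:
  assumes "separable_space (euclidean :: 'y::real_normed_vector topology)"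
  obtains D :: "'y::real_normed_vector set" where "countable D" "\<And>y e. e > 0 \<Longrightarrow> \<exists>d\<in>D. norm (y - d) < e"
proof -
  obtain D :: "'y set" where D: "countable D" "closure D = UNIV"
    using assms by (auto simp: separable_space_def)
  have "\<exists>d\<in>D. norm (y - d) < e" if "e > 0" for y e
  proof -
    have "y \<in> closure D" using D(2) by simp
    then show ?thesis using that by (metis closure_approachable dist_norm norm_minus_commute)
  qed
  then show ?thesis using D(1) that by blast
qed

text \<open>For \<open>s = k\<close> the powers of \<open>\<rho>\<close> cancel: approximating polynomial functions at nearby points need not be close,
  but their distance is at most proportional to the constants.\<close>

lemma integer_order_poly_norm_close:
  fixes \<nu> :: "(real^'n \<Rightarrow> 'y::banach) \<Rightarrow> real"
  assumes nu: "cont_seminorm_on (cball 0 1) \<nu>" and k: "k \<ge> 0"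
  shows "\<exists>C>0. \<forall>S c1 c2 \<delta>1 \<delta>2 a a1 a2 P1 P2 \<rho>. S \<in> distributions \<longrightarrow>
    (a1, P1) \<in> approx_set \<nu> S k (real_of_int k) c1 \<delta>1 \<longrightarrow>
    (a2, P2) \<in> approx_set \<nu> S k (real_of_int k) c2 \<delta>2 \<longrightarrow> 0 < \<rho> \<longrightarrow> \<rho> \<le> 1 \<longrightarrow> 8 * \<rho> < \<delta>1 \<longrightarrow> 8 * \<rho> < \<delta>2 \<longrightarrow>
    norm (a1 - a) \<le> \<rho> \<longrightarrow> norm (a2 - a) \<le> \<rho> \<longrightarrow> c1 \<ge> 0 \<longrightarrow> c2 \<ge> 0 \<longrightarrow>
    poly_norm k (\<lambda>x. P1 x - P2 x) \<le> C * (2 + norm a) ^ nat k * (c1 + c2)"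
proof -
  let ?s = "real_of_int k"
  obtain C where C0: "C > 0" and C: "\<forall>S c1 c2 \<delta>1 \<delta>2 a a1 a2 P1 P2 \<rho>. S \<in> distributions \<longrightarrow> (a1, P1) \<in> approx_set \<nu> S k ?s c1 \<delta>1 \<longrightarrow>
    (a2, P2) \<in> approx_set \<nu> S k ?s c2 \<delta>2 \<longrightarrow> 0 < \<rho> \<longrightarrow> 8 * \<rho> < \<delta>1 \<longrightarrow> 8 * \<rho> < \<delta>2 \<longrightarrow>
    norm (a1 - a) \<le> \<rho> \<longrightarrow> norm (a2 - a) \<le> \<rho> \<longrightarrow>
    poly_norm k (\<lambda>x. P1 x - P2 x) \<le> C * (c1 + c2) * \<rho> powr ?s * ((\<rho> + 1 + norm a) / \<rho>) ^ nat k"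
    using approx_set_poly_norm_close[OF nu, of k ?s] by (elim exE conjE) (rule that)
  show ?thesis
  proof (intro exI[of _ C] conjI C0 allI impI)
    fix S c1 c2 \<delta>1 \<delta>2 a a1 a2 P1 P2 and \<rho> :: real
    assume S: "S \<in> distributions" and 1: "(a1, P1) \<in> approx_set \<nu> S k ?s c1 \<delta>1"
      and 2: "(a2, P2) \<in> approx_set \<nu> S k ?s c2 \<delta>2" and \<rho>: "0 < \<rho>" "\<rho> \<le> 1" "8 * \<rho> < \<delta>1" "8 * \<rho> < \<delta>2"
      and a: "norm (a1 - a) \<le> \<rho>" "norm (a2 - a) \<le> \<rho>" and c: "c1 \<ge> 0" "c2 \<ge> 0"
    have "poly_norm k (\<lambda>x. P1 x - P2 x) \<le> C * (c1 + c2) * \<rho> powr ?s * ((\<rho> + 1 + norm a) / \<rho>) ^ nat k"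
      by (rule C[rule_format, OF S 1 2 \<rho>(1,3,4) a])
    also have "\<dots> = C * (c1 + c2) * (\<rho> + 1 + norm a) ^ nat k"
      by (simp only: mult.assoc scale_cancel[OF \<rho>(1) k])
    also have "\<dots> \<le> C * (c1 + c2) * (2 + norm a) ^ nat k"
      using \<rho> C0 c by (intro mult_left_mono power_mono) (auto simp: add_nonneg_nonneg)
    finally show "poly_norm k (\<lambda>x. P1 x - P2 x) \<le> C * (2 + norm a) ^ nat k * (c1 + c2)" by (simp only: mult_ac)
  qed
qed

context
  fixes \<nu> :: "(real^'n \<Rightarrow> 'y::banach) \<Rightarrow> real" and T :: "(real^'n \<Rightarrow> 'y) \<Rightarrow> real" and k :: int
  assumes nu: "cont_seminorm_on (cball 0 1) \<nu>" and T: "T \<in> distributions"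
begin

lemma closedin_approx_set: "closedin (prod_topology euclidean (poly_top k)) (approx_set \<nu> T k s c \<delta>)"
proof (rule closedin_prod_poly_seqI)
  show "approx_set \<nu> T k s c \<delta> \<subseteq> UNIV \<times> poly_upto k" by (auto simp: approx_set_def)
  fix as a Ps P
  assume "\<And>i. (as i, Ps i) \<in> approx_set \<nu> T k s c \<delta>" "as \<longlonglongrightarrow> a" "P \<in> poly_upto k"
    "(\<lambda>i. poly_norm k (\<lambda>x. Ps i x - P x)) \<longlonglongrightarrow> 0"
  then show "(a, P) \<in> approx_set \<nu> T k s c \<delta>" by (rule approx_set_closed_norm[OF nu T])
qed

lemma jets_eq:
  "{(a, P). has_jet \<nu> k T a P} =
    (\<Inter>p. \<Union>q. approx_set \<nu> T k (real_of_int k) (1 / real (Suc p)) (1 / real (Suc q)))"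
  using has_jet_iff_nat[OF nu T, of k] by auto

lemma jets_borel: "{(a, P). has_jet \<nu> k T a P} \<in> borel_in (prod_topology euclidean (poly_top k))"
  unfolding jets_eq by (intro borel_in_INT borel_in_UN borel_in_closedin closedin_approx_set)

text \<open>At nearby points the polynomial functions are within bounded distance of each other, so a weak-star limit
  exists and belongs to the limit point.\<close>

lemma domain_approx_set_closed:
  assumes k: "k \<ge> 0" and sep: "separable_space (euclidean :: 'y topology)" and c: "c \<ge> 0" and \<delta>: "\<delta> > 0"
  shows "closed (Domain (approx_set \<nu> T k (real_of_int k) c \<delta>))"
  unfolding closed_sequential_limits
proof (intro allI impI, elim conjE)
  let ?s = "real_of_int k"
  fix as a assume mem: "\<forall>i. as i \<in> Domain (approx_set \<nu> T k ?s c \<delta>)" and lim: "as \<longlonglongrightarrow> a"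
  have "\<forall>i. \<exists>P. (as i, P) \<in> approx_set \<nu> T k ?s c \<delta>" using mem by blast
  from choice[OF this] obtain Ps where Ps: "\<And>i. (as i, Ps i) \<in> approx_set \<nu> T k ?s c \<delta>" by blast
  obtain C where C: "\<forall>S c1 c2 \<delta>1 \<delta>2 a a1 a2 P1 P2 \<rho>. S \<in> distributions \<longrightarrow>
    (a1, P1) \<in> approx_set \<nu> S k ?s c1 \<delta>1 \<longrightarrow>
    (a2, P2) \<in> approx_set \<nu> S k ?s c2 \<delta>2 \<longrightarrow> 0 < \<rho> \<longrightarrow> \<rho> \<le> 1 \<longrightarrow> 8 * \<rho> < \<delta>1 \<longrightarrow> 8 * \<rho> < \<delta>2 \<longrightarrow>
    norm (a1 - a) \<le> \<rho> \<longrightarrow> norm (a2 - a) \<le> \<rho> \<longrightarrow> c1 \<ge> 0 \<longrightarrow> c2 \<ge> 0 \<longrightarrow>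
    poly_norm k (\<lambda>x. P1 x - P2 x) \<le> C * (2 + norm a) ^ nat k * (c1 + c2)"
    using integer_order_poly_norm_close[OF nu k] by (elim exE conjE) (rule that)
  define \<rho> where "\<rho> = min 1 (\<delta> / 16)"
  have \<rho>: "0 < \<rho>" "\<rho> \<le> 1" "8 * \<rho> < \<delta>" using \<delta> by (auto simp: \<rho>_def)
  obtain N where N: "\<And>i. i \<ge> N \<Longrightarrow> norm (as i - a) < \<rho>" using LIMSEQ_D[OF lim \<rho>(1)] by blast
  let ?M = "C * (2 + norm a) ^ nat k * (c + c) + poly_norm k (Ps N)"
  have bd: "poly_norm k (Ps (i + N)) \<le> ?M" for i
  proof -
    have "poly_norm k (\<lambda>x. Ps (i + N) x - Ps N x) \<le> C * (2 + norm a) ^ nat k * (c + c)"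
      by (rule C[rule_format, OF T Ps Ps \<rho>(1,2,3) \<rho>(3)]) (use N[of "i + N"] N[of N] c in auto)
    then show ?thesis
      using poly_norm_triangle[OF approx_setD(1)[OF Ps[of "i + N"]] approx_setD(1)[OF Ps[of N]] poly_zero] by simp
  qed
  obtain D :: "'y set" where D: "countable D" "\<And>y e. e > 0 \<Longrightarrow> \<exists>d\<in>D. norm (y - d) < e"
    using separable_dense[OF sep] by blast
  have "\<exists>r P. strict_mono (r :: nat \<Rightarrow> nat) \<and> wconv k (\<lambda>i. Ps (r i + N)) P"
    by (rule weak_star_compact[OF D approx_setD(1)[OF Ps] bd])
  then obtain r P where r: "strict_mono (r :: nat \<Rightarrow> nat)" and w: "wconv k (\<lambda>i. Ps (r i + N)) P" by blast
  have "(\<lambda>i. as (r i + N)) \<longlonglongrightarrow> a"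
    using LIMSEQ_subseq_LIMSEQ[OF LIMSEQ_ignore_initial_segment[OF lim, of N] r] by (simp add: o_def)
  then have "(a, P) \<in> approx_set \<nu> T k ?s c \<delta>" by (rule approx_set_closed[OF T Ps _ w])
  then show "a \<in> Domain (approx_set \<nu> T k ?s c \<delta>)" by blast
qed

text \<open>Different \<open>p\<close> may provide different polynomial functions on the right-hand side; \<open>jet_exists\<close> shows that they
  converge to a jet.\<close>

lemma jets_domain_eq:
  assumes k: "k \<ge> 0"
  shows "Domain {(a, P). has_jet \<nu> k T a P} =
    (\<Inter>p. \<Union>q. Domain (approx_set \<nu> T k (real_of_int k) (1 / real (Suc p)) (1 / real (Suc q))))"
proof
  show "Domain {(a, P). has_jet \<nu> k T a P} \<subseteq>
    (\<Inter>p. \<Union>q. Domain (approx_set \<nu> T k (real_of_int k) (1 / real (Suc p)) (1 / real (Suc q))))"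
    unfolding jets_eq by blast
  show "(\<Inter>p. \<Union>q. Domain (approx_set \<nu> T k (real_of_int k) (1 / real (Suc p)) (1 / real (Suc q))))
    \<subseteq> Domain {(a, P). has_jet \<nu> k T a P}"
  proof
    fix a assume "a \<in> (\<Inter>p. \<Union>q. Domain (approx_set \<nu> T k (real_of_int k) (1 / real (Suc p)) (1 / real (Suc q))))"
    then have dom: "\<exists>q. a \<in> Domain (approx_set \<nu> T k (real_of_int k) (1 / real (Suc p)) (1 / real (Suc q)))" for p
      by blast
    have "\<forall>p. \<exists>z. (a, fst z) \<in> approx_set \<nu> T k (real_of_int k) (1 / real (Suc p)) (1 / real (Suc (snd z)))"
    proof
      fix p
      obtain q P where "(a, P) \<in> approx_set \<nu> T k (real_of_int k) (1 / real (Suc p)) (1 / real (Suc q))"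
        using dom[of p] by blast
      then show "\<exists>z. (a, fst z) \<in> approx_set \<nu> T k (real_of_int k) (1 / real (Suc p)) (1 / real (Suc (snd z)))"
        by (intro exI[of _ "(P, q)"]) simp
    qed
    from choice[OF this] obtain z
      where z: "\<And>p. (a, fst (z p)) \<in> approx_set \<nu> T k (real_of_int k) (1 / real (Suc p)) (1 / real (Suc (snd (z p))))" by blast
    have "\<exists>P. has_jet \<nu> k T a P \<and> (\<lambda>p. poly_norm k (\<lambda>x. fst (z p) x - P x)) \<longlonglongrightarrow> 0"
      by (rule jet_exists[OF nu T k z]) simp
    then show "a \<in> Domain {(a, P). has_jet \<nu> k T a P}" by blast
  qed
qed

lemma jets_domain_borel:
  assumes "k \<ge> 0" "separable_space (euclidean :: 'y topology)"
  shows "Domain {(a, P). has_jet \<nu> k T a P} \<in> borel_in euclidean"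
  unfolding jets_domain_eq[OF assms(1)]
  by (intro borel_in_INT borel_in_UN borel_in_closedin) (simp add: domain_approx_set_closed[OF assms])

text \<open>Over a point \<open>a\<close> of the domain, the pairs of \<open>approx_set\<close> with constant \<open>1/p\<close> near \<open>a\<close> have polynomial
  functions within a multiple of \<open>1/p\<close> of the jet. If some of them lie in \<open>F\<close> for every \<open>p\<close>, then the jet lies in
  the closed set \<open>F\<close>. The closures replace the projections themselves, which need not be Borel sets, as \<open>F\<close> may fail to
  be weak-star closed.\<close>

lemma jets_preimage:
  assumes k: "k \<ge> 0" and F: "closedin (poly_top k) F"
  shows "{(a, P). has_jet \<nu> k T a P}\<inverse> `` F = Domain {(a, P). has_jet \<nu> k T a P} \<inter>
    (\<Inter>p. \<Union>q. closure (Domain (approx_set \<nu> T k (real_of_int k) (1 / real (Suc p)) (1 / real (Suc q)) \<inter> UNIV \<times> F)))"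
proof
  let ?s = "real_of_int k"
  let ?A = "\<lambda>p q. approx_set \<nu> T k ?s (1 / real (Suc p)) (1 / real (Suc q))"
  show "{(a, P). has_jet \<nu> k T a P}\<inverse> `` F \<subseteq> Domain {(a, P). has_jet \<nu> k T a P} \<inter>
    (\<Inter>p. \<Union>q. closure (Domain (?A p q \<inter> UNIV \<times> F)))"
  proof
    fix a assume "a \<in> {(a, P). has_jet \<nu> k T a P}\<inverse> `` F"
    then obtain P where P: "P \<in> F" "has_jet \<nu> k T a P" by blast
    have "\<exists>q. a \<in> closure (Domain (?A p q \<inter> UNIV \<times> F))" for p
    proof -
      obtain q where "(a, P) \<in> ?A p q" using P(2) has_jet_iff_nat[OF nu T] by blast
      then have "a \<in> Domain (?A p q \<inter> UNIV \<times> F)" using P(1) by blast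
      then show ?thesis by (intro exI[of _ q] subsetD[OF closure_subset])
    qed
    then show "a \<in> Domain {(a, P). has_jet \<nu> k T a P} \<inter> (\<Inter>p. \<Union>q. closure (Domain (?A p q \<inter> UNIV \<times> F)))"
      using P(2) by blast
  qed
  show "Domain {(a, P). has_jet \<nu> k T a P} \<inter> (\<Inter>p. \<Union>q. closure (Domain (?A p q \<inter> UNIV \<times> F)))
     \<subseteq> {(a, P). has_jet \<nu> k T a P}\<inverse> `` F"
  proof
    fix a assume a: "a \<in> Domain {(a, P). has_jet \<nu> k T a P} \<inter> (\<Inter>p. \<Union>q. closure (Domain (?A p q \<inter> UNIV \<times> F)))"
    then obtain P where P: "has_jet \<nu> k T a P" by blast
    have Pk: "P \<in> poly_upto k" using P by (simp add: has_jet_def)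
    obtain C where C0: "C > 0" and C: "\<forall>S c1 c2 \<delta>1 \<delta>2 a a1 a2 P1 P2 \<rho>. S \<in> distributions \<longrightarrow>
      (a1, P1) \<in> approx_set \<nu> S k ?s c1 \<delta>1 \<longrightarrow>
      (a2, P2) \<in> approx_set \<nu> S k ?s c2 \<delta>2 \<longrightarrow> 0 < \<rho> \<longrightarrow> \<rho> \<le> 1 \<longrightarrow> 8 * \<rho> < \<delta>1 \<longrightarrow> 8 * \<rho> < \<delta>2 \<longrightarrow>
      norm (a1 - a) \<le> \<rho> \<longrightarrow> norm (a2 - a) \<le> \<rho> \<longrightarrow> c1 \<ge> 0 \<longrightarrow> c2 \<ge> 0 \<longrightarrow>
      poly_norm k (\<lambda>x. P1 x - P2 x) \<le> C * (2 + norm a) ^ nat k * (c1 + c2)"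
      using integer_order_poly_norm_close[OF nu k] by (elim exE conjE) (rule that)
    define B where "B = C * (2 + norm a) ^ nat k"
    have B0: "B > 0" unfolding B_def using C0 by (intro mult_pos_pos zero_less_power add_pos_nonneg) auto
    have "P \<in> F"
    proof (rule ccontr)
      assume "P \<notin> F"
      moreover have "openin (poly_top k) (poly_upto k - F)"
        using F by (simp add: closedin_def topspace_poly_top)
      ultimately obtain e where e: "e > 0" "\<forall>Q\<in>poly_upto k. poly_norm k (\<lambda>x. Q x - P x) < e \<longrightarrow> Q \<in> poly_upto k - F"
        unfolding openin_poly_top using Pk by blast
      have eB: "e / (2 * B) > 0" using e(1) B0 by simp
      obtain p where p: "1 / real (Suc p) < e / (2 * B)"
        using reals_Archimedean[OF eB] by (auto simp: inverse_eq_divide)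
      obtain q where q: "a \<in> closure (Domain (?A p q \<inter> UNIV \<times> F))" using a by blast
      obtain q' where q': "(a, P) \<in> ?A p q'" using P has_jet_iff_nat[OF nu T] by blast
      define \<rho> where "\<rho> = min 1 (min (1 / real (Suc q)) (1 / real (Suc q')) / 16)"
      have "0 < min 1 (min u v / 16)" "min 1 (min u v / 16) \<le> 1" "8 * min 1 (min u v / 16) < u" "8 * min 1 (min u v / 16) < v"
        if "0 < u" "0 < v" for u v :: real using that by auto
      from this[of "1 / real (Suc q)" "1 / real (Suc q')"]
      have \<rho>: "0 < \<rho>" "\<rho> \<le> 1" "8 * \<rho> < 1 / real (Suc q)" "8 * \<rho> < 1 / real (Suc q')"
        unfolding \<rho>_def by simp_all
      obtain a' where a': "a' \<in> Domain (?A p q \<inter> UNIV \<times> F)" "dist a' a < \<rho>"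
        using q \<rho>(1) unfolding closure_approachable by blast
      then obtain P' where P': "(a', P') \<in> ?A p q" "P' \<in> F" by blast
      have "poly_norm k (\<lambda>x. P' x - P x) \<le> C * (2 + norm a) ^ nat k * (1 / real (Suc p) + 1 / real (Suc p))"
        by (rule C[rule_format, OF T P'(1) q' \<rho>]) (use a'(2) \<rho>(1) in \<open>auto simp: dist_norm\<close>)
      also have "\<dots> = B * (2 * (1 / real (Suc p)))" by (simp add: B_def)
      also have "\<dots> < B * (2 * (e / (2 * B)))" using p B0 by (intro mult_strict_left_mono) auto
      also have "\<dots> = e" using B0 by simp
      finally have "P' \<in> poly_upto k - F" using e(2) approx_setD(1)[OF P'(1)] by blast
      then show False using P'(2) by blast
    qed
    then show "a \<in> {(a, P). has_jet \<nu> k T a P}\<inverse> `` F" using P by blast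
  qed
qed

lemma jets_borel_pfun:
  assumes k: "k \<ge> 0" and sep: "separable_space (euclidean :: 'y topology)"
  shows "borel_pfun euclidean (poly_top k) {(a, P). has_jet \<nu> k T a P}"
proof (rule borel_pfunI)
  show "{(a, P). has_jet \<nu> k T a P} \<subseteq> topspace euclidean \<times> topspace (poly_top k)"
    by (auto simp: topspace_poly_top has_jet_def)
  show "single_valued {(a, P). has_jet \<nu> k T a P}"
    unfolding single_valued_def using jet_unique[OF nu T k] by blast
  show "Domain {(a, P). has_jet \<nu> k T a P} \<in> borel_in euclidean" by (rule jets_domain_borel[OF k sep])
  fix F :: "(real^'n \<Rightarrow> ('y \<Rightarrow>\<^sub>L real)) set" assume F: "closedin (poly_top k) F"
  show "{(a, P). has_jet \<nu> k T a P}\<inverse> `` F \<in> borel_in euclidean"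
    unfolding jets_preimage[OF k F]
    by (intro borel_in_Int jets_domain_borel[OF k sep] borel_in_INT borel_in_UN borel_in_closedin) simp
qed

end

section \<open>Finite dimensional values\<close>

text \<open>Otherwise there are coefficient vectors of norm \<open>1\<close> whose linear combinations tend to \<open>0\<close>; a convergent
  subsequence contradicts independence.\<close>

lemma coordinates_bounded:
  fixes B :: "'y::real_normed_vector set"
  assumes B: "finite B" "independent B"
  shows "\<exists>C>0. \<forall>c. (\<Sum>b\<in>B. \<bar>c b\<bar>) \<le> C * norm (\<Sum>b\<in>B. c b *\<^sub>R b)"
proof (rule ccontr)
  assume N: "\<not> (\<exists>C>0. \<forall>c. (\<Sum>b\<in>B. \<bar>c b\<bar>) \<le> C * norm (\<Sum>b\<in>B. c b *\<^sub>R b))"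
  have "\<forall>i. \<exists>d. (\<Sum>b\<in>B. \<bar>d b\<bar>) = 1 \<and> norm (\<Sum>b\<in>B. d b *\<^sub>R b) \<le> 1 / real (Suc i)"
  proof
    fix i
    have "\<not> (\<forall>c. (\<Sum>b\<in>B. \<bar>c b\<bar>) \<le> real (Suc i) * norm (\<Sum>b\<in>B. c b *\<^sub>R b))" using N by simp
    then obtain c where c: "(\<Sum>b\<in>B. \<bar>c b\<bar>) > real (Suc i) * norm (\<Sum>b\<in>B. c b *\<^sub>R b)" by (auto simp: not_le)
    define s where "s = (\<Sum>b\<in>B. \<bar>c b\<bar>)"
    have s: "s > 0" using c unfolding s_def[symmetric]
      by (rule order_le_less_trans[rotated]) (intro mult_nonneg_nonneg norm_ge_zero of_nat_0_le_iff)
    have 1: "(\<Sum>b\<in>B. \<bar>c b / s\<bar>) = 1"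
      using s by (simp add: s_def abs_mult sum_divide_distrib[symmetric])
    have "(\<Sum>b\<in>B. (c b / s) *\<^sub>R b) = (1 / s) *\<^sub>R (\<Sum>b\<in>B. c b *\<^sub>R b)"
      by (simp add: scaleR_sum_right)
    then have "norm (\<Sum>b\<in>B. (c b / s) *\<^sub>R b) = norm (\<Sum>b\<in>B. c b *\<^sub>R b) / s" using s by simp
    also have "\<dots> \<le> 1 / real (Suc i)"
      using c s unfolding s_def[symmetric] by (simp add: divide_simps mult.commute)
    finally show "\<exists>d. (\<Sum>b\<in>B. \<bar>d b\<bar>) = 1 \<and> norm (\<Sum>b\<in>B. d b *\<^sub>R b) \<le> 1 / real (Suc i)"
      using 1 by (intro exI[of _ "\<lambda>b. c b / s"]) simp
  qed
  from choice[OF this] obtain d where d: "\<And>i. (\<Sum>b\<in>B. \<bar>d i b\<bar>) = 1" "\<And>i. norm (\<Sum>b\<in>B. d i b *\<^sub>R b) \<le> 1 / real (Suc i)"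
    by blast
  have d1: "norm (d i b) \<le> 1" if "b \<in> B" for i b
    using member_le_sum[of b B "\<lambda>b. \<bar>d i b\<bar>"] that B(1) d(1)[of i] by simp
  obtain r where r: "strict_mono (r :: nat \<Rightarrow> nat)" "\<And>b. b \<in> B \<Longrightarrow> \<exists>l. (\<lambda>n. d (r n) b) \<longlonglongrightarrow> l"
  proof (rule function_convergent_subsequence[of B d 1])
    show "countable B" using B(1) by (rule countable_finite)
    show "norm (d i b) \<le> 1" if "b \<in> B" for i b by (rule d1[OF that])
  qed (rule that)
  have "\<forall>b. \<exists>l. b \<in> B \<longrightarrow> (\<lambda>n. d (r n) b) \<longlonglongrightarrow> l" using r(2) by blast
  from choice[OF this] obtain l where l: "\<And>b. b \<in> B \<Longrightarrow> (\<lambda>n. d (r n) b) \<longlonglongrightarrow> l b" by blast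
  have "(\<lambda>n. \<Sum>b\<in>B. \<bar>d (r n) b\<bar>) \<longlonglongrightarrow> (\<Sum>b\<in>B. \<bar>l b\<bar>)" by (intro tendsto_sum tendsto_rabs l)
  then have "(\<lambda>n::nat. 1) \<longlonglongrightarrow> (\<Sum>b\<in>B. \<bar>l b\<bar>)" unfolding d(1) .
  then have l1: "(\<Sum>b\<in>B. \<bar>l b\<bar>) = 1" by (rule LIMSEQ_unique) (rule tendsto_const)
  have "(\<lambda>n. norm (\<Sum>b\<in>B. d (r n) b *\<^sub>R b)) \<longlonglongrightarrow> norm (\<Sum>b\<in>B. l b *\<^sub>R b)"
    by (intro tendsto_norm tendsto_sum tendsto_scaleR l tendsto_const)
  moreover have "(\<lambda>n. norm (\<Sum>b\<in>B. d (r n) b *\<^sub>R b)) \<longlonglongrightarrow> 0"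
  proof (rule tendsto_sandwich[OF _ _ tendsto_const LIMSEQ_subseq_LIMSEQ[OF one_over_Suc_null r(1), unfolded o_def]])
    show "\<forall>\<^sub>F n in sequentially. norm (\<Sum>b\<in>B. d (r n) b *\<^sub>R b) \<le> 1 / real (Suc (r n))"
      by (intro always_eventually allI d(2))
  qed simp
  ultimately have "norm (\<Sum>b\<in>B. l b *\<^sub>R b) = 0" by (rule LIMSEQ_unique)
  then have "(\<Sum>b\<in>B. l b *\<^sub>R b) = 0" by simp
  then have "l b = 0" if "b \<in> B" for b
    using independentD[OF B(2) B(1) order_refl _ that] by blast
  then show False using l1 by simp
qed

lemma finite_dim_basis:
  fixes B0 :: "'y::real_normed_vector set"
  assumes "finite B0" "span B0 = UNIV"
  obtains B where "finite B" "independent B" "span B = (UNIV :: 'y set)"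
proof -
  obtain B where B: "B \<subseteq> B0" "independent B" "B0 \<subseteq> span B" using maximal_independent_subset[of B0] by blast
  have "span B0 \<subseteq> span B" using B(3) by (simp add: span_minimal)
  then have "span B = UNIV" using assms(2) by blast
  then show ?thesis using that B finite_subset[OF B(1) assms(1)] by blast
qed

text \<open>Rational linear combinations of the spanning set.\<close>

lemma finite_dim_dense:
  fixes B :: "'y::real_normed_vector set"
  assumes B: "finite B" "span B = UNIV"
  shows "\<exists>D::'y set. countable D \<and> (\<forall>y. \<forall>e>0. \<exists>d\<in>D. norm (y - d) < e)"
proof -
  let ?D = "(\<lambda>q. \<Sum>b\<in>B. q b *\<^sub>R b) ` (PiE B (\<lambda>_. \<rat>))"
  have "countable ?D" by (intro countable_image countable_PiE B(1) countable_rat)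
  moreover have "\<exists>d\<in>?D. norm (y - d) < e" if e: "e > 0" for y e
  proof -
    have "y \<in> range (\<lambda>u. \<Sum>b\<in>B. u b *\<^sub>R b)" using B(2) span_finite[OF B(1)] by auto
    then obtain c where c: "y = (\<Sum>b\<in>B. c b *\<^sub>R b)" by blast
    define s where "s = 1 + (\<Sum>b\<in>B. norm b)"
    have s: "s > 0" unfolding s_def by (intro add_pos_nonneg sum_nonneg) auto
    have "\<forall>b. \<exists>q\<in>\<rat>. c b - e / s < q \<and> q < c b" using e s by (intro allI Rats_dense_in_real) simp
    then have "\<forall>b. \<exists>q. q \<in> \<rat> \<and> c b - e / s < q \<and> q < c b" by blast
    from choice[OF this] obtain q where q: "\<And>b. q b \<in> \<rat>" "\<And>b. c b - e / s < q b \<and> q b < c b" by blast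
    have "(\<Sum>b\<in>B. restrict q B b *\<^sub>R b) = (\<Sum>b\<in>B. q b *\<^sub>R b)" by (rule sum.cong) auto
    moreover have "restrict q B \<in> PiE B (\<lambda>_. \<rat>)" using q(1) by auto
    ultimately have mem: "(\<Sum>b\<in>B. q b *\<^sub>R b) \<in> ?D"
      by (intro image_eqI[of _ _ "restrict q B"]) simp_all
    have "norm (y - (\<Sum>b\<in>B. q b *\<^sub>R b)) = norm (\<Sum>b\<in>B. (c b - q b) *\<^sub>R b)"
      by (simp add: c sum_subtractf scaleR_diff_left)
    also have "\<dots> \<le> (\<Sum>b\<in>B. (e / s) * norm b)"
    proof (rule sum_norm_le)
      fix b
      have "\<bar>c b - q b\<bar> \<le> e / s" using q(2)[of b] by linarith
      then show "norm ((c b - q b) *\<^sub>R b) \<le> (e / s) * norm b"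
        unfolding norm_scaleR by (rule mult_right_mono) simp
    qed
    also have "\<dots> = (e / s) * (s - 1)" by (simp add: s_def sum_distrib_left)
    also have "\<dots> < (e / s) * s" using e s by (intro mult_strict_left_mono) auto
    also have "\<dots> = e" using s by simp
    finally show ?thesis using mem by blast
  qed
  ultimately show ?thesis by blast
qed

lemma dual_norm_le_coordinates:
  fixes B :: "'y::real_normed_vector set"
  assumes B: "finite B" "independent B" "span B = UNIV"
  shows "\<exists>C>0. \<forall>L :: 'y \<Rightarrow>\<^sub>L real. norm L \<le> C * (\<Sum>b\<in>B. \<bar>blinfun_apply L b\<bar>)"
proof -
  obtain C where C0: "C > 0" and C: "\<forall>c. (\<Sum>b\<in>B. \<bar>c b\<bar>) \<le> C * norm (\<Sum>b\<in>B. c b *\<^sub>R b)"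
    using coordinates_bounded[OF B(1,2)] by (elim exE conjE) (rule that)
  have "norm L \<le> C * (\<Sum>b\<in>B. \<bar>blinfun_apply L b\<bar>)" for L :: "'y \<Rightarrow>\<^sub>L real"
  proof (rule norm_blinfun_bound)
    let ?s = "\<Sum>b\<in>B. \<bar>blinfun_apply L b\<bar>"
    have s0: "?s \<ge> 0" by (intro sum_nonneg) auto
    show "0 \<le> C * ?s" using C0 s0 by simp
    fix y
    have "y \<in> range (\<lambda>u. \<Sum>b\<in>B. u b *\<^sub>R b)" using B(3) span_finite[OF B(1)] by auto
    then obtain c where c: "y = (\<Sum>b\<in>B. c b *\<^sub>R b)" by blast
    have "norm (blinfun_apply L y) \<le> (\<Sum>b\<in>B. \<bar>c b\<bar> * \<bar>blinfun_apply L b\<bar>)"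
      unfolding c blinfun.sum_right by (rule sum_norm_le) (simp add: blinfun.scaleR_right abs_mult)
    also have "\<dots> \<le> (\<Sum>b\<in>B. \<bar>c b\<bar> * ?s)"
      by (intro sum_mono mult_left_mono member_le_sum) (use B(1) in auto)
    also have "\<dots> = (\<Sum>b\<in>B. \<bar>c b\<bar>) * ?s" by (simp add: sum_distrib_right)
    also have "\<dots> \<le> (C * norm y) * ?s" using C[rule_format, of c] s0 unfolding c[symmetric] by (intro mult_right_mono) auto
    finally show "norm (blinfun_apply L y) \<le> C * ?s * norm y" by (simp add: mult_ac)
  qed
  then show ?thesis using C0 by blast
qed

text \<open>In finite dimensions weak-star convergence of the values is norm convergence. The uniform Lipschitz bound and a
  finite net of the unit ball make it uniform there.\<close>

lemma wconv_imp_norm_conv: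
  fixes Ps :: "nat \<Rightarrow> real^'n \<Rightarrow> ('y::banach \<Rightarrow>\<^sub>L real)" and B :: "'y set"
  assumes B: "finite B" "independent B" "span B = UNIV" and w: "wconv k Ps P"
  shows "(\<lambda>i. poly_norm k (\<lambda>x. Ps i x - P x)) \<longlonglongrightarrow> 0"
proof (rule LIMSEQ_I)
  fix e :: real assume e: "e > 0"
  have P: "P \<in> poly_upto k" "\<And>i. Ps i \<in> poly_upto k" using w by (auto simp: wconv_def)
  have D: "(\<lambda>x. Ps i x - P x) \<in> poly_upto k" for i by (rule poly_diff[OF P(2) P(1)])
  obtain M where M: "\<And>i. poly_norm k (Ps i) \<le> M" using w by (auto simp: wconv_def)
  have dM: "poly_norm k (\<lambda>x. Ps i x - P x) \<le> M + poly_norm k P" for i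
    using poly_norm_triangle[OF P(2) poly_zero P(1), of i] poly_norm_commute[OF poly_zero P(1)] M[of i] by simp
  define M' where "M' = \<bar>M + poly_norm k P\<bar> + 1"
  have M': "poly_norm k (\<lambda>x. Ps i x - P x) \<le> M'" "M' > 0" for i using dM[of i] by (auto simp: M'_def)
  obtain A where A0: "A > 0" and A: "\<forall>L :: 'y \<Rightarrow>\<^sub>L real. norm L \<le> A * (\<Sum>b\<in>B. \<bar>blinfun_apply L b\<bar>)"
    using dual_norm_le_coordinates[OF B] by (elim exE conjE) (rule that)
  obtain L where L0: "L > 0" and L: "\<forall>(P :: real^'n \<Rightarrow> ('y \<Rightarrow>\<^sub>L real)) x z. P \<in> poly_upto k \<longrightarrow> norm x \<le> 1 \<longrightarrow> norm z \<le> 1 \<longrightarrow>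
     norm (P x - P z) \<le> L * poly_norm k P * norm (x - z) \<and> norm (P x) \<le> L * poly_norm k P"
    using poly_lipschitz[of k 1] by (elim exE conjE) (rule that)
  obtain C where C0: "C > 0" and C: "\<forall>(P :: real^'n \<Rightarrow> ('y \<Rightarrow>\<^sub>L real)) M. P \<in> poly_upto k \<longrightarrow>
       (\<forall>x. norm x \<le> 1 \<longrightarrow> norm (P x) \<le> M) \<longrightarrow> poly_norm k P \<le> C * M"
    using poly_norm_le[of k] by (elim exE conjE) (rule that)
  define d where "d = e / (4 * C)"
  have d: "d > 0" using e C0 by (simp add: d_def)
  have null: "(\<lambda>i. Ps i x - P x) \<longlonglongrightarrow> 0" for x
  proof (rule Lim_null_comparison[OF always_eventually[OF allI[OF A[rule_format]]]])
    have "(\<lambda>i. A * (\<Sum>b\<in>B. \<bar>blinfun_apply (Ps i x - P x) b\<bar>)) \<longlonglongrightarrow> A * (\<Sum>b\<in>B. \<bar>0\<bar>)"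
    proof (intro tendsto_mult tendsto_const tendsto_sum tendsto_rabs)
      fix b
      have "(\<lambda>i. blinfun_apply (Ps i x) b - blinfun_apply (P x) b) \<longlonglongrightarrow> 0"
        using w by (intro LIM_zero) (simp add: wconv_def)
      then show "(\<lambda>i. blinfun_apply (Ps i x - P x) b) \<longlonglongrightarrow> 0" by (simp add: blinfun.diff_left)
    qed
    then show "(\<lambda>i. A * (\<Sum>b\<in>B. \<bar>blinfun_apply (Ps i x - P x) b\<bar>)) \<longlonglongrightarrow> 0" by simp
  qed
  have ptw: "\<forall>\<^sub>F i in sequentially. norm (Ps i x - P x) < d" for x
    using tendstoD[OF null[of x] d] by (simp add: dist_norm)
  have LM: "d / (L * M') > 0" using d L0 M'(2) by simp
  obtain G where G: "finite G" "G \<subseteq> cball (0::real^'n) 1" "cball (0::real^'n) 1 \<subseteq> (\<Union>x\<in>G. ball x (d / (L * M')))"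
    using seq_compact_imp_totally_bounded[of "cball (0::real^'n) 1"] LM compact_imp_seq_compact[OF compact_cball] by blast
  have "\<forall>\<^sub>F i in sequentially. \<forall>x\<in>G. norm (Ps i x - P x) < d"
    using ptw by (intro eventually_ball_finite G(1)) blast
  then obtain N where N: "\<And>i x. i \<ge> N \<Longrightarrow> x \<in> G \<Longrightarrow> norm (Ps i x - P x) < d"
    by (auto simp: eventually_sequentially)
  have "norm (poly_norm k (\<lambda>x. Ps i x - P x) - 0) < e" if i: "i \<ge> N" for i
  proof -
    have "norm (Ps i x - P x) \<le> 2 * d" if x: "norm x \<le> 1" for x
    proof -
      have "x \<in> (\<Union>x\<in>G. ball x (d / (L * M')))" by (rule subsetD[OF G(3)]) (use x in simp)
      then obtain g where g: "g \<in> G" "dist g x < d / (L * M')" by auto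
      have ng: "norm g \<le> 1" using G(2) g(1) by auto
      have "norm ((Ps i x - P x) - (Ps i g - P g)) \<le> L * poly_norm k (\<lambda>x. Ps i x - P x) * norm (x - g)"
        using L[rule_format, OF D[of i] x ng] by simp
      also have "\<dots> \<le> L * M' * (d / (L * M'))"
        using g(2) L0 M'(1)[of i] M'(2) poly_norm_nonneg[OF D[of i]] by (intro mult_mono) (auto simp: dist_norm norm_minus_commute)
      also have "\<dots> = d" using L0 M'(2) by simp
      finally have "norm ((Ps i x - P x) - (Ps i g - P g)) \<le> d" .
      then show ?thesis using N[OF i g(1)] norm_triangle_sub[of "Ps i x - P x" "Ps i g - P g"] by linarith
    qed
    then have "poly_norm k (\<lambda>x. Ps i x - P x) \<le> C * (2 * d)"
      by (intro C[rule_format, OF D])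
    also have "\<dots> < e" using e C0 by (simp add: d_def)
    finally show ?thesis using poly_norm_nonneg[OF D[of i]] by simp
  qed
  then show "\<exists>N. \<forall>i\<ge>N. norm (poly_norm k (\<lambda>x. Ps i x - P x) - 0) < e" by blast
qed

section \<open>Countable dense families of functions\<close>

text \<open>Separability of spaces of continuous functions on a compact set, for several functions \<open>ev f i\<close> attached to
  \<open>f\<close> at once and with approximants chosen from \<open>F\<close> itself. Every \<open>f\<close> has a code, namely a modulus of continuity
  for \<open>e/4\<close> and approximate values from \<open>D\<close> on a finite net. There are countably many codes, and functions with a
  common code differ by less than \<open>e\<close>.\<close>

lemma countable_dense_family:
  fixes ev :: "'f \<Rightarrow> 'i \<Rightarrow> 'a::metric_space \<Rightarrow> 'v::metric_space" and F :: "'f set" and D :: "'v set"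
  assumes I: "finite I" and K: "compact K" and D: "countable D" "\<And>v d. d > 0 \<Longrightarrow> \<exists>u\<in>D. dist v u < d"
    and cont: "\<And>f i. f \<in> F \<Longrightarrow> i \<in> I \<Longrightarrow> continuous_on K (ev f i)" and e: "(e::real) > 0"
  shows "\<exists>F0\<subseteq>F. countable F0 \<and> (\<forall>f\<in>F. \<exists>g\<in>F0. \<forall>i\<in>I. \<forall>x\<in>K. dist (ev f i x) (ev g i x) < e)"
proof -
  have "\<forall>m::nat. \<exists>G. finite G \<and> G \<subseteq> K \<and> K \<subseteq> (\<Union>x\<in>G. ball x (1 / real (Suc m)))"
    using seq_compact_imp_totally_bounded[OF compact_imp_seq_compact[OF K]] by simp
  from choice[OF this] obtain G where G: "\<And>m. finite (G m)" "\<And>m. G m \<subseteq> K"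
    "\<And>m. K \<subseteq> (\<Union>x\<in>G m. ball x (1 / real (Suc m)))" by blast
  define code where "code = (\<lambda>f c. (\<forall>i\<in>I. \<forall>x\<in>K. \<forall>x'\<in>K. dist x' x < 1 / real (Suc (fst c)) \<longrightarrow> dist (ev f i x') (ev f i x) < e/4) \<and>
     (\<forall>i\<in>I. \<forall>x\<in>G (fst c). dist (ev f i x) (snd c (i, x)) < e/4))"
  define Cd where "Cd = (SIGMA m:UNIV. PiE (I \<times> G m) (\<lambda>_. D))"
  have Cd: "countable Cd" unfolding Cd_def
    by (intro countable_SIGMA countable_PiE finite_cartesian_product I G D(1)) auto
  have ex: "\<exists>c\<in>Cd. code f c" if f: "f \<in> F" for f
  proof -
    have "\<forall>i. \<exists>m::nat. i \<in> I \<longrightarrow> (\<forall>x\<in>K. \<forall>x'\<in>K. dist x' x < 1 / real (Suc m) \<longrightarrow> dist (ev f i x') (ev f i x) < e/4)"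
    proof
      fix i
      show "\<exists>m::nat. i \<in> I \<longrightarrow> (\<forall>x\<in>K. \<forall>x'\<in>K. dist x' x < 1 / real (Suc m) \<longrightarrow> dist (ev f i x') (ev f i x) < e/4)"
      proof (cases "i \<in> I")
        case True
        have "uniformly_continuous_on K (ev f i)" by (rule compact_uniformly_continuous[OF cont[OF f True] K])
        moreover have "e/4 > 0" using e by simp
        ultimately obtain d where d: "d > 0" "\<forall>x\<in>K. \<forall>x'\<in>K. dist x' x < d \<longrightarrow> dist (ev f i x') (ev f i x) < e/4"
          unfolding uniformly_continuous_on_def by blast
        obtain m :: nat where m: "1 / real (Suc m) < d"
          using reals_Archimedean[OF d(1)] by (auto simp: inverse_eq_divide)
        show ?thesis
          by (intro exI[of _ m] impI ballI d(2)[rule_format]) (use m in auto)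
      qed simp
    qed
    from choice[OF this] obtain mf where mf: "\<And>i x x'. i \<in> I \<Longrightarrow> x \<in> K \<Longrightarrow> x' \<in> K \<Longrightarrow> dist x' x < 1 / real (Suc (mf i)) \<Longrightarrow>
      dist (ev f i x') (ev f i x) < e/4" by blast
    define m where "m = (\<Sum>i\<in>I. mf i)"
    have mle: "1 / real (Suc m) \<le> 1 / real (Suc (mf i))" if "i \<in> I" for i
    proof -
      have "mf i \<le> m" unfolding m_def by (rule member_le_sum) (use that I in auto)
      then show ?thesis by (intro divide_left_mono) auto
    qed
    have "\<forall>z. \<exists>u. u \<in> D \<and> dist (ev f (fst z) (snd z)) u < e/4"
    proof
      fix z
      show "\<exists>u. u \<in> D \<and> dist (ev f (fst z) (snd z)) u < e/4"
        using D(2)[of "e/4" "ev f (fst z) (snd z)"] e by auto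
    qed
    from choice[OF this] obtain \<phi> where \<phi>: "\<And>z. \<phi> z \<in> D" "\<And>z. dist (ev f (fst z) (snd z)) (\<phi> z) < e/4" by blast
    have "(m, restrict \<phi> (I \<times> G m)) \<in> Cd" unfolding Cd_def using \<phi>(1) by auto
    moreover have "code f (m, restrict \<phi> (I \<times> G m))"
      unfolding code_def fst_conv snd_conv
    proof (intro conjI ballI impI)
      fix i x x' assume "i \<in> I" "x \<in> K" "x' \<in> K" "dist x' x < 1 / real (Suc m)"
      then show "dist (ev f i x') (ev f i x) < e/4" using mf[of i x x'] mle[of i] by linarith
    next
      fix i x assume "i \<in> I" "x \<in> G m"
      then show "dist (ev f i x) (restrict \<phi> (I \<times> G m) (i, x)) < e/4" using \<phi>(2)[of "(i, x)"] by simp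
    qed
    ultimately show ?thesis by blast
  qed
  have close: "dist (ev f i x) (ev g i x) < e" if f: "code f c" and g: "code g c" and i: "i \<in> I" and x: "x \<in> K" for f g c i x
  proof -
    obtain x' where x': "x' \<in> G (fst c)" "dist x' x < 1 / real (Suc (fst c))"
      using subsetD[OF G(3)[of "fst c"] x] by auto
    have x'K: "x' \<in> K" using x'(1) G(2) by blast
    have "dist x x' < 1 / real (Suc (fst c))" using x'(2) by (simp only: dist_commute)
    then have 1: "dist (ev f i x) (ev f i x') < e/4"
      using f i x x'K unfolding code_def by blast
    have 2: "dist (ev f i x') (snd c (i, x')) < e/4" using f i x'(1) unfolding code_def by blast
    have 3: "dist (ev g i x') (snd c (i, x')) < e/4" using g i x'(1) unfolding code_def by blast
    have 4: "dist (ev g i x') (ev g i x) < e/4" using g i x x'K x'(2) unfolding code_def by blast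
    have "dist (ev f i x) (ev g i x) \<le> dist (ev f i x) (ev f i x') + dist (ev f i x') (ev g i x)" by (rule dist_triangle)
    moreover have "dist (ev f i x') (ev g i x) \<le> dist (ev f i x') (ev g i x') + dist (ev g i x') (ev g i x)" by (rule dist_triangle)
    moreover have "dist (ev f i x') (ev g i x') \<le> dist (ev f i x') (snd c (i, x')) + dist (ev g i x') (snd c (i, x'))"
      by (rule dist_triangle2)
    ultimately show ?thesis using 1 2 3 4 by linarith
  qed
  define pick where "pick = (\<lambda>c. SOME f. f \<in> F \<and> code f c)"
  have pick: "pick c \<in> F \<and> code (pick c) c" if "f \<in> F" "code f c" for f c
    unfolding pick_def by (rule someI[of _ f]) (use that in blast)
  let ?F0 = "pick ` {c \<in> Cd. \<exists>f\<in>F. code f c}"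
  have "?F0 \<subseteq> F" using pick by blast
  moreover have "countable ?F0" using Cd by (intro countable_image) (rule countable_subset[OF _ Cd], blast)
  moreover have "\<exists>g\<in>?F0. \<forall>i\<in>I. \<forall>x\<in>K. dist (ev f i x) (ev g i x) < e" if f: "f \<in> F" for f
  proof -
    obtain c where c: "c \<in> Cd" "code f c" using ex[OF f] by blast
    show ?thesis
    proof (rule bexI[of _ "pick c"])
      show "pick c \<in> ?F0" using c f by blast
      show "\<forall>i\<in>I. \<forall>x\<in>K. dist (ev f i x) (ev (pick c) i x) < e"
        using close[OF c(2) conjunct2[OF pick[OF f c(2)]]] by blast
    qed
  qed
  ultimately show ?thesis by (intro exI[of _ ?F0] conjI ballI)
qed

text \<open>The \<open>m\<close>-th approximant is close in all derivatives of order at most \<open>m\<close> along basis vectors.\<close>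

lemma countable_dense_test_functions:
  fixes V :: "(real^'n \<Rightarrow> 'y::banach) set"
  assumes D: "countable D" "\<And>(y::'y) e. e > 0 \<Longrightarrow> \<exists>d\<in>D. norm (y - d) < e" and V: "V \<subseteq> test_fun_in (cball 0 1)"
  shows "\<exists>V0\<subseteq>V. countable V0 \<and> (\<forall>\<theta>\<in>V. \<exists>\<theta>s. (\<forall>i. \<theta>s i \<in> V0) \<and> tconv (cball 0 1) \<theta>s \<theta>)"
proof -
  let ?I = "\<lambda>m. {bs. set bs \<subseteq> (Basis::(real^'n) set) \<and> length bs \<le> m}"
  have "\<forall>m::nat. \<exists>V0\<subseteq>V. countable V0 \<and> (\<forall>\<theta>\<in>V. \<exists>\<eta>\<in>V0. \<forall>bs\<in>?I m. \<forall>x\<in>cball 0 1.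
      dist (dderiv bs \<theta> x) (dderiv bs \<eta> x) < 1 / real (Suc m))"
  proof
    fix m :: nat
    have D2: "\<exists>u\<in>D. dist v u < d" if "d > 0" for v d using D(2)[OF that, of v] by (simp add: dist_norm)
    show "\<exists>V0\<subseteq>V. countable V0 \<and> (\<forall>\<theta>\<in>V. \<exists>\<eta>\<in>V0. \<forall>bs\<in>?I m. \<forall>x\<in>cball 0 1.
      dist (dderiv bs \<theta> x) (dderiv bs \<eta> x) < 1 / real (Suc m))"
    proof (rule countable_dense_family[OF _ compact_cball D(1) D2])
      show "finite (?I m)" by (rule finite_lists_length_le) simp
      fix \<theta> bs assume "\<theta> \<in> V"
      then show "continuous_on (cball 0 1) (dderiv bs \<theta>)" using V test_fun_inD(2) by (intro continuous_on_dderiv) blast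
    qed simp_all
  qed
  from choice[OF this] obtain V0 where V0': "\<forall>m. V0 m \<subseteq> V \<and> countable (V0 m) \<and>
      (\<forall>\<theta>\<in>V. \<exists>\<eta>\<in>V0 m. \<forall>bs\<in>?I m. \<forall>x\<in>cball 0 1. dist (dderiv bs \<theta> x) (dderiv bs \<eta> x) < 1 / real (Suc m))"
    by (elim exE) (rule that)
  note V0 = conjunct1[OF spec[OF V0']] conjunct1[OF conjunct2[OF spec[OF V0']]]
    bspec[OF conjunct2[OF conjunct2[OF spec[OF V0']]]]
  have "\<exists>\<theta>s. (\<forall>i. \<theta>s i \<in> (\<Union>m. V0 m)) \<and> tconv (cball 0 1) \<theta>s \<theta>" if \<theta>: "\<theta> \<in> V" for \<theta>
  proof -
    have "\<forall>m. \<exists>\<eta>. \<eta> \<in> V0 m \<and> (\<forall>bs\<in>?I m. \<forall>x\<in>cball 0 1. dist (dderiv bs \<theta> x) (dderiv bs \<eta> x) < 1 / real (Suc m))"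
      using V0(3)[OF \<theta>] unfolding Bex_def by (rule allI)
    from choice[OF this] obtain \<theta>s where \<theta>s': "\<forall>m. \<theta>s m \<in> V0 m \<and>
      (\<forall>bs\<in>?I m. \<forall>x\<in>cball 0 1. dist (dderiv bs \<theta> x) (dderiv bs (\<theta>s m) x) < 1 / real (Suc m))"
      by (elim exE) (rule that)
    have \<theta>s: "\<theta>s m \<in> V0 m"
      "bs \<in> ?I m \<Longrightarrow> x \<in> cball 0 1 \<Longrightarrow> dist (dderiv bs \<theta> x) (dderiv bs (\<theta>s m) x) < 1 / real (Suc m)" for m bs x
      using \<theta>s'[rule_format, of m] by simp_all
    have t: "\<theta> \<in> test_fun_in (cball 0 1)" "\<theta>s i \<in> test_fun_in (cball 0 1)" for i using V V0(1) \<theta> \<theta>s(1) by blast+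
    have sm: "smooth \<theta>" "smooth (\<theta>s i)" for i using t test_fun_inD(2) by blast+
    have bd: "norm (dderiv vs (\<theta>s i) x - dderiv vs \<theta> x) \<le> real DIM(real^'n) ^ m * (1 / real (Suc i))"
      if i: "i \<ge> m" and vs: "length vs = m" "\<forall>v\<in>set vs. norm v \<le> 1" for i m vs x
    proof -
      have "norm (dderiv bs (\<lambda>x. \<theta>s i x - \<theta> x) x) \<le> 1 / real (Suc i)" if bs: "length bs = m" "set bs \<subseteq> Basis" for bs
      proof (cases "x \<in> cball 0 1")
        case True
        have "bs \<in> ?I i" using bs i by simp
        then show ?thesis using \<theta>s(2)[of bs i x] True
          by (simp add: dderiv_diff[OF sm(2) sm(1)] dist_norm norm_minus_commute)
      next
        case False
        then show ?thesis
          using dderiv_outside[OF t(1) False] dderiv_outside[OF t(2) False] by (simp add: dderiv_diff[OF sm(2) sm(1)])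
      qed
      from dderiv_basis_bound[OF smooth_diff[OF sm(2) sm(1)] this vs]
      show ?thesis by (simp add: dderiv_diff[OF sm(2) sm(1)])
    qed
    have "tconv (cball 0 1) \<theta>s \<theta>"
      unfolding tconv_def
    proof (intro conjI allI impI t)
      fix m :: nat and e :: real assume e: "e > 0"
      have "(\<lambda>i. real DIM(real^'n) ^ m * (1 / real (Suc i))) \<longlonglongrightarrow> real DIM(real^'n) ^ m * 0"
        by (intro tendsto_mult tendsto_const one_over_Suc_null)
      then have "\<forall>\<^sub>F i in sequentially. real DIM(real^'n) ^ m * (1 / real (Suc i)) < e"
        using e by (intro order_tendstoD(2)) auto
      moreover have "\<forall>\<^sub>F i in sequentially. i \<ge> m" by (rule eventually_ge_at_top)
      ultimately show "\<forall>\<^sub>F i in sequentially. \<forall>vs x. length vs = m \<longrightarrow> (\<forall>v\<in>set vs. norm v \<le> 1) \<longrightarrow>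
        norm (dderiv vs (\<theta>s i) x - dderiv vs \<theta> x) \<le> e"
      proof eventually_elim
        case (elim i)
        show ?case
        proof (intro allI impI)
          fix vs :: "(real^'n) list" and x assume vs: "length vs = m" "\<forall>v\<in>set vs. norm v \<le> 1"
          show "norm (dderiv vs (\<theta>s i) x - dderiv vs \<theta> x) \<le> e"
            using bd[OF elim(2) vs, of x] elim(1) by linarith
        qed
      qed
    qed
    moreover have "\<forall>i. \<theta>s i \<in> (\<Union>m. V0 m)" using \<theta>s(1) by blast
    ultimately show ?thesis by (intro exI[of _ \<theta>s] conjI)
  qed
  moreover have "(\<Union>m. V0 m) \<subseteq> V" "countable (\<Union>m. V0 m)" using V0(1,2) by auto
  ultimately show ?thesis by (intro exI[of _ "\<Union>m. V0 m"] conjI ballI)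
qed

text \<open>A pair \<open>(a, P)\<close> is encoded by finitely many real functions: the coordinates of \<open>a\<close>, as constant functions, and
  the coordinates of \<open>P\<close> on a basis of \<open>Y\<close>.\<close>

lemma countable_dense_pairs:
  fixes F :: "((real^'n) \<times> (real^'n \<Rightarrow> ('y::banach \<Rightarrow>\<^sub>L real))) set" and B :: "'y set"
  assumes B: "finite B" "independent B" "span B = UNIV" and F: "F \<subseteq> UNIV \<times> poly_upto k"
  shows "\<exists>F0\<subseteq>F. countable F0 \<and> (\<forall>(a, P)\<in>F. \<exists>z. (\<forall>i. z i \<in> F0) \<and> (\<lambda>i. fst (z i)) \<longlonglongrightarrow> a \<and>
     (\<lambda>i. poly_norm k (\<lambda>x. snd (z i) x - P x)) \<longlonglongrightarrow> 0)"
proof -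
  obtain A where A0: "A > 0" and A: "\<forall>L :: 'y \<Rightarrow>\<^sub>L real. norm L \<le> A * (\<Sum>b\<in>B. \<bar>blinfun_apply L b\<bar>)"
    using dual_norm_le_coordinates[OF B] by (elim exE conjE) (rule that)
  obtain C where C0: "C > 0" and C: "\<forall>(P :: real^'n \<Rightarrow> ('y \<Rightarrow>\<^sub>L real)) M. P \<in> poly_upto k \<longrightarrow>
       (\<forall>x. norm x \<le> 1 \<longrightarrow> norm (P x) \<le> M) \<longrightarrow> poly_norm k P \<le> C * M"
    using poly_norm_le[of k] by (elim exE conjE) (rule that)
  define ev :: "(real^'n) \<times> (real^'n \<Rightarrow> ('y \<Rightarrow>\<^sub>L real)) \<Rightarrow> (real^'n) + 'y \<Rightarrow> real^'n \<Rightarrow> real"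
    where "ev = (\<lambda>f i x. case i of Inl u \<Rightarrow> fst f \<bullet> u | Inr y \<Rightarrow> blinfun_apply (snd f x) y)"
  let ?I = "Inl ` (Basis::(real^'n) set) \<union> Inr ` B"
  have "\<forall>m::nat. \<exists>F0\<subseteq>F. countable F0 \<and> (\<forall>f\<in>F. \<exists>g\<in>F0. \<forall>i\<in>?I. \<forall>x\<in>cball 0 1.
      dist (ev f i x) (ev g i x) < 1 / real (Suc m))"
  proof
    fix m :: nat
    have D2: "\<exists>u\<in>\<rat>. dist v u < d" if d: "d > 0" for v d :: real
    proof -
      obtain u where "u \<in> \<rat>" "v < u" "u < v + d" using Rats_dense_in_real[of v "v + d"] d by auto
      then show ?thesis by (intro bexI[of _ u]) (auto simp: dist_real_def)
    qed
    show "\<exists>F0\<subseteq>F. countable F0 \<and> (\<forall>f\<in>F. \<exists>g\<in>F0. \<forall>i\<in>?I. \<forall>x\<in>cball 0 1.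
      dist (ev f i x) (ev g i x) < 1 / real (Suc m))"
    proof (rule countable_dense_family[OF _ compact_cball countable_rat D2])
      show "finite ?I" using B(1) by simp
      fix f i assume f: "f \<in> F" and i: "i \<in> ?I"
      have "snd f \<in> poly_upto k" using f F by auto
      then have "continuous_on (cball 0 1) (snd f)" by (rule continuous_poly)
      then show "continuous_on (cball 0 1) (ev f i)"
        by (cases i) (auto simp: ev_def intro!: blinfun.continuous_on continuous_on_const)
    qed simp_all
  qed
  from choice[OF this] obtain F0 where F0': "\<forall>m. F0 m \<subseteq> F \<and> countable (F0 m) \<and>
      (\<forall>f\<in>F. \<exists>g\<in>F0 m. \<forall>i\<in>?I. \<forall>x\<in>cball 0 1. dist (ev f i x) (ev g i x) < 1 / real (Suc m))"
    by (elim exE) (rule that)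
  note F0 = conjunct1[OF spec[OF F0']] conjunct1[OF conjunct2[OF spec[OF F0']]]
    bspec[OF conjunct2[OF conjunct2[OF spec[OF F0']]]]
  have main: "\<exists>z. (\<forall>i. z i \<in> (\<Union>m. F0 m)) \<and> (\<lambda>i. fst (z i)) \<longlonglongrightarrow> a \<and> (\<lambda>i. poly_norm k (\<lambda>x. snd (z i) x - P x)) \<longlonglongrightarrow> 0"
    if aP: "(a, P) \<in> F" for a P
  proof -
    have "\<forall>m. \<exists>g. g \<in> F0 m \<and> (\<forall>i\<in>?I. \<forall>x\<in>cball 0 1. dist (ev (a, P) i x) (ev g i x) < 1 / real (Suc m))"
      using F0(3)[OF aP] unfolding Bex_def by (rule allI)
    from choice[OF this] obtain z where z': "\<forall>m. z m \<in> F0 m \<and>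
      (\<forall>i\<in>?I. \<forall>x\<in>cball 0 1. dist (ev (a, P) i x) (ev (z m) i x) < 1 / real (Suc m))"
      by (elim exE) (rule that)
    have z: "z m \<in> F0 m"
      "i \<in> ?I \<Longrightarrow> x \<in> cball 0 1 \<Longrightarrow> dist (ev (a, P) i x) (ev (z m) i x) < 1 / real (Suc m)" for m i x
      using spec[OF z', of m] by blast+
    have zF: "z m \<in> UNIV \<times> poly_upto k" for m using subsetD[OF F subsetD[OF F0(1) z(1)]] .
    have P: "P \<in> poly_upto k" "snd (z m) \<in> poly_upto k" for m using aP F zF[of m] by (auto simp: mem_Times_iff)
    have "(\<lambda>m. fst (z m) - a) \<longlonglongrightarrow> 0"
    proof (rule Lim_null_comparison)
      show "\<forall>\<^sub>F m in sequentially. norm (fst (z m) - a) \<le> real DIM(real^'n) * (1 / real (Suc m))"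
      proof (intro always_eventually allI)
        fix m
        have "norm (fst (z m) - a) \<le> (\<Sum>u\<in>Basis. \<bar>(fst (z m) - a) \<bullet> u\<bar>)" by (rule norm_le_l1)
        also have "\<dots> \<le> (\<Sum>u\<in>(Basis::(real^'n) set). 1 / real (Suc m))"
        proof (rule sum_mono)
          fix u :: "real^'n" assume "u \<in> Basis"
          then have "dist (ev (a, P) (Inl u) 0) (ev (z m) (Inl u) 0) < 1 / real (Suc m)" by (intro z(2)) auto
          then show "\<bar>(fst (z m) - a) \<bullet> u\<bar> \<le> 1 / real (Suc m)"
            by (simp add: ev_def dist_real_def inner_diff_left abs_minus_commute)
        qed
        finally show "norm (fst (z m) - a) \<le> real DIM(real^'n) * (1 / real (Suc m))" by simp
      qed
      have "(\<lambda>m. real DIM(real^'n) * (1 / real (Suc m))) \<longlonglongrightarrow> real DIM(real^'n) * 0"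
        by (intro tendsto_mult tendsto_const one_over_Suc_null)
      then show "(\<lambda>m. real DIM(real^'n) * (1 / real (Suc m))) \<longlonglongrightarrow> 0" by simp
    qed
    then have "(\<lambda>m. fst (z m)) \<longlonglongrightarrow> a" by (rule LIM_zero_cancel)
    moreover have "(\<lambda>m. poly_norm k (\<lambda>x. snd (z m) x - P x)) \<longlonglongrightarrow> 0"
    proof (rule tendsto_sandwich[OF _ _ tendsto_const])
      show "\<forall>\<^sub>F m in sequentially. 0 \<le> poly_norm k (\<lambda>x. snd (z m) x - P x)"
        by (intro always_eventually allI poly_norm_nonneg poly_diff P)
      show "\<forall>\<^sub>F m in sequentially. poly_norm k (\<lambda>x. snd (z m) x - P x) \<le> C * (A * (real (card B) * (1 / real (Suc m))))"
      proof (intro always_eventually allI C[rule_format, OF poly_diff[OF P(2) P(1)]])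
        fix m and x :: "real^'n" assume x: "norm x \<le> 1"
        have "norm (snd (z m) x - P x) \<le> A * (\<Sum>b\<in>B. \<bar>blinfun_apply (snd (z m) x - P x) b\<bar>)" by (rule A[rule_format])
        also have "\<dots> \<le> A * (\<Sum>b\<in>B. 1 / real (Suc m))"
        proof (intro mult_left_mono sum_mono)
          fix b assume "b \<in> B"
          then have "dist (ev (a, P) (Inr b) x) (ev (z m) (Inr b) x) < 1 / real (Suc m)" using x by (intro z(2)) auto
          then show "\<bar>blinfun_apply (snd (z m) x - P x) b\<bar> \<le> 1 / real (Suc m)"
            by (simp add: ev_def dist_real_def blinfun.diff_left abs_minus_commute)
        qed (use A0 in simp)
        finally show "norm (snd (z m) x - P x) \<le> A * (real (card B) * (1 / real (Suc m)))" by simp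
      qed
      have "(\<lambda>m. C * (A * (real (card B) * (1 / real (Suc m))))) \<longlonglongrightarrow> C * (A * (real (card B) * 0))"
        by (intro tendsto_mult tendsto_const one_over_Suc_null)
      then show "(\<lambda>m. C * (A * (real (card B) * (1 / real (Suc m))))) \<longlonglongrightarrow> 0" by simp
    qed
    moreover have "\<forall>i. z i \<in> (\<Union>m. F0 m)" using z(1) by blast
    ultimately show ?thesis by (intro exI[of _ z] conjI)
  qed
  show ?thesis
  proof (intro exI[of _ "\<Union>m. F0 m"] conjI)
    show "(\<Union>m. F0 m) \<subseteq> F" using F0(1) by blast
    show "countable (\<Union>m. F0 m)" using F0(2) by (intro countable_UN) auto
    show "\<forall>(a, P)\<in>F. \<exists>z. (\<forall>i. z i \<in> (\<Union>m. F0 m)) \<and> (\<lambda>i. fst (z i)) \<longlonglongrightarrow> a \<and>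
     (\<lambda>i. poly_norm k (\<lambda>x. snd (z i) x - P x)) \<longlonglongrightarrow> 0"
      unfolding case_prod_beta
    proof
      fix f assume "f \<in> F"
      then have "(fst f, snd f) \<in> F" by simp
      then show "\<exists>z. (\<forall>i. z i \<in> (\<Union>m. F0 m)) \<and> (\<lambda>i. fst (z i)) \<longlonglongrightarrow> fst f \<and>
        (\<lambda>i. poly_norm k (\<lambda>x. snd (z i) x - snd f x)) \<longlonglongrightarrow> 0" by (rule main)
    qed
  qed
qed

section \<open>Joint measurability in the point and the distribution\<close>

lemma topspace_distributions_top: "topspace distributions_top = (distributions :: ((real^'n \<Rightarrow> 'y::banach) \<Rightarrow> real) set)"
proof -
  have "distributions \<subseteq> PiE test_fun (\<lambda>_. UNIV :: real set)"
    by (auto simp: distributions_def PiE_def)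
  from Int_absorb1[OF this] show ?thesis
    by (simp add: distributions_top_def topspace_subtopology topspace_product_topology)
qed

lemma continuous_map_evaluation:
  "\<theta> \<in> test_fun \<Longrightarrow> continuous_map distributions_top euclideanreal (\<lambda>S. S \<theta>)"
  unfolding distributions_top_def
  by (intro continuous_map_from_subtopology continuous_map_product_projection)

text \<open>Norm convergence implies bounded weak-star convergence, for which the pairing is continuous; sequences
  suffice in a normed space.\<close>

lemma continuous_map_poly_pairing:
  fixes \<theta> :: "real^'n \<Rightarrow> 'y::banach"
  assumes \<theta>: "\<theta> \<in> test_fun_in (cball 0 1)"
  shows "continuous_map (poly_top k) euclideanreal (\<lambda>P. pairing (\<lambda>x. P (g + r *\<^sub>R x)) \<theta>)"
  unfolding continuous_map_def
proof (intro conjI allI impI)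
  fix U :: "real set" assume "openin euclideanreal U"
  then have U: "open U" by simp
  let ?J = "\<lambda>P :: real^'n \<Rightarrow> ('y \<Rightarrow>\<^sub>L real). pairing (\<lambda>x. P (g + r *\<^sub>R x)) \<theta>"
  show "openin (poly_top k) {P \<in> topspace (poly_top k). ?J P \<in> U}"
    unfolding openin_poly_top topspace_poly_top
  proof (intro conjI ballI)
    fix P assume "P \<in> {P \<in> poly_upto k. ?J P \<in> U}"
    then have P: "P \<in> poly_upto k" "?J P \<in> U" by auto
    show "\<exists>e>0. \<forall>Q\<in>poly_upto k. poly_norm k (\<lambda>x. Q x - P x) < e \<longrightarrow> Q \<in> {P \<in> poly_upto k. ?J P \<in> U}"
    proof (rule ccontr)
      assume N: "\<not> (\<exists>e>0. \<forall>Q\<in>poly_upto k. poly_norm k (\<lambda>x. Q x - P x) < e \<longrightarrow> Q \<in> {P \<in> poly_upto k. ?J P \<in> U})"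
      have "\<forall>i. \<exists>Q. Q \<in> poly_upto k \<and> poly_norm k (\<lambda>x. Q x - P x) < 1 / real (Suc i) \<and> ?J Q \<notin> U"
      proof
        fix i
        have "1 / real (Suc i) > 0" by simp
        then have "\<not> (\<forall>Q\<in>poly_upto k. poly_norm k (\<lambda>x. Q x - P x) < 1 / real (Suc i) \<longrightarrow> Q \<in> {P \<in> poly_upto k. ?J P \<in> U})"
          using N by blast
        then show "\<exists>Q. Q \<in> poly_upto k \<and> poly_norm k (\<lambda>x. Q x - P x) < 1 / real (Suc i) \<and> ?J Q \<notin> U" by blast
      qed
      from choice[OF this] obtain Q where Q': "\<forall>i. Q i \<in> poly_upto k \<and> poly_norm k (\<lambda>x. Q i x - P x) < 1 / real (Suc i) \<and> ?J (Q i) \<notin> U"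
        by (elim exE) (rule that)
      note Q = conjunct1[OF spec[OF Q']] conjunct1[OF conjunct2[OF spec[OF Q']]] conjunct2[OF conjunct2[OF spec[OF Q']]]
      have "(\<lambda>i. poly_norm k (\<lambda>x. Q i x - P x)) \<longlonglongrightarrow> 0"
      proof (rule tendsto_sandwich[OF _ _ tendsto_const one_over_Suc_null])
        show "\<forall>\<^sub>F i in sequentially. 0 \<le> poly_norm k (\<lambda>x. Q i x - P x)"
          by (intro always_eventually allI poly_norm_nonneg poly_diff Q(1) P(1))
        show "\<forall>\<^sub>F i in sequentially. poly_norm k (\<lambda>x. Q i x - P x) \<le> 1 / real (Suc i)"
          by (intro always_eventually allI less_imp_le Q(2))
      qed
      then have "wconv k Q P" by (rule wconvI_poly_norm[OF P(1) Q(1)])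
      then have "(\<lambda>i. ?J (Q i)) \<longlonglongrightarrow> ?J P"
        by (rule pairing_tendsto[OF _ tconv_const[OF \<theta>] tendsto_const tendsto_const])
      then have "\<forall>\<^sub>F i in sequentially. ?J (Q i) \<in> U" using U P(2) by (rule topological_tendstoD)
      then have "\<forall>\<^sub>F i in sequentially. False" using Q(3) by simp
      then show False by simp
    qed
  qed auto
qed auto

text \<open>By continuity in the point, \<open>h > c\<close> holds at \<open>a\<close> iff, for some \<open>n\<close> and \<open>j\<close>, \<open>h \<ge> c + 1/n\<close> at all
  points of a countable dense set within \<open>1/j\<close> of \<open>a\<close>. For a fixed point of the dense set this is a closed condition.\<close>

lemma separately_continuous_sublevel_borel:
  fixes h :: "'a::{metric_space, second_countable_topology} \<Rightarrow> 'z \<Rightarrow> real"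
  assumes a: "\<And>z. z \<in> topspace Z \<Longrightarrow> continuous_on UNIV (\<lambda>a. h a z)"
    and z: "\<And>a. continuous_map Z euclideanreal (h a)"
  shows "{w \<in> topspace (prod_topology euclidean Z). h (fst w) (snd w) \<le> c} \<in> borel_in (prod_topology euclidean Z)"
proof -
  let ?X = "prod_topology (euclidean :: 'a topology) Z"
  interpret sigma_algebra "topspace ?X" "borel_in ?X" by (rule sigma_algebra_borel_in)
  obtain E :: "'a set" where E: "countable E" "\<And>X. open X \<Longrightarrow> X \<noteq> {} \<Longrightarrow> \<exists>d\<in>E. d \<in> X"
    using countable_dense_exists by blast
  have eq: "h (fst w) (snd w) > c \<longleftrightarrow>
      (\<exists>n::nat. \<exists>j::nat. \<forall>g\<in>E. 1 / real (Suc j) \<le> dist (fst w) g \<or> c + 1 / real (Suc n) \<le> h g (snd w))"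
    if w: "w \<in> topspace ?X" for w
  proof -
    have sw: "snd w \<in> topspace Z" using w by (auto simp: topspace_prod_topology)
    have cont: "continuous_on UNIV (\<lambda>a. h a (snd w))" by (rule a[OF sw])
    show ?thesis
    proof
      assume gt: "h (fst w) (snd w) > c"
      then obtain n :: nat where n: "1 / real (Suc n) < h (fst w) (snd w) - c"
        using reals_Archimedean[of "h (fst w) (snd w) - c"] by (auto simp: inverse_eq_divide)
      have "h (fst w) (snd w) - c - 1 / real (Suc n) > 0" using n by simp
      then obtain d where d: "d > 0" "\<And>x. dist x (fst w) < d \<Longrightarrow> dist (h x (snd w)) (h (fst w) (snd w)) < h (fst w) (snd w) - c - 1 / real (Suc n)"
        using cont unfolding continuous_on_iff by (metis UNIV_I)
      obtain j :: nat where j: "1 / real (Suc j) < d" using reals_Archimedean[OF d(1)] by (auto simp: inverse_eq_divide)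
      have "1 / real (Suc j) \<le> dist (fst w) g \<or> c + 1 / real (Suc n) \<le> h g (snd w)" for g
      proof (cases "1 / real (Suc j) \<le> dist (fst w) g")
        case False
        then have "dist g (fst w) < d" using j by (simp add: dist_commute)
        from d(2)[OF this] show ?thesis by (simp add: dist_real_def abs_less_iff)
      qed simp
      then show "\<exists>n::nat. \<exists>j::nat. \<forall>g\<in>E. 1 / real (Suc j) \<le> dist (fst w) g \<or> c + 1 / real (Suc n) \<le> h g (snd w)" by blast
    next
      assume "\<exists>n::nat. \<exists>j::nat. \<forall>g\<in>E. 1 / real (Suc j) \<le> dist (fst w) g \<or> c + 1 / real (Suc n) \<le> h g (snd w)"
      then obtain n j :: nat where nj: "\<And>g. g \<in> E \<Longrightarrow> 1 / real (Suc j) \<le> dist (fst w) g \<or> c + 1 / real (Suc n) \<le> h g (snd w)" by blast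
      show "h (fst w) (snd w) > c"
      proof (rule ccontr)
        assume le: "\<not> h (fst w) (snd w) > c"
        have "0 < 1 / real (Suc n)" by simp
        then obtain d where d: "d > 0" "\<And>x. dist x (fst w) < d \<Longrightarrow> dist (h x (snd w)) (h (fst w) (snd w)) < 1 / real (Suc n)"
          using cont unfolding continuous_on_iff by (metis UNIV_I)
        have "0 < min d (1 / real (Suc j))" using d(1) by simp
        then have "fst w \<in> ball (fst w) (min d (1 / real (Suc j)))" by (simp only: centre_in_ball)
        then have "ball (fst w) (min d (1 / real (Suc j))) \<noteq> {}" by blast
        then obtain g where g: "g \<in> E" "g \<in> ball (fst w) (min d (1 / real (Suc j)))" using E(2)[OF open_ball] by blast
        have "dist g (fst w) < d" "\<not> 1 / real (Suc j) \<le> dist (fst w) g" using g(2) by (simp_all add: dist_commute)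
        then show False using nj[OF g(1)] d(2)[of g] le by (simp add: dist_real_def abs_less_iff)
      qed
    qed
  qed
  have closed: "{w \<in> topspace ?X. 1 / real (Suc j) \<le> dist (fst w) g \<or> c + 1 / real (Suc n) \<le> h g (snd w)} \<in> borel_in ?X" for j n g
  proof -
    have c1: "continuous_map ?X euclideanreal (\<lambda>w. dist (fst w) g)"
    proof -
      have "continuous_map euclidean euclideanreal (\<lambda>x. dist x g)" by (auto intro!: continuous_intros)
      from continuous_map_compose[OF continuous_map_fst this] show ?thesis by (simp add: o_def)
    qed
    have c2: "continuous_map ?X euclideanreal (\<lambda>w. h g (snd w))"
      using continuous_map_compose[OF continuous_map_snd z[of g]] by (simp add: o_def)
    have 1: "closedin ?X {w \<in> topspace ?X. dist (fst w) g \<in> {1 / real (Suc j)..}}"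
      by (rule closedin_continuous_map_preimage[OF c1]) auto
    have 2: "closedin ?X {w \<in> topspace ?X. h g (snd w) \<in> {c + 1 / real (Suc n)..}}"
      by (rule closedin_continuous_map_preimage[OF c2]) auto
    have "{w \<in> topspace ?X. 1 / real (Suc j) \<le> dist (fst w) g \<or> c + 1 / real (Suc n) \<le> h g (snd w)}
       = {w \<in> topspace ?X. dist (fst w) g \<in> {1 / real (Suc j)..}} \<union> {w \<in> topspace ?X. h g (snd w) \<in> {c + 1 / real (Suc n)..}}"
      by auto
    then show ?thesis using closedin_Un[OF 1 2] borel_in_closedin by simp
  qed
  have "{w \<in> topspace ?X. \<exists>n::nat. \<exists>j::nat. \<forall>g\<in>E. 1 / real (Suc j) \<le> dist (fst w) g \<or> c + 1 / real (Suc n) \<le> h g (snd w)} \<in> borel_in ?X"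
    by (intro sets_Collect_countable_Ex sets_Collect_countable_All' closed E(1))
  moreover have "{w \<in> topspace ?X. h (fst w) (snd w) \<le> c} = topspace ?X -
     {w \<in> topspace ?X. \<exists>n::nat. \<exists>j::nat. \<forall>g\<in>E. 1 / real (Suc j) \<le> dist (fst w) g \<or> c + 1 / real (Suc n) \<le> h g (snd w)}"
    using eq by (auto simp: not_le[symmetric])
  ultimately show ?thesis using top Diff by simp
qed

lemma defect_continuous_point:
  fixes P :: "real^'n \<Rightarrow> ('y::banach \<Rightarrow>\<^sub>L real)"
  assumes "S \<in> distributions" "P \<in> poly_upto k" "\<theta> \<in> test_fun_in (cball 0 1)" "r > 0"
  shows "continuous_on UNIV (\<lambda>a. defect S P a r \<theta>)"
  unfolding continuous_on_sequentially o_def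
  using defect_tendsto[OF assms(1) wconv_const[OF assms(2)] tconv_const[OF assms(3)] _ tendsto_const assms(4) assms(4)]
  by blast

lemma defect_sublevel_borel:
  fixes P :: "real^'n \<Rightarrow> ('y::banach \<Rightarrow>\<^sub>L real)"
  assumes P: "P \<in> poly_upto k" and \<theta>: "\<theta> \<in> test_fun_in (cball 0 1)" and r: "r > 0"
  shows "{w \<in> topspace (prod_topology euclidean distributions_top). defect (snd w) P (fst w) r \<theta> \<le> c}
    \<in> borel_in (prod_topology euclidean distributions_top)"
proof (rule separately_continuous_sublevel_borel[of distributions_top "\<lambda>a S. defect S P a r \<theta>"])
  show "continuous_on UNIV (\<lambda>a. defect S P a r \<theta>)" if "S \<in> topspace distributions_top" for S
    using that by (intro defect_continuous_point[OF _ P \<theta> r]) (simp add: topspace_distributions_top)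
  show "continuous_map distributions_top euclideanreal (\<lambda>S. defect S P a r \<theta>)" for a
    unfolding defect_eq[OF P \<theta> r]
    by (intro continuous_map_diff continuous_map_real_divide continuous_map_evaluation rescaled_test_fun' \<theta> r)
      (use r in auto)
qed

lemma defect_sublevel_borel_triple:
  fixes \<theta> :: "real^'n \<Rightarrow> 'y::banach"
  assumes \<theta>: "\<theta> \<in> test_fun_in (cball 0 1)" and r: "r > 0"
  shows "{w \<in> topspace (prod_topology euclidean (prod_topology distributions_top (poly_top k))).
      defect (fst (snd w)) (snd (snd w)) (fst w) r \<theta> \<le> c}
    \<in> borel_in (prod_topology euclidean (prod_topology distributions_top (poly_top k)))"
proof (rule separately_continuous_sublevel_borel[of "prod_topology distributions_top (poly_top k)" "\<lambda>a z. defect (fst z) (snd z) a r \<theta>"])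
  let ?Z = "prod_topology distributions_top (poly_top k) :: (((real^'n \<Rightarrow> 'y) \<Rightarrow> real) \<times> (real^'n \<Rightarrow> ('y \<Rightarrow>\<^sub>L real))) topology"
  have Z: "fst z \<in> distributions" "snd z \<in> poly_upto k" if "z \<in> topspace ?Z" for z
    using that by (auto simp: topspace_prod_topology topspace_distributions_top topspace_poly_top)
  show "continuous_on UNIV (\<lambda>a. defect (fst z) (snd z) a r \<theta>)" if "z \<in> topspace ?Z" for z
    by (rule defect_continuous_point[OF Z[OF that] \<theta> r])
  show "continuous_map ?Z euclideanreal (\<lambda>z. defect (fst z) (snd z) a r \<theta>)" for a
  proof (rule continuous_map_eq)
    have 1: "continuous_map ?Z euclideanreal (\<lambda>z. fst z (\<lambda>x. \<theta> ((1 / r) *\<^sub>R (x - a))))"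
      using continuous_map_compose[OF continuous_map_fst continuous_map_evaluation[OF rescaled_test_fun'[OF \<theta> r]]]
      by (simp add: o_def)
    have 2: "continuous_map ?Z euclideanreal (\<lambda>z. pairing (\<lambda>x. snd z (a + r *\<^sub>R x)) \<theta>)"
      using continuous_map_compose[OF continuous_map_snd continuous_map_poly_pairing[OF \<theta>]] by (simp add: o_def)
    show "continuous_map ?Z euclideanreal (\<lambda>z. fst z (\<lambda>x. \<theta> ((1 / r) *\<^sub>R (x - a))) / r ^ CARD('n) - pairing (\<lambda>x. snd z (a + r *\<^sub>R x)) \<theta>)"
      by (intro continuous_map_diff continuous_map_real_divide 1 2) (use r in auto)
    show "fst z (\<lambda>x. \<theta> ((1 / r) *\<^sub>R (x - a))) / r ^ CARD('n) - pairing (\<lambda>x. snd z (a + r *\<^sub>R x)) \<theta> = defect (fst z) (snd z) a r \<theta>"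
      if "z \<in> topspace ?Z" for z
      by (rule defect_eq[OF Z(2)[OF that] \<theta> r, symmetric])
  qed
qed

text \<open>The rescaled error is continuous in the test function and in the scale.\<close>

lemma approx_set_countable_iff:
  fixes P :: "real^'n \<Rightarrow> ('y::banach \<Rightarrow>\<^sub>L real)"
  assumes V0: "V0 \<subseteq> {\<theta> \<in> test_fun_in (cball 0 1). \<nu> \<theta> \<le> 1}"
    and dense: "\<And>\<theta>. \<theta> \<in> {\<theta> \<in> test_fun_in (cball 0 1). \<nu> \<theta> \<le> 1} \<Longrightarrow> \<exists>\<theta>s. (\<forall>i. \<theta>s i \<in> V0) \<and> tconv (cball 0 1) \<theta>s \<theta>"
    and S: "S \<in> distributions" and P: "P \<in> poly_upto k"
  shows "(a, P) \<in> approx_set \<nu> S k s c \<delta> \<longleftrightarrow> (\<forall>r\<in>\<rat> \<inter> {0<..<\<delta>}. \<forall>\<theta>\<in>V0. defect S P a r \<theta> \<le> c * r powr s)"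
proof
  assume L: "(a, P) \<in> approx_set \<nu> S k s c \<delta>"
  show "\<forall>r\<in>\<rat> \<inter> {0<..<\<delta>}. \<forall>\<theta>\<in>V0. defect S P a r \<theta> \<le> c * r powr s"
  proof (intro ballI)
    fix r \<theta> assume "r \<in> \<rat> \<inter> {0<..<\<delta>}" "\<theta> \<in> V0"
    then show "defect S P a r \<theta> \<le> c * r powr s"
      using approx_setD(2)[OF L, of r] V0 by (auto simp: close_at_def)
  qed
next
  assume R: "\<forall>r\<in>\<rat> \<inter> {0<..<\<delta>}. \<forall>\<theta>\<in>V0. defect S P a r \<theta> \<le> c * r powr s"
  have "defect S P a r \<theta> \<le> c * r powr s" if r: "0 < r" "r < \<delta>" and \<theta>: "\<theta> \<in> test_fun_in (cball 0 1)" "\<nu> \<theta> \<le> 1" for r \<theta>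
  proof -
    have "\<exists>\<theta>s. (\<forall>i. \<theta>s i \<in> V0) \<and> tconv (cball 0 1) \<theta>s \<theta>" using dense[of \<theta>] \<theta> by simp
    then obtain \<theta>s where \<theta>s: "\<forall>i. \<theta>s i \<in> V0" "tconv (cball 0 1) \<theta>s \<theta>" by blast
    have "\<forall>i. \<exists>q\<in>\<rat>. max (r/2) (r - 1 / real (Suc i)) < q \<and> q < r"
      using r by (intro allI Rats_dense_in_real) auto
    then have "\<forall>i. \<exists>q. q \<in> \<rat> \<and> max (r/2) (r - 1 / real (Suc i)) < q \<and> q < r" by blast
    from choice[OF this] obtain q where q: "\<And>i. q i \<in> \<rat>" "\<And>i. max (r/2) (r - 1 / real (Suc i)) < q i" "\<And>i. q i < r" by blast
    have q0: "q i > 0" "q i < \<delta>" for i using q(2)[of i] q(3)[of i] r by auto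
    have ql: "q \<longlonglongrightarrow> r"
    proof (rule tendsto_sandwich)
      show "\<forall>\<^sub>F i in sequentially. r - 1 / real (Suc i) \<le> q i" using q(2) by (intro always_eventually allI) (simp add: less_imp_le)
      show "\<forall>\<^sub>F i in sequentially. q i \<le> r" using q(3) by (intro always_eventually allI) (simp add: less_imp_le)
      have "(\<lambda>i. r - 1 / real (Suc i)) \<longlonglongrightarrow> r - 0" by (intro tendsto_diff tendsto_const one_over_Suc_null)
      then show "(\<lambda>i. r - 1 / real (Suc i)) \<longlonglongrightarrow> r" by simp
    qed (rule tendsto_const)
    have "(\<lambda>i. defect S P a (q i) (\<theta>s i)) \<longlonglongrightarrow> defect S P a r \<theta>"
      by (rule defect_tendsto[OF S wconv_const[OF P] \<theta>s(2) tendsto_const ql q0(1) r(1)])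
    moreover have "(\<lambda>i. c * q i powr s) \<longlonglongrightarrow> c * r powr s"
      using r(1) by (intro tendsto_mult tendsto_const tendsto_powr ql) auto
    moreover have "\<exists>N. \<forall>i\<ge>N. defect S P a (q i) (\<theta>s i) \<le> c * q i powr s"
      using R q(1) q0 \<theta>s(1) by (intro exI[of _ 0] allI impI) simp
    ultimately show ?thesis by (rule LIMSEQ_le)
  qed
  then show "(a, P) \<in> approx_set \<nu> S k s c \<delta>" using P by (simp add: approx_set_def close_at_def)
qed

section \<open>Borel dependence on the point and the distribution\<close>

lemma topspace_prod_distributions:
  "topspace (prod_topology euclidean distributions_top) = UNIV \<times> (distributions :: ((real^'n \<Rightarrow> 'y::banach) \<Rightarrow> real) set)"
  by (simp add: topspace_prod_topology topspace_distributions_top)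

text \<open>Here \<open>Y\<close> has the finite basis \<open>B\<close>, and \<open>V0\<close> is a countable dense subset of the unit ball of \<open>\<nu>\<close>.\<close>

context
  fixes \<nu> :: "(real^'n \<Rightarrow> 'y::banach) \<Rightarrow> real" and k :: int and B :: "'y set"
    and V0 :: "(real^'n \<Rightarrow> 'y) set"
  assumes nu: "cont_seminorm_on (cball 0 1) \<nu>" and k: "k \<ge> 0"
    and B: "finite B" "independent B" "span B = UNIV"
    and V0: "V0 \<subseteq> {\<theta> \<in> test_fun_in (cball 0 1). \<nu> \<theta> \<le> 1}" "countable V0"
    and dense: "\<And>\<theta>. \<theta> \<in> {\<theta> \<in> test_fun_in (cball 0 1). \<nu> \<theta> \<le> 1} \<Longrightarrow> \<exists>\<theta>s. (\<forall>i. \<theta>s i \<in> V0) \<and> tconv (cball 0 1) \<theta>s \<theta>"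
begin

lemma V0_test: "\<theta> \<in> V0 \<Longrightarrow> \<theta> \<in> test_fun_in (cball 0 1)"
  using V0(1) by blast

lemma jets_triple_borel:
  "{(a, S, P). S \<in> distributions \<and> has_jet \<nu> k S a P}
    \<in> borel_in (prod_topology euclidean (prod_topology distributions_top (poly_top k)))"
proof -
  let ?X = "prod_topology (euclidean :: (real^'n) topology) (prod_topology distributions_top (poly_top k)) ::
    ((real^'n) \<times> ((real^'n \<Rightarrow> 'y) \<Rightarrow> real) \<times> (real^'n \<Rightarrow> ('y \<Rightarrow>\<^sub>L real))) topology"
  interpret sigma_algebra "topspace ?X" "borel_in ?X" by (rule sigma_algebra_borel_in)
  have X: "topspace ?X = UNIV \<times> distributions \<times> poly_upto k"
    by (simp add: topspace_prod_topology topspace_distributions_top topspace_poly_top)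
  let ?good = "\<lambda>w. \<forall>p::nat. \<exists>q::nat. \<forall>r\<in>\<rat> \<inter> {0<..<1 / real (Suc q)}. \<forall>\<theta>\<in>V0.
      defect (fst (snd w)) (snd (snd w)) (fst w) r \<theta> \<le> 1 / real (Suc p) * r powr real_of_int k"
  have "{w \<in> topspace ?X. ?good w} \<in> borel_in ?X"
  proof (intro sets_Collect_countable_All sets_Collect_countable_Ex sets_Collect_countable_All')
    fix p q :: nat and r \<theta> assume r: "r \<in> \<rat> \<inter> {0<..<1 / real (Suc q)}" and \<theta>: "\<theta> \<in> V0"
    show "{w \<in> topspace ?X. defect (fst (snd w)) (snd (snd w)) (fst w) r \<theta> \<le> 1 / real (Suc p) * r powr real_of_int k} \<in> borel_in ?X"
      by (rule defect_sublevel_borel_triple[OF V0_test[OF \<theta>]]) (use r in simp)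
  qed (auto intro: V0(2) countable_rat)
  moreover have "{(a, S, P). S \<in> distributions \<and> has_jet \<nu> k S a P} = {w \<in> topspace ?X. ?good w}"
  proof (rule set_eqI)
    fix w :: "(real^'n) \<times> ((real^'n \<Rightarrow> 'y) \<Rightarrow> real) \<times> (real^'n \<Rightarrow> ('y \<Rightarrow>\<^sub>L real))"
    obtain a S P where w: "w = (a, S, P)" by (cases w)
    show "w \<in> {(a, S, P). S \<in> distributions \<and> has_jet \<nu> k S a P} \<longleftrightarrow> w \<in> {w \<in> topspace ?X. ?good w}"
    proof (cases "S \<in> distributions \<and> P \<in> poly_upto k")
      case True
      then have "has_jet \<nu> k S a P \<longleftrightarrow> ?good w"
        unfolding w fst_conv snd_conv has_jet_iff_nat[OF nu conjunct1[OF True]]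
        by (subst approx_set_countable_iff[OF V0(1) dense]) auto
      then show ?thesis using True unfolding w X by simp
    next
      case False
      then show ?thesis unfolding w X by (auto simp: has_jet_def)
    qed
  qed
  ultimately show ?thesis by simp
qed

text \<open>The existential quantifier over \<open>P\<close> is not a countable union. But the admissible \<open>P\<close> form a bounded, hence
  relatively norm compact, set, and there are only countably many inequalities. So a solution exists iff, for
  every \<open>N\<close>, the inequalities of index at most \<open>N\<close> hold up to \<open>1/(N + 1)\<close> for some pair of a countable
  dense subset of the candidates whose first entry is within \<open>1/(N + 1)\<close> of the given point.\<close>

lemma approx_projection_borel:
  assumes F: "F \<subseteq> UNIV \<times> poly_upto k"
    and seq: "\<And>as Ps a P. (\<And>i. (as i, Ps i) \<in> F) \<Longrightarrow> as \<longlonglongrightarrow> a \<Longrightarrow> P \<in> poly_upto k \<Longrightarrow>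
       (\<lambda>i. poly_norm k (\<lambda>x. Ps i x - P x)) \<longlonglongrightarrow> 0 \<Longrightarrow> (a, P) \<in> F"
    and \<delta>: "\<delta> > 0"
  shows "{w \<in> topspace (prod_topology euclidean distributions_top). \<exists>P. (fst w, P) \<in> F \<and> poly_norm k P \<le> M \<and>
      (fst w, P) \<in> approx_set \<nu> (snd w) k s c \<delta>} \<in> borel_in (prod_topology euclidean distributions_top)"
proof -
  let ?X = "prod_topology (euclidean :: (real^'n) topology) distributions_top :: ((real^'n) \<times> ((real^'n \<Rightarrow> 'y) \<Rightarrow> real)) topology"
  interpret sigma_algebra "topspace ?X" "borel_in ?X" by (rule sigma_algebra_borel_in)
  \<comment> \<open>The inequalities are indexed by pairs of a rational scale and a test function, and enumerated.\<close>
  define I where "I = (\<rat> \<inter> {0<..<\<delta>}) \<times> V0"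
  have "\<exists>\<theta>s. (\<forall>i. \<theta>s i \<in> V0) \<and> tconv (cball 0 1) \<theta>s (\<lambda>x. 0)"
  proof (rule dense)
    have z: "(\<lambda>x::real^'n. 0::'y) \<in> test_fun_in (cball 0 1)" by (rule test_fun_in_zero[OF compact_cball])
    moreover have "\<nu> (\<lambda>x. 0) = 0" using seminorm_hom[OF nu z, of 0] by simp
    ultimately show "(\<lambda>x. 0) \<in> {\<theta> \<in> test_fun_in (cball 0 1). \<nu> \<theta> \<le> 1}" by simp
  qed
  then have "V0 \<noteq> {}" by blast
  moreover obtain q where "q \<in> \<rat>" "0 < q" "q < \<delta>" using Rats_dense_in_real[OF \<delta>] by blast
  ultimately have "I \<noteq> {}" unfolding I_def by auto
  moreover have "countable I" unfolding I_def by (intro countable_SIGMA countable_Int1 countable_rat V0(2))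
  ultimately have range: "range (from_nat_into I) = I" by (rule range_from_nat_into)
  define rr where "rr = (\<lambda>j. fst (from_nat_into I j))"
  define th where "th = (\<lambda>j. snd (from_nat_into I j))"
  have I: "(rr j, th j) \<in> I" for j using range by (auto simp: rr_def th_def)
  have rr: "rr j > 0" for j using I[of j] by (auto simp: I_def)
  have th: "th j \<in> test_fun_in (cball 0 1)" for j using I[of j] V0_test by (auto simp: I_def)
  have approx_iff: "(a, P) \<in> approx_set \<nu> S k s c \<delta> \<longleftrightarrow> (\<forall>j. defect S P a (rr j) (th j) \<le> c * rr j powr s)"
    if S: "S \<in> distributions" and P: "P \<in> poly_upto k" for a P S
  proof -
    have "(a, P) \<in> approx_set \<nu> S k s c \<delta> \<longleftrightarrow> (\<forall>i\<in>I. defect S P a (fst i) (snd i) \<le> c * fst i powr s)"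
      unfolding I_def by (subst approx_set_countable_iff[OF V0(1) dense S P]) auto
    also have "\<dots> \<longleftrightarrow> (\<forall>i\<in>range (from_nat_into I). defect S P a (fst i) (snd i) \<le> c * fst i powr s)"
      unfolding range ..
    finally show ?thesis by (simp add: rr_def th_def)
  qed
  define FM where "FM = {z \<in> F. poly_norm k (snd z) \<le> M}"
  have FM: "FM \<subseteq> UNIV \<times> poly_upto k" using F by (auto simp: FM_def)
  obtain F0 where F0: "F0 \<subseteq> FM" "countable F0"
    and F0_dense: "\<forall>(a, P)\<in>FM. \<exists>z. (\<forall>i. z i \<in> F0) \<and> (\<lambda>i. fst (z i)) \<longlonglongrightarrow> a \<and>
     (\<lambda>i. poly_norm k (\<lambda>x. snd (z i) x - P x)) \<longlonglongrightarrow> 0"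
    using countable_dense_pairs[OF B FM] by (elim exE conjE) (rule that)
  have F0k: "snd z \<in> poly_upto k" if "z \<in> F0" for z using that F0(1) FM by auto
  let ?good = "\<lambda>w. \<forall>N::nat. \<exists>z\<in>F0. dist (fst w) (fst z) < 1 / real (Suc N) \<and>
     (\<forall>j\<in>{..N}. defect (snd w) (snd z) (fst w) (rr j) (th j) \<le> c * rr j powr s + 1 / real (Suc N))"
  have "{w \<in> topspace ?X. ?good w} \<in> borel_in ?X"
  proof (intro sets_Collect_countable_All sets_Collect_countable_Ex' F0(2) sets_Collect_conj sets_Collect_finite_All')
    fix N j :: nat and z assume z: "z \<in> F0"
    show "{w \<in> topspace ?X. defect (snd w) (snd z) (fst w) (rr j) (th j) \<le> c * rr j powr s + 1 / real (Suc N)} \<in> borel_in ?X"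
      by (rule defect_sublevel_borel[OF F0k[OF z] th rr])
  next
    fix N :: nat and z :: "(real^'n) \<times> (real^'n \<Rightarrow> ('y \<Rightarrow>\<^sub>L real))"
    have c1: "continuous_map ?X euclideanreal (\<lambda>w. dist (fst w) (fst z))"
    proof -
      have "continuous_map euclidean euclideanreal (\<lambda>x. dist x (fst z))" by (auto intro!: continuous_intros)
      from continuous_map_compose[OF continuous_map_fst this] show ?thesis by (simp add: o_def)
    qed
    have "openin ?X {w \<in> topspace ?X. dist (fst w) (fst z) \<in> {..<1 / real (Suc N)}}"
      by (rule openin_continuous_map_preimage[OF c1]) auto
    then have "{w \<in> topspace ?X. dist (fst w) (fst z) \<in> {..<1 / real (Suc N)}} \<in> borel_in ?X" by (rule borel_in_openin)
    then show "{w \<in> topspace ?X. dist (fst w) (fst z) < 1 / real (Suc N)} \<in> borel_in ?X" by (simp only: lessThan_iff)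
  qed auto
  moreover have "(\<exists>P. (a, P) \<in> F \<and> poly_norm k P \<le> M \<and> (a, P) \<in> approx_set \<nu> S k s c \<delta>) \<longleftrightarrow> ?good (a, S)"
    if S: "S \<in> distributions" for a S
  proof
    assume "\<exists>P. (a, P) \<in> F \<and> poly_norm k P \<le> M \<and> (a, P) \<in> approx_set \<nu> S k s c \<delta>"
    then obtain P where P: "(a, P) \<in> F" "poly_norm k P \<le> M" "(a, P) \<in> approx_set \<nu> S k s c \<delta>" by blast
    have Pk: "P \<in> poly_upto k" by (rule approx_setD(1)[OF P(3)])
    have "(a, P) \<in> FM" using P by (simp add: FM_def)
    from bspec[OF F0_dense this] obtain z where z: "\<And>i. z i \<in> F0" "(\<lambda>i. fst (z i)) \<longlonglongrightarrow> a"
      "(\<lambda>i. poly_norm k (\<lambda>x. snd (z i) x - P x)) \<longlonglongrightarrow> 0" by auto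
    have w: "wconv k (\<lambda>i. snd (z i)) P" by (rule wconvI_poly_norm[OF Pk F0k[OF z(1)] z(3)])
    show "?good (a, S)"
      unfolding fst_conv snd_conv
    proof
      fix N :: nat
      have N: "1 / real (Suc N) > 0" by simp
      have "\<forall>\<^sub>F i in sequentially. dist (fst (z i)) a < 1 / real (Suc N)" by (rule tendstoD[OF z(2) N])
      moreover have "\<forall>\<^sub>F i in sequentially. \<forall>j\<in>{..N}. defect S (snd (z i)) a (rr j) (th j) < c * rr j powr s + 1 / real (Suc N)"
      proof (intro eventually_ball_finite ballI)
        fix j
        have "(\<lambda>i. defect S (snd (z i)) a (rr j) (th j)) \<longlonglongrightarrow> defect S P a (rr j) (th j)"
          by (rule defect_tendsto[OF S w tconv_const[OF th] tendsto_const tendsto_const rr rr])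
        moreover have "defect S P a (rr j) (th j) \<le> c * rr j powr s" using approx_iff[OF S Pk, of a] P(3) by blast
        then have "defect S P a (rr j) (th j) < c * rr j powr s + 1 / real (Suc N)" using N by linarith
        ultimately show "\<forall>\<^sub>F i in sequentially. defect S (snd (z i)) a (rr j) (th j) < c * rr j powr s + 1 / real (Suc N)"
          by (rule order_tendstoD(2))
      qed simp
      ultimately have "\<forall>\<^sub>F i in sequentially. dist (fst (z i)) a < 1 / real (Suc N) \<and>
         (\<forall>j\<in>{..N}. defect S (snd (z i)) a (rr j) (th j) < c * rr j powr s + 1 / real (Suc N))" by (rule eventually_conj)
      then obtain i where i: "dist (fst (z i)) a < 1 / real (Suc N)"
         "\<forall>j\<in>{..N}. defect S (snd (z i)) a (rr j) (th j) < c * rr j powr s + 1 / real (Suc N)"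
        by (auto simp: eventually_sequentially)
      show "\<exists>z\<in>F0. dist a (fst z) < 1 / real (Suc N) \<and>
         (\<forall>j\<in>{..N}. defect S (snd z) a (rr j) (th j) \<le> c * rr j powr s + 1 / real (Suc N))"
        using i by (intro bexI[OF _ z(1)[of i]] conjI ballI) (auto simp: dist_commute less_imp_le)
    qed
  next
    \<comment> \<open>A limit of approximate solutions solves all inequalities.\<close>
    assume good: "?good (a, S)"
    have "\<forall>N. \<exists>z. z \<in> F0 \<and> dist a (fst z) < 1 / real (Suc N) \<and>
         (\<forall>j\<in>{..N}. defect S (snd z) a (rr j) (th j) \<le> c * rr j powr s + 1 / real (Suc N))"
      using good unfolding fst_conv snd_conv Bex_def .
    from choice[OF this] obtain z where z': "\<forall>N. z N \<in> F0 \<and> dist a (fst (z N)) < 1 / real (Suc N) \<and>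
         (\<forall>j\<in>{..N}. defect S (snd (z N)) a (rr j) (th j) \<le> c * rr j powr s + 1 / real (Suc N))"
      by (elim exE) (rule that)
    note z = conjunct1[OF spec[OF z']] conjunct1[OF conjunct2[OF spec[OF z']]] bspec[OF conjunct2[OF conjunct2[OF spec[OF z']]]]
    have zM: "poly_norm k (snd (z N)) \<le> M" "z N \<in> F" for N using z(1)[of N] F0(1) by (auto simp: FM_def)
    obtain D :: "'y set" where D: "countable D" "\<forall>y. \<forall>e>0. \<exists>d\<in>D. norm (y - d) < e"
      using finite_dim_dense[OF B(1,3)] by blast
    have D2: "\<exists>d\<in>D. norm (y - d) < e" if "e > 0" for y e using D(2) that by blast
    have "\<exists>r P. strict_mono (r :: nat \<Rightarrow> nat) \<and> wconv k (\<lambda>i. snd (z (r i))) P"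
      by (rule weak_star_compact[OF D(1) D2 F0k[OF z(1)] zM(1)])
    then obtain r P where r: "strict_mono (r :: nat \<Rightarrow> nat)" and w: "wconv k (\<lambda>i. snd (z (r i))) P" by blast
    have Pk: "P \<in> poly_upto k" using w by (simp add: wconv_def)
    have nl: "(\<lambda>i. poly_norm k (\<lambda>x. snd (z (r i)) x - P x)) \<longlonglongrightarrow> 0" by (rule wconv_imp_norm_conv[OF B w])
    have rl: "(\<lambda>i. 1 / real (Suc (r i))) \<longlonglongrightarrow> 0"
      using LIMSEQ_subseq_LIMSEQ[OF one_over_Suc_null r] by (simp add: o_def)
    have al: "(\<lambda>i. fst (z (r i))) \<longlonglongrightarrow> a"
    proof (rule LIM_zero_cancel, rule Lim_null_comparison[OF _ rl])
      show "\<forall>\<^sub>F i in sequentially. norm (fst (z (r i)) - a) \<le> 1 / real (Suc (r i))"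
        using z(2) by (intro always_eventually allI less_imp_le) (simp add: dist_norm norm_minus_commute)
    qed
    have "(a, P) \<in> F" by (rule seq[OF _ al Pk nl]) (use zM(2) in simp)
    moreover have "poly_norm k P \<le> M"
    proof -
      have "poly_norm k P \<le> M + poly_norm k (\<lambda>x. snd (z (r i)) x - P x)" for i
      proof -
        have "poly_norm k (\<lambda>x. P x - 0) \<le> poly_norm k (\<lambda>x. P x - snd (z (r i)) x) + poly_norm k (\<lambda>x. snd (z (r i)) x - 0)"
          by (rule poly_norm_triangle[OF Pk F0k[OF z(1)] poly_zero])
        then show ?thesis using zM(1)[of "r i"] poly_norm_commute[OF Pk F0k[OF z(1)], of "r i"] by simp
      qed
      moreover have "(\<lambda>i. M + poly_norm k (\<lambda>x. snd (z (r i)) x - P x)) \<longlonglongrightarrow> M + 0"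
        by (intro tendsto_add tendsto_const nl)
      ultimately show ?thesis by (intro LIMSEQ_le_const[of _ M]) auto
    qed
    moreover have "(a, P) \<in> approx_set \<nu> S k s c \<delta>"
      unfolding approx_iff[OF S Pk]
    proof
      fix j
      have "(\<lambda>i. defect S (snd (z (r i))) a (rr j) (th j)) \<longlonglongrightarrow> defect S P a (rr j) (th j)"
        by (rule defect_tendsto[OF S w tconv_const[OF th] tendsto_const tendsto_const rr rr])
      moreover have "(\<lambda>i. c * rr j powr s + 1 / real (Suc (r i))) \<longlonglongrightarrow> c * rr j powr s + 0"
        by (intro tendsto_add tendsto_const rl)
      moreover have "\<exists>N. \<forall>i\<ge>N. defect S (snd (z (r i))) a (rr j) (th j) \<le> c * rr j powr s + 1 / real (Suc (r i))"
      proof (intro exI[of _ j] allI impI)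
        fix i assume "i \<ge> j"
        then have "j \<in> {..r i}" using seq_suble[OF r, of i] by simp
        then show "defect S (snd (z (r i))) a (rr j) (th j) \<le> c * rr j powr s + 1 / real (Suc (r i))" by (rule z(3))
      qed
      ultimately have "defect S P a (rr j) (th j) \<le> c * rr j powr s + 0" by (rule LIMSEQ_le)
      then show "defect S P a (rr j) (th j) \<le> c * rr j powr s" by simp
    qed
    ultimately show "\<exists>P. (a, P) \<in> F \<and> poly_norm k P \<le> M \<and> (a, P) \<in> approx_set \<nu> S k s c \<delta>" by blast
  qed
  then have "{w \<in> topspace ?X. \<exists>P. (fst w, P) \<in> F \<and> poly_norm k P \<le> M \<and> (fst w, P) \<in> approx_set \<nu> (snd w) k s c \<delta>}
      = {w \<in> topspace ?X. ?good w}"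
    unfolding topspace_prod_distributions by (intro Collect_cong conj_cong refl) (auto simp: mem_Times_iff)
  ultimately show ?thesis by simp
qed

text \<open>As for the domain in the separable case, \<open>jet_exists\<close> permits choosing the polynomial functions for different
  \<open>p\<close> independently. The additional quantifier over \<open>M\<close> supplies the bound required for compactness.\<close>

lemma jets_projection_borel:
  assumes F: "F \<subseteq> UNIV \<times> poly_upto k"
    and seq: "\<And>as Ps a P. (\<And>i. (as i, Ps i) \<in> F) \<Longrightarrow> as \<longlonglongrightarrow> a \<Longrightarrow> P \<in> poly_upto k \<Longrightarrow>
       (\<lambda>i. poly_norm k (\<lambda>x. Ps i x - P x)) \<longlonglongrightarrow> 0 \<Longrightarrow> (a, P) \<in> F"
  shows "{(a, S). S \<in> distributions \<and> (\<exists>P. has_jet \<nu> k S a P \<and> (a, P) \<in> F)}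
    \<in> borel_in (prod_topology euclidean distributions_top)"
proof -
  let ?X = "prod_topology (euclidean :: (real^'n) topology) distributions_top :: ((real^'n) \<times> ((real^'n \<Rightarrow> 'y) \<Rightarrow> real)) topology"
  let ?s = "real_of_int k"
  interpret sigma_algebra "topspace ?X" "borel_in ?X" by (rule sigma_algebra_borel_in)
  let ?good = "\<lambda>w. \<forall>p::nat. \<exists>q::nat. \<exists>M::nat. \<exists>P. (fst w, P) \<in> F \<and> poly_norm k P \<le> real M \<and>
      (fst w, P) \<in> approx_set \<nu> (snd w) k ?s (1 / real (Suc p)) (1 / real (Suc q))"
  have good_borel: "{w \<in> topspace ?X. ?good w} \<in> borel_in ?X"
  proof (intro sets_Collect_countable_All sets_Collect_countable_Ex)
    fix p q M :: nat
    show "{w \<in> topspace ?X. \<exists>P. (fst w, P) \<in> F \<and> poly_norm k P \<le> real M \<and>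
      (fst w, P) \<in> approx_set \<nu> (snd w) k ?s (1 / real (Suc p)) (1 / real (Suc q))} \<in> borel_in ?X"
    proof (rule approx_projection_borel[OF F])
      fix as a Ps P
      assume "\<And>i. (as i, Ps i) \<in> F" "as \<longlonglongrightarrow> a" "P \<in> poly_upto k" "(\<lambda>i. poly_norm k (\<lambda>x. Ps i x - P x)) \<longlonglongrightarrow> 0"
      then show "(a, P) \<in> F" by (rule seq)
    qed simp
  qed
  have eq: "(\<exists>P. has_jet \<nu> k S a P \<and> (a, P) \<in> F) \<longleftrightarrow> ?good (a, S)" if S: "S \<in> distributions" for a S
  proof
    assume "\<exists>P. has_jet \<nu> k S a P \<and> (a, P) \<in> F"
    then obtain P where P: "has_jet \<nu> k S a P" "(a, P) \<in> F" by blast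
    obtain M :: nat where M: "poly_norm k P \<le> real M" using real_arch_simple by blast
    show "?good (a, S)"
      unfolding fst_conv snd_conv
    proof
      fix p
      obtain q where "(a, P) \<in> approx_set \<nu> S k ?s (1 / real (Suc p)) (1 / real (Suc q))"
        using P(1) unfolding has_jet_iff_nat[OF nu S] by blast
      then show "\<exists>q::nat. \<exists>M::nat. \<exists>P. (a, P) \<in> F \<and> poly_norm k P \<le> real M \<and>
        (a, P) \<in> approx_set \<nu> S k ?s (1 / real (Suc p)) (1 / real (Suc q))"
        using P(2) M by (intro exI[of _ q] exI[of _ M] exI[of _ P] conjI)
    qed
  next
    assume good: "?good (a, S)"
    have "\<forall>p. \<exists>z. (a, fst z) \<in> F \<and> (a, fst z) \<in> approx_set \<nu> S k ?s (1 / real (Suc p)) (1 / real (Suc (snd z)))"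
    proof
      fix p
      obtain q P where "(a, P) \<in> F" "(a, P) \<in> approx_set \<nu> S k ?s (1 / real (Suc p)) (1 / real (Suc q))"
        using spec[OF good, of p] unfolding fst_conv snd_conv by blast
      then show "\<exists>z. (a, fst z) \<in> F \<and> (a, fst z) \<in> approx_set \<nu> S k ?s (1 / real (Suc p)) (1 / real (Suc (snd z)))"
        by (intro exI[of _ "(P, q)"]) simp
    qed
    from choice[OF this] obtain z where z': "\<forall>p. (a, fst (z p)) \<in> F \<and>
       (a, fst (z p)) \<in> approx_set \<nu> S k ?s (1 / real (Suc p)) (1 / real (Suc (snd (z p))))"
      by (elim exE) (rule that)
    note z = conjunct1[OF spec[OF z']] conjunct2[OF spec[OF z']]
    have "\<exists>P. has_jet \<nu> k S a P \<and> (\<lambda>p. poly_norm k (\<lambda>x. fst (z p) x - P x)) \<longlonglongrightarrow> 0"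
      by (rule jet_exists[OF nu S k z(2)]) simp
    then obtain P where P: "has_jet \<nu> k S a P" "(\<lambda>p. poly_norm k (\<lambda>x. fst (z p) x - P x)) \<longlonglongrightarrow> 0" by blast
    have Pk: "P \<in> poly_upto k" using P(1) by (simp add: has_jet_def)
    have "(a, P) \<in> F" by (rule seq[OF z(1) tendsto_const Pk P(2)])
    then show "\<exists>P. has_jet \<nu> k S a P \<and> (a, P) \<in> F" using P(1) by blast
  qed
  have "{(a, S). S \<in> distributions \<and> (\<exists>P. has_jet \<nu> k S a P \<and> (a, P) \<in> F)} = {w \<in> topspace ?X. ?good w}"
  proof (rule set_eqI)
    fix w :: "(real^'n) \<times> ((real^'n \<Rightarrow> 'y) \<Rightarrow> real)"
    obtain a S where w: "w = (a, S)" by (cases w)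
    show "w \<in> {(a, S). S \<in> distributions \<and> (\<exists>P. has_jet \<nu> k S a P \<and> (a, P) \<in> F)} \<longleftrightarrow> w \<in> {w \<in> topspace ?X. ?good w}"
    proof (cases "S \<in> distributions")
      case True
      then show ?thesis
        unfolding w topspace_prod_distributions mem_Collect_eq prod.case eq[OF True] by blast
    next
      case False
      then show ?thesis unfolding w topspace_prod_distributions by blast
    qed
  qed
  with good_borel show ?thesis by simp
qed

end

text \<open>A symmetric multilinear map is a derivative at \<open>0\<close> of its own homogeneous polynomial function, and such
  derivatives are bounded.\<close>

lemma sym_mlin_bounded:
  fixes \<psi> :: "(real^'n) list \<Rightarrow> ('y::banach \<Rightarrow>\<^sub>L real)"
  assumes \<psi>: "\<psi> \<in> sym_mlin m"
  obtains C where "\<And>vs. length vs = m \<Longrightarrow> \<forall>v\<in>set vs. norm v \<le> 1 \<Longrightarrow> norm (\<psi> vs) \<le> C"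
proof -
  define \<phi> where "\<phi> = (\<lambda>l. if l = m then \<psi> else (\<lambda>vs\<in>{vs. length vs = l}. 0))"
  have \<phi>: "\<phi> l \<in> sym_mlin l" for l
    using \<psi> by (auto simp: \<phi>_def intro!: sym_mlin_restrictI linear_zero)
  define P where "P = (\<lambda>x. \<Sum>l<Suc m. \<phi> l (replicate l x))"
  have P: "P \<in> poly_upto (int m)" by (rule poly_uptoI[OF \<phi>]) (simp add: P_def nat_add_distrib)
  have "norm (\<psi> vs) \<le> mlin_norm m (nth_deriv m P 0)" if vs: "length vs = m" "\<forall>v\<in>set vs. norm v \<le> 1" for vs
  proof -
    have "dderiv vs P 0 = fact m *\<^sub>R \<psi> vs"
      unfolding P_def by (subst dderiv_poly_at_0[OF \<phi>]) (simp add: vs(1) \<phi>_def)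
    then have "fact m * norm (\<psi> vs) \<le> mlin_norm m (nth_deriv m P 0)"
      using norm_dderiv_le_mlin_norm[OF P vs, of 0] by simp
    moreover have "1 * norm (\<psi> vs) \<le> fact m * norm (\<psi> vs)" by (intro mult_right_mono fact_ge_1) simp
    ultimately show ?thesis by simp
  qed
  then show ?thesis by (rule that)
qed

lemma
  fixes U :: "((real^'n) list \<Rightarrow> ('y::banach \<Rightarrow>\<^sub>L real)) set"
  shows openin_sym_mlin_topD: "openin (sym_mlin_top m) U \<Longrightarrow> \<psi> \<in> U \<Longrightarrow>
     \<exists>e>0. \<forall>\<phi>\<in>sym_mlin m. mlin_norm m (\<lambda>vs. \<phi> vs - \<psi> vs) < e \<longrightarrow> \<phi> \<in> U"
    and topspace_sym_mlin_top: "topspace (sym_mlin_top m) = (sym_mlin m :: ((real^'n) list \<Rightarrow> ('y \<Rightarrow>\<^sub>L real)) set)"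
proof -
  have z: "mlin_norm m (\<lambda>vs. \<psi> vs - \<psi> vs) = 0" for \<psi> :: "(real^'n) list \<Rightarrow> ('y \<Rightarrow>\<^sub>L real)"
  proof (rule antisym)
    show "mlin_norm m (\<lambda>vs. \<psi> vs - \<psi> vs) \<le> 0" by (rule mlin_norm_le) simp
    have "norm (\<psi> (replicate m 0) - \<psi> (replicate m 0)) \<le> mlin_norm m (\<lambda>vs. \<psi> vs - \<psi> vs)"
      by (rule norm_le_mlin_norm[where B = 0]) auto
    then show "0 \<le> mlin_norm m (\<lambda>vs. \<psi> vs - \<psi> vs)" by simp
  qed
  have diff: "norm (u vs - v vs) \<le> mlin_norm m (\<lambda>vs. u vs - v vs)"
    if uv: "u \<in> sym_mlin m" "v \<in> sym_mlin m" and vs: "length vs = m" "\<forall>v\<in>set vs. norm v \<le> 1"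
    for u v :: "(real^'n) list \<Rightarrow> ('y \<Rightarrow>\<^sub>L real)" and vs
  proof -
    obtain C where C: "\<And>vs. length vs = m \<Longrightarrow> \<forall>v\<in>set vs. norm v \<le> 1 \<Longrightarrow> norm (u vs) \<le> C"
      using sym_mlin_bounded[OF uv(1)] by blast
    obtain D where D: "\<And>vs. length vs = m \<Longrightarrow> \<forall>v\<in>set vs. norm v \<le> 1 \<Longrightarrow> norm (v vs) \<le> D"
      using sym_mlin_bounded[OF uv(2)] by blast
    show ?thesis
      by (rule norm_le_mlin_norm[where \<psi> = "\<lambda>vs. u vs - v vs" and B = "C + D", OF _ vs])
        (intro order_trans[OF norm_triangle_ineq4] add_mono C D)
  qed
  have tri: "mlin_norm m (\<lambda>x. u x - w x) \<le> mlin_norm m (\<lambda>x. u x - v x) + mlin_norm m (\<lambda>x. v x - w x)"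
    if "u \<in> sym_mlin m" "v \<in> sym_mlin m" "w \<in> sym_mlin m" for u v w :: "(real^'n) list \<Rightarrow> ('y \<Rightarrow>\<^sub>L real)"
  proof (rule mlin_norm_le)
    fix vs :: "(real^'n) list" assume vs: "length vs = m" "\<forall>v\<in>set vs. norm v \<le> 1"
    have "norm (u vs - w vs) \<le> norm (u vs - v vs) + norm (v vs - w vs)"
      using norm_triangle_ineq[of "u vs - v vs" "v vs - w vs"] by simp
    also have "\<dots> \<le> mlin_norm m (\<lambda>x. u x - v x) + mlin_norm m (\<lambda>x. v x - w x)"
      by (intro add_mono diff that vs)
    finally show "norm (u vs - w vs) \<le> mlin_norm m (\<lambda>x. u x - v x) + mlin_norm m (\<lambda>x. v x - w x)" .
  qed
  have J: "J \<subseteq> {()} \<longleftrightarrow> J = {} \<or> J = {()}" for J by auto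
  have op: "openin (sym_mlin_top m) U \<longleftrightarrow> U \<subseteq> sym_mlin m \<and> (\<forall>w\<in>U. \<exists>J e. finite J \<and> J \<subseteq> {()} \<and> e > 0 \<and>
        {u \<in> sym_mlin m. \<forall>i\<in>J. mlin_norm m (\<lambda>x. u x - w x) < e} \<subseteq> U)"
    for U :: "((real^'n) list \<Rightarrow> ('y \<Rightarrow>\<^sub>L real)) set"
    unfolding sym_mlin_top_def by (rule openin_seminorms_topology) (use z tri in simp_all)
  show "openin (sym_mlin_top m) U \<Longrightarrow> \<psi> \<in> U \<Longrightarrow>
     \<exists>e>0. \<forall>\<phi>\<in>sym_mlin m. mlin_norm m (\<lambda>vs. \<phi> vs - \<psi> vs) < e \<longrightarrow> \<phi> \<in> U"
    unfolding op J by blast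
  show "topspace (sym_mlin_top m) = (sym_mlin m :: ((real^'n) list \<Rightarrow> ('y \<Rightarrow>\<^sub>L real)) set)"
    unfolding sym_mlin_top_def by (rule topspace_seminorms_topology) (use z in simp_all)
qed

text \<open>Norm convergence of \<open>Ps\<close> bounds the derivatives of \<open>Ps i - P\<close> uniformly on bounded sets, and the derivatives
  of \<open>P\<close> are continuous. Derivatives along basis vectors suffice.\<close>

lemma nth_deriv_jointly_continuous:
  fixes Ps :: "nat \<Rightarrow> real^'n \<Rightarrow> ('y::banach \<Rightarrow>\<^sub>L real)"
  assumes Ps: "\<And>i. Ps i \<in> poly_upto k" and P: "P \<in> poly_upto k" and a: "as \<longlonglongrightarrow> a"
    and lim: "(\<lambda>i. poly_norm k (\<lambda>x. Ps i x - P x)) \<longlonglongrightarrow> 0" and e: "e > 0"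
  shows "\<exists>i. mlin_norm m (\<lambda>vs. nth_deriv m (Ps i) (as i) vs - nth_deriv m P a vs) < e"
proof -
  obtain A where A: "\<And>i. norm (as i) \<le> A" using convergent_imp_bounded[OF a] by (auto simp: bounded_iff)
  obtain C where C0: "C > 0" and C: "\<forall>(P :: real^'n \<Rightarrow> ('y \<Rightarrow>\<^sub>L real)) us x M. P \<in> poly_upto k \<longrightarrow>
       (\<forall>x. norm x \<le> 1 \<longrightarrow> norm (P x) \<le> M) \<longrightarrow> length us = m \<longrightarrow> (\<forall>u\<in>set us. norm u \<le> 1) \<longrightarrow>
       norm x \<le> A \<longrightarrow> norm (dderiv us P x) \<le> C * M"
    using poly_deriv_bound[of k m A] by (elim exE conjE) (rule that)
  let ?L = "{bs. length bs = m \<and> set bs \<subseteq> (Basis::(real^'n) set)}"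
  define h where "h = (\<lambda>i. C * poly_norm k (\<lambda>x. Ps i x - P x) + (\<Sum>bs\<in>?L. norm (dderiv bs P (as i) - dderiv bs P a)))"
  have "(\<lambda>i. dderiv bs P (as i)) \<longlonglongrightarrow> dderiv bs P a" for bs
    using continuous_on_dderiv[OF smooth_poly[OF P], of UNIV bs] a
    by (simp add: continuous_on_sequentially o_def)
  then have "h \<longlonglongrightarrow> C * 0 + (\<Sum>bs\<in>?L. norm (dderiv bs P a - dderiv bs P a))"
    unfolding h_def by (intro tendsto_add tendsto_mult tendsto_const lim tendsto_sum tendsto_norm tendsto_diff)
  then have h: "(\<lambda>i. real DIM(real^'n) ^ m * h i) \<longlonglongrightarrow> real DIM(real^'n) ^ m * 0"
    by (intro tendsto_mult tendsto_const) simp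
  have hb: "norm (dderiv bs (Ps i) (as i) - dderiv bs P a) \<le> h i" if bs: "length bs = m" "set bs \<subseteq> Basis" for bs i
  proof -
    have u: "\<forall>u\<in>set bs. norm u \<le> 1" using bs(2) by (auto simp: subset_iff)
    have "norm (dderiv bs (\<lambda>x. Ps i x - P x) (as i)) \<le> C * poly_norm k (\<lambda>x. Ps i x - P x)"
      by (rule C[rule_format, OF poly_diff[OF Ps P] poly_le_poly_norm[OF poly_diff[OF Ps P]] bs(1) bspec[OF u] A])
    then have 1: "norm (dderiv bs (Ps i) (as i) - dderiv bs P (as i)) \<le> C * poly_norm k (\<lambda>x. Ps i x - P x)"
      by (simp add: dderiv_diff[OF smooth_poly[OF Ps] smooth_poly[OF P]])
    have 2: "norm (dderiv bs P (as i) - dderiv bs P a) \<le> (\<Sum>bs\<in>?L. norm (dderiv bs P (as i) - dderiv bs P a))"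
      by (rule member_le_sum[of bs ?L "\<lambda>bs. norm (dderiv bs P (as i) - dderiv bs P a)"])
        (use bs finite_basis_lists in auto)
    have "norm (dderiv bs (Ps i) (as i) - dderiv bs P a)
        \<le> norm (dderiv bs (Ps i) (as i) - dderiv bs P (as i)) + norm (dderiv bs P (as i) - dderiv bs P a)"
      using norm_triangle_ineq[of "dderiv bs (Ps i) (as i) - dderiv bs P (as i)" "dderiv bs P (as i) - dderiv bs P a"] by simp
    then show ?thesis unfolding h_def using 1 2 by linarith
  qed
  have le: "mlin_norm m (\<lambda>vs. nth_deriv m (Ps i) (as i) vs - nth_deriv m P a vs) \<le> real DIM(real^'n) ^ m * h i" for i
  proof (rule mlin_norm_le)
    fix vs :: "(real^'n) list" assume vs: "length vs = m" "\<forall>v\<in>set vs. norm v \<le> 1"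
    \<comment> \<open>A function whose derivatives at \<open>a\<close> are the differences in question, so that
      \<open>dderiv_basis_bound\<close> applies.\<close>
    let ?f = "\<lambda>x. Ps i (1 *\<^sub>R x + (as i - a)) - P x"
    have sm: "smooth ?f" by (rule smooth_diff[OF smooth_affine[OF smooth_poly[OF Ps]] smooth_poly[OF P]])
    have d: "dderiv us ?f a = dderiv us (Ps i) (as i) - dderiv us P a" for us
    proof -
      have "dderiv us ?f a = dderiv us (\<lambda>x. Ps i (1 *\<^sub>R x + (as i - a))) a - dderiv us P a"
        by (simp only: dderiv_diff[OF smooth_affine[OF smooth_poly[OF Ps]] smooth_poly[OF P]])
      then show ?thesis by (simp only: dderiv_affine[OF smooth_poly[OF Ps]]) simp
    qed
    have "norm (dderiv vs ?f a) \<le> real DIM(real^'n) ^ m * h i"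
      by (rule dderiv_basis_bound[OF sm _ vs]) (simp only: d hb)
    then show "norm (nth_deriv m (Ps i) (as i) vs - nth_deriv m P a vs) \<le> real DIM(real^'n) ^ m * h i"
      unfolding d by (simp add: nth_deriv_def vs(1))
  qed
  have "\<forall>\<^sub>F i in sequentially. real DIM(real^'n) ^ m * h i < e"
    using order_tendstoD(2)[OF h, of e] e by simp
  then obtain i where "real DIM(real^'n) ^ m * h i < e" by (auto simp: eventually_sequentially)
  then show ?thesis using le[of i] by (intro exI[of _ i]) linarith
qed

text \<open>The value of the derivative is a continuous function of the point and the jet, so preimages of closed sets are
  projections as in \<open>jets_projection_borel\<close>; the preimage of the whole space is the domain.\<close>

lemma finite_dim_case:
  fixes \<nu> :: "(real^'n \<Rightarrow> 'y::banach) \<Rightarrow> real"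
  assumes nu: "cont_seminorm_on (cball 0 1) \<nu>" and k: "k \<ge> 0" and fin: "\<exists>B :: 'y set. finite B \<and> span B = UNIV"
  shows "{(a, S, P). S \<in> distributions \<and> has_jet \<nu> k S a P}
           \<in> borel_in (prod_topology euclidean (prod_topology distributions_top (poly_top k))) \<and>
         borel_pfun (prod_topology euclidean distributions_top) (sym_mlin_top j)
           {((a, S), pt_deriv \<nu> k j S a) | a S. S \<in> distributions \<and> pt_differentiable \<nu> k S a} \<and>
         Domain {((a, S), pt_deriv \<nu> k j S a) | a S.
             S \<in> distributions \<and> pt_differentiable \<nu> k S a}
           \<in> borel_in (prod_topology euclidean distributions_top)"
proof -
  obtain B :: "'y set" where B: "finite B" "independent B" "span B = UNIV" using fin finite_dim_basis by metis
  obtain D :: "'y set" where D: "countable D" "\<forall>y. \<forall>e>0. \<exists>d\<in>D. norm (y - d) < e"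
    using finite_dim_dense[OF B(1,3)] by blast
  have D2: "\<exists>d\<in>D. norm (y - d) < e" if "e > 0" for y e using D(2) that by blast
  let ?V = "{\<theta> \<in> test_fun_in (cball 0 1). \<nu> \<theta> \<le> 1}"
  have "\<exists>V0\<subseteq>?V. countable V0 \<and> (\<forall>\<theta>\<in>?V. \<exists>\<theta>s. (\<forall>i. \<theta>s i \<in> V0) \<and> tconv (cball 0 1) \<theta>s \<theta>)"
    by (rule countable_dense_test_functions[OF D(1) D2]) auto
  then obtain V0 where V0: "V0 \<subseteq> ?V" "countable V0"
    and dense': "\<forall>\<theta>\<in>?V. \<exists>\<theta>s. (\<forall>i. \<theta>s i \<in> V0) \<and> tconv (cball 0 1) \<theta>s \<theta>" by (elim exE conjE) (rule that)
  note dense = bspec[OF dense']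
  note proj = jets_projection_borel[OF nu k B V0 dense]
  let ?G = "{((a, S), pt_deriv \<nu> k j S a) | a S. S \<in> distributions \<and> pt_differentiable \<nu> k S a}"
  have val: "pt_deriv \<nu> k j S a = nth_deriv j P a" if "S \<in> distributions" "has_jet \<nu> k S a P" for S a P
  proof -
    have "(THE P. has_jet \<nu> k S a P) = P"
      by (rule the_equality) (rule that(2), rule jet_unique[OF nu that(1) k _ that(2)])
    then show ?thesis by (simp add: pt_deriv_def)
  qed
  have preimage: "?G\<inverse> `` C = {(a, S). S \<in> distributions \<and> (\<exists>P. has_jet \<nu> k S a P \<and> (a, P) \<in> {(a, P). P \<in> poly_upto k \<and> nth_deriv j P a \<in> C})}" for C
  proof (rule set_eqI)
    fix w :: "(real^'n) \<times> ((real^'n \<Rightarrow> 'y) \<Rightarrow> real)"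
    obtain a S where w: "w = (a, S)" by (cases w)
    have "w \<in> ?G\<inverse> `` C \<longleftrightarrow> S \<in> distributions \<and> pt_differentiable \<nu> k S a \<and> pt_deriv \<nu> k j S a \<in> C"
      unfolding w by blast
    also have "\<dots> \<longleftrightarrow> S \<in> distributions \<and> (\<exists>P. has_jet \<nu> k S a P \<and> nth_deriv j P a \<in> C)"
      unfolding pt_differentiable_def using val by metis
    finally show "w \<in> ?G\<inverse> `` C \<longleftrightarrow> w \<in> {(a, S). S \<in> distributions \<and> (\<exists>P. has_jet \<nu> k S a P \<and> (a, P) \<in> {(a, P). P \<in> poly_upto k \<and> nth_deriv j P a \<in> C})}"
      by (auto simp: w has_jet_def)
  qed
  have "?G\<inverse> `` UNIV \<in> borel_in (prod_topology euclidean distributions_top)"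
    unfolding preimage by (rule proj) auto
  moreover have "?G\<inverse> `` UNIV = Domain ?G" by blast
  ultimately have dom: "Domain ?G \<in> borel_in (prod_topology euclidean distributions_top)" by (simp only:)
  have "borel_pfun (prod_topology euclidean distributions_top) (sym_mlin_top j) ?G"
  proof (rule borel_pfunI[OF _ _ dom])
    show "?G \<subseteq> topspace (prod_topology euclidean distributions_top) \<times> topspace (sym_mlin_top j)"
    proof
      fix g assume "g \<in> ?G"
      then obtain a S P where g: "g = ((a, S), pt_deriv \<nu> k j S a)" "S \<in> distributions" "has_jet \<nu> k S a P"
        unfolding pt_differentiable_def by blast
      have "pt_deriv \<nu> k j S a \<in> sym_mlin j"
        unfolding val[OF g(2,3)] by (rule nth_deriv_poly_sym_mlin[of _ k]) (use g(3) in \<open>simp add: has_jet_def\<close>)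
      then show "g \<in> topspace (prod_topology euclidean distributions_top) \<times> topspace (sym_mlin_top j)"
        using g(2) unfolding g(1) topspace_prod_distributions topspace_sym_mlin_top by simp
    qed
    show "single_valued ?G" unfolding single_valued_def by blast
    fix C :: "((real^'n) list \<Rightarrow> ('y \<Rightarrow>\<^sub>L real)) set" assume "closedin (sym_mlin_top j) C"
    then have C: "openin (sym_mlin_top j) (sym_mlin j - C)" by (simp add: closedin_def topspace_sym_mlin_top)
    show "?G\<inverse> `` C \<in> borel_in (prod_topology euclidean distributions_top)"
      unfolding preimage
    proof (rule proj)
      show "{(a, P). P \<in> poly_upto k \<and> nth_deriv j P a \<in> C} \<subseteq> UNIV \<times> poly_upto k" by auto
      fix as :: "nat \<Rightarrow> real^'n" and a :: "real^'n" and Ps :: "nat \<Rightarrow> real^'n \<Rightarrow> ('y \<Rightarrow>\<^sub>L real)" and P :: "real^'n \<Rightarrow> ('y \<Rightarrow>\<^sub>L real)"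
      assume "\<And>i. (as i, Ps i) \<in> {(a, P). P \<in> poly_upto k \<and> nth_deriv j P a \<in> C}"
      then have Ps: "\<And>i. Ps i \<in> poly_upto k" "\<And>i. nth_deriv j (Ps i) (as i) \<in> C" by auto
      assume lim: "as \<longlonglongrightarrow> a" "P \<in> poly_upto k" "(\<lambda>i. poly_norm k (\<lambda>x. Ps i x - P x)) \<longlonglongrightarrow> 0"
      have "nth_deriv j P a \<in> C"
      proof (rule ccontr)
        assume "nth_deriv j P a \<notin> C"
        then have "nth_deriv j P a \<in> sym_mlin j - C" using nth_deriv_poly_sym_mlin[OF lim(2)] by blast
        from openin_sym_mlin_topD[OF C this] obtain e where e: "e > 0"
          "\<forall>\<phi>\<in>sym_mlin j. mlin_norm j (\<lambda>vs. \<phi> vs - nth_deriv j P a vs) < e \<longrightarrow> \<phi> \<in> sym_mlin j - C" by blast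
        obtain i where "mlin_norm j (\<lambda>vs. nth_deriv j (Ps i) (as i) vs - nth_deriv j P a vs) < e"
          using nth_deriv_jointly_continuous[OF Ps(1) lim(2,1,3) e(1)] by blast
        then show False using e(2) nth_deriv_poly_sym_mlin[OF Ps(1)] Ps(2)[of i] by blast
      qed
      then show "(a, P) \<in> {(a, P). P \<in> poly_upto k \<and> nth_deriv j P a \<in> C}" using lim(2) by simp
    qed
  qed
  then show ?thesis using jets_triple_borel[OF nu k B V0 dense] dom by blast
qed

theorem corollary1p2:
  fixes k :: int and \<alpha> :: real
    and \<nu> :: "(real^'n \<Rightarrow> 'y::banach) \<Rightarrow> real"
    and T :: "(real^'n \<Rightarrow> 'y) \<Rightarrow> real"
  assumes "0 < \<alpha>" and "\<alpha> \<le> 1" and "real_of_int k + \<alpha> \<ge> 0"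
    and "cont_seminorm_on (cball 0 1) \<nu>"
    and "T \<in> distributions"
  shows
    "countable_union_of_compacts (prod_topology euclidean (poly_top k))
       {(a, P). has_jet_holder \<nu> k \<alpha> T a P} \<and>
     (k \<ge> 0 \<longrightarrow>
       {(a, P). has_jet \<nu> k T a P} \<in> borel_in (prod_topology euclidean (poly_top k))) \<and>
     countable_union_of_compacts euclidean {a. pt_differentiable_holder \<nu> k \<alpha> T a} \<and>
     (k \<ge> 0 \<and> separable_space (euclidean :: 'y topology) \<longrightarrow>
       borel_pfun euclidean (poly_top k) {(a, P). has_jet \<nu> k T a P} \<and>
       Domain {(a, P). has_jet \<nu> k T a P} \<in> borel_in euclidean) \<and>
     (k \<ge> 0 \<and> (\<exists>B :: 'y set. finite B \<and> span B = UNIV) \<longrightarrow>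
       (\<forall>j::nat. int j \<le> k \<longrightarrow>
         {(a, S, P). S \<in> distributions \<and> has_jet \<nu> k S a P}
           \<in> borel_in (prod_topology euclidean (prod_topology distributions_top (poly_top k))) \<and>
         borel_pfun (prod_topology euclidean distributions_top) (sym_mlin_top j)
           {((a, S), pt_deriv \<nu> k j S a) | a S. S \<in> distributions \<and> pt_differentiable \<nu> k S a} \<and>
         Domain {((a, S), pt_deriv \<nu> k j S a) | a S.
             S \<in> distributions \<and> pt_differentiable \<nu> k S a}
           \<in> borel_in (prod_topology euclidean distributions_top)))"
proof (intro conjI impI allI; (elim conjE)?)
  obtain E :: "nat \<Rightarrow> ((real^'n) \<times> (real^'n \<Rightarrow> ('y \<Rightarrow>\<^sub>L real))) set"
    where E: "{(a, P). has_jet_holder \<nu> k \<alpha> T a P} = (\<Union>i. E i)"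
      "\<forall>i. compactin (prod_topology euclidean (poly_top k)) (E i) \<and> compact (fst ` E i)"
    using holder_jets_compact_union[OF assms(4,5,1), of k] by (elim exE conjE) (rule that)
  show "countable_union_of_compacts (prod_topology euclidean (poly_top k)) {(a, P). has_jet_holder \<nu> k \<alpha> T a P}"
    unfolding countable_union_of_compacts_def using E by (intro exI[of _ E]) simp
  have "{a. pt_differentiable_holder \<nu> k \<alpha> T a} = fst ` {(a, P). has_jet_holder \<nu> k \<alpha> T a P}"
    unfolding pt_differentiable_holder_def by force
  also have "\<dots> = (\<Union>i. fst ` E i)" unfolding E(1) by blast
  finally show "countable_union_of_compacts euclidean {a. pt_differentiable_holder \<nu> k \<alpha> T a}"
    unfolding countable_union_of_compacts_def using E(2) by (intro exI[of _ "\<lambda>i. fst ` E i"]) simp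
  show "{(a, P). has_jet \<nu> k T a P} \<in> borel_in (prod_topology euclidean (poly_top k))"
    by (rule jets_borel[OF assms(4,5)])
  show "borel_pfun euclidean (poly_top k) {(a, P). has_jet \<nu> k T a P}"
    if "k \<ge> 0" "separable_space (euclidean :: 'y topology)"
    by (rule jets_borel_pfun[OF assms(4,5) that])
  show "Domain {(a, P). has_jet \<nu> k T a P} \<in> borel_in euclidean"
    if "k \<ge> 0" "separable_space (euclidean :: 'y topology)"
    by (rule jets_domain_borel[OF assms(4,5) that])
qed (use finite_dim_case[OF assms(4)] in blast)+

end
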